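(* Let $P_C(z,\bar z)$ be a real-valued weighted homogeneous polynomial of weighted degree $1$ with respect to the (finite) multitype weights $(\mu_1,\mu_2)$, without pluriharmonic terms, such that the hypersurface $M_H=\{(z,w)\in\mathbb C^2\times\mathbb C:\operatorname{Im}w=P_C(z,\bar z)\}$ is holomorphically nondegenerate. Let $\mathfrak g_n$ be the component of $\mathfrak g=\mathrm{aut}(M_H,0)$ consisting of vector fields of weight in $(0,1)$ not commuting with $W=\partial_w$. If $\dim\mathfrak g_n>0$, then $M_H$ is biholomorphically equivalent to $$\operatorname{Im}w=\operatorname{Re}\,z_1\bar z_2^{\,l}$$ or to $$\operatorname{Im}w=|z_1|^2\pm|z_2|^{2l}$$ for some positive integer $l$ (and some choice of sign).
   Context: Multitype. A weight is a pair of rationals $\Lambda=(\lambda_1,\lambda_2)$ with $\frac12\ge\lambda_1\ge\lambda_2\ge0$; $z_j,\bar z_j$ have weight $\lambda_j$ and $w,u=\operatorname{Re}w,v=\operatorname{Im}w$ have weight $1$. For a smooth real hypersurface $M\subset\mathbb C^3$ and $p\in M$ of finite type, $\Lambda$ is distinguished if there are local holomorphic coordinates $(z_1,z_2,w)$ centered at $p$ in which $M$ is given by $v=P(z,\bar z)+o_\Lambda(1)$, where $P$ is a nonzero $\Lambda$-homogeneous polynomial of weighted degree $1$ without pluriharmonic terms and $o_\Lambda(1)$ is a smooth function whose derivatives of weighted order $\le1$ vanish at $0$. The multitype weight $(\mu_1,\mu_2)$ is the infimum of all distinguished weights in lexicographic order; the multitype is finite if $\mu_1,\mu_2\ne0$.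 Here $(\mu_1,\mu_2)$ is the multitype weight of $M_H$ at $0$, and it is finite. $\mathrm{aut}(M_H,0)$ is the real Lie algebra of germs at $0$ of holomorphic vector fields $X$ on $\mathbb C^3$ with $\operatorname{Re}X$ tangent to $M_H$. It is graded by weight, with $z_j$ of weight $\mu_j$, $w$ of weight $1$, $\partial_{z_j}$ of weight $-\mu_j$, $\partial_w$ of weight $-1$. It decomposes as $\mathfrak g=\mathfrak g_{-1}\oplus\bigoplus_{j=1}^2\mathfrak g_{-\mu_j}\oplus\mathfrak g_0\oplus\mathfrak g_c\oplus\mathfrak g_n\oplus\mathfrak g_1$, where the numerical index is the weight, and $\mathfrak g_c\oplus\mathfrak g_n$ is the sum of all components with weight in $(0,1)$: $\mathfrak g_c$ is the subspace of those commuting with $W=\partial_w$, and $\mathfrak g_n$ consists of those not commuting with $W$ (a complement of $\mathfrak g_c$); thus $\dim\mathfrak g_n>0$ means that some vector field in $\mathfrak g$ of weight in $(0,1)$ does not commute with $\partial_w$. $M_H$ is holomorphically nondegenerate (at $0$) if no nonzero germ at $0$ of a holomorphic vector field on $\mathbb C^3$ is tangent to $M_H$ as a complex vector field. Biholomorphic equivalence is equivalence of germs at $0$. *)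

theory Defs
  imports "HOL-Analysis.Analysis" "HOL-Library.Poly_Mapping"
begin

text \<open>
  Points of \<open>\<complex>\<^sup>3\<close> are \<open>p :: complex ^ 3\<close> with \<open>z\<^sub>1 = p $ 1\<close>, \<open>z\<^sub>2 = p $ 2\<close>, \<open>w = p $ 3\<close>.
  Germs are represented by functions (or sets) considered near the base point.
\<close>

section \<open>Holomorphic maps and equivalence of germs\<close>

definition holomorphic_map_on :: "(complex ^ 'n \<Rightarrow> complex ^ 'm) \<Rightarrow> (complex ^ 'n) set \<Rightarrow> bool" where
  "holomorphic_map_on F U \<longleftrightarrow>
     (\<forall>p\<in>U. \<exists>L. (F has_derivative L) (at p) \<and> (\<forall>c v. L (c *s v) = c *s L v))"

definition biholomorphic_map ::
    "(complex ^ 3) set \<Rightarrow> (complex ^ 3) set \<Rightarrow> (complex ^ 3 \<Rightarrow> complex ^ 3) \<Rightarrow> bool" where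
  "biholomorphic_map U V F \<longleftrightarrow>
     open U \<and> open V \<and> bij_betw F U V \<and>
     holomorphic_map_on F U \<and> holomorphic_map_on (inv_into U F) V"

definition biholomorphically_equivalent_at_0 :: "(complex ^ 3) set \<Rightarrow> (complex ^ 3) set \<Rightarrow> bool" where
  "biholomorphically_equivalent_at_0 M N \<longleftrightarrow>
     (\<exists>U V F. 0 \<in> U \<and> biholomorphic_map U V F \<and> F 0 = 0 \<and> F ` (M \<inter> U) = N \<inter> V)"

section \<open>Weights and polynomials in \<open>z\<close> and \<open>cnj z\<close>\<close>

type_synonym weight = "rat \<times> rat"

definition is_weight :: "weight \<Rightarrow> bool" where
  "is_weight \<Lambda> \<longleftrightarrow> 1/2 \<ge> fst \<Lambda> \<and> fst \<Lambda> \<ge> snd \<Lambda> \<and> snd \<Lambda> \<ge> 0"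

definition lex_le :: "weight \<Rightarrow> weight \<Rightarrow> bool" where
  "lex_le \<Lambda> \<Lambda>' \<longleftrightarrow> fst \<Lambda> < fst \<Lambda>' \<or> (fst \<Lambda> = fst \<Lambda>' \<and> snd \<Lambda> \<le> snd \<Lambda>')"

text \<open>
  The exponent \<open>((a\<^sub>1, a\<^sub>2), (b\<^sub>1, b\<^sub>2))\<close> stands for the monomial
  \<open>z\<^sub>1^a\<^sub>1 z\<^sub>2^a\<^sub>2 (cnj z\<^sub>1)^b\<^sub>1 (cnj z\<^sub>2)^b\<^sub>2\<close>.
\<close>

type_synonym zpoly = "((nat \<times> nat) \<times> (nat \<times> nat)) \<Rightarrow>\<^sub>0 complex"

definition zpoly_eval :: "zpoly \<Rightarrow> complex \<Rightarrow> complex \<Rightarrow> complex" where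
  "zpoly_eval P z1 z2 =
     (\<Sum>((a1, a2), (b1, b2)) \<in> Poly_Mapping.keys P.
        Poly_Mapping.lookup P ((a1, a2), (b1, b2)) * z1 ^ a1 * z2 ^ a2 * cnj z1 ^ b1 * cnj z2 ^ b2)"

definition real_valued :: "zpoly \<Rightarrow> bool" where
  "real_valued P \<longleftrightarrow> (\<forall>z1 z2. zpoly_eval P z1 z2 \<in> \<real>)"

definition weighted_homogeneous :: "weight \<Rightarrow> rat \<Rightarrow> zpoly \<Rightarrow> bool" where
  "weighted_homogeneous \<Lambda> d P \<longleftrightarrow>
     (\<forall>a1 a2 b1 b2. ((a1, a2), (b1, b2)) \<in> Poly_Mapping.keys P \<longrightarrow>
        of_nat (a1 + b1) * fst \<Lambda> + of_nat (a2 + b2) * snd \<Lambda> = d)"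

definition no_pluriharmonic_terms :: "zpoly \<Rightarrow> bool" where
  "no_pluriharmonic_terms P \<longleftrightarrow> (\<forall>(\<alpha>, \<beta>) \<in> Poly_Mapping.keys P. \<alpha> \<noteq> (0, 0) \<and> \<beta> \<noteq> (0, 0))"

section \<open>Remainder terms\<close>

primrec Ck_on :: "nat \<Rightarrow> 'a::euclidean_space set \<Rightarrow> ('a \<Rightarrow> real) \<Rightarrow> bool" where
  "Ck_on 0 U f \<longleftrightarrow> continuous_on U f"
| "Ck_on (Suc k) U f \<longleftrightarrow>
     (\<forall>x\<in>U. f differentiable (at x)) \<and>
     (\<forall>b\<in>Basis. Ck_on k U (\<lambda>x. frechet_derivative f (at x) b))"

definition smooth_on :: "'a::euclidean_space set \<Rightarrow> ('a \<Rightarrow> real) \<Rightarrow> bool" where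
  "smooth_on U f \<longleftrightarrow> (\<forall>k. Ck_on k U f)"

primrec iterated_deriv :: "'a::euclidean_space list \<Rightarrow> ('a \<Rightarrow> real) \<Rightarrow> 'a \<Rightarrow> real" where
  "iterated_deriv [] f = f"
| "iterated_deriv (b # bs) f = (\<lambda>x. frechet_derivative (iterated_deriv bs f) (at x) b)"

text \<open>
  Remainders are functions of \<open>(z\<^sub>1, z\<^sub>2, u)\<close>. A basis vector of
  \<open>complex \<times> complex \<times> real\<close> is a real coordinate direction of \<open>z\<^sub>1\<close>, \<open>z\<^sub>2\<close> or \<open>u\<close>; real and
  imaginary directions of \<open>z\<^sub>j\<close> carry the same weight, so vanishing of the real partial
  derivatives is the same as vanishing of those in \<open>z\<^sub>j\<close> and \<open>cnj z\<^sub>j\<close>.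
\<close>

definition direction_weight :: "weight \<Rightarrow> complex \<times> complex \<times> real \<Rightarrow> rat" where
  "direction_weight \<Lambda> b =
     (if fst b \<noteq> 0 then fst \<Lambda> else if fst (snd b) \<noteq> 0 then snd \<Lambda> else 1)"

definition little_o_weight1 :: "weight \<Rightarrow> (complex \<times> complex \<times> real \<Rightarrow> real) \<Rightarrow> bool" where
  "little_o_weight1 \<Lambda> f \<longleftrightarrow>
     (\<forall>bs. set bs \<subseteq> Basis \<and> sum_list (map (direction_weight \<Lambda>) bs) \<le> 1 \<longrightarrow>
        iterated_deriv bs f 0 = 0)"

section \<open>Multitype\<close>

definition distinguished_weight :: "(complex ^ 3) set \<Rightarrow> complex ^ 3 \<Rightarrow> weight \<Rightarrow> bool" where
  "distinguished_weight M p \<Lambda> \<longleftrightarrow>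
     is_weight \<Lambda> \<and>
     (\<exists>U V F P f W.
        p \<in> U \<and> biholomorphic_map U V F \<and> F p = 0 \<and>
        P \<noteq> 0 \<and> real_valued P \<and> weighted_homogeneous \<Lambda> 1 P \<and> no_pluriharmonic_terms P \<and>
        open W \<and> smooth_on W f \<and> little_o_weight1 \<Lambda> f \<and>
        (\<forall>q\<in>V. (q $ 1, q $ 2, Re (q $ 3)) \<in> W) \<and>
        F ` (M \<inter> U) =
          {q \<in> V. Im (q $ 3) = Re (zpoly_eval P (q $ 1) (q $ 2)) + f (q $ 1, q $ 2, Re (q $ 3))})"

text \<open>
  The multitype weight is the lexicographic infimum of the distinguished weights. The first
  conjunct excludes points of infinite type, where the multitype is undefined: a distinguished
  weight exists exactly at points of finite type.
\<close>

definition multitype_weight :: "(complex ^ 3) set \<Rightarrow> complex ^ 3 \<Rightarrow> weight \<Rightarrow> bool" where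
  "multitype_weight M p \<mu> \<longleftrightarrow>
     (\<exists>\<Lambda>. distinguished_weight M p \<Lambda>) \<and>
     is_weight \<mu> \<and>
     (\<forall>\<Lambda>. distinguished_weight M p \<Lambda> \<longrightarrow> lex_le \<mu> \<Lambda>) \<and>
     (\<forall>\<nu>. is_weight \<nu> \<and> (\<forall>\<Lambda>. distinguished_weight M p \<Lambda> \<longrightarrow> lex_le \<nu> \<Lambda>) \<longrightarrow> lex_le \<nu> \<mu>)"

section \<open>Model hypersurfaces and their infinitesimal automorphisms\<close>

definition model_hypersurface :: "zpoly \<Rightarrow> (complex ^ 3) set" where
  "model_hypersurface P = {p. Im (p $ 3) = Re (zpoly_eval P (p $ 1) (p $ 2))}"

definition model_defining_function :: "zpoly \<Rightarrow> complex ^ 3 \<Rightarrow> real" where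
  "model_defining_function P p = Im (p $ 3) - Re (zpoly_eval P (p $ 1) (p $ 2))"

definition wirtinger_deriv :: "(complex ^ 3 \<Rightarrow> real) \<Rightarrow> complex ^ 3 \<Rightarrow> 3 \<Rightarrow> complex" where
  "wirtinger_deriv r p j =
     (of_real (frechet_derivative r (at p) (axis j 1))
        - \<i> * of_real (frechet_derivative r (at p) (axis j \<i>))) / 2"

text \<open>The function \<open>X : complex ^ 3 \<Rightarrow> complex ^ 3\<close> is the field \<open>\<Sum>\<^sub>j X\<^sub>j \<partial>/\<partial>z\<^sub>j\<close>, with \<open>z\<^sub>3 = w\<close>.\<close>

definition vf_apply :: "(complex ^ 3 \<Rightarrow> complex ^ 3) \<Rightarrow> (complex ^ 3 \<Rightarrow> real) \<Rightarrow> complex ^ 3 \<Rightarrow> complex" where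
  "vf_apply X r p = (\<Sum>j\<in>UNIV. X p $ j * wirtinger_deriv r p j)"

definition holomorphic_vf_germ_at_0 :: "(complex ^ 3 \<Rightarrow> complex ^ 3) \<Rightarrow> bool" where
  "holomorphic_vf_germ_at_0 X \<longleftrightarrow> (\<exists>U. open U \<and> 0 \<in> U \<and> holomorphic_map_on X U)"

definition holomorphically_nondegenerate :: "zpoly \<Rightarrow> bool" where
  "holomorphically_nondegenerate P \<longleftrightarrow>
     (\<forall>X. holomorphic_vf_germ_at_0 X \<and>
          (\<forall>\<^sub>F p in nhds 0. p \<in> model_hypersurface P \<longrightarrow>
             vf_apply X (model_defining_function P) p = 0)
        \<longrightarrow> (\<forall>\<^sub>F p in nhds 0. X p = 0))"

definition aut :: "zpoly \<Rightarrow> (complex ^ 3 \<Rightarrow> complex ^ 3) set" where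
  "aut P = {X. holomorphic_vf_germ_at_0 X \<and>
               (\<forall>\<^sub>F p in nhds 0. p \<in> model_hypersurface P \<longrightarrow>
                  Re (vf_apply X (model_defining_function P) p) = 0)}"

definition coord_weight :: "weight \<Rightarrow> 3 \<Rightarrow> rat" where
  "coord_weight \<mu> j = (if j = 1 then fst \<mu> else if j = 2 then snd \<mu> else 1)"

text \<open>
  \<open>X\<close> has weight \<open>\<kappa>\<close> if it is a sum of terms \<open>c z\<^sub>1^a\<^sub>1 z\<^sub>2^a\<^sub>2 w^m \<partial>/\<partial>z\<^sub>j\<close> whose weight, with
  \<open>\<partial>/\<partial>z\<^sub>j\<close> counted negatively, is \<open>\<kappa>\<close>. For positive weights these sums are finite.
\<close>

definition vf_of_weight :: "weight \<Rightarrow> rat \<Rightarrow> (complex ^ 3 \<Rightarrow> complex ^ 3) \<Rightarrow> bool" where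
  "vf_of_weight \<mu> \<kappa> X \<longleftrightarrow>
     (\<forall>j. \<exists>Q :: (nat \<times> nat \<times> nat) \<Rightarrow>\<^sub>0 complex.
        (\<forall>a1 a2 m. (a1, a2, m) \<in> Poly_Mapping.keys Q \<longrightarrow>
           of_nat a1 * fst \<mu> + of_nat a2 * snd \<mu> + of_nat m - coord_weight \<mu> j = \<kappa>) \<and>
        (\<forall>\<^sub>F p in nhds 0. X p $ j =
           (\<Sum>(a1, a2, m) \<in> Poly_Mapping.keys Q. Poly_Mapping.lookup Q (a1, a2, m) * (p $ 1) ^ a1 * (p $ 2) ^ a2 * (p $ 3) ^ m)))"

definition aut_component :: "zpoly \<Rightarrow> weight \<Rightarrow> rat \<Rightarrow> (complex ^ 3 \<Rightarrow> complex ^ 3) set" where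
  "aut_component P \<mu> \<kappa> = {X \<in> aut P. vf_of_weight \<mu> \<kappa> X}"

text \<open>
  For holomorphic fields the derivatives below are complex linear, so this is the usual bracket
  of \<open>\<Sum>\<^sub>j X\<^sub>j \<partial>/\<partial>z\<^sub>j\<close> and \<open>\<Sum>\<^sub>j Y\<^sub>j \<partial>/\<partial>z\<^sub>j\<close>.
\<close>

definition lie_bracket ::
    "(complex ^ 3 \<Rightarrow> complex ^ 3) \<Rightarrow> (complex ^ 3 \<Rightarrow> complex ^ 3) \<Rightarrow> complex ^ 3 \<Rightarrow> complex ^ 3" where
  "lie_bracket X Y p = frechet_derivative Y (at p) (X p) - frechet_derivative X (at p) (Y p)"

definition commute_at_0 :: "(complex ^ 3 \<Rightarrow> complex ^ 3) \<Rightarrow> (complex ^ 3 \<Rightarrow> complex ^ 3) \<Rightarrow> bool" where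
  "commute_at_0 X Y \<longleftrightarrow> (\<forall>\<^sub>F p in nhds 0. lie_bracket X Y p = 0)"

definition W_field :: "complex ^ 3 \<Rightarrow> complex ^ 3" where
  "W_field = (\<lambda>p. axis 3 1)"

text \<open>
  The component \<open>g\<^sub>n\<close> is only determined as a complement of \<open>g\<^sub>c\<close> in the sum of the
  components of weight in \<open>(0,1)\<close>; it has positive dimension exactly when some field of weight in
  \<open>(0,1)\<close> does not commute with \<open>W\<close>.
\<close>

definition dim_gn_positive :: "zpoly \<Rightarrow> weight \<Rightarrow> bool" where
  "dim_gn_positive P \<mu> \<longleftrightarrow>
     (\<exists>\<kappa> X. 0 < \<kappa> \<and> \<kappa> < 1 \<and> X \<in> aut_component P \<mu> \<kappa> \<and> \<not> commute_at_0 X W_field)"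

end

theory Submission
  imports Defs
begin

text \<open>
  A field of weight in \<open>(0, 1)\<close> has the form \<open>F\<^sub>0 + w F\<^sub>1\<close> with \<open>F\<^sub>0\<close>, \<open>F\<^sub>1\<close> independent of \<open>w\<close>, and it does
  not commute with \<open>\<partial>\<^sub>w\<close> exactly if \<open>F\<^sub>1 \<noteq> 0\<close>. For weight reasons \<open>F\<^sub>1\<close> becomes \<open>c z^k \<partial>\<^sub>t\<close>, up to its
  \<open>\<partial>\<^sub>w\<close>-component, after a polynomial change of coordinates, and the tangency equation says first that
  \<open>P(z, c z^k t) = Im G(z, t) + V(z, Im t)\<close> with \<open>G\<close> holomorphic, and second that
  \<open>V V\<^sub>y + 2 Re (f V\<^sub>z) + Im H V\<^sub>y\<close> is the imaginary part of a holomorphic function. On \<open>\<bar>z\<bar> = 1\<close> the second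
  equation, expanded in powers of \<open>Re t\<close> and \<open>Im t\<close>, is a triangular system between the Fourier
  coefficients of \<open>V\<close> and those of the field. Its top rows and nondegeneracy leave only \<open>k = 0\<close> and, up to a
  shear in \<open>t\<close>, \<open>V = A (Im t)\<^sup>2 + B \<bar>z\<bar>^(2 l)\<close> or \<open>V = Im t * Re (e z^l)\<close>, which differ from the two models
  by the imaginary part of a holomorphic polynomial and a scaling. If both weights are \<open>1/2\<close>, then \<open>P\<close> is a
  nondegenerate Hermitian form and one completes the square.
\<close>

section \<open>Trigonometric polynomials on the unit circle\<close>

text \<open>Everything is weighted homogeneous, so an identity valid for |z| = 1 and all t is valid
  everywhere; this is what permits working with Fourier coefficients in z. The obstacle is k >= 1:
  then t -> c z^k t is not invertible at z = 0, the transformed field may have poles there, and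
  nondegeneracy can no longer be tested on its coefficients. What replaces it is that in P(z, c z^k
  t) every t carries a factor z^k, so that V has no term of extremal frequency in positive powers of
  Im t (\<open>sing\<close>). The flag \<open>ns\<close>, which will be k = 0, separates the two
  regimes. Let K be the last power of t in the field. The quadratic term V V_y enters only the row
  of (Re t)^0, so for K >= 2 most rows near K are linear and homogeneous. Rows K - 1 and K - 3 link
  the same two leading entries by factors in the ratio K (K-1 choose 2) = 3 (K choose 3), which is
  the recurrent contradiction. Only K = 3 with a real constant as leading coefficient survives and
  yields the square; K <= 1 yields the model linear in Im t. The pair a = b = 1/2 stands apart
  because the weights then no longer exclude leading exponents such as -1.\<close>

definition ev :: "(int \<Rightarrow> complex) \<Rightarrow> complex \<Rightarrow> complex" where
  "ev c u = (\<Sum>k | c k \<noteq> 0. c k * u powi k)"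

definition trig_poly :: "(complex \<Rightarrow> complex) \<Rightarrow> bool" where
  "trig_poly f \<longleftrightarrow> (\<exists>c. finite {k. c k \<noteq> 0} \<and> (\<forall>u. cmod u = 1 \<longrightarrow> f u = ev c u))"

text \<open>The choice is harmless: for a trigonometric polynomial the coefficients are unique by
  \<open>coef_unique\<close>, and for other functions the value is never interpreted.\<close>

definition coef :: "(complex \<Rightarrow> complex) \<Rightarrow> int \<Rightarrow> complex" where
  "coef f = (SOME c. finite {k. c k \<noteq> 0} \<and> (\<forall>u. cmod u = 1 \<longrightarrow> f u = ev c u))"

lemma ev_superset:
  assumes "finite T" "{k. c k \<noteq> 0} \<subseteq> T"
  shows "ev c u = (\<Sum>k\<in>T. c k * u powi k)"
  unfolding ev_def by (rule sum.mono_neutral_left) (use assms in auto)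

lemma unit_circle_infinite: "infinite {u::complex. cmod u = 1}"
proof
  assume "finite {u::complex. cmod u = 1}"
  moreover have "(\<lambda>t. cis t) ` {0<..<pi} \<subseteq> {u. cmod u = 1}" by auto
  moreover have "inj_on (\<lambda>t. cis t) {0<..<pi}"
  proof (rule inj_onI)
    fix x y assume "x \<in> {0<..<pi}" "y \<in> {0<..<pi}" "cis x = cis y"
    then show "x = y" by (metis cis.simps(1) cos_inj_pi greaterThanLessThan_iff less_eq_real_def)
  qed
  ultimately have "finite {0<..<pi}" by (meson finite_image_iff finite_subset)
  then show False using infinite_Ioo[of 0 pi] pi_gt_zero by blast
qed

text \<open>Multiplication by u^N turns the Laurent sum into an ordinary polynomial with infinitely
  many roots.\<close>

lemma ev_eq_0:
  assumes fin: "finite {k. c k \<noteq> 0}" and z: "\<And>u. cmod u = 1 \<Longrightarrow> ev c u = 0"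
  shows "c k = 0"
proof -
  obtain N :: nat where N: "\<And>k. c k \<noteq> 0 \<Longrightarrow> \<bar>k\<bar> \<le> int N"
  proof -
    have "finite ((\<lambda>k. nat \<bar>k\<bar>) ` {k. c k \<noteq> 0})" using fin by simp
    then obtain M where "\<forall>x\<in>(\<lambda>k. nat \<bar>k\<bar>) ` {k. c k \<noteq> 0}. x \<le> M"
      using finite_nat_set_iff_bounded_le by blast
    then show ?thesis using that[of M] by force
  qed
  define p where "p = (\<Sum>m\<le>2*N. monom (c (int m - int N)) m)"
  have "poly p u = 0" if u: "cmod u = 1" for u
  proof -
    have u0: "u \<noteq> 0" using u by auto
    have "poly p u = (\<Sum>m\<le>2*N. c (int m - int N) * u ^ m)"
      by (simp add: p_def poly_sum poly_monom)
    also have "\<dots> = (\<Sum>k\<in>{-int N..int N}. c k * u powi (k + int N))"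
      by (rule sum.reindex_bij_witness[of _ "\<lambda>k. nat (k + int N)" "\<lambda>m. int m - int N"])
         (auto simp: power_int_def nat_add_distrib)
    also have "\<dots> = u powi int N * (\<Sum>k\<in>{-int N..int N}. c k * u powi k)"
      by (simp add: sum_distrib_left power_int_add u0 mult_ac)
    also have "(\<Sum>k\<in>{-int N..int N}. c k * u powi k) = ev c u"
      by (rule ev_superset[symmetric]) (use N in force)+
    finally show ?thesis using z[OF u] by simp
  qed
  then have "{u. cmod u = 1} \<subseteq> {u. poly p u = 0}" by auto
  then have "infinite {u. poly p u = 0}" using unit_circle_infinite finite_subset by blast
  then have p0: "p = 0" using poly_roots_finite by blast
  show ?thesis
  proof (rule ccontr)
    assume ck: "c k \<noteq> 0"
    have "coeff p (nat (k + int N)) = (\<Sum>m\<le>2*N. if m = nat (k + int N) then c (int m - int N) else 0)"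
      by (simp add: p_def coeff_sum)
    also have "\<dots> = c k" using N[OF ck] by (subst sum.delta) auto
    finally have "coeff p (nat (k + int N)) = c k" .
    then show False using p0 ck by simp
  qed
qed

lemma finite_supp_add: "finite {k. c k \<noteq> (0::complex)} \<Longrightarrow> finite {k. d k \<noteq> 0} \<Longrightarrow> finite {k. c k + d k \<noteq> 0}"
  by (rule finite_subset[of _ "{k. c k \<noteq> 0} \<union> {k. d k \<noteq> 0}"]) auto

lemma ev_add:
  assumes "finite {k. c k \<noteq> 0}" "finite {k. d k \<noteq> 0}"
  shows "ev (\<lambda>k. c k + d k) u = ev c u + ev d u"
proof -
  let ?T = "{k. c k \<noteq> 0} \<union> {k. d k \<noteq> 0}"
  have "ev (\<lambda>k. c k + d k) u = (\<Sum>k\<in>?T. (c k + d k) * u powi k)"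
    by (rule ev_superset) (use assms in auto)
  moreover have "ev c u = (\<Sum>k\<in>?T. c k * u powi k)" "ev d u = (\<Sum>k\<in>?T. d k * u powi k)"
    by (rule ev_superset; use assms in auto)+
  ultimately show ?thesis by (simp add: ring_distribs sum.distrib)
qed

lemma ev_cmul: "ev (\<lambda>k. x * c k) u = x * ev c u"
  by (cases "x = 0") (simp_all add: ev_def sum_distrib_left mult.assoc)

lemma coef_unique:
  assumes "finite {k. c k \<noteq> 0}" "\<And>u. cmod u = 1 \<Longrightarrow> f u = ev c u"
  shows "coef f = c"
proof -
  let ?P = "\<lambda>c. finite {k. c k \<noteq> 0} \<and> (\<forall>u. cmod u = 1 \<longrightarrow> f u = ev c u)"
  have "?P (coef f)" unfolding coef_def by (rule someI[of ?P c]) (use assms in auto)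
  then have fin: "finite {k. coef f k \<noteq> 0}" and e: "\<And>u. cmod u = 1 \<Longrightarrow> f u = ev (coef f) u" by auto
  have "finite {k. -1 * c k \<noteq> 0}" using assms(1) by simp
  then have "ev (\<lambda>k. coef f k + -1 * c k) u = 0" if "cmod u = 1" for u
    using ev_add[OF fin, of "\<lambda>k. -1 * c k" u] ev_cmul[of "-1" c u] e[OF that] assms(2)[OF that] by simp
  moreover have "finite {k. coef f k + -1 * c k \<noteq> 0}" using fin assms(1) by (intro finite_supp_add) auto
  ultimately have "coef f k + -1 * c k = 0" for k using ev_eq_0[of "\<lambda>k. coef f k + -1 * c k" k] by simp
  then show ?thesis by (intro ext) simp
qed

lemma trig_polyI:
  "finite {k. c k \<noteq> 0} \<Longrightarrow> (\<And>u. cmod u = 1 \<Longrightarrow> f u = ev c u) \<Longrightarrow> trig_poly f"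
  unfolding trig_poly_def by blast

lemma trig_polyD:
  assumes "trig_poly f"
  shows "finite {k. coef f k \<noteq> 0}" "cmod u = 1 \<Longrightarrow> f u = ev (coef f) u"
proof -
  from assms obtain c where c: "finite {k. c k \<noteq> 0}" "\<And>u. cmod u = 1 \<Longrightarrow> f u = ev c u"
    unfolding trig_poly_def by blast
  then have "coef f = c" by (rule coef_unique)
  with c show "finite {k. coef f k \<noteq> 0}" "cmod u = 1 \<Longrightarrow> f u = ev (coef f) u" by auto
qed

lemma coef_cong: "(\<And>u. cmod u = 1 \<Longrightarrow> f u = g u) \<Longrightarrow> coef f = coef g"
  unfolding coef_def by (rule arg_cong[where f = Eps]) (auto intro!: ext)

lemma trig_poly_cong: "(\<And>u. cmod u = 1 \<Longrightarrow> f u = g u) \<Longrightarrow> trig_poly f \<Longrightarrow> trig_poly g"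
  unfolding trig_poly_def by (elim exE conjE) (rule exI, rule conjI, assumption, simp)

lemma trig_poly_eq_0: "trig_poly f \<Longrightarrow> (\<And>k. coef f k = 0) \<Longrightarrow> cmod u = 1 \<Longrightarrow> f u = 0"
  using trig_polyD(2)[of f u] by (simp add: ev_def)

named_theorems tp_intros
named_theorems coef_simps

lemma coef_add_aux:
  assumes "trig_poly f" "trig_poly g"
  shows "trig_poly (\<lambda>u. f u + g u) \<and> coef (\<lambda>u. f u + g u) = (\<lambda>k. coef f k + coef g k)"
proof -
  note 1 = trig_polyD[OF assms(1)] and 2 = trig_polyD[OF assms(2)]
  have fin: "finite {k. coef f k + coef g k \<noteq> 0}" using 1(1) 2(1) by (rule finite_supp_add)
  have e: "f u + g u = ev (\<lambda>k. coef f k + coef g k) u" if "cmod u = 1" for u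
    using ev_add[OF 1(1) 2(1)] 1(2)[OF that] 2(2)[OF that] by simp
  show ?thesis using trig_polyI[OF fin, of "\<lambda>u. f u + g u"] coef_unique[OF fin, of "\<lambda>u. f u + g u"] e by blast
qed

lemma tp_add[tp_intros]: "trig_poly f \<Longrightarrow> trig_poly g \<Longrightarrow> trig_poly (\<lambda>u. f u + g u)"
  and coef_add[coef_simps]: "trig_poly f \<Longrightarrow> trig_poly g \<Longrightarrow> coef (\<lambda>u. f u + g u) k = coef f k + coef g k"
  using coef_add_aux by auto

lemma coef_cmul_aux:
  assumes "trig_poly f"
  shows "trig_poly (\<lambda>u. x * f u) \<and> coef (\<lambda>u. x * f u) = (\<lambda>k. x * coef f k)"
proof -
  note 1 = trig_polyD[OF assms(1)]
  have fin: "finite {k. x * coef f k \<noteq> 0}" by (rule finite_subset[OF _ 1(1)]) auto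
  have e: "x * f u = ev (\<lambda>k. x * coef f k) u" if "cmod u = 1" for u
    using ev_cmul 1(2)[OF that] by simp
  show ?thesis using trig_polyI[OF fin, of "\<lambda>u. x * f u"] coef_unique[OF fin, of "\<lambda>u. x * f u"] e by blast
qed

lemma tp_cmul[tp_intros]: "trig_poly f \<Longrightarrow> trig_poly (\<lambda>u. x * f u)"
  and coef_cmul[coef_simps]: "trig_poly f \<Longrightarrow> coef (\<lambda>u. x * f u) k = x * coef f k"
  using coef_cmul_aux by auto

lemma coef_shift_aux:
  assumes "trig_poly f"
  shows "trig_poly (\<lambda>u. u powi m * f u) \<and> coef (\<lambda>u. u powi m * f u) = (\<lambda>k. coef f (k - m))"
proof -
  note 1 = trig_polyD[OF assms(1)]
  have "{k. coef f (k - m) \<noteq> 0} = (\<lambda>k. k + m) ` {k. coef f k \<noteq> 0}"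
    by (auto simp: image_iff) (metis diff_add_cancel)
  then have fin: "finite {k. coef f (k - m) \<noteq> 0}" using 1(1) by simp
  have e: "u powi m * f u = ev (\<lambda>k. coef f (k - m)) u" if "cmod u = 1" for u
  proof -
    have u: "u \<noteq> 0" using that by auto
    have "u powi m * f u = (\<Sum>k | coef f k \<noteq> 0. coef f k * u powi (k + m))"
      by (simp add: 1(2)[OF that] ev_def sum_distrib_left power_int_add u mult_ac)
    also have "\<dots> = ev (\<lambda>k. coef f (k - m)) u" unfolding ev_def
      by (rule sum.reindex_bij_witness[of _ "\<lambda>k. k - m" "\<lambda>k. k + m"]) auto
    finally show ?thesis .
  qed
  show ?thesis using trig_polyI[OF fin, of "\<lambda>u. u powi m * f u"] coef_unique[OF fin, of "\<lambda>u. u powi m * f u"] e by blast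
qed

lemma tp_shift[tp_intros]: "trig_poly f \<Longrightarrow> trig_poly (\<lambda>u. u powi m * f u)"
  and coef_shift[coef_simps]: "trig_poly f \<Longrightarrow> coef (\<lambda>u. u powi m * f u) k = coef f (k - m)"
  using coef_shift_aux by auto

text \<open>On the circle cnj u = 1/u, so conjugation reverses the frequencies.\<close>

lemma coef_cnj_aux:
  assumes "trig_poly f"
  shows "trig_poly (\<lambda>u. cnj (f u)) \<and> coef (\<lambda>u. cnj (f u)) = (\<lambda>k. cnj (coef f (-k)))"
proof -
  note 1 = trig_polyD[OF assms(1)]
  have "{k. cnj (coef f (-k)) \<noteq> 0} = uminus ` {k. coef f k \<noteq> 0}"
    by (auto simp: image_iff) (metis add.inverse_inverse)
  then have fin: "finite {k. cnj (coef f (-k)) \<noteq> 0}" using 1(1) by simp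
  have e: "cnj (f u) = ev (\<lambda>k. cnj (coef f (-k))) u" if "cmod u = 1" for u
  proof -
    have u: "u \<noteq> 0" using that by auto
    have cu: "cnj u = inverse u" using that
      by (metis complex_norm_square inverse_unique mult.commute of_real_1 power_one u)
    have "cnj (f u) = (\<Sum>k | coef f k \<noteq> 0. cnj (coef f k) * u powi (-k))"
      by (simp add: 1(2)[OF that] ev_def cnj_sum cu power_int_minus power_int_inverse[symmetric] complex_cnj_power_int)
    also have "\<dots> = ev (\<lambda>k. cnj (coef f (-k))) u" unfolding ev_def
      by (rule sum.reindex_bij_witness[of _ uminus uminus]) auto
    finally show ?thesis .
  qed
  show ?thesis using trig_polyI[OF fin, of "\<lambda>u. cnj (f u)"] coef_unique[OF fin, of "\<lambda>u. cnj (f u)"] e by blast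
qed

lemma tp_cnj[tp_intros]: "trig_poly f \<Longrightarrow> trig_poly (\<lambda>u. cnj (f u))"
  and coef_cnj[coef_simps]: "trig_poly f \<Longrightarrow> coef (\<lambda>u. cnj (f u)) k = cnj (coef f (-k))"
  using coef_cnj_aux by auto

lemma coef_const_aux: "trig_poly (\<lambda>u. x) \<and> coef (\<lambda>u. x) = (\<lambda>k. if k = 0 then x else 0)"
proof -
  have fin: "finite {k::int. (if k = 0 then x else 0) \<noteq> 0}"
    by (rule finite_subset[of _ "{0}"]) auto
  have e: "x = ev (\<lambda>k. if k = 0 then x else 0) u" for u
    by (subst ev_superset[of "{0}"]) auto
  show ?thesis using trig_polyI[OF fin, of "\<lambda>u. x"] coef_unique[OF fin, of "\<lambda>u. x"] e by auto
qed

lemma tp_const[tp_intros]: "trig_poly (\<lambda>u. x)"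
  and coef_const[coef_simps]: "coef (\<lambda>u. x) k = (if k = 0 then x else 0)"
  using coef_const_aux by auto

lemma tp_powi[tp_intros]: "trig_poly (\<lambda>u. u powi m)"
  and coef_powi[coef_simps]: "coef (\<lambda>u. u powi m) k = (if k = m then 1 else 0)"
  using tp_shift[of "\<lambda>u. 1" m, OF tp_const] coef_shift[of "\<lambda>u. 1" m k, OF tp_const]
  by (auto simp: coef_simps)

lemma tp_minus[tp_intros]: "trig_poly f \<Longrightarrow> trig_poly (\<lambda>u. - f u)"
  and coef_minus[coef_simps]: "trig_poly f \<Longrightarrow> coef (\<lambda>u. - f u) k = - coef f k"
  using tp_cmul[of f "-1"] coef_cmul[of f "-1"] by auto

lemma tp_diff[tp_intros]: "trig_poly f \<Longrightarrow> trig_poly g \<Longrightarrow> trig_poly (\<lambda>u. f u - g u)"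
  and coef_diff[coef_simps]: "trig_poly f \<Longrightarrow> trig_poly g \<Longrightarrow> coef (\<lambda>u. f u - g u) k = coef f k - coef g k"
  using tp_add[OF _ tp_minus, of f g] coef_add[OF _ tp_minus, of f g] by (auto simp: coef_minus)

lemma tp_mulc[tp_intros]: "trig_poly f \<Longrightarrow> trig_poly (\<lambda>u. f u * x)"
  and coef_mulc[coef_simps]: "trig_poly f \<Longrightarrow> coef (\<lambda>u. f u * x) k = coef f k * x"
  using tp_cmul[of f x] coef_cmul[of f x] by (auto simp: mult.commute)

lemma tp_divc[tp_intros]: "trig_poly f \<Longrightarrow> trig_poly (\<lambda>u. f u / x)"
  and coef_divc[coef_simps]: "trig_poly f \<Longrightarrow> coef (\<lambda>u. f u / x) k = coef f k / x"
  using tp_mulc[of f "inverse x"] coef_mulc[of f "inverse x"] by (auto simp: divide_inverse)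

lemma tp_sum[tp_intros]: "(\<And>i. i \<in> I \<Longrightarrow> trig_poly (f i)) \<Longrightarrow> trig_poly (\<lambda>u. \<Sum>i\<in>I. f i u)"
  by (induction I rule: infinite_finite_induct) (auto intro: tp_intros)

lemma tp_ev[tp_intros]: "trig_poly (ev c)" 
  unfolding ev_def by (intro tp_intros)

lemma coef_ev: "finite {k. c k \<noteq> 0} \<Longrightarrow> coef (ev c) = c"
  by (rule coef_unique) auto

lemma tp_mult:
  assumes "trig_poly f" "trig_poly g"
  shows "trig_poly (\<lambda>u. f u * g u)"
proof -
  have "trig_poly (\<lambda>u. \<Sum>k | coef f k \<noteq> 0. coef f k * (u powi k * g u))"
    by (intro tp_intros assms)
  then show ?thesis
    by (rule trig_poly_cong[rotated])
      (simp add: trig_polyD(2)[OF assms(1)] ev_def sum_distrib_right mult.assoc)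
qed

lemma coef_mult:
  assumes "trig_poly f" "trig_poly g"
  shows "coef (\<lambda>u. f u * g u) k = (\<Sum>m | coef f m \<noteq> 0. coef f m * coef g (k - m))"
proof -
  have 1: "coef (\<lambda>u. \<Sum>m\<in>I. coef f m * (u powi m * g u)) k = (\<Sum>m\<in>I. coef f m * coef g (k - m))" for I
    by (induction I rule: infinite_finite_induct) (simp_all add: coef_simps tp_intros assms)
  have 2: "coef (\<lambda>u. f u * g u) = coef (\<lambda>u. \<Sum>m | coef f m \<noteq> 0. coef f m * (u powi m * g u))"
    by (rule coef_cong)
      (simp add: trig_polyD(2)[OF assms(1)] ev_def sum_distrib_right mult.assoc)
  show ?thesis unfolding 2 1 ..
qed

lemma coef_of_real_Re:
  assumes "trig_poly f"
  shows "coef (\<lambda>u. of_real (Re (f u))) k = (coef f k + cnj (coef f (-k))) / 2"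
    and "trig_poly (\<lambda>u. of_real (Re (f u)))"
proof -
  have *: "(\<lambda>u. complex_of_real (Re (f u))) = (\<lambda>u. (f u + cnj (f u)) / 2)"
    by (auto simp: fun_eq_iff complex_eq_iff)
  show "coef (\<lambda>u. of_real (Re (f u))) k = (coef f k + cnj (coef f (-k))) / 2"
    unfolding * by (simp add: coef_simps tp_intros assms)
  show "trig_poly (\<lambda>u. of_real (Re (f u)))" unfolding * by (intro tp_intros assms)
qed

lemma coef_real:
  assumes "trig_poly f" "\<And>u. cmod u = 1 \<Longrightarrow> f u \<in> \<real>"
  shows "coef f (-k) = cnj (coef f k)"
proof -
  have "coef f = coef (\<lambda>u. cnj (f u))" by (rule coef_cong) (use assms(2) in \<open>auto simp: Reals_cnj_iff\<close>)
  then show ?thesis using coef_cnj[OF assms(1), of "-k"] by simp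
qed

section \<open>The tangency equation on the unit circle\<close>

lemma coef_mult_top:
  assumes "trig_poly f" "trig_poly g" "\<And>m. m > p \<Longrightarrow> coef f m = 0" "\<And>m. m > q \<Longrightarrow> coef g m = 0"
  shows "coef (\<lambda>u. f u * g u) (p + q) = coef f p * coef g q"
proof -
  have "coef f m * coef g (p + q - m) = 0" if "m \<noteq> p" for m
  proof (cases "m > p")
    case False
    then have "p + q - m > q" using that by simp
    then show ?thesis using assms(4) by simp
  qed (use assms(3) in simp)
  then have "coef (\<lambda>u. f u * g u) (p + q)
      = (\<Sum>m | coef f m \<noteq> 0. if m = p then coef f p * coef g q else 0)"
    unfolding coef_mult[OF assms(1,2)] by (intro sum.cong) auto
  also have "\<dots> = coef f p * coef g q" by (simp add: trig_polyD(1)[OF assms(1)])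
  finally show ?thesis .
qed

lemma trig_poly_top:
  assumes "trig_poly f" "coef f k \<noteq> 0"
  obtains p where "coef f p \<noteq> 0" "\<And>m. m > p \<Longrightarrow> coef f m = 0" "p \<ge> k"
proof -
  have fin: "finite {k. coef f k \<noteq> 0}" using trig_polyD(1)[OF assms(1)] .
  have ne: "{k. coef f k \<noteq> 0} \<noteq> {}" using assms(2) by auto
  have "coef f (Max {k. coef f k \<noteq> 0}) \<noteq> 0" using Max_in[OF fin ne] by simp
  moreover have "coef f m = 0" if "m > Max {k. coef f k \<noteq> 0}" for m
    using Max_ge[OF fin, of m] that by fastforce
  moreover have "Max {k. coef f k \<noteq> 0} \<ge> k" using Max_ge[OF fin] assms(2) by simp
  ultimately show ?thesis using that by blast
qed

text \<open>Top frequencies add under multiplication and the leading coefficients multiply, so there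
  are no zero divisors.\<close>

lemma trig_poly_mult_eq_0:
  assumes "trig_poly f" "trig_poly g" "\<And>u. cmod u = 1 \<Longrightarrow> f u * g u = 0"
  shows "(\<forall>k. coef f k = 0) \<or> (\<forall>k. coef g k = 0)"
proof (rule ccontr)
  assume "\<not> ?thesis"
  then obtain k k' where "coef f k \<noteq> 0" "coef g k' \<noteq> 0" by blast
  then obtain p q where p: "coef f p \<noteq> 0" "\<And>m. m > p \<Longrightarrow> coef f m = 0"
    and q: "coef g q \<noteq> 0" "\<And>m. m > q \<Longrightarrow> coef g m = 0"
    using trig_poly_top[OF assms(1)] trig_poly_top[OF assms(2)] by metis
  have "coef (\<lambda>u. f u * g u) (p + q) = coef f p * coef g q"
    by (rule coef_mult_top) (use assms p q in auto)
  moreover have "coef (\<lambda>u. f u * g u) = coef (\<lambda>u. 0)" by (rule coef_cong) (use assms(3) in auto)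
  ultimately show False using p(1) q(1) by (simp add: coef_simps)
qed

lemma coef_of_real_Im:
  assumes "trig_poly f"
  shows "coef (\<lambda>u. of_real (Im (f u))) k = (coef f k - cnj (coef f (-k))) / (2 * \<i>)"
    and "trig_poly (\<lambda>u. of_real (Im (f u)))"
proof -
  have *: "(\<lambda>u. complex_of_real (Im (f u))) = (\<lambda>u. (f u - cnj (f u)) / (2 * \<i>))"
    by (auto simp: fun_eq_iff complex_eq_iff)
  show "coef (\<lambda>u. of_real (Im (f u))) k = (coef f k - cnj (coef f (-k))) / (2 * \<i>)"
    unfolding * by (simp add: coef_simps tp_intros assms)
  show "trig_poly (\<lambda>u. of_real (Im (f u)))" unfolding * by (intro tp_intros assms)
qed

text \<open>The imaginary part has the frequencies m and -m, which can cancel only if they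
  coincide.\<close>

lemma Im_monomial_eq_0:
  assumes "\<And>u. cmod u = 1 \<Longrightarrow> Im (x * u powi m) = 0"
  shows "x = 0 \<or> (m = 0 \<and> Im x = 0)"
proof -
  have tp: "trig_poly (\<lambda>u. x * u powi m)" by (intro tp_intros)
  have "coef (\<lambda>u. complex_of_real (Im (x * u powi m))) = coef (\<lambda>u. 0)"
    by (rule coef_cong) (simp only: assms of_real_0)
  then have "coef (\<lambda>u. complex_of_real (Im (x * u powi m))) m = 0" by (simp add: coef_simps)
  then have "x - cnj (if -m = m then x else 0) = 0"
    unfolding coef_of_real_Im(1)[OF tp] by (cases "m = 0") (auto simp: coef_simps tp_intros)
  moreover have "m = 0 \<Longrightarrow> Im x = 0" using assms[of 1] by simp
  ultimately show ?thesis by (cases "m = 0") auto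
qed

text \<open>For m nonzero, rotating u turns x u^m through all arguments; the witness makes it real
  and nonnegative.\<close>

lemma Im_monomial_has_zero:
  assumes "m \<noteq> 0"
  obtains u where "cmod u = 1" "Im (x * u powi m) = 0"
proof (cases "x = 0")
  case True
  then show ?thesis using that[of 1] by simp
next
  case False
  define \<theta> where "\<theta> = - Arg x / real_of_int m"
  have "x = of_real (cmod x) * cis (Arg x)" using False by (simp add: rcis_def[symmetric] rcis_cmod_Arg)
  moreover have "cis \<theta> powi m = cis (- Arg x)" using assms by (simp add: cis_power_int \<theta>_def)
  ultimately have "x * cis \<theta> powi m = of_real (cmod x) * (cis (Arg x) * cis (- Arg x))"
    by (metis mult.assoc)
  also have "\<dots> = of_real (cmod x)" by (simp add: cis_mult)
  finally show ?thesis using that[of "cis \<theta>"] by simp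
qed

text \<open>The degree in z and cnj z that a function of weight 1 leaves for the coefficient of y^j.
  It is a real number, since for some j no monomial has this weight and the value is not an
  integer.\<close>

definition ndeg :: "real \<Rightarrow> real \<Rightarrow> nat \<Rightarrow> real" where
  "ndeg a b j = (1 - b * real j) / a"

text \<open>
  If \<open>A j k\<close> is the coefficient of \<open>u^k y^j\<close> in \<open>V\<close> on the circle, it comes from \<open>z^p cnj z^q\<close> with
  \<open>p + q = ndeg a b j\<close> and \<open>p - q = k\<close>, so \<open>u * V\<^sub>z\<close> multiplies it by \<open>p = (ndeg a b j + k) / 2\<close>.
\<close>

definition euler_coef :: "real \<Rightarrow> real \<Rightarrow> (nat \<Rightarrow> int \<Rightarrow> complex) \<Rightarrow> nat \<Rightarrow> int \<Rightarrow> complex" where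
  "euler_coef a b A j k = of_real ((ndeg a b j + real_of_int k) / 2) * A j k"

text \<open>
  Restricted to \<open>\<bar>z\<bar> = 1\<close>, the model is \<open>V u t = (\<Sum>j. ev (A j) u * (Im t) ^ j)\<close>, and \<open>\<phi>\<close>, \<open>\<beta>\<close>, \<open>\<gamma>\<close> are the
  coefficients of \<open>t ^ i\<close> in the three components of the symmetry; \<open>rows\<close> is the tangency equation, sorted by
  powers of \<open>Re t\<close> and \<open>Im t\<close>. \<open>ns\<close> tells that the direction of the symmetry does not degenerate at \<open>z = 0\<close>.
  The normalizations \<open>N1\<close> and \<open>N2\<close> are reached by adding a holomorphic monomial to \<open>w\<close> and by a shear
  \<open>t \<mapsto> t + h * z ^ m\<close>.
\<close>

locale circle_data =
  fixes a b :: real and A :: "nat \<Rightarrow> int \<Rightarrow> complex" and \<phi> \<beta> \<gamma> :: "nat \<Rightarrow> complex"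
    and e s t :: "nat \<Rightarrow> int" and d :: nat and ns :: bool and S :: "nat \<Rightarrow> nat \<Rightarrow> complex \<Rightarrow> complex"
  assumes a: "0 < a" "a \<le> 1/2" and b: "0 < b" "b \<le> 1/2" and nonquad: "\<not> (a = 1/2 \<and> b = 1/2)"
    and A_supp: "\<And>j k. A j k \<noteq> 0 \<Longrightarrow> \<bar>real_of_int k\<bar> \<le> ndeg a b j"
    and A_real: "\<And>j u. cmod u = 1 \<Longrightarrow> ev (A j) u \<in> \<real>"
    and wt\<phi>: "\<And>i. \<phi> i \<noteq> 0 \<Longrightarrow> a * e i + b * (real i + 1) = 1 \<and> e i \<ge> -1"
    and wt\<beta>: "\<And>i. \<beta> i \<noteq> 0 \<Longrightarrow> a * s i + b * real i = 1"
    and wt\<gamma>: "\<And>i. \<gamma> i \<noteq> 0 \<Longrightarrow> a * t i + b * (real i + 1) = 2"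
    and bounded: "\<exists>L. \<forall>i\<ge>L. \<phi> i = 0 \<and> \<beta> i = 0 \<and> \<gamma> i = 0"
    and d: "d \<ge> 1" "\<exists>k. A d k \<noteq> 0" "\<And>j k. j > d \<Longrightarrow> A j k = 0"
    and S_eq: "\<And>i j u. S i j u = \<phi> i * (u powi e i * ev (euler_coef a b A j) u)
        + of_nat (j + 1) * \<beta> i / (2 * \<i>) * (u powi s i * ev (A (j + 1)) u)
        - (if j = 0 then \<gamma> i / (2 * \<i>) else 0) * u powi t i"
    and rows: "\<And>i J u. cmod u = 1 \<Longrightarrow>
        Re (\<Sum>h\<le>J. of_nat ((i + h) choose h) * \<i> ^ h * S (i + h) (J - h) u)
        = (if i = 0 then - (\<Sum>j\<le>J. real (J - j + 1) * Re (ev (A j) u) * Re (ev (A (J - j + 1)) u)) / 2 else 0)"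
    and sing: "\<And>j k. \<not> ns \<Longrightarrow> j \<ge> 1 \<Longrightarrow> A j k \<noteq> 0 \<Longrightarrow> \<bar>real_of_int k\<bar> < ndeg a b j"
    and ND1: "\<And>i. ns \<Longrightarrow> (\<And>j u. cmod u = 1 \<Longrightarrow> S i j u = 0) \<Longrightarrow> \<phi> i = 0 \<and> \<beta> i = 0 \<and> \<gamma> i = 0"
    and ND2: "ns \<Longrightarrow> \<exists>j k. euler_coef a b A j k \<noteq> 0"
    and N1: "\<And>k. ns \<Longrightarrow> real_of_int k = ndeg a b 0 \<Longrightarrow> A 0 k = 0"
    and N2: "\<And>k. ns \<Longrightarrow> ndeg a b d = 0 \<Longrightarrow> d \<ge> 2 \<Longrightarrow> real_of_int k = ndeg a b (d - 1) \<Longrightarrow> A (d - 1) k = 0"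
begin

abbreviation "n \<equiv> ndeg a b"
abbreviation "AA j \<equiv> ev (A j)"
abbreviation "B \<equiv> euler_coef a b A"
abbreviation "BB j \<equiv> ev (B j)"

section \<open>Supports, Hermitian symmetry and degrees\<close>

lemma finA: "finite {k. A j k \<noteq> 0}"
proof (rule finite_subset)
  show "{k. A j k \<noteq> 0} \<subseteq> {- \<lfloor>n j\<rfloor>..\<lfloor>n j\<rfloor>}"
  proof
    fix k assume "k \<in> {k. A j k \<noteq> 0}"
    then have "real_of_int k \<le> n j" "real_of_int (-k) \<le> n j" using A_supp[of j k] by auto
    then show "k \<in> {- \<lfloor>n j\<rfloor>..\<lfloor>n j\<rfloor>}" unfolding le_floor_iff[symmetric] by auto
  qed
qed simp

lemma finB: "finite {k. B j k \<noteq> 0}"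
  by (rule finite_subset[OF _ finA[of j]]) (auto simp: euler_coef_def)

lemma coefAA[coef_simps]: "coef (AA j) = A j" by (rule coef_ev[OF finA])
lemma coefBB[coef_simps]: "coef (BB j) = B j" by (rule coef_ev[OF finB])

lemma herm: "A j (-k) = cnj (A j k)"
  using coef_real[of "AA j" k] A_real by (simp add: coef_simps tp_intros)

lemma A_supp_neg: "A j (-k) \<noteq> 0 \<longleftrightarrow> A j k \<noteq> 0" by (simp add: herm)

lemma AA_Re: "cmod u = 1 \<Longrightarrow> AA j u = of_real (Re (AA j u))" using A_real[of u j] by auto

lemma AA_Im[simp]: "cmod u = 1 \<Longrightarrow> Im (AA j u) = 0" using A_real[of u j] by (auto elim: Reals_cases)

lemma AA_gt[simp]: "j > d \<Longrightarrow> AA j u = 0" using d(3) by (simp add: ev_def)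

lemma BB_gt[simp]: "j > d \<Longrightarrow> BB j u = 0" using d(3) by (simp add: ev_def euler_coef_def)

lemma tpS[tp_intros]: "trig_poly (S i j)"
proof -
  have "S i j = (\<lambda>u. \<phi> i * (u powi e i * ev (euler_coef a b A j) u)
        + of_nat (j + 1) * \<beta> i / (2 * \<i>) * (u powi s i * ev (A (j + 1)) u)
        - (if j = 0 then \<gamma> i / (2 * \<i>) else 0) * u powi t i)" by (simp add: S_eq fun_eq_iff)
  then show ?thesis by (simp only:) (intro tp_intros)
qed

lemma coefS: "coef (S i j) k = \<phi> i * B j (k - e i)
   + of_nat (j + 1) * \<beta> i / (2 * \<i>) * A (j + 1) (k - s i)
   - (if j = 0 \<and> k = t i then \<gamma> i / (2 * \<i>) else 0)"
proof -
  have *: "S i j = (\<lambda>u. \<phi> i * (u powi e i * ev (euler_coef a b A j) u)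
        + of_nat (j + 1) * \<beta> i / (2 * \<i>) * (u powi s i * ev (A (j + 1)) u)
        - (if j = 0 then \<gamma> i / (2 * \<i>) else 0) * u powi t i)" by (simp add: S_eq fun_eq_iff)
  show ?thesis unfolding * by (simp add: coef_simps tp_intros)
qed

lemma n_ge0: "A j k \<noteq> 0 \<Longrightarrow> n j \<ge> 0" using A_supp[of j k] by linarith

lemma n_le_d: "n d \<ge> 0" using d(2) n_ge0 by blast

lemma bd_le: "b * real d \<le> 1" using n_le_d a(1) by (simp add: ndeg_def zero_le_divide_iff)

lemma n_pos: "j < d \<Longrightarrow> n j > 0"
proof -
  assume "j < d"
  then have "b * real j < b * real d" using b(1) by simp
  then show ?thesis using bd_le a(1) by (simp add: ndeg_def)
qed

lemma B_eq_0: "B j k = 0 \<longleftrightarrow> A j k = 0 \<or> real_of_int k = - n j"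
proof -
  have "(n j + real_of_int k) / 2 = 0 \<longleftrightarrow> real_of_int k = - n j" by auto
  then show ?thesis unfolding euler_coef_def mult_eq_0_iff of_real_eq_0_iff by blast
qed

text \<open>The Euler factor kills only the frequency -n j, while the support of A j is symmetric; a
  surviving k would give k = -k = -n j.\<close>

lemma B_all_0:
  assumes "\<And>k. B j k = 0"
  shows "n j = 0 \<or> (\<forall>k. A j k = 0)"
proof (rule ccontr)
  assume "\<not> ?thesis"
  then obtain k where k: "A j k \<noteq> 0" "n j \<noteq> 0" by auto
  then have "real_of_int k = - n j" using assms[of k] B_eq_0 by blast
  moreover have "A j (-k) \<noteq> 0" using k A_supp_neg by simp
  then have "real_of_int (-k) = - n j" using assms[of "-k"] B_eq_0 by blast
  ultimately show False using k(2) by simp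
qed

lemma AA_not_0: "\<exists>u. cmod u = 1 \<and> AA d u \<noteq> 0"
  using ev_eq_0[OF finA, of d] d(2) by blast

lemma S_gt:
  assumes "\<phi> i = 0 \<and> \<beta> i = 0 \<and> \<gamma> i = 0"
  shows "S i j u = 0"
  using assms by (simp add: S_eq)

lemma S_d: "S i d u = \<phi> i * (u powi e i * BB d u)" "j > d \<Longrightarrow> S i j u = 0"
  using d(1) by (auto simp: S_eq)

text \<open>The coefficient of y^J in V V_y, which is the inhomogeneity of the row i = 0 up to the
  factor -1/2.\<close>

definition "QQ J u = (\<Sum>j\<le>J. real (J - j + 1) * Re (AA j u) * Re (AA (J - j + 1) u))"

lemma QQ_eq_0: "J \<ge> 2 * d \<Longrightarrow> QQ J u = 0"
  unfolding QQ_def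
proof (rule sum.neutral, rule ballI)
  fix j assume "J \<ge> 2 * d" "j \<in> {..J}"
  then have "j > d \<or> J - j + 1 > d" by auto
  then show "real (J - j + 1) * Re (AA j u) * Re (AA (J - j + 1) u) = 0" by auto
qed

definition "vanish_above K \<longleftrightarrow> (\<forall>i>K. \<phi> i = 0 \<and> \<beta> i = 0 \<and> \<gamma> i = 0)"

text \<open>Triangularity: if K is the last index of the field, the row i = K - r keeps only its
  first r + 1 summands.\<close>

lemma row_cut:
  assumes "vanish_above K" "i + r = K" "J \<ge> r" "cmod u = 1"
  shows "Re (\<Sum>h\<le>r. of_nat ((i + h) choose h) * \<i> ^ h * S (i + h) (J - h) u)
    = (if i = 0 then - QQ J u / 2 else 0)"
proof -
  have "(\<Sum>h\<le>J. of_nat ((i + h) choose h) * \<i> ^ h * S (i + h) (J - h) u)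
      = (\<Sum>h\<le>r. of_nat ((i + h) choose h) * \<i> ^ h * S (i + h) (J - h) u)"
  proof (rule sum.mono_neutral_right)
    show "\<forall>h\<in>{..J} - {..r}. of_nat ((i + h) choose h) * \<i> ^ h * S (i + h) (J - h) u = 0"
      using assms(1,2) by (auto simp: vanish_above_def intro!: S_gt)
  qed (use assms in auto)
  then show ?thesis using rows[OF assms(4), of i J] unfolding QQ_def by simp
qed

lemma row0:
  assumes "vanish_above K" "K \<ge> 1" "cmod u = 1"
  shows "Re (S K J u) = 0"
  using row_cut[OF assms(1), of K 0 J u] assms by simp

lemma row1:
  assumes "vanish_above K" "K \<ge> 2" "cmod u = 1" "J \<ge> 1"
  shows "Re (S (K - 1) J u) = real K * Im (S K (J - 1) u)"
  using row_cut[OF assms(1), of "K - 1" 1 J u] assms by simp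

lemma row1':
  assumes "vanish_above K" "K \<ge> 2" "cmod u = 1"
  shows "Re (S (K - 1) 0 u) = 0"
  using rows[of u "K - 1" 0] assms by simp

text \<open>The summand with \<open>S K (J - 2)\<close> enters through its real part and has dropped
  out by \<open>row0\<close>.\<close>

lemma row2:
  assumes "vanish_above K" "K \<ge> 2" "cmod u = 1" "J \<ge> 2"
  shows "Re (S (K - 2) J u) - real (K - 1) * Im (S (K - 1) (J - 1) u) = (if K = 2 then - QQ J u / 2 else 0)"
proof -
  have "Suc (Suc (K - 2)) = K" "Suc (K - 2) = K - 1" using assms(2) by auto
  then show ?thesis
    using row_cut[OF assms(1), of "K - 2" 2 J u] row0[OF assms(1) _ assms(3), of "J - 2"] assms
    by (simp add: numeral_2_eq_2 split: if_splits) 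
qed

lemma row3:
  assumes "vanish_above K" "K \<ge> 3" "cmod u = 1" "J \<ge> 3"
  shows "Re (S (K - 3) J u) - real (K - 2) * Im (S (K - 2) (J - 1) u)
    - real ((K - 1) choose 2) * Re (S (K - 1) (J - 2) u) + real (K choose 3) * Im (S K (J - 3) u)
    = (if K = 3 then - QQ J u / 2 else 0)"
proof -
  have "Suc (K - 3) = K - 2" "Suc (Suc (K - 3)) = K - 1" "Suc (Suc (Suc (K - 3))) = K" using assms(2) by auto
  then show ?thesis
    using row_cut[OF assms(1), of "K - 3" 3 J u] assms
    by (simp add: numeral_3_eq_3 numeral_2_eq_2 split: if_splits) 
qed

text \<open>V has degree d in y, so there is no entry \<open>S (K - 1) (d + 1)\<close> to balance Im
  \<open>S K d\<close> in row K - 1; the real part is killed by row K.\<close>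

lemma S_top_row:
  assumes "vanish_above K" "K \<ge> 2" "cmod u = 1"
  shows "S K d u = 0"
proof -
  have "Re (S (K - 1) (d + 1) u) = real K * Im (S K d u)" using row1[OF assms, of "d + 1"] by simp
  then have "Im (S K d u) = 0" using assms(2) S_d(2) by simp
  then show ?thesis using row0[OF assms(1) _ assms(3)] assms(2) by (simp add: complex_eq_iff)
qed

lemma Im_SK_eq_0:
  assumes "vanish_above K" "K \<ge> 2" "J \<ge> 1" "\<And>u. cmod u = 1 \<Longrightarrow> Re (S (K - 1) J u) = 0" "cmod u = 1"
  shows "S K (J - 1) u = 0"
  using row1[OF assms(1,2,5,3)] row0[OF assms(1) _ assms(5)] assms(2) assms(4)[OF assms(5)]
  by (simp add: complex_eq_iff)

text \<open>The top entry is \<phi> K u^e times the Euler derivative of A d, and that derivative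
  vanishes only if A d has degree 0 in z.\<close>

lemma \<phi>_0_or_n_0:
  assumes "vanish_above K" "K \<ge> 2"
  shows "\<phi> K = 0 \<or> n d = 0"
proof -
  have "coef (S K d) = coef (\<lambda>u. 0)" by (rule coef_cong) (rule S_top_row[OF assms])
  then have "coef (S K d) (k + e K) = 0" for k by (simp add: coef_simps)
  then have "\<phi> K * B d k = 0" for k using d by (simp add: coefS)
  then show ?thesis using B_all_0[of d] d(2) by fastforce
qed

end

section \<open>A leading coefficient of the t-component that is a real constant\<close>

context circle_data begin

lemma S_phi0: "\<phi> i = 0 \<Longrightarrow> S i j u = of_nat (j + 1) * \<beta> i / (2 * \<i>) * (u powi s i * AA (j + 1) u)
        - (if j = 0 then \<gamma> i / (2 * \<i>) else 0) * u powi t i"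
  by (simp add: S_eq)

lemma div_2i: "x / (2 * \<i>) = - \<i> * x / 2"
  by (simp add: complex_eq_iff Re_divide Im_divide)

lemma Re_S_phi0:
  assumes "\<phi> i = 0" "cmod u = 1"
  shows "Re (S i j u) = real (j + 1) * (Im (\<beta> i * u powi s i) * Re (AA (j + 1) u)) / 2
           - (if j = 0 then Im (\<gamma> i * u powi t i) / 2 else 0)"
    and "Im (S i j u) = - real (j + 1) * (Re (\<beta> i * u powi s i) * Re (AA (j + 1) u)) / 2
           + (if j = 0 then Re (\<gamma> i * u powi t i) / 2 else 0)"
proof -
  obtain r where r: "AA (j + 1) u = of_real r" using A_real[OF assms(2), of "j+1"] by (auto elim: Reals_cases)
  define X Y where "X = \<beta> i * u powi s i" and "Y = \<gamma> i * u powi t i"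
  have "S i j u = of_real (real (j + 1) * r / 2) * (- \<i> * X) - (if j = 0 then - \<i> * Y / 2 else 0)"
    using r unfolding S_phi0[OF assms(1)] div_2i
    by (cases "j = 0") (simp_all add: algebra_simps X_def Y_def)
  then show "Re (S i j u) = real (j + 1) * (Im (\<beta> i * u powi s i) * Re (AA (j + 1) u)) / 2
           - (if j = 0 then Im (\<gamma> i * u powi t i) / 2 else 0)"
    "Im (S i j u) = - real (j + 1) * (Re (\<beta> i * u powi s i) * Re (AA (j + 1) u)) / 2
           + (if j = 0 then Re (\<gamma> i * u powi t i) / 2 else 0)"
    unfolding X_def[symmetric] Y_def[symmetric] r by (simp_all, (simp_all add: algebra_simps)?)
qed

text \<open>For a leading term r t^K with r real, row K - 1 ties the Euler derivative of A d to A d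
  itself, which forces A d to be constant on the circle. Rows K - 1 and K - 3 then demand two ratios
  that differ by the factor 3. For K = 2 there is no row K - 3; there the mean of row i = 0, J = 1
  is 0 on the left and -(A 1 0)^2 / 2 on the right.\<close>

lemma top_beta_not_real_constant:
  assumes va: "vanish_above K" and K: "K \<ge> 2" and \<phi>0: "\<phi> K = 0"
    and \<beta>0: "\<beta> K \<noteq> 0" and s0: "s K = 0" and Im\<beta>: "Im (\<beta> K) = 0"
  shows False
proof -
  have bK: "b * real K = 1" using wt\<beta>[OF \<beta>0] s0 by simp
  define r where "r = Re (\<beta> K)"
  have r: "\<beta> K = of_real r" "r \<noteq> 0" using Im\<beta> \<beta>0 by (auto simp: r_def complex_eq_iff)
  have \<gamma>0: "\<gamma> K = 0"
  proof -
    have "Im (\<gamma> K * u powi t K) = 0" if "cmod u = 1" for u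
      using row0[OF va _ that, of 0] K Re_S_phi0(1)[OF \<phi>0 that, of 0] s0 by (simp add: r)
    then have "\<gamma> K = 0 \<or> t K = 0" using Im_monomial_eq_0 by blast
    moreover have "\<gamma> K \<noteq> 0 \<Longrightarrow> t K \<noteq> 0"
      using wt\<gamma>[of K] bK b by (auto simp: algebra_simps)
    ultimately show ?thesis by blast
  qed
  have ImS: "Im (S K j u) = - real (j + 1) * r * Re (AA (j + 1) u) / 2" if "cmod u = 1" for j u
    using Re_S_phi0(2)[OF \<phi>0 that, of j] s0 \<gamma>0 by (simp add: r)
  have dd: "Suc (d - 1) = d" using d(1) by simp
  let ?p = "\<phi> (K - 1)"
  have R1: "Re (S (K - 1) d u) = - real K * real d * r * Re (AA d u) / 2" if "cmod u = 1" for u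
    using row1[OF va K that d(1)] ImS[OF that, of "d - 1"] dd by simp
  have p0: "?p \<noteq> 0"
  proof
    assume "?p = 0"
    then have "AA d u = 0" if "cmod u = 1" for u
      using R1[OF that] S_d(1)[of "K - 1" u] r(2) K d(1) AA_Re[OF that, of d] by simp
    then show False using AA_not_0 by blast
  qed
  have e0: "e (K - 1) = 0"
    using wt\<phi>[OF p0] bK K a(1) by (simp add: of_nat_diff algebra_simps)
  have SK1: "S (K - 1) d u = ?p * BB d u" for u using S_d(1)[of "K - 1" u] e0 by simp
  have nd: "n d \<noteq> 0"
  proof
    assume n0: "n d = 0"
    have "B d k = 0" for k
      using A_supp[of d k] n0 by (auto simp: euler_coef_def)
    then have "BB d u = 0" for u by (simp add: ev_def)
    then have "AA d u = 0" if "cmod u = 1" for u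
      using R1[OF that] SK1[of u] r(2) K d(1) AA_Re[OF that, of d] by simp
    then show False using AA_not_0 by blast
  qed
  then have "n d > 0" using n_le_d by simp
  then have "b * real d < b * real K" using bK a(1) by (simp add: ndeg_def zero_less_divide_iff)
  then have dK: "d < K" using b(1) by simp
  have R2: "Im (S (K - 1) d u) = 0" if "cmod u = 1" for u
  proof -
    have "K = 2 \<Longrightarrow> d = 1" using dK d(1) by simp
    then have "K = 2 \<Longrightarrow> QQ (d + 1) u = 0" by (intro QQ_eq_0) auto
    then show ?thesis using row2[OF va K that, of "d + 1"] S_d(2)[of "d + 1" "K - 2" u] K d(1)
      by (simp split: if_splits)
  qed
  have eqf: "?p * BB d u = of_real (- real K * real d * r / 2) * AA d u" if "cmod u = 1" for u
    using R1[OF that] R2[OF that] AA_Re[OF that, of d] SK1[of u] by (simp add: complex_eq_iff)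
  have eqc: "?p * B d k = of_real (- real K * real d * r / 2) * A d k" for k
    using fun_cong[OF coef_cong[of "\<lambda>u. ?p * BB d u", OF eqf], of k] by (simp only: coef_simps tp_intros)
  have pn: "?p * (n d + real_of_int k) = of_real (- real K * real d * r)" if "A d k \<noteq> 0" for k
  proof -
    have "(?p * of_real ((n d + real_of_int k) / 2) - of_real (- real K * real d * r / 2)) * A d k = 0"
      unfolding left_diff_distrib mult.assoc using eqc[of k] by (simp add: euler_coef_def)
    then have "?p * of_real ((n d + real_of_int k) / 2) = of_real (- real K * real d * r / 2)"
      using that by (metis mult_eq_0_iff right_minus_eq)
    then show ?thesis by (simp add: field_simps)
  qed
  \<comment> \<open>The support is symmetric, and by \<open>pn\<close> the number n d + k is the
    same at k and -k.\<close>
  have k0: "k = 0" if "A d k \<noteq> 0" for k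
  proof -
    have "A d (-k) \<noteq> 0" using that A_supp_neg by simp
    then have "?p * (n d + real_of_int k) = ?p * (n d + real_of_int (-k))"
      using pn[OF that] pn[of "-k"] by metis
    then show ?thesis using p0 by simp
  qed
  show False
  proof (cases "K \<ge> 3")
    case True
    obtain u where u: "cmod u = 1" "AA d u \<noteq> 0" using AA_not_0 by blast
    have "d = 1 \<or> d = 2" if "K = 3" using dK d(1) that by auto
    then have q: "K = 3 \<Longrightarrow> QQ (d + 2) u = 0" by (intro QQ_eq_0) auto
    \<comment> \<open>At J = d + 2 the entries \<open>S (K - 3) (d + 2)\<close> and
      \<open>S (K - 2) (d + 1)\<close> vanish because their second index exceeds d.\<close>
    have E: "- real ((K - 1) choose 2) * Re (S (K - 1) d u) + real (K choose 3) * Im (S K (d - 1) u) = 0"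
      using row3[OF va True u(1), of "d + 2"] q S_d(2) d(1) by (simp split: if_splits)
    have ImS': "Im (S K (d - 1) u) = - real d * r * Re (AA d u) / 2"
      using ImS[OF u(1), of "d - 1"] dd by simp
    have "- real ((K - 1) choose 2) * (- real K * real d * r * Re (AA d u) / 2)
        + real (K choose 3) * (- real d * r * Re (AA d u) / 2) = 0"
      using E unfolding R1[OF u(1)] ImS' .
    then have "(real K * real ((K - 1) choose 2) - real (K choose 3)) * (real d * r * Re (AA d u) / 2) = 0"
      by (auto simp add: algebra_simps)
    moreover have "real d * r * Re (AA d u) / 2 \<noteq> 0"
      using d(1) r(2) u AA_Re[OF u(1), of d] by auto
    ultimately have "real K * real ((K - 1) choose 2) = real (K choose 3)" by simp
    then have "K * ((K - 1) choose 2) = K choose 3" by (metis of_nat_eq_iff of_nat_mult)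
    moreover have "3 * (K choose 3) = K * ((K - 1) choose 2)"
      using binomial_absorption[of 2 "K"] by (simp add: numeral_3_eq_3 numeral_2_eq_2)
    moreover have "K choose 3 > 0" using True by simp
    ultimately show False by simp
  next
    case False
    then have K2: "K = 2" using K by simp
    then have d1: "d = 1" using dK d(1) by simp
    have b2: "b = 1/2" using bK K2 by simp
    have Ip: "Im ?p = 0"
    proof -
      obtain k where k: "A d k \<noteq> 0" using d(2) by blast
      have "Im (?p * of_real (n d + real_of_int k)) = 0" unfolding pn[OF k] by simp
      then show ?thesis using nd k0[OF k] by simp
    qed
    \<comment> \<open>The complex form of row i = 0, J = 1. Its mean turns out to be \<i> times a
      real number.\<close>
    define F where "F = (\<lambda>u. S 0 1 u + \<i> * S 1 0 u)"
    have "Re (F u) = - (Re (AA 1 u))\<^sup>2 / 2" if "cmod u = 1" for u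
      using rows[OF that, of 0 1] d1 by (simp add: F_def power2_eq_square)
    moreover have AAc: "AA 1 u = A 1 0" for u
      using k0 d1 by (subst ev_superset[of "{0}"]) auto
    ultimately have "coef (\<lambda>u. complex_of_real (Re (F u))) = coef (\<lambda>u. complex_of_real (- (Re (A 1 0))\<^sup>2 / 2))"
      by (intro coef_cong) (simp only:)
    then have "coef (\<lambda>u. complex_of_real (Re (F u))) 0 = of_real (- (Re (A 1 0))\<^sup>2 / 2)"
      by (simp add: coef_simps)
    moreover have tF: "trig_poly F" unfolding F_def by (intro tp_intros)
    ultimately have cF: "(coef F 0 + cnj (coef F 0)) / 2 = of_real (- (Re (A 1 0))\<^sup>2 / 2)"
      using coef_of_real_Re(1)[OF tF, of 0] by simp
    have "coef F 0 = coef (S 0 1) 0 + \<i> * coef (S 1 0) 0"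
      unfolding F_def by (simp add: coef_simps tp_intros)
    moreover have "coef (S 0 1) 0 = 0"
    proof -
      have "\<phi> 0 * B 1 (- e 0) = 0"
        using wt\<phi>[of 0] k0[of "- e 0"] d1 b by (auto simp: euler_coef_def)
      then show ?thesis using d(3)[of 2] d1 by (simp add: coefS numeral_2_eq_2)
    qed
    moreover have "coef (S 1 0) 0 = ?p * B 0 0"
    proof -
      have "\<beta> 1 * A 1 (- s 1) = 0" using wt\<beta>[of 1] k0[of "- s 1"] d1 b by (cases "\<beta> 1 = 0"; cases "A 1 (- s 1) = 0") auto
      moreover have "t 1 = 0 \<Longrightarrow> \<gamma> 1 = 0" using wt\<gamma>[of 1] b by auto
      ultimately show ?thesis using K2 e0 by (auto simp add: coefS)
    qed
    moreover have "Im (?p * B 0 0) = 0"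
      using Ip herm[of 0 0] by (simp add: euler_coef_def complex_eq_iff)
    ultimately have "Re (coef F 0) = 0" by simp
    then have "Re (A 1 0) = 0" using cF by (simp add: complex_eq_iff)
    moreover have "Im (A 1 0) = 0" using herm[of 1 0] by (simp add: complex_eq_iff)
    ultimately have "A 1 0 = 0" by (simp add: complex_eq_iff)
    then show False using d(2) k0 d1 by metis
  qed
qed

end

section \<open>Leading coefficients of the t- and w-components\<close>

context circle_data begin

text \<open>The case V = A2 y^2 + A0 |z|^(2 l): having only the frequency 0 means depending on |z|
  alone.\<close>

definition "square_form \<longleftrightarrow> ns \<and> d = 2 \<and> b = 1/2 \<and> (\<forall>k. A 1 k = 0) \<and> A 2 0 \<noteq> 0 \<and> (\<forall>k. k \<noteq> 0 \<longrightarrow> A 2 k = 0)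
   \<and> A 0 0 \<noteq> 0 \<and> (\<forall>k. k \<noteq> 0 \<longrightarrow> A 0 k = 0)"

lemma AA_eq_0D: "(\<And>u. cmod u = 1 \<Longrightarrow> AA j u = 0) \<Longrightarrow> A j k = 0"
  using ev_eq_0[OF finA] by blast

text \<open>Row K - 1 equates Im (\<beta> (K - 1) u^s) times A 2 with a nonzero constant. The first
  factor therefore has no zero on the circle, so s = 0, and the weight equations b (K + 1) = 2 and b
  (K - 1) = 1 give b = 1/2 and K = 3. The lower rows then dispose of A 1 and of the nonzero
  frequencies of A 0.\<close>

lemma square_of_constant_gamma:
  assumes va: "vanish_above K" and K: "K \<ge> 2" and \<phi>0: "\<phi> K = 0" and \<beta>0: "\<beta> K = 0"
    and \<gamma>0: "\<gamma> K \<noteq> 0" and t0: "t K = 0" and Im\<gamma>: "Im (\<gamma> K) = 0"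
  shows square_form
proof -
  have bK: "b * (real K + 1) = 2" using wt\<gamma>[OF \<gamma>0] t0 by simp
  define g where "g = Re (\<gamma> K)"
  have g: "g \<noteq> 0" using \<gamma>0 Im\<gamma> by (auto simp: g_def complex_eq_iff)
  have "(1/2) * (real K + 1) \<ge> b * (real K + 1)" using b by (intro mult_right_mono) auto
  then have K3: "K \<ge> 3" using bK by simp
  have bKe: "b * real K = 2 - b" using bK by (simp add: algebra_simps)
  have ImS: "Im (S K j u) = (if j = 0 then g / 2 else 0)" if "cmod u = 1" for j u
    using Re_S_phi0(2)[OF \<phi>0 that, of j] \<beta>0 t0 by (simp add: g_def)
  \<comment> \<open>The weights would force e (K - 1) = -1 and a = 1 - b, possible under a, b <= 1/2
    only for the excluded pair (1/2, 1/2).\<close>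
  have p0: "\<phi> (K - 1) = 0"
  proof (rule ccontr)
    assume p: "\<phi> (K - 1) \<noteq> 0"
    have w: "a * e (K - 1) = b - 1" and e: "e (K - 1) \<ge> -1"
      using wt\<phi>[OF p] bKe K by (simp_all add: of_nat_diff)
    have "a * e (K - 1) < 0" using w b by simp
    then have "e (K - 1) < 0" using a(1) by (simp add: mult_less_0_iff)
    then have "e (K - 1) = -1" using e by simp
    then have "a = 1 - b" using w by simp
    then show False using a b nonquad by auto
  qed
  have R1: "real (J + 1) * (Im (\<beta> (K - 1) * u powi s (K - 1)) * Re (AA (J + 1) u)) / 2
      = (if J = 1 then real K * g / 2 else 0)" if "cmod u = 1" "J \<ge> 1" for u J
  proof -
    have "Re (S (K - 1) J u) = (if J = 1 then real K * g / 2 else 0)"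
      using row1[OF va K that] ImS[OF that(1), of "J - 1"] that(2) by auto
    then show ?thesis unfolding Re_S_phi0(1)[OF p0 that(1), of J] using that(2) by simp
  qed
  have s1: "s (K - 1) = 0"
  proof (rule ccontr)
    assume "s (K - 1) \<noteq> 0"
    then obtain u where "cmod u = 1" "Im (\<beta> (K - 1) * u powi s (K - 1)) = 0" by (rule Im_monomial_has_zero)
    then show False using R1[of u 1] K g by simp
  qed
  define h where "h = Im (\<beta> (K - 1))"
  have R1': "real (J + 1) * h * Re (AA (J + 1) u) = (if J = 1 then real K * g else 0)"
    if "cmod u = 1" "J \<ge> 1" for u J
    using R1[OF that] s1 by (simp add: h_def split: if_splits)
  have h0: "h \<noteq> 0" using R1'[of 1 1] K g by auto
  have "\<beta> (K - 1) \<noteq> 0" using h0 by (auto simp: h_def)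
  then have "b * real (K - 1) = 1" using wt\<beta>[of "K - 1"] s1 by (simp only: of_int_0 mult_zero_right add_0 not_False_eq_True)
  then have "b * real K - b = 1" using K by (simp add: of_nat_diff algebra_simps)
  then have b2: "b = 1/2" using bKe by simp
  have K3: "K = 3" using bKe b2 by simp
  define c where "c = 3 * g / (2 * h)"
  have AA2: "AA 2 u = of_real c" if "cmod u = 1" for u
  proof -
    have "Re (AA 2 u) = c" using R1'[OF that, of 1] h0 K3 by (simp add: c_def field_simps numeral_2_eq_2)
    then show ?thesis using AA_Re[OF that, of 2] by metis
  qed
  have c0: "c \<noteq> 0" using g h0 by (simp add: c_def)
  have A2: "A 2 k = (if k = 0 then of_real c else 0)" for k
    using fun_cong[OF coef_cong[of "AA 2", OF AA2], of k] by (simp add: coef_simps)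
  have "A (J + 1) k = 0" if "J \<ge> 2" for J k
  proof (rule AA_eq_0D)
    fix u :: complex assume u: "cmod u = 1"
    show "AA (J + 1) u = 0" using R1'[OF u, of J] that h0 AA_Re[OF u, of "J + 1"] by simp
  qed
  then have A3: "A j k = 0" if "j \<ge> 3" for j k using that by (metis Suc_eq_plus1 Suc_leD Suc_le_D Suc_le_mono numeral_2_eq_2 numeral_3_eq_3)
  have d2: "d = 2"
  proof (rule antisym)
    show "d \<le> 2" using A3 d(2) by (metis Suc_leI linorder_not_less numeral_2_eq_2 numeral_3_eq_3)
    show "2 \<le> d" using A2[of 0] c0 d(3)[of 2 0] by (simp add: not_le[symmetric]) (metis not_le)
  qed
  have n2: "n 2 = 0" by (simp add: ndeg_def b2)
  \<comment> \<open>As n 2 = 0, the frequency 0 of A 2 is already extremal, which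
    \<open>sing\<close> would forbid.\<close>
  have ns: ns using sing[of 2 0] A2[of 0] c0 n2 by auto
  have n0: "n 0 = 1 / a" and n1: "n 1 = 1 / (2 * a)" by (simp_all add: ndeg_def b2)
  have K1: "K - 1 = 2" using K3 by simp
  \<comment> \<open>Row i = 2, J = 0 says that A 1 is, up to a factor, the imaginary part of a
    monomial of extremal frequency n 1; \<open>N2\<close> has removed exactly these
    frequencies.\<close>
  have A1: "A 1 k = 0" for k
  proof -
    have e1: "of_real h * AA 1 u = of_real (Im (\<gamma> 2 * u powi t 2))" if "cmod u = 1" for u
    proof -
      have "h * Re (AA 1 u) = Im (\<gamma> 2 * u powi t 2)"
        using row1'[OF va K that] Re_S_phi0(1)[OF p0 that, of 0] s1 K1 by (simp add: h_def)
      then show ?thesis using AA_Re[OF that, of 1] by (metis of_real_mult)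
    qed
    have tp: "trig_poly (\<lambda>u. \<gamma> 2 * u powi t 2)" by (intro tp_intros)
    have "of_real h * A 1 k = coef (\<lambda>u. of_real (Im (\<gamma> 2 * u powi t 2))) k"
      using fun_cong[OF coef_cong[of "\<lambda>u. of_real h * AA 1 u", OF e1], of k] by (simp add: coef_simps tp_intros)
    also have "\<dots> = (\<gamma> 2 * (if k = t 2 then 1 else 0) - cnj (\<gamma> 2 * (if -k = t 2 then 1 else 0))) / (2 * \<i>)"
      unfolding coef_of_real_Im(1)[OF tp] by (simp only: coef_simps tp_intros)
    finally have *: "of_real h * A 1 k = \<dots>" .
    show ?thesis
    proof (rule ccontr)
      assume nz: "A 1 k \<noteq> 0"
      then have "\<gamma> 2 \<noteq> 0" "k = t 2 \<or> -k = t 2" using * h0 by (auto split: if_splits)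
      moreover have "a * t 2 = 1/2" using wt\<gamma>[of 2] \<open>\<gamma> 2 \<noteq> 0\<close> b2 by simp
      then have "real_of_int (t 2) = n 1" unfolding n1 using a(1) by (simp add: field_simps)
      ultimately have "real_of_int k = n 1 \<or> real_of_int (-k) = n 1" by auto
      then have "A 1 k = 0 \<or> A 1 (-k) = 0" using N2[OF ns, of k] N2[OF ns, of "-k"] d2 n2 by auto
      then show False using nz A_supp_neg by blast
    qed
  qed
  then have AA1: "AA 1 u = 0" for u by (simp add: ev_def)
  \<comment> \<open>Rows i = 1, J = 0 and i = 0, J = 1 are compared at the frequencies k and -k. The
    first makes \<phi> 1 B 0 skew-Hermitian there, the second then makes \<phi> 1 purely imaginary;
    together they give n 0 + k = n 0 - k.\<close>
  have A0: "k = 0" if nz: "A 0 k \<noteq> 0" for k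
  proof -
    define x where "x k = \<phi> 1 * B 0 k" for k
    have nk: "real_of_int k \<noteq> n 0" "real_of_int (-k) \<noteq> n 0"
      using N1[OF ns, of k] N1[OF ns, of "-k"] nz A_supp_neg by blast+
    have e1: "\<phi> 1 \<noteq> 0 \<Longrightarrow> e 1 = 0" using wt\<phi>[of 1] b2 a by auto
    have t1: "\<gamma> 1 \<noteq> 0 \<Longrightarrow> t 1 = n 0" using wt\<gamma>[of 1] b2 a by (auto simp: n0 field_simps)
    have s0: "\<beta> 0 \<noteq> 0 \<Longrightarrow> s 0 = n 0" using wt\<beta>[of 0] a by (auto simp: n0 field_simps)
    have c10: "coef (S 1 0) k' = x k'" if "k' = k \<or> k' = -k" for k'
      using e1 t1 nk that A1 by (cases "\<phi> 1 = 0"; cases "\<gamma> 1 = 0") (auto simp: coefS x_def)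
    have B1: "B 1 k = 0" for k using A1 by (simp add: euler_coef_def)
    have c01: "coef (S 0 1) k' = 0" if "k' = k \<or> k' = -k" for k'
    proof -
      have "\<beta> 0 * A 2 (k' - s 0) = 0" using s0 nk that A2[of "k' - s 0"] by (cases "\<beta> 0 = 0") auto
      then show ?thesis using B1 by (simp add: coefS numeral_2_eq_2)
    qed
    have "coef (\<lambda>u. complex_of_real (Re (S 1 0 u))) = coef (\<lambda>u. 0)"
      using rows[of _ 1 0] by (intro coef_cong) simp
    then have "coef (\<lambda>u. complex_of_real (Re (S 1 0 u))) k = 0" by (simp add: coef_simps)
    then have X1: "x k + cnj (x (-k)) = 0"
      unfolding coef_of_real_Re(1)[OF tpS] using c10[of k] c10[of "-k"] by simp
    define F where "F = (\<lambda>u. S 0 1 u + \<i> * S 1 0 u)"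
    have tF: "trig_poly F" unfolding F_def by (intro tp_intros)
    have "of_real (Re (F u)) = - of_real c * AA 0 u" if "cmod u = 1" for u
    proof -
      have "Re (F u) = - c * Re (AA 0 u)"
        using rows[OF that, of 0 1] AA2[OF that] AA1[of u] by (simp add: F_def numeral_2_eq_2 mult.commute)
      then show ?thesis using AA_Re[OF that, of 0] by (metis of_real_minus of_real_mult)
    qed
    then have "coef (\<lambda>u. of_real (Re (F u))) = coef (\<lambda>u. - of_real c * AA 0 u)" by (rule coef_cong)
    then have "coef (\<lambda>u. of_real (Re (F u))) k = - of_real c * A 0 k" by (simp add: coef_simps tp_intros)
    moreover have "coef F k' = \<i> * x k'" if "k' = k \<or> k' = -k" for k'
      using c01[OF that] c10[OF that] by (simp add: F_def coef_simps tp_intros)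
    ultimately have "(\<i> * x k + cnj (\<i> * x (-k))) / 2 = - of_real c * A 0 k"
      unfolding coef_of_real_Re(1)[OF tF] by simp
    moreover have "cnj (x (-k)) = - x k" using X1 by (simp add: add_eq_0_iff)
    ultimately have X2: "\<i> * x k = - of_real c * A 0 k" by simp
    have ph: "\<phi> 1 \<noteq> 0" using X2 nz c0 by (auto simp: x_def)
    have cx: "cnj (x (-k)) = cnj (\<phi> 1) * of_real ((n 0 - real_of_int k) / 2) * A 0 k"
      using herm[of 0 k] by (simp add: x_def euler_coef_def)
    have Y1: "(\<phi> 1 * of_real ((n 0 + real_of_int k) / 2) + cnj (\<phi> 1) * of_real ((n 0 - real_of_int k) / 2)) * A 0 k = 0"
      using X1 unfolding cx by (simp add: x_def euler_coef_def ring_distribs mult.assoc)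
    have "(\<i> * \<phi> 1 * of_real ((n 0 + real_of_int k) / 2) + of_real c) * A 0 k = 0"
      using X2 by (simp add: x_def euler_coef_def ring_distribs mult.assoc)
    then have Y2: "\<i> * \<phi> 1 * of_real ((n 0 + real_of_int k) / 2) = - of_real c"
      using nz by (simp add: add_eq_0_iff2)
    from Y1 have Y1': "\<phi> 1 * of_real ((n 0 + real_of_int k) / 2) = - cnj (\<phi> 1) * of_real ((n 0 - real_of_int k) / 2)"
      using nz by (simp add: add_eq_0_iff2)
    have nk0: "n 0 + real_of_int k \<noteq> 0" "n 0 - real_of_int k \<noteq> 0" using nk by auto
    from Y2 have "Re (\<phi> 1) = 0" using nk0 by (simp add: complex_eq_iff)
    then have "cnj (\<phi> 1) = - \<phi> 1" by (simp add: complex_eq_iff)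
    with Y1' have "\<phi> 1 * of_real ((n 0 + real_of_int k) / 2) = \<phi> 1 * of_real ((n 0 - real_of_int k) / 2)" by simp
    then have "complex_of_real ((n 0 + real_of_int k) / 2) = of_real ((n 0 - real_of_int k) / 2)" using ph by simp
    then show ?thesis unfolding of_real_eq_iff by simp
  qed
  \<comment> \<open>Otherwise V would be a multiple of y^2 without any z, against
    \<open>ND2\<close>.\<close>
  have "A 0 0 \<noteq> 0"
  proof
    assume z: "A 0 0 = 0"
    obtain j k where jk: "B j k \<noteq> 0" using ND2[OF ns] by blast
    then have "A j k \<noteq> 0" by (simp add: B_eq_0)
    then have "j = 2" "k = 0" using A0 z A1 d(3) d2 A2 by (metis One_nat_def less_2_cases nat_neq_iff)+
    then show False using jk n2 by (simp add: euler_coef_def)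
  qed
  then show ?thesis unfolding square_form_def using ns d2 b2 A1 A2 c0 A0 by auto
qed

text \<open>For d = 1, row K at J = 0 reads Im (\<beta> u^s) A 1 = Im (\<gamma> u^t). If p is the
  top frequency of A 1, this gives |s| + p = t or -t, while the weights give t = s + n 1. Reality of
  \<open>S (K - 1) 1\<close> excludes \<phi> (K - 1), hence \<open>S K 0\<close> vanishes, which
  contradicts \<open>ND1\<close> if \<open>ns\<close> holds and \<open>sing\<close> if it does
  not.\<close>

lemma top_beta_real_constant:
  assumes va: "vanish_above K" and K: "K \<ge> 2" and \<phi>0: "\<phi> K = 0" and d1: "d = 1"
    and ne: "\<not> (\<beta> K = 0 \<or> (s K = 0 \<and> Im (\<beta> K) = 0))"
  shows False
proof -
  have \<beta>0: "\<beta> K \<noteq> 0" using ne by simp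
  have n1: "n 1 > 0" using a b by (simp add: ndeg_def)
  have eq0: "of_real (Im (\<beta> K * u powi s K)) * AA 1 u = of_real (Im (\<gamma> K * u powi t K))" if "cmod u = 1" for u
  proof -
    have "Im (\<beta> K * u powi s K) * Re (AA 1 u) = Im (\<gamma> K * u powi t K)"
      using row0[OF va _ that, of 0] K Re_S_phi0(1)[OF \<phi>0 that, of 0] by simp
    then show ?thesis using AA_Re[OF that, of 1] by (metis of_real_mult)
  qed
  have tpb: "trig_poly (\<lambda>u. \<beta> K * u powi s K)" and tpg: "trig_poly (\<lambda>u. \<gamma> K * u powi t K)" by (intro tp_intros)+
  \<comment> \<open>Row K - 2 at J = 2: since d = 1, both \<open>S (K - 2) 2\<close> and the
    quadratic term are zero.\<close>
  have real1: "S (K - 1) 1 u \<in> \<real>" if "cmod u = 1" for u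
    using row2[OF va K that, of 2] S_d(2)[of 2 "K - 2" u] QQ_eq_0[of 2 u] d1 K
    by (simp add: complex_is_Real_iff split: if_splits)
  define x where "x = coef (S (K - 1) 1)"
  have x: "x k = \<phi> (K - 1) * B 1 (k - e (K - 1))" for k
    using d(3)[of 2] d1 by (simp add: x_def coefS numeral_2_eq_2)
  have xr: "x (-k) = cnj (x k)" for k
    unfolding x_def by (rule coef_real[OF tpS real1])
  obtain p where p: "A 1 p \<noteq> 0" "\<And>m. m > p \<Longrightarrow> A 1 m = 0"
    using trig_poly_top[of "AA 1"] d(2) d1 by (metis coefAA tp_ev)
  have p0: "p \<ge> 0"
  proof (rule ccontr)
    assume "\<not> p \<ge> 0"
    then have "A 1 (-p) = 0" using p(2) by simp
    then show False using p(1) A_supp_neg by blast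
  qed
  have Apm: "A 1 k \<noteq> 0 \<Longrightarrow> \<bar>k\<bar> \<le> p" for k
    using p(2)[of k] p(2)[of "-k"] A_supp_neg[of 1 k] by fastforce
  have tn: "\<gamma> K \<noteq> 0 \<Longrightarrow> real_of_int (t K) = real_of_int (s K) + n 1"
  proof -
    assume g: "\<gamma> K \<noteq> 0"
    have "a * t K = a * s K + (1 - b)" using wt\<gamma>[OF g] wt\<beta>[OF \<beta>0] by (simp add: algebra_simps)
    then show ?thesis using a(1) by (simp add: ndeg_def field_simps)
  qed
  define f where "f = (\<lambda>u. complex_of_real (Im (\<beta> K * u powi s K)))"
  have tf: "trig_poly f" and cf: "coef f k = ((if k = s K then \<beta> K else 0) - (if -k = s K then cnj (\<beta> K) else 0)) / (2 * \<i>)" for k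
    using coef_of_real_Im[OF tpb] unfolding f_def by (auto simp: coef_simps tp_intros)
  have cg: "coef (\<lambda>u. f u * AA 1 u) k = ((if k = t K then \<gamma> K else 0) - (if -k = t K then cnj (\<gamma> K) else 0)) / (2 * \<i>)" for k
  proof -
    have "coef (\<lambda>u. f u * AA 1 u) k = coef (\<lambda>u. complex_of_real (Im (\<gamma> K * u powi t K))) k"
      unfolding f_def by (rule fun_cong[OF coef_cong]) (rule eq0)
    then show ?thesis using coef_of_real_Im(1)[OF tpg, of k] by (auto simp: coef_simps tp_intros)
  qed
  have cfp: "coef f \<bar>s K\<bar> \<noteq> 0"
  proof (cases "s K = 0")
    case True
    then have "\<beta> K \<noteq> cnj (\<beta> K)" using ne by (auto simp: complex_eq_iff)
    then show ?thesis using True by (simp add: cf)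
  qed (use \<beta>0 in \<open>auto simp: cf\<close>)
  have topc: "coef (\<lambda>u. f u * AA 1 u) (\<bar>s K\<bar> + p) = coef f \<bar>s K\<bar> * A 1 p"
  proof -
    have "coef f m = 0" if "m > \<bar>s K\<bar>" for m using that by (auto simp: cf)
    then show ?thesis using coef_mult_top[OF tf, of "AA 1" "\<bar>s K\<bar>" p] p(2) by (simp only: coefAA tp_ev)
  qed
  then have "coef (\<lambda>u. f u * AA 1 u) (\<bar>s K\<bar> + p) \<noteq> 0" using cfp p(1) by simp
  then have g0: "\<gamma> K \<noteq> 0" and tp: "\<bar>s K\<bar> + p = t K \<or> \<bar>s K\<bar> + p = - t K"
    unfolding cg by (auto split: if_splits)
  have tp': "real_of_int (\<bar>s K\<bar> + p) = real_of_int (s K) + n 1 \<or> real_of_int (\<bar>s K\<bar> + p) = - real_of_int (s K) - n 1"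
    using tp tn[OF g0] by auto
  \<comment> \<open>Otherwise e (K - 1) = s K, and reality of \<open>S (K - 1) 1\<close> reflects
    frequencies. Reflecting p + s gives s <= 0; if p < n 1, reflecting -p + s gives s >= 0 as well.
    Each case then contradicts \<open>tp'\<close>.\<close>
  have ph: "\<phi> (K - 1) = 0"
  proof (rule ccontr)
    assume ph: "\<phi> (K - 1) \<noteq> 0"
    have "a * e (K - 1) + b * real K = 1" using wt\<phi>[OF ph] K by (simp add: of_nat_diff)
    then have "a * e (K - 1) = a * s K" using wt\<beta>[OF \<beta>0] by linarith
    then have es: "e (K - 1) = s K" using a(1) by simp
    have np: "real_of_int p \<noteq> - n 1" using p0 n1 by linarith
    have "x (p + s K) \<noteq> 0" using x[of "p + s K"] es ph p(1) np by (simp add: B_eq_0)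
    then have "x (- p - s K) \<noteq> 0" using xr[of "p + s K"] by simp
    then have 1: "A 1 (- p - 2 * s K) \<noteq> 0" "real_of_int (- p - 2 * s K) \<noteq> - n 1"
      using x[of "- p - s K"] es by (simp_all add: B_eq_0 algebra_simps)
    have s0: "s K \<le> 0" using Apm[OF 1(1)] by simp
    show False
    proof (cases "real_of_int p = n 1")
      case True
      then have "s K < 0" using 1(2) s0 by (cases "s K = 0") auto
      then show False using tp' True n1 p0 by linarith
    next
      case False
      have "x (- p + s K) \<noteq> 0"
        using x[of "- p + s K"] es ph p(1) A_supp_neg[of 1 p] False by (simp add: B_eq_0)
      then have "x (p - s K) \<noteq> 0" using xr[of "- p + s K"] by simp
      then have "A 1 (p - 2 * s K) \<noteq> 0"
        using x[of "p - s K"] es by (simp add: B_eq_0 algebra_simps)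
      then have "s K = 0" using Apm s0 by fastforce
      then show False using tp' False p0 n1 by auto
    qed
  qed
  have SK0: "S K 0 u = 0" if "cmod u = 1" for u
    using Im_SK_eq_0[OF va K, of 1 u] that S_d(1)[of "K - 1"] d1 ph by simp
  show False
  proof (cases ns)
    case True
    have "S K j u = 0" if "cmod u = 1" for j u
      using SK0[OF that] S_d(1)[of K u] S_d(2)[of j K u] \<phi>0 d1 by (cases "j = 0"; cases "j = 1") auto
    then show False using ND1[OF True] \<beta>0 by blast
  next
    case False
    have "coef (S K 0) = coef (\<lambda>u. 0)" by (rule coef_cong) (rule SK0)
    then have "coef (S K 0) (p + s K) = 0" by (simp add: coef_simps)
    then have "p + s K = t K" using \<phi>0 p(1) \<beta>0 by (auto simp: coefS split: if_splits)
    then have "real_of_int p = n 1" using tn[OF g0] by linarith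
    then show False using sing[OF False _ p(1)] by simp
  qed
qed

end

section \<open>A nonzero leading coefficient of the z-component\<close>

context circle_data begin

text \<open>Now A d is a constant, b d = 1, and all entries \<open>S i d\<close> vanish, which also
  yields \<beta> K = 0. The exponent e K decides the rest. If e K >= 1, some top frequency of Re
  \<open>S K J\<close> stays unbalanced. If e K = 0, V depends on |z| and y only, \<phi> K is
  imaginary, and the mean of row K - 1 leaves no room for it. If e K = -1, row K - 1 carries the
  vanishing of \<open>S K J\<close> from J = d - 1 down to 0, against \<open>ND1\<close>.\<close>

lemma top_phi_eq_0:
  assumes va: "vanish_above K" and K: "K \<ge> 2" and \<phi>0: "\<phi> K \<noteq> 0" and nd: "n d = 0"
  shows False
proof -
  have ns: ns using sing[of d] d nd by fastforce
  have bd: "b * real d = 1" using nd a(1) by (simp add: ndeg_def)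
  have d2: "d \<ge> 2"
  proof (rule ccontr)
    assume "\<not> d \<ge> 2"
    then have "d = 1" using d(1) by simp
    then show False using bd b by simp
  qed
  have Ad: "k = 0" if "A d k \<noteq> 0" for k using A_supp[OF that] nd by simp
  define c where "c = A d 0"
  have c0: "c \<noteq> 0" using d(2) Ad unfolding c_def by metis
  have Bd: "B d k = 0" for k using Ad[of k] nd by (auto simp: euler_coef_def)
  then have BBd: "BB d u = 0" for u by (simp add: ev_def)
  have Sd: "S i d u = 0" for i u using S_d(1) BBd by simp
  have AAd: "AA d u = c" for u unfolding c_def by (subst ev_superset[of "{0}"]) (use Ad in auto)
  have dd: "Suc (d - 1) = d" using d2 by simp
  have notall: "\<exists>J u. cmod u = 1 \<and> S K J u \<noteq> 0" using ND1[OF ns, of K] \<phi>0 by blast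
  have we: "a * e K + b * (real K + 1) = 1" and e1: "e K \<ge> -1" using wt\<phi>[OF \<phi>0] by auto
  have SKd1: "S K (d - 1) u = 0" if "cmod u = 1" for u
    using Im_SK_eq_0[OF va K d(1) _ that] Sd by simp
  have cSd1: "coef (S K (d - 1)) = coef (\<lambda>u. 0)" by (rule coef_cong) (rule SKd1)
  have eq1: "\<phi> K * B (d - 1) (k - e K) + of_nat d * \<beta> K / (2 * \<i>) * A d (k - s K) = 0" for k
  proof -
    have "coef (S K (d - 1)) k = 0" unfolding cSd1 by (simp add: coef_simps)
    moreover have "d - 1 + 1 = d" "d - 1 \<noteq> 0" using d2 by auto
    ultimately show ?thesis unfolding coefS by simp
  qed
  have nd1: "n (d - 1) = b / a" using bd d2 a(1) by (simp add: ndeg_def of_nat_diff algebra_simps)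
  have N2': "A (d - 1) k = 0" if "real_of_int k = n (d - 1) \<or> real_of_int k = - n (d - 1)" for k
    using N2[OF ns nd d2, of k] N2[OF ns nd d2, of "-k"] A_supp_neg[of "d - 1" k] that by auto
  \<comment> \<open>In \<open>eq1\<close> a coefficient of B (d - 1) can be balanced only by \<beta>
    K, and the weights place this at the extremal frequency n (d - 1), which \<open>N2\<close> has
    cleared.\<close>
  have Ad1: "A (d - 1) k = 0" for k
  proof (rule ccontr)
    assume nz: "A (d - 1) k \<noteq> 0"
    then have "B (d - 1) k \<noteq> 0" using N2' by (auto simp: B_eq_0)
    then have "\<beta> K \<noteq> 0" "k + e K - s K = 0"
      using eq1[of "k + e K"] \<phi>0 Ad[of "k + e K - s K"]
      by (cases "\<beta> K = 0"; cases "A d (k + e K - s K) = 0"; simp)+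
    then have "a * s K + b * real K = 1" "s K = k + e K" using wt\<beta> by auto
    then have "a * real_of_int k = b" using we by (simp add: algebra_simps)
    then have "real_of_int k = n (d - 1)" unfolding nd1 using a(1) by (simp add: field_simps)
    then show False using nz N2' by blast
  qed
  have \<beta>K: "\<beta> K = 0" using eq1[of "s K"] Ad1 c0 d2 by (auto simp: c_def euler_coef_def)
  have cS: "coef (S K J) k = \<phi> K * B J (k - e K) - (if J = 0 \<and> k = t K then \<gamma> K / (2 * \<i>) else 0)" for J k
    by (simp add: coefS \<beta>K)
  have tK: "\<gamma> K \<noteq> 0 \<Longrightarrow> real_of_int (t K) = real_of_int (e K) + n 0"
  proof -
    assume "\<gamma> K \<noteq> 0"
    then have "a * t K = a * e K + 1" using wt\<gamma>[of K] we by auto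
    then show ?thesis using a(1) by (simp add: ndeg_def field_simps)
  qed
  have ReS: "coef (S K J) k + cnj (coef (S K J) (-k)) = 0" for J k
  proof -
    have "coef (\<lambda>u. complex_of_real (Re (S K J u))) = coef (\<lambda>u. 0)"
      using row0[OF va] K by (intro coef_cong) simp
    then have "coef (\<lambda>u. complex_of_real (Re (S K J u))) k = 0" by (simp add: coef_simps)
    then show ?thesis unfolding coef_of_real_Re(1)[OF tpS] by simp
  qed
  have N1': "A 0 k = 0" if "real_of_int k = n 0 \<or> real_of_int k = - n 0" for k
    using N1[OF ns, of k] N1[OF ns, of "-k"] A_supp_neg[of 0 k] that by auto
  have someA: "\<exists>J<d. \<exists>k. A J k \<noteq> 0"
  proof -
    obtain j k where jk: "B j k \<noteq> 0" using ND2[OF ns] by blast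
    then have "A j k \<noteq> 0" by (simp add: B_eq_0)
    moreover have "j < d" using jk Bd calculation d(3)[of j k] by (metis linorder_neqE_nat)
    ultimately show ?thesis by blast
  qed
  consider "e K \<ge> 1" | "e K = 0" | "e K = -1" using e1 by linarith
  then show False
  proof cases
    case 1
    \<comment> \<open>With p the top frequency of A J, the frequency p + e K of \<open>S K J\<close>
      has its mirror image outside the support of A J shifted by e K.\<close>
    obtain J k where J: "J < d" "A J k \<noteq> 0" using someA by blast
    obtain p where p: "A J p \<noteq> 0" "\<And>m. m > p \<Longrightarrow> A J m = 0"
      using trig_poly_top[of "AA J" k] J(2) by (metis coefAA tp_ev)
    have p0: "p \<ge> 0"
    proof (rule ccontr)
      assume "\<not> p \<ge> 0"
      then have "A J (-p) = 0" using p(2) by simp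
      then show False using p(1) A_supp_neg by blast
    qed
    have nJ: "n J > 0" using n_pos[OF J(1)] .
    have "B J p \<noteq> 0" using p(1) p0 nJ by (simp add: B_eq_0)
    moreover have "\<not> (J = 0 \<and> p + e K = t K \<and> \<gamma> K \<noteq> 0)" using tK N1'[of p] p(1) by (cases "J = 0"; cases "\<gamma> K = 0") auto
    ultimately have "coef (S K J) (p + e K) \<noteq> 0" using \<phi>0 by (auto simp: cS)
    moreover have "coef (S K J) (- (p + e K)) = 0"
    proof -
      have "A J (- (p + e K) - e K) = 0"
        using p(2)[of "p + 2 * e K"] 1 A_supp_neg[of J "p + 2 * e K"] by (auto simp: algebra_simps)
      moreover have "\<not> (J = 0 \<and> - (p + e K) = t K \<and> \<gamma> K \<noteq> 0)"
      proof
        assume h: "J = 0 \<and> - (p + e K) = t K \<and> \<gamma> K \<noteq> 0"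
        then have "real_of_int (- (p + e K)) = real_of_int (e K) + n 0" using tK by metis
        then show False using nJ h p0 1 by simp
      qed
      ultimately show ?thesis by (auto simp: cS euler_coef_def)
    qed
    ultimately show False using ReS[of J "p + e K"] by simp
  next
    case 2
    \<comment> \<open>The equation at the frequency k has real part Re (\<phi> K) n J and imaginary
      part Im (\<phi> K) k.\<close>
    have key: "k = 0 \<and> Re (\<phi> K) = 0" if J: "J < d" "A J k \<noteq> 0" for J k
    proof -
      have nt: "\<not> (J = 0 \<and> j = t K \<and> \<gamma> K \<noteq> 0)" if "j = k \<or> j = - k" for j
      proof
        assume h: "J = 0 \<and> j = t K \<and> \<gamma> K \<noteq> 0"
        then have "real_of_int j = n 0" using tK 2 by simp
        then have "A 0 k = 0" using N1'[of k] that by auto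
        then show False using J(2) h by simp
      qed
      have "\<phi> K * B J k + cnj (\<phi> K * B J (-k)) = 0"
        using ReS[of J k] nt[of k] nt[of "-k"] 2 unfolding cS by (auto split: if_splits)
      then have "(\<phi> K * of_real ((n J + k) / 2) + cnj (\<phi> K) * of_real ((n J - k) / 2)) * A J k = 0"
        using herm[of J k] by (simp add: euler_coef_def ring_distribs mult.assoc)
      then have *: "\<phi> K * of_real ((n J + k) / 2) + cnj (\<phi> K) * of_real ((n J - k) / 2) = 0" using J(2) by simp
      have "Re (\<phi> K) * n J = 0" using arg_cong[OF *, of Re] by (simp add: field_simps)
      then have r: "Re (\<phi> K) = 0" using n_pos[OF J(1)] by simp
      have "Im (\<phi> K) * k = 0" using arg_cong[OF *, of Im] by (simp add: field_simps)
      then show ?thesis using r \<phi>0 by (auto simp: complex_eq_iff)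
    qed
    obtain J k where J: "J < d" "A J k \<noteq> 0" using someA by blast
    then have k0: "k = 0" and rp: "Re (\<phi> K) = 0" using key by auto
    have supp0: "k = 0" if "A j k \<noteq> 0" for j k
      using key[of j k] Ad[of k] d(3)[of j k] that by (metis linorder_neqE_nat)
    have we': "b * (real K + 1) = 1" using we 2 by simp
    have "coef (\<lambda>u. complex_of_real (Re (S (K - 1) (J + 1) u))) = coef (\<lambda>u. of_nat K * complex_of_real (Im (S K J u)))"
      using row1[OF va K, of _ "J + 1"] by (intro coef_cong) simp
    then have "coef (\<lambda>u. complex_of_real (Re (S (K - 1) (J + 1) u))) 0
        = coef (\<lambda>u. of_nat K * complex_of_real (Im (S K J u))) 0" by (rule fun_cong)
    then have eq: "(coef (S (K - 1) (J + 1)) 0 + cnj (coef (S (K - 1) (J + 1)) 0)) / 2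
        = of_nat K * ((coef (S K J) 0 - cnj (coef (S K J) 0)) / (2 * \<i>))"
      unfolding coef_cmul[OF coef_of_real_Im(2)[OF tpS]] coef_of_real_Re(1)[OF tpS] coef_of_real_Im(1)[OF tpS] by simp
    have "coef (S (K - 1) (J + 1)) 0 = 0"
    proof -
      have "\<phi> (K - 1) * B (J + 1) (- e (K - 1)) = 0"
      proof (cases "\<phi> (K - 1) = 0")
        case False
        then have "a * e (K - 1) + b * real K = 1" using wt\<phi>[OF False] K by (simp add: of_nat_diff)
        then have "e (K - 1) \<noteq> 0" using we' b by (auto simp: algebra_simps)
        then show ?thesis using supp0[of "J + 1" "- e (K - 1)"] by (auto simp: euler_coef_def)
      qed simp
      moreover have "\<beta> (K - 1) * A (J + 2) (- s (K - 1)) = 0"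
      proof (cases "\<beta> (K - 1) = 0")
        case False
        then have "a * s (K - 1) + b * (real K - 1) = 1" using wt\<beta>[OF False] K by (simp add: of_nat_diff)
        then have "s (K - 1) \<noteq> 0" using we' b by (auto simp: algebra_simps)
        then show ?thesis using supp0[of "J + 2" "- s (K - 1)"] by auto
      qed simp
      ultimately show ?thesis by (auto simp: coefS)
    qed
    moreover have X: "coef (S K J) 0 = \<phi> K * of_real (n J / 2) * A J 0"
    proof -
      have "\<gamma> K \<noteq> 0 \<Longrightarrow> t K \<noteq> 0 \<or> J \<noteq> 0" using tK 2 n_pos[OF J(1)] by (cases "J = 0") auto
      then show ?thesis using 2 by (auto simp: cS euler_coef_def)
    qed
    ultimately have "coef (S K J) 0 = cnj (coef (S K J) 0)" using eq K by simp
    moreover have "cnj (coef (S K J) 0) = - coef (S K J) 0"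
      unfolding X using rp herm[of J 0] by (simp add: complex_eq_iff)
    ultimately have "coef (S K J) 0 = 0" by simp
    then have "\<phi> K * of_real (n J / 2) * A J 0 = 0" unfolding X .
    then show False using \<phi>0 n_pos[OF J(1)] J(2) k0 by simp
  next
    case 3
    \<comment> \<open>With b d = 1 and e K = -1 the weight of \<phi> K becomes a = b r. As r is an
      integer, the weights of \<phi> (K - 1) and \<beta> (K - 1) turn into the divisibility
      conditions r | 1 and r | 2.\<close>
    define r where "r = int K + 1 - int d"
    have "a = b * (real K + 1) - b * real d" using we bd 3 by simp
    then have ar: "a = b * real_of_int r" by (simp add: r_def algebra_simps)
    have r1: "r \<ge> 1" using ar a(1) b(1) by (simp add: zero_less_mult_iff)
    have ph': "r = 1 \<and> e (K - 1) = 0" if "\<phi> (K - 1) \<noteq> 0"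
    proof -
      have "a * e (K - 1) + b * real K = 1" using wt\<phi>[OF that] K by (simp add: of_nat_diff)
      then have "b * (real_of_int r * e (K - 1)) = b * (1 - real_of_int r)"
        using bd unfolding ar by (simp add: r_def algebra_simps)
      then have "real_of_int r * e (K - 1) = 1 - real_of_int r" using b(1) by simp
      then have "real_of_int (r * (e (K - 1) + 1)) = real_of_int 1" by (simp add: algebra_simps)
      then have "r * (e (K - 1) + 1) = 1" unfolding of_int_eq_iff .
      then show ?thesis using r1 by (auto simp: zmult_eq_1_iff)
    qed
    have be': "(r = 1 \<and> s (K - 1) = 1) \<or> (r = 2 \<and> s (K - 1) = 0)" if "\<beta> (K - 1) \<noteq> 0"
    proof -
      have "a * s (K - 1) + b * (real K - 1) = 1" using wt\<beta>[OF that] K by (simp add: of_nat_diff)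
      then have "b * (real_of_int r * s (K - 1)) = b * (2 - real_of_int r)"
        using bd unfolding ar by (simp add: r_def algebra_simps)
      then have "real_of_int r * s (K - 1) = 2 - real_of_int r" using b(1) by simp
      then have "real_of_int (r * (s (K - 1) + 1)) = real_of_int 2" by (simp add: algebra_simps)
      then have *: "r * (s (K - 1) + 1) = 2" unfolding of_int_eq_iff .
      then have "r dvd 2" by (metis dvd_triv_left)
      then have "r \<le> 2" by (simp add: zdvd_imp_le)
      then have "r = 1 \<or> r = 2" using r1 by linarith
      then show ?thesis using * by auto
    qed
    have "\<beta> (K - 1) = 0"
    proof (rule ccontr)
      assume be: "\<beta> (K - 1) \<noteq> 0"
      consider "r = 1" "s (K - 1) = 1" | "r = 2" "s (K - 1) = 0" using be'[OF be] by blast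
      then show False
      proof cases
        case 1
        \<comment> \<open>Here d = 2 would be the excluded pair of weights, so K = d >= 3 and row K
          - 2 at J = d makes \<open>S (K - 1) (d - 1)\<close> real. Its only frequency is 1, so it
          vanishes.\<close>
        have "a = b" using ar 1 by simp
        moreover have "d = 2 \<Longrightarrow> b = 1/2" using bd by simp
        ultimately have d3: "d \<ge> 3" using nonquad d2 by (cases "d = 2") auto
        have Kd: "K = d" using 1(1) by (simp add: r_def)
        have K3: "K \<ge> 3" using Kd d3 by simp
        have "S (K - 1) (d - 1) u \<in> \<real>" if "cmod u = 1" for u
          using row2[OF va K that d2] K3 Sd by (simp add: complex_is_Real_iff split: if_splits)
        then have "coef (S (K - 1) (d - 1)) (-1) = cnj (coef (S (K - 1) (d - 1)) 1)"
          by (intro coef_real tpS)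
        moreover have "coef (S (K - 1) (d - 1)) k = of_nat d * \<beta> (K - 1) / (2 * \<i>) * A d (k - 1)" for k
          using Ad1 1(2) d2 dd by (simp add: coefS euler_coef_def)
        moreover have "A d (- 2) = 0" using Ad[of "-2"] by (cases "A d (- 2) = 0") simp_all
        ultimately have "cnj (of_nat d * \<beta> (K - 1) / (2 * \<i>) * c) = 0"
          by (simp add: c_def)
        then show False using be d2 c0 by simp
      next
        case 2
        \<comment> \<open>From a = 2 b <= 1/2 and b d = 1 follows d >= 4. Now \<beta> (K - 1) u^s is
          constant; row K - 2 kills its real part, and the incompatible factors of rows K - 1 and K
          - 3 kill its imaginary part.\<close>
        have Kd: "K = d + 1" using 2(1) by (simp add: r_def)
        have "4 * b \<le> b * real d" using ar 2(1) a(2) bd by simp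
        then have d4: "d \<ge> 4" using b(1) by (simp add: mult.commute)
        have K3: "K \<ge> 3" using Kd d4 by simp
        have p0: "\<phi> (K - 1) = 0" using ph' 2(1) by auto
        have RI: "Re (S (K - 1) (d - 1) u) = real d * (Im (\<beta> (K - 1)) * Re c) / 2"
           "Im (S (K - 1) (d - 1) u) = - real d * (Re (\<beta> (K - 1)) * Re c) / 2" if "cmod u = 1" for u
          using Re_S_phi0[OF p0 that, of "d - 1"] 2(2) d2 dd AAd by simp_all
        have cr: "Re c \<noteq> 0" using AA_Re[of 1 d] AAd c0 by auto
        have "Im (S (K - 1) (d - 1) 1) = 0"
          using row2[OF va K _ d2, of 1] K3 Sd by (simp split: if_splits)
        then have re: "Re (\<beta> (K - 1)) = 0" using RI(2)[of 1] cr d2 by simp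
        have r1e: "Re (S (K - 1) (d - 1) 1) = real K * Im (S K (d - 2) 1)"
          using row1[OF va K, of 1 "d - 1"] d2 by (simp add: numeral_2_eq_2)
        have "- real ((K - 1) choose 2) * Re (S (K - 1) (d - 1) 1) + real (K choose 3) * Im (S K (d - 2) 1) = 0"
          using row3[OF va K3, of 1 "d + 1"] Kd d4 Sd S_d(2)[of "d + 1"] by (simp add: Suc_diff_le split: if_splits)
        then have "(real (K choose 3) - real K * real ((K - 1) choose 2)) * Im (S K (d - 2) 1) = 0"
          unfolding r1e by (simp add: algebra_simps)
        moreover have "3 * (K choose 3) = K * ((K - 1) choose 2)"
          using binomial_absorption[of 2 "K"] by (simp add: numeral_3_eq_3 numeral_2_eq_2)
        then have "real K * real ((K - 1) choose 2) = 3 * real (K choose 3)"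
          by (metis of_nat_mult of_nat_numeral)
        moreover have "real (K choose 3) > 0" using K3 by simp
        ultimately have "Im (S K (d - 2) 1) = 0" by simp
        then have "Im (\<beta> (K - 1)) = 0" using r1e RI(1)[of 1] cr d2 by simp
        then show False using re be by (simp add: complex_eq_iff)
      qed
    qed
    then have SK1: "S (K - 1) J u = \<phi> (K - 1) * BB J u" if "J \<ge> 1" for J u
      using that ph' by (cases "\<phi> (K - 1) = 0") (simp_all add: S_eq)
    \<comment> \<open>Downward in J: if \<open>S K (J + 1)\<close> vanishes, so does B (J + 1)
      because \<phi> K is nonzero, hence \<open>S (K - 1) (J + 1)\<close>, and row K - 1 passes this
      on to \<open>S K J\<close>.\<close>
    have all0: "\<forall>u. cmod u = 1 \<longrightarrow> S K J u = 0" if "J \<le> d - 1" for J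
      using that
    proof (induction rule: inc_induct)
      case base
      then show ?case using SKd1 by blast
    next
      case (step J)
      have "coef (S K (Suc J)) = coef (\<lambda>u. 0)" by (rule coef_cong) (use step.IH in blast)
      then have "coef (S K (Suc J)) (k + e K) = 0" for k by (simp add: coef_simps)
      then have "B (Suc J) k = 0" for k using \<phi>0 by (simp add: cS)
      then have "BB (Suc J) u = 0" for u by (simp add: ev_def)
      then have "Re (S (K - 1) (Suc J) u) = 0" for u using SK1[of "Suc J"] by simp
      then show ?case using Im_SK_eq_0[OF va K, of "Suc J"] by simp
    qed
    have "S K J u = 0" if "cmod u = 1" for J u
      using all0[of J] that Sd S_d(2)[of J K u] by (cases J d rule: linorder_cases) auto
    then show False using notall by blast
  qed
qed

end

section \<open>Fields at most linear in t, and the classification on the circle\<close>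

context circle_data begin

text \<open>The coefficient of y is 2 Re (A 1 m z^m). The two frequencies allowed for A 0 are those
  of z^p cnj z^m and its conjugate, precisely what a shear t -> t + h z^p can absorb.\<close>

definition "linear_form \<longleftrightarrow> ns \<and> d = 1 \<and> (\<exists>m>0. real_of_int m = n 1 \<and> A 1 m \<noteq> 0 \<and> (\<forall>k. A 1 k \<noteq> 0 \<longrightarrow> k = m \<or> k = -m)
   \<and> (\<forall>k. A 0 k \<noteq> 0 \<longrightarrow> real_of_int k = n 0 - 2 * real_of_int m \<or> real_of_int k = - (n 0 - 2 * real_of_int m)))"

text \<open>With only rows 0 and 1 left, the quadratic term decides. Its leading coefficient d (A
  d)^2 at y^(2 d - 1) must be matched by \<open>S 1 (2 * d - 2)\<close>, which is zero for d > 2 and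
  has the wrong frequencies for d = 2. For d = 1, with c = A 1 m, the frequencies determine \<beta>
  1 = -2 c, \<gamma> 1 = \<beta> 1 c and \<phi> 0 = -c / m, and what remains is a two-term recursion
  for A 0.\<close>

lemma linear_of_two_rows:
  assumes va: "vanish_above 1"
  shows linear_form
proof -
  have L1: "Re (S 1 J u) = 0" if "cmod u = 1" for J u using row0[OF va _ that] by simp
  have L0: "Re (S 0 J u) - Im (S 1 (J - 1) u) = - QQ J u / 2" if "cmod u = 1" "J \<ge> 1" for J u
    using row_cut[OF va, of 0 1 J u] that by simp
  have L00: "Re (S 0 0 u) = - (Re (AA 0 u) * Re (AA 1 u)) / 2" if "cmod u = 1" for u
    using rows[OF that, of 0 0] by simp
  have top: "QQ (2 * d - 1) u = real d * (Re (AA d u))\<^sup>2" for u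
  proof -
    have "(\<Sum>j\<le>2 * d - 1. real (2 * d - 1 - j + 1) * Re (AA j u) * Re (AA (2 * d - 1 - j + 1) u))
        = (\<Sum>j\<le>2 * d - 1. if j = d then real d * (Re (AA d u))\<^sup>2 else 0)"
    proof (rule sum.cong)
      fix j assume j: "j \<in> {..2 * d - 1}"
      consider "j = d" | "j > d" | "2 * d - 1 - j + 1 > d" using j by fastforce
      then show "real (2 * d - 1 - j + 1) * Re (AA j u) * Re (AA (2 * d - 1 - j + 1) u)
        = (if j = d then real d * (Re (AA d u))\<^sup>2 else 0)"
      proof cases
        case 1
        then have "2 * d - 1 - j + 1 = d" using d(1) by simp
        then show ?thesis using 1 by (simp add: power2_eq_square)
      qed auto
    qed simp
    then show ?thesis using d(1) by (simp add: QQ_def)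
  qed
  have d1: "d = 1"
  proof (rule ccontr)
    assume "d \<noteq> 1"
    then have d2: "d \<ge> 2" using d(1) by simp
    have Im1: "Im (S 1 (2 * d - 2) u) = real d * (Re (AA d u))\<^sup>2 / 2" if "cmod u = 1" for u
      using L0[OF that, of "2 * d - 1"] S_d(2)[of "2 * d - 1" 0 u] top[of u] d2
      by (simp add: numeral_2_eq_2)
    have deq: "d = 2"
    proof (rule ccontr)
      assume "d \<noteq> 2"
      then have "2 * d - 2 > d" using d2 by simp
      then have "AA d u = 0" if "cmod u = 1" for u
        using Im1[OF that] S_d(2) d2 AA_Re[OF that, of d] by simp
      then show False using AA_not_0 by blast
    qed
    have e1: "\<i> * (AA 2 u * AA 2 u) = \<phi> 1 * (u powi e 1 * BB 2 u)" if "cmod u = 1" for u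
    proof -
      have "S 1 2 u = \<i> * of_real ((Re (AA 2 u))\<^sup>2)"
        using Im1[OF that] L1[OF that, of 2] deq by (simp add: complex_eq_iff)
      moreover have "S 1 2 u = \<phi> 1 * (u powi e 1 * BB 2 u)" using S_d(1)[of 1 u] deq by simp
      moreover have "of_real ((Re (AA 2 u))\<^sup>2) = AA 2 u * AA 2 u"
        using AA_Re[OF that, of 2] by (metis of_real_power power2_eq_square)
      ultimately show ?thesis by simp
    qed
    obtain p where p: "A 2 p \<noteq> 0" "\<And>m. m > p \<Longrightarrow> A 2 m = 0"
      using trig_poly_top[of "AA 2"] d(2) deq by (metis coefAA tp_ev)
    have p0: "p \<ge> 0"
    proof (rule ccontr)
      assume "\<not> p \<ge> 0"
      then have "A 2 (-p) = 0" using p(2) by simp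
      then show False using p(1) A_supp_neg by blast
    qed
    \<comment> \<open>The square of the real function A 2 has the frequency -2 p, so A 2 has -2 p -
      e 1. As e 1 = n 2 >= 0, only p = e 1 = 0 fits, and there the Euler factor is zero.\<close>
    have tAA: "trig_poly (\<lambda>u. AA 2 u * AA 2 u)" by (intro tp_mult tp_intros)
    have "coef (\<lambda>u. AA 2 u * AA 2 u) (p + p) = A 2 p * A 2 p"
      using coef_mult_top[of "AA 2" "AA 2" p p] p(2) by (simp only: coefAA tp_ev)
    moreover have "coef (\<lambda>u. AA 2 u * AA 2 u) (- (p + p)) = cnj (coef (\<lambda>u. AA 2 u * AA 2 u) (p + p))"
      by (rule coef_real[OF tAA]) (use A_real in auto)
    ultimately have "coef (\<lambda>u. AA 2 u * AA 2 u) (- (p + p)) \<noteq> 0" using p(1) by simp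
    moreover have rel: "\<i> * coef (\<lambda>u. AA 2 u * AA 2 u) k = \<phi> 1 * B 2 (k - e 1)" for k
      using fun_cong[OF coef_cong[of "\<lambda>u. \<i> * (AA 2 u * AA 2 u)", OF e1], of k]
      by (simp add: coef_simps tp_intros tAA)
    ultimately have "\<phi> 1 * B 2 (- (p + p) - e 1) \<noteq> 0"
      unfolding rel[symmetric] by simp
    then have nz: "\<phi> 1 \<noteq> 0" "B 2 (- (p + p) - e 1) \<noteq> 0" by auto
    then have A2: "A 2 (- (p + p) - e 1) \<noteq> 0" by (simp add: B_eq_0)
    then have "A 2 (p + p + e 1) \<noteq> 0" using A_supp_neg[of 2 "- (p + p) - e 1"] by (simp add: add.commute add.left_commute)
    then have ep: "p + p + e 1 \<le> p" using p(2) by (meson not_le)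
    have "a * e 1 + b * 2 = 1" using wt\<phi>[OF nz(1)] by simp
    then have en: "real_of_int (e 1) = n 2" using a(1) by (simp add: ndeg_def field_simps)
    then have "e 1 \<ge> 0" using n_le_d deq by simp
    then have "p = 0" "e 1 = 0" using ep p0 by auto
    then show False using nz(2) en by (simp add: euler_coef_def)
  qed
  have n1: "n 1 > 0" using a b by (simp add: ndeg_def)
  have A2: "A j k = 0" if "j \<ge> 2" for j k using d(3)[of j k] that d1 by simp
  then have AA2: "AA j u = 0" if "j \<ge> 2" for j u using that by (simp add: ev_def)
  have "S 1 1 u = 0" if "cmod u = 1" for u
    using L0[OF that, of 2] S_d(2)[of 2 0 u] QQ_eq_0[of 2 u] d1 L1[OF that, of 1]
    by (simp add: complex_eq_iff)
  then have "coef (S 1 1) = coef (\<lambda>u. 0)" by (intro coef_cong) simp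
  then have "coef (S 1 1) (k + e 1) = 0" for k by (simp add: coef_simps)
  then have "\<phi> 1 * B 1 k = 0" for k using A2 by (simp add: coefS)
  then have \<phi>1: "\<phi> 1 = 0" using B_all_0[of 1] n1 d(2) d1 by fastforce
  have s1: "\<beta> 1 \<noteq> 0 \<Longrightarrow> s 1 = n 1" using wt\<beta>[of 1] a(1) by (simp add: ndeg_def field_simps)
  have t1: "\<gamma> 1 \<noteq> 0 \<Longrightarrow> t 1 = 2 * n 1" using wt\<gamma>[of 1] a(1) by (simp add: ndeg_def field_simps)
  have e0: "\<phi> 0 \<noteq> 0 \<Longrightarrow> e 0 = n 1" using wt\<phi>[of 0] a(1) by (simp add: ndeg_def field_simps)
  have c01: "coef (S 0 1) k = \<phi> 0 * B 1 (k - e 0)" for k using A2 by (simp add: coefS)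
  have c10: "coef (S 1 0) k = \<beta> 1 / (2 * \<i>) * A 1 (k - s 1) - (if k = t 1 then \<gamma> 1 / (2 * \<i>) else 0)" for k
    unfolding coefS \<phi>1 by simp
  have R1: "of_real (Re (S 0 1 u)) - of_real (Im (S 1 0 u)) = - (AA 1 u * AA 1 u) / 2" if "cmod u = 1" for u
  proof -
    have "Re (S 0 1 u) - Im (S 1 0 u) = - (Re (AA 1 u) * Re (AA 1 u)) / 2"
      using L0[OF that, of 1] AA2[of 2 u] by (simp add: QQ_def numeral_2_eq_2)
    then show ?thesis using AA_Re[OF that, of 1]
      by (metis of_real_diff of_real_divide of_real_minus of_real_mult of_real_numeral)
  qed
  have tAA: "trig_poly (\<lambda>u. AA 1 u * AA 1 u)" by (intro tp_mult tp_intros)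
  have R1c: "(coef (S 0 1) k + cnj (coef (S 0 1) (-k))) / 2 - (coef (S 1 0) k - cnj (coef (S 1 0) (-k))) / (2 * \<i>)
     = - coef (\<lambda>u. AA 1 u * AA 1 u) k / 2" for k
  proof -
    have "coef (\<lambda>u. of_real (Re (S 0 1 u)) - of_real (Im (S 1 0 u))) k = coef (\<lambda>u. - (AA 1 u * AA 1 u) / 2) k"
      by (rule fun_cong[OF coef_cong]) (rule R1)
    then show ?thesis
      unfolding coef_diff[OF coef_of_real_Re(2)[OF tpS] coef_of_real_Im(2)[OF tpS]]
        coef_of_real_Re(1)[OF tpS] coef_of_real_Im(1)[OF tpS] coef_divc[OF tp_minus[OF tAA]] coef_minus[OF tAA] .
  qed
  have R10: "coef (S 1 0) k + cnj (coef (S 1 0) (-k)) = 0" for k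
  proof -
    have "coef (\<lambda>u. complex_of_real (Re (S 1 0 u))) = coef (\<lambda>u. 0)" using L1 by (intro coef_cong) simp
    then have "coef (\<lambda>u. complex_of_real (Re (S 1 0 u))) k = 0" by (simp add: coef_simps)
    then show ?thesis unfolding coef_of_real_Re(1)[OF tpS] by simp
  qed
  \<comment> \<open>Otherwise the mean of (A 1)^2, which is the sum of the squares |A 1 m|^2, would
    vanish.\<close>
  have \<beta>1: "\<beta> 1 \<noteq> 0"
  proof
    assume be: "\<beta> 1 = 0"
    have "\<gamma> 1 = 0"
    proof (rule ccontr)
      assume g: "\<gamma> 1 \<noteq> 0"
      then have "- t 1 \<noteq> t 1" using t1 n1 by auto
      then show False using R10[of "t 1"] g be c10[of "t 1"] c10[of "- t 1"] by simp
    qed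
    then have z: "coef (S 1 0) k = 0" for k using be c10[of k] by simp
    have "\<phi> 0 * B 1 (- e 0) = 0" using e0 by (cases "\<phi> 0 = 0") (simp_all add: B_eq_0)
    then have "coef (\<lambda>u. AA 1 u * AA 1 u) 0 = 0" using R1c[of 0] z c01[of 0] by auto
    then have "(\<Sum>m | A 1 m \<noteq> 0. A 1 m * cnj (A 1 m)) = 0"
      by (simp add: coef_mult tp_intros coefAA herm)
    then have "of_real (\<Sum>m | A 1 m \<noteq> 0. (cmod (A 1 m))\<^sup>2) = (0::complex)"
      by (simp only: of_real_sum complex_norm_square)
    then have "(\<Sum>m | A 1 m \<noteq> 0. (cmod (A 1 m))\<^sup>2) = 0" by (simp only: of_real_eq_0_iff)
    then have "\<forall>m\<in>{m. A 1 m \<noteq> 0}. (cmod (A 1 m))\<^sup>2 = 0"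
      by (subst (asm) sum_nonneg_eq_0_iff[OF finA]) auto
    then show False using d(2) d1 by auto
  qed
  define m where "m = s 1"
  have mn: "real_of_int m = n 1" using s1[OF \<beta>1] by (simp add: m_def)
  then have m0: "m > 0" using n1 by simp
  have t1': "\<gamma> 1 \<noteq> 0 \<Longrightarrow> t 1 = 2 * m" using t1 mn by linarith
  have A1le: "\<bar>k\<bar> \<le> m" if "A 1 k \<noteq> 0" for k using A_supp[OF that] mn by linarith
  have c10': "coef (S 1 0) k = (\<beta> 1 * A 1 (k - m) - (if k = 2 * m then \<gamma> 1 else 0)) / (2 * \<i>)" for k
    unfolding c10 using t1' by (cases "\<gamma> 1 = 0") (auto simp: m_def diff_divide_distrib right_diff_distrib)
  note [simp del] = One_nat_def
  \<comment> \<open>For |j| < m the frequency j + m of \<open>S 1 0\<close> has no counterpart at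
    -(j + m), although its real part vanishes.\<close>
  have A1: "j = m \<or> j = -m" if "A 1 j \<noteq> 0" for j
  proof (rule ccontr)
    assume h: "\<not> (j = m \<or> j = -m)"
    then have "\<bar>j\<bar> < m" using A1le[OF that] by auto
    moreover have "A 1 (- (j + m) - m) = 0"
      using A1le[of "- (j + m) - m"] \<open>\<bar>j\<bar> < m\<close> by (cases "A 1 (- (j + m) - m) = 0") auto
    moreover have "j + m \<noteq> 2 * m" "- (j + m) \<noteq> 2 * m" using \<open>\<bar>j\<bar> < m\<close> by auto
    ultimately show False using R10[of "j + m"] that \<beta>1 by (simp add: c10')
  qed
  define c where "c = A 1 m"
  have c0: "c \<noteq> 0"
  proof
    assume "c = 0"
    then have "A 1 k = 0" for k using A1[of k] herm[of 1 m] by (auto simp: c_def)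
    then show False using d(2) d1 by auto
  qed
  have A1m: "A 1 m = c" "A 1 (-m) = cnj c" using herm[of 1 m] by (simp_all add: c_def)
  have A1z: "A 1 (m + 2 * m) = 0" "A 1 (- 3 * m) = 0" using A1le[of "m + 2 * m"] A1le[of "- 3 * m"] m0 by fastforce+
  have ns: ns using sing[of 1 m] c0 A1m mn m0 by fastforce
  have g: "\<gamma> 1 = \<beta> 1 * c"
    using R10[of "2 * m"] A1m A1z m0 by (simp add: c10')
  have bc: "cnj (\<beta> 1 * cnj c) = \<beta> 1 * cnj c"
    using R10[of 0] A1m m0 by (simp add: c10' field_simps)
  have AAc: "AA 1 u = c * u powi m + cnj c * u powi (-m)" for u
  proof -
    have "AA 1 u = (\<Sum>k\<in>{m, -m}. A 1 k * u powi k)"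
      by (rule ev_superset) (use A1 in auto)
    then show ?thesis using m0 A1m by simp
  qed
  have cprod: "coef (\<lambda>u. f u * AA 1 u) k = c * coef f (k - m) + cnj c * coef f (k + m)" if "trig_poly f" for f k
  proof -
    have "coef (\<lambda>u. f u * AA 1 u) = coef (\<lambda>u. c * (u powi m * f u) + cnj c * (u powi (-m) * f u))"
      by (rule coef_cong) (simp add: AAc algebra_simps)
    then show ?thesis using that by (simp add: coef_simps tp_intros)
  qed
  have sq: "coef (\<lambda>u. AA 1 u * AA 1 u) k = c * A 1 (k - m) + cnj c * A 1 (k + m)" for k
    using cprod[of "AA 1" k] by (simp add: coef_simps tp_intros)
  have bB: "\<phi> 0 * B 1 (k - e 0) = \<phi> 0 * B 1 (k - m)" for k
  proof (cases "\<phi> 0 = 0")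
    case False
    then have "e 0 = m" using e0 mn by linarith
    then show ?thesis by simp
  qed simp
  \<comment> \<open>From the frequency 0 of row i = 0, J = 1; the frequency 2 m of the same row
    gives \<open>ph\<close>.\<close>
  have be2: "\<beta> 1 = - 2 * c"
  proof -
    have "B 1 (- m) = 0" using mn by (simp add: euler_coef_def)
    then have "coef (S 0 1) 0 = 0" using bB[of 0] by (simp add: c01)
    then have "- (coef (S 1 0) 0 - cnj (coef (S 1 0) 0)) / (2 * \<i>) = - c * cnj c"
      using R1c[of 0] A1m by (simp add: sq field_simps)
    moreover have "coef (S 1 0) 0 = \<beta> 1 * cnj c / (2 * \<i>)" using A1m m0 by (simp add: c10')
    ultimately have "(\<beta> 1 * cnj c) = - 2 * c * cnj c"
      using bc by (simp add: field_simps)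
    then have "(\<beta> 1 + 2 * c) * cnj c = 0" by (simp add: ring_distribs)
    then show ?thesis using c0 by (simp add: add_eq_0_iff2)
  qed
  have ph: "\<phi> 0 * of_int m = - c"
  proof -
    have "coef (S 0 1) (2 * m) = \<phi> 0 * of_int m * c"
      using bB[of "2 * m"] mn A1m by (simp add: c01 euler_coef_def) (metis of_real_of_int_eq)
    moreover have "coef (S 0 1) (- (2 * m)) = 0"
      using bB[of "- (2 * m)"] A1z by (simp add: c01 euler_coef_def)
    moreover have "coef (S 1 0) (2 * m) = 0" "coef (S 1 0) (- (2 * m)) = 0"
      using A1m g A1z m0 by (simp_all add: c10')
    ultimately have "\<phi> 0 * of_int m * c = - (c * c)"
      using R1c[of "2 * m"] A1m A1z by (simp add: sq add.commute)
    then have "(\<phi> 0 * of_int m + c) * c = 0" by (simp add: ring_distribs)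
    then show ?thesis using c0 by (simp add: add_eq_0_iff2)
  qed
  have N1': "A 0 k = 0" if "real_of_int k = n 0 \<or> real_of_int k = - n 0" for k
    using N1[OF ns, of k] N1[OF ns, of "-k"] A_supp_neg[of 0 k] that by auto
  have R0c: "(coef (S 0 0) l + cnj (coef (S 0 0) (-l))) / 2 = - (c * A 0 (l - m) + cnj c * A 0 (l + m)) / 2" for l
  proof -
    have "of_real (Re (S 0 0 u)) = - (AA 0 u * AA 1 u) / 2" if "cmod u = 1" for u
      using L00[OF that] AA_Re[OF that, of 1] AA_Re[OF that, of 0]
      by (metis of_real_divide of_real_minus of_real_mult of_real_numeral)
    then have "coef (\<lambda>u. of_real (Re (S 0 0 u))) = coef (\<lambda>u. - (AA 0 u * AA 1 u) / 2)" by (rule coef_cong)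
    moreover have "trig_poly (\<lambda>u. AA 0 u * AA 1 u)" by (intro tp_mult tp_intros)
    ultimately have "coef (\<lambda>u. of_real (Re (S 0 0 u))) l = - (coef (\<lambda>u. AA 0 u * AA 1 u) l) / 2"
      by (simp add: coef_simps tp_intros)
    then show ?thesis unfolding coef_of_real_Re(1)[OF tpS] by (simp add: cprod tp_intros coef_simps)
  qed
  have t0: "\<gamma> 0 \<noteq> 0 \<Longrightarrow> t 0 = n 0 + m" using wt\<gamma>[of 0] a(1) mn by (simp add: ndeg_def field_simps)
  have s0: "\<beta> 0 \<noteq> 0 \<Longrightarrow> s 0 = n 0" using wt\<beta>[of 0] a(1) by (simp add: ndeg_def field_simps)
  \<comment> \<open>Row i = 0, J = 0 at the frequency k - m relates A 0 k to A 0 (k - 2 m) alone.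
    Multiplication by m eliminates \<phi> 0 through \<open>ph\<close>.\<close>
  have step: "of_real (4 * m - n 0 - k) * A 0 (k - 2 * m) \<noteq> 0"
    if k: "A 0 k \<noteq> 0" "real_of_int k \<noteq> n 0 - 2 * m" "real_of_int k \<noteq> - (n 0 - 2 * m)" for k
  proof -
    have kn: "\<bar>real_of_int k\<bar> \<le> n 0" "real_of_int k \<noteq> n 0" "real_of_int k \<noteq> - n 0"
      using A_supp[OF k(1)] N1'[of k] k(1) by auto
    define l where "l = k - m"
    have "\<beta> 0 * A 1 (l - s 0) = 0"
      using A1[of "l - s 0"] s0 kn k m0 by (cases "\<beta> 0 = 0"; cases "A 1 (l - s 0) = 0") (auto simp: l_def)
    moreover have "\<beta> 0 * A 1 (- l - s 0) = 0"
      using A1[of "- l - s 0"] s0 kn k m0 by (cases "\<beta> 0 = 0"; cases "A 1 (- l - s 0) = 0") (auto simp: l_def)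
    moreover have "\<gamma> 0 = 0 \<or> (l \<noteq> t 0 \<and> - l \<noteq> t 0)"
      using t0 kn k m0 by (cases "\<gamma> 0 = 0") (auto simp: l_def)
    moreover have "\<phi> 0 * B 0 (k' - e 0) = \<phi> 0 * B 0 (k' - m)" for k'
    proof (cases "\<phi> 0 = 0")
      case False
      then have "e 0 = m" using e0 mn by linarith
      then show ?thesis by simp
    qed simp
    ultimately have cl: "coef (S 0 0) l = \<phi> 0 * B 0 (l - m)" "coef (S 0 0) (- l) = \<phi> 0 * B 0 (- l - m)"
      by (auto simp: coefS)
    have R: "\<phi> 0 * B 0 (l - m) + cnj (\<phi> 0) * cnj (B 0 (- l - m)) = - (c * A 0 (l - m) + cnj c * A 0 (l + m))"
      using R0c[of l] unfolding cl divide_cancel_right by simp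
    have b1: "B 0 (l - m) = of_real ((n 0 + k - 2 * m) / 2) * A 0 (k - 2 * m)"
      by (simp add: euler_coef_def l_def)
    have b2: "cnj (B 0 (- l - m)) = of_real ((n 0 - k) / 2) * A 0 k"
      using herm[of 0 k] by (simp add: euler_coef_def l_def)
    have lm: "l - m = k - 2 * m" "l + m = k" by (simp_all add: l_def)
    have "\<phi> 0 * (of_real ((n 0 + k - 2 * m) / 2) * A 0 (k - 2 * m)) + cnj (\<phi> 0) * (of_real ((n 0 - k) / 2) * A 0 k)
        = - (c * A 0 (k - 2 * m) + cnj c * A 0 k)"
      using R unfolding b1 b2 unfolding lm .
    moreover define X Y where "X = of_real ((n 0 + k - 2 * m) / 2) * A 0 (k - 2 * m)" and "Y = of_real ((n 0 - k) / 2) * A 0 k"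
    ultimately have E: "\<phi> 0 * X + cnj (\<phi> 0) * Y = - (c * A 0 (k - 2 * m) + cnj c * A 0 k)"
      by (simp only:)
    have "(\<phi> 0 * of_int m) * X + (cnj (\<phi> 0) * of_int m) * Y = of_int m * (\<phi> 0 * X + cnj (\<phi> 0) * Y)"
      by (simp add: algebra_simps)
    then have "(\<phi> 0 * of_int m) * X + (cnj (\<phi> 0) * of_int m) * Y
        = of_int m * - (c * A 0 (k - 2 * m) + cnj c * A 0 k)"
      unfolding E .
    moreover have "cnj (\<phi> 0) * of_int m = - cnj c" using arg_cong[OF ph, of cnj] by simp
    ultimately have "- c * X - cnj c * Y = of_int m * - (c * A 0 (k - 2 * m) + cnj c * A 0 k)"
      unfolding ph by simp
    then have "2 * (cnj c * (of_real (2 * m - n 0 + k) * A 0 k)) = 2 * - (c * (of_real (4 * m - n 0 - k) * A 0 (k - 2 * m)))"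
      by (simp add: X_def Y_def field_simps)
    then have "cnj c * (of_real (2 * m - n 0 + k) * A 0 k) = - (c * (of_real (4 * m - n 0 - k) * A 0 (k - 2 * m)))"
      unfolding mult_cancel_left by simp
    moreover have "complex_of_real (2 * m - n 0 + k) \<noteq> 0" using k(2) unfolding of_real_eq_0_iff by linarith
    ultimately show ?thesis using k(1) c0 by auto
  qed
  \<comment> \<open>\<open>step\<close> moves a frequency outside the two allowed ones down by 2 m
    within this finite set, so the set has no least element.\<close>
  define Bad where "Bad = {k. A 0 k \<noteq> 0 \<and> real_of_int k \<noteq> n 0 - 2 * m \<and> real_of_int k \<noteq> - (n 0 - 2 * m)}"
  have "Bad = {}"
  proof (rule ccontr)
    assume ne: "Bad \<noteq> {}"
    have fin: "finite Bad" by (rule finite_subset[OF _ finA[of 0]]) (auto simp: Bad_def)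
    define k where "k = Min Bad"
    have "k \<in> Bad" using Min_in[OF fin ne] by (simp add: k_def)
    then have k: "A 0 k \<noteq> 0" "real_of_int k \<noteq> n 0 - 2 * m" "real_of_int k \<noteq> - (n 0 - 2 * m)" by (auto simp: Bad_def)
    have st: "A 0 (k - 2 * m) \<noteq> 0" "4 * m - n 0 - k \<noteq> 0" using step[OF k] unfolding mult_eq_0_iff of_real_eq_0_iff by blast+
    have "real_of_int (k - 2 * m) \<noteq> n 0 - 2 * m" using N1'[of k] k(1) by auto
    moreover have "real_of_int (k - 2 * m) \<noteq> - (n 0 - 2 * m)" using st(2) by auto
    ultimately have "k - 2 * m \<in> Bad" using st(1) by (simp add: Bad_def)
    then have "k \<le> k - 2 * m" using Min_le[OF fin] by (simp add: k_def)
    then show False using m0 by simp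
  qed
  then have "\<forall>k. A 0 k \<noteq> 0 \<longrightarrow> real_of_int k = n 0 - 2 * real_of_int m \<or> real_of_int k = - (n 0 - 2 * real_of_int m)"
    by (auto simp: Bad_def)
  moreover have "A 1 m \<noteq> 0" using c0 by (simp add: c_def)
  moreover have "\<forall>k. A 1 k \<noteq> 0 \<longrightarrow> k = m \<or> k = - m" using A1 by simp
  ultimately have fin: "0 < m \<and> real_of_int m = n 1 \<and> A 1 m \<noteq> 0 \<and> (\<forall>k. A 1 k \<noteq> 0 \<longrightarrow> k = m \<or> k = -m)
   \<and> (\<forall>k. A 0 k \<noteq> 0 \<longrightarrow> real_of_int k = n 0 - 2 * real_of_int m \<or> real_of_int k = - (n 0 - 2 * real_of_int m))"
    by (intro conjI m0 mn)
  show ?thesis unfolding linear_form_def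
    by (rule conjI[OF ns], rule conjI[OF d1], rule exI[of _ m], rule fin)
qed

text \<open>If the last index K is at least 2, then \<phi> K = 0 and \<beta> K = 0, so \<gamma> K is
  nonzero; row K makes it a real constant.\<close>

lemma classification: "square_form \<or> linear_form"
proof (cases "vanish_above 1")
  case True
  then show ?thesis using linear_of_two_rows by blast
next
  case False
  define P where "P i \<longleftrightarrow> \<not> (\<phi> i = 0 \<and> \<beta> i = 0 \<and> \<gamma> i = 0)" for i
  obtain L where L: "\<And>i. P i \<Longrightarrow> i \<le> L" using bounded unfolding P_def by (meson nle_le)
  obtain i where i: "i > 1" "P i" using False unfolding vanish_above_def P_def by blast
  define K where "K = (GREATEST i. P i)"
  have PK: "P K" unfolding K_def using GreatestI_nat[of P i L] i(2) L by blast
  have le: "P j \<Longrightarrow> j \<le> K" for j unfolding K_def using Greatest_le_nat[of P j L] L by blast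
  have va: "vanish_above K" unfolding vanish_above_def using le P_def by (meson not_le)
  have K: "K \<ge> 2" using le[OF i(2)] i(1) by simp
  show ?thesis
  proof (cases "\<phi> K = 0")
    case False
    then show ?thesis using \<phi>_0_or_n_0[OF va K] top_phi_eq_0[OF va K] by blast
  next
    case ph: True
    have be: "\<beta> K = 0 \<or> (s K = 0 \<and> Im (\<beta> K) = 0)"
    proof (cases "d = 1")
      case True
      then show ?thesis using top_beta_real_constant[OF va K ph True] by blast
    next
      case False
      then have d2: "d \<ge> 2" "Suc (d - 1) = d" using d(1) by auto
      \<comment> \<open>For d >= 2, row K at J = d - 1 contains \<beta> K without \<gamma> K, and a
        product with A d vanishes only if the other factor does.\<close>
      define f where "f = (\<lambda>u. complex_of_real (Im (\<beta> K * u powi s K)))"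
      have tf: "trig_poly f" unfolding f_def by (intro coef_of_real_Im(2) tp_intros)
      have "f u * AA d u = 0" if "cmod u = 1" for u
      proof -
        have "real d * (Im (\<beta> K * u powi s K) * Re (AA d u)) / 2 = 0"
          using row0[OF va _ that, of "d - 1"] Re_S_phi0(1)[OF ph that, of "d - 1"] K d2 by simp
        then have "Im (\<beta> K * u powi s K) * Re (AA d u) = 0" using d2 by simp
        then show ?thesis unfolding f_def using AA_Re[OF that, of d] by (metis of_real_0 of_real_mult)
      qed
      then have "\<forall>k. coef f k = 0"
        using trig_poly_mult_eq_0[OF tf, of "AA d"] d(2) by (auto simp: coefAA tp_intros)
      then have "f u = 0" if "cmod u = 1" for u using trig_poly_eq_0[OF tf _ that] by blast
      then have "Im (\<beta> K * u powi s K) = 0" if "cmod u = 1" for u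
        using that unfolding f_def of_real_eq_0_iff by blast
      then show ?thesis by (rule Im_monomial_eq_0)
    qed
    show ?thesis
    proof (cases "\<beta> K = 0")
      case False
      then show ?thesis using be top_beta_not_real_constant[OF va K ph] by blast
    next
      case b0: True
      then have g0: "\<gamma> K \<noteq> 0" using PK ph by (simp add: P_def)
      have "Im (\<gamma> K * u powi t K) = 0" if "cmod u = 1" for u
        using row0[OF va _ that, of 0] Re_S_phi0(1)[OF ph that, of 0] K b0 by simp
      then have "t K = 0 \<and> Im (\<gamma> K) = 0" using Im_monomial_eq_0 g0 by blast
      then show ?thesis using square_of_constant_gamma[OF va K ph b0 g0] by blast
    qed
  qed
qed

end

section \<open>Weighted homogeneous polynomials\<close>

text \<open>
  \<open>P\<close> is a polynomial in \<open>z\<close>, \<open>cnj z\<close>, \<open>t\<close>, \<open>cnj t\<close>, homogeneous of degree \<open>w\<close> for the weights \<open>a\<close> of \<open>z\<close>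
  and \<open>b\<close> of \<open>t\<close>, with Wirtinger derivatives \<open>Pz\<close> and \<open>Pt\<close>; the flag \<open>h\<close> requires it to be holomorphic.
\<close>

inductive wpoly :: "bool \<Rightarrow> real \<Rightarrow> real \<Rightarrow> real \<Rightarrow> (complex \<Rightarrow> complex \<Rightarrow> complex) \<Rightarrow>
    (complex \<Rightarrow> complex \<Rightarrow> complex) \<Rightarrow> (complex \<Rightarrow> complex \<Rightarrow> complex) \<Rightarrow> bool" for h a b where
  wpoly_zero: "wpoly h a b w (\<lambda>z t. 0) (\<lambda>z t. 0) (\<lambda>z t. 0)"
| wpoly_mono: "a * real (p + q) + b * real (i + j) = w \<Longrightarrow> (h \<Longrightarrow> q = 0 \<and> j = 0) \<Longrightarrow>
    wpoly h a b w (\<lambda>z t. c * z ^ p * cnj z ^ q * t ^ i * cnj t ^ j)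
      (\<lambda>z t. c * of_nat p * z ^ (p - 1) * cnj z ^ q * t ^ i * cnj t ^ j)
      (\<lambda>z t. c * of_nat i * z ^ p * cnj z ^ q * t ^ (i - 1) * cnj t ^ j)"
| wpoly_add: "wpoly h a b w P Pz Pt \<Longrightarrow> wpoly h a b w Q Qz Qt \<Longrightarrow>
    wpoly h a b w (\<lambda>z t. P z t + Q z t) (\<lambda>z t. Pz z t + Qz z t) (\<lambda>z t. Pt z t + Qt z t)"

lemma wpoly_eqI:
  assumes "wpoly h a b w P Pz Pt"
    and "w = w'" "\<And>z t. P z t = P' z t" "\<And>z t. Pz z t = Pz' z t" "\<And>z t. Pt z t = Pt' z t"
  shows "wpoly h a b w' P' Pz' Pt'"
proof -
  have "P = P'" "Pz = Pz'" "Pt = Pt'" by (intro ext, rule assms)+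
  then show ?thesis using assms by simp
qed

lemma wpoly_const: "wpoly h a b 0 (\<lambda>z t. c) (\<lambda>z t. 0) (\<lambda>z t. 0)"
  by (rule wpoly_eqI[OF wpoly_mono[of a 0 0 b 0 0 0 h c]]) auto

lemma wpoly_z: "wpoly h a b a (\<lambda>z t. z) (\<lambda>z t. 1) (\<lambda>z t. 0)"
  by (rule wpoly_eqI[OF wpoly_mono[of a 1 0 b 0 0 a h 1]]) auto

lemma wpoly_t: "wpoly h a b b (\<lambda>z t. t) (\<lambda>z t. 0) (\<lambda>z t. 1)"
  by (rule wpoly_eqI[OF wpoly_mono[of a 0 0 b 1 0 b h 1]]) auto

lemma wpoly_weaken: "wpoly True a b w P Pz Pt \<Longrightarrow> wpoly h a b w P Pz Pt"
proof (induction rule: wpoly.induct)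
  case (wpoly_mono p q i j w c)
  show ?case by (rule wpoly.wpoly_mono) (use wpoly_mono in auto)
qed (auto intro: wpoly_zero wpoly_add)

lemma wpoly_cmul: 
  assumes "wpoly h a b w P Pz Pt"
  shows "wpoly h a b w (\<lambda>z t. x * P z t) (\<lambda>z t. x * Pz z t) (\<lambda>z t. x * Pt z t)"
  using assms
proof induction
  case (wpoly_zero w)
  show ?case by (rule wpoly_eqI[OF wpoly.wpoly_zero]) auto
next
  case (wpoly_mono p q i j w c)
  show ?case by (rule wpoly_eqI[OF wpoly.wpoly_mono[of a p q b i j w h "x * c"]]) (use wpoly_mono in auto)
next
  case (wpoly_add w P Pz Pt Q Qz Qt)
  show ?case by (rule wpoly_eqI[OF wpoly.wpoly_add[OF wpoly_add.IH]]) (auto simp: algebra_simps)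
qed

lemma wpoly_diff:
  assumes "wpoly h a b w P Pz Pt" "wpoly h a b w Q Qz Qt"
  shows "wpoly h a b w (\<lambda>z t. P z t - Q z t) (\<lambda>z t. Pz z t - Qz z t) (\<lambda>z t. Pt z t - Qt z t)"
  by (rule wpoly_eqI[OF wpoly_add[OF assms(1) wpoly_cmul[OF assms(2), of "-1"]]]) auto

lemma power_deriv_mult:
  "of_nat p * z ^ (p - 1) * z ^ p' + z ^ p * (of_nat p' * z ^ (p' - 1)) = of_nat (p + p') * (z::complex) ^ (p + p' - 1)"
proof (cases "p = 0 \<or> p' = 0")
  case False
  then obtain r r' where "p = Suc r" "p' = Suc r'" by (metis not0_implies_Suc)
  then show ?thesis by (simp add: power_add algebra_simps)
qed auto

lemma wpoly_mult:
  assumes "wpoly h a b w P Pz Pt" "wpoly h a b w' Q Qz Qt"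
  shows "wpoly h a b (w + w') (\<lambda>z t. P z t * Q z t)
    (\<lambda>z t. Pz z t * Q z t + P z t * Qz z t) (\<lambda>z t. Pt z t * Q z t + P z t * Qt z t)"
  using assms(1)
proof induction
  case (wpoly_zero w)
  show ?case by (rule wpoly_eqI[OF wpoly.wpoly_zero]) auto
next
  case (wpoly_add w P Pz Pt Q' Qz' Qt')
  show ?case by (rule wpoly_eqI[OF wpoly.wpoly_add[OF wpoly_add.IH]]) (auto simp: algebra_simps)
next
  case (wpoly_mono p q i j w c)
  note m = this
  from assms(2) show ?case
  proof induction
    case (wpoly_zero w)
    show ?case by (rule wpoly_eqI[OF wpoly.wpoly_zero]) auto
  next
    case (wpoly_add w P Pz Pt Q' Qz' Qt')
    show ?case by (rule wpoly_eqI[OF wpoly.wpoly_add[OF wpoly_add.IH]]) (auto simp: algebra_simps)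
  next
    case (wpoly_mono p' q' i' j' w' c')
    have w: "a * real (p + p' + (q + q')) + b * real (i + i' + (j + j')) = w + w'"
      using m(1) wpoly_mono(1) by (simp add: algebra_simps)
    show ?case
    proof (rule wpoly_eqI[OF wpoly.wpoly_mono[of a "p + p'" "q + q'" b "i + i'" "j + j'" "w + w'" h "c * c'"]], goal_cases)
      case (5 z t)
      have "c * c' * of_nat (p + p') * z ^ (p + p' - 1) * cnj z ^ (q + q') * t ^ (i + i') * cnj t ^ (j + j')
        = c * c' * cnj z ^ (q + q') * t ^ (i + i') * cnj t ^ (j + j') * (of_nat (p + p') * z ^ (p + p' - 1))"
        by (simp only: mult_ac)
      then show ?case unfolding power_deriv_mult[symmetric] by (simp add: power_add ring_distribs mult_ac)
    next
      case (6 z t)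
      have "c * c' * of_nat (i + i') * z ^ (p + p') * cnj z ^ (q + q') * t ^ (i + i' - 1) * cnj t ^ (j + j')
        = c * c' * z ^ (p + p') * cnj z ^ (q + q') * cnj t ^ (j + j') * (of_nat (i + i') * t ^ (i + i' - 1))"
        by (simp only: mult_ac)
      then show ?case unfolding power_deriv_mult[symmetric] by (simp add: power_add ring_distribs mult_ac)
    qed (use w m wpoly_mono in \<open>auto simp: power_add algebra_simps\<close>)
  qed
qed

lemma wpoly_power:
  assumes "wpoly h a b w P Pz Pt"
  shows "wpoly h a b (real n * w) (\<lambda>z t. P z t ^ n)
    (\<lambda>z t. of_nat n * P z t ^ (n - 1) * Pz z t) (\<lambda>z t. of_nat n * P z t ^ (n - 1) * Pt z t)"
proof (induction n)
  case 0
  show ?case by (rule wpoly_eqI[OF wpoly_const[of h a b 1]]) auto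
next
  case (Suc n)
  show ?case by (rule wpoly_eqI[OF wpoly_mult[OF Suc assms]]; cases n; simp add: algebra_simps)
qed

lemma wpoly_cnj_hol:
  assumes "wpoly True a b w P Pz Pt"
  shows "wpoly False a b w (\<lambda>z t. cnj (P z t)) (\<lambda>z t. 0) (\<lambda>z t. 0)"
  using assms
proof induction
  case (wpoly_zero w)
  show ?case by (rule wpoly_eqI[OF wpoly.wpoly_zero]) auto
next
  case (wpoly_mono p q i j w c)
  show ?case by (rule wpoly_eqI[OF wpoly.wpoly_mono[of a 0 p b 0 i w False "cnj c"]]) (use wpoly_mono in auto)
next
  case (wpoly_add w P Pz Pt Q Qz Qt)
  show ?case by (rule wpoly_eqI[OF wpoly.wpoly_add[OF wpoly_add.IH]]) auto
qed

text \<open>Only holomorphic substitutions are allowed, so the conjugate variables add nothing to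
  the Wirtinger chain rule.\<close>

lemma wpoly_subst:
  assumes "wpoly h a b w P Pz Pt"
    and Z: "wpoly True a' b' a Z Zz Zt" and T: "wpoly True a' b' b T Tz Tt"
  shows "wpoly h a' b' w (\<lambda>z t. P (Z z t) (T z t))
    (\<lambda>z t. Pz (Z z t) (T z t) * Zz z t + Pt (Z z t) (T z t) * Tz z t)
    (\<lambda>z t. Pz (Z z t) (T z t) * Zt z t + Pt (Z z t) (T z t) * Tt z t)"
  using assms(1)
proof induction
  case (wpoly_zero w)
  show ?case by (rule wpoly_eqI[OF wpoly.wpoly_zero]) auto
next
  case (wpoly_add w P Pz Pt Q' Qz' Qt')
  show ?case by (rule wpoly_eqI[OF wpoly.wpoly_add[OF wpoly_add.IH]]) (auto simp: algebra_simps)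
next
  case (wpoly_mono p q i j w c)
  have Mh: "wpoly h a' b' (real p * a + real i * b) (\<lambda>z t. Z z t ^ p * T z t ^ i)
     (\<lambda>z t. of_nat p * Z z t ^ (p - 1) * Zz z t * T z t ^ i + Z z t ^ p * (of_nat i * T z t ^ (i - 1) * Tz z t))
     (\<lambda>z t. of_nat p * Z z t ^ (p - 1) * Zt z t * T z t ^ i + Z z t ^ p * (of_nat i * T z t ^ (i - 1) * Tt z t))"
    by (rule wpoly_mult[OF wpoly_power[OF wpoly_weaken[OF Z]] wpoly_power[OF wpoly_weaken[OF T]]])
  have "wpoly h a' b' (real q * a + real j * b) (\<lambda>z t. cnj (Z z t) ^ q * cnj (T z t) ^ j) (\<lambda>z t. 0) (\<lambda>z t. 0)"
  proof (cases h)
    case True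
    then have "q = 0" "j = 0" using wpoly_mono by auto
    then show ?thesis by (intro wpoly_eqI[OF wpoly_const[of h a' b' 1]]) auto
  next
    case False
    then show ?thesis
      using wpoly_eqI[OF wpoly_mult[OF wpoly_power[OF wpoly_cnj_hol[OF Z], of q] wpoly_power[OF wpoly_cnj_hol[OF T], of j]]]
      by auto
  qed
  from wpoly_cmul[OF wpoly_mult[OF Mh this], of c] show ?case
    by (rule wpoly_eqI) (use wpoly_mono(1) in \<open>auto simp: algebra_simps\<close>)
qed

lemma monomial_deriv:
  "((\<lambda>x::complex \<times> complex. fst x ^ p * snd x ^ i) has_derivative
      (\<lambda>d. of_nat p * z ^ (p - 1) * t ^ i * fst d + of_nat i * z ^ p * t ^ (i - 1) * snd d)) (at (z, t))"
proof -
  have d1: "((\<lambda>x::complex \<times> complex. fst x ^ p) has_derivative (\<lambda>d. of_nat p * fst d * z ^ (p - 1))) (at (z, t))"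
    using has_derivative_power[OF has_derivative_fst[OF has_derivative_ident], where n = p and x = "(z, t)" and S = UNIV] by simp
  have d3: "((\<lambda>x::complex \<times> complex. snd x ^ i) has_derivative (\<lambda>d. of_nat i * snd d * t ^ (i - 1))) (at (z, t))"
    using has_derivative_power[OF has_derivative_snd[OF has_derivative_ident], where n = i and x = "(z, t)" and S = UNIV] by simp
  show ?thesis
    by (rule has_derivative_eq_rhs[OF has_derivative_mult[OF d1 d3]]) (simp add: fun_eq_iff mult_ac)
qed

lemma product_deriv_expand:
  "c * (F * cnj (g1 * x + g2 * y) + (f1 * x + f2 * y) * cnj G)
    = c * f1 * cnj G * x + c * f2 * cnj G * y + cnj (cnj c * g1 * cnj F * x + cnj c * g2 * cnj F * y)"
  by (simp add: algebra_simps)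

text \<open>The relation \<open>wpoly\<close> records only the derivatives in z and t. Those in cnj
  z and cnj t are the conjugates of the recorded derivatives of cnj P, which completes the real
  differential.\<close>

lemma wpoly_cnj:
  assumes "wpoly False a b w P Pz Pt"
  shows "\<exists>Qz Qt. wpoly False a b w (\<lambda>z t. cnj (P z t)) Qz Qt \<and>
    (\<forall>z t. ((\<lambda>x. P (fst x) (snd x)) has_derivative
      (\<lambda>d. Pz z t * fst d + Pt z t * snd d + cnj (Qz z t * fst d + Qt z t * snd d))) (at (z, t)))"
  using assms
proof induction
  case (wpoly_zero w)
  show ?case by (intro exI[of _ "\<lambda>z t. 0"] conjI wpoly_eqI[OF wpoly.wpoly_zero]) auto
next
  case (wpoly_add w P Pz Pt Q Qz Qt)
  from wpoly_add.IH obtain P1 P2 Q1 Q2 where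
    1: "wpoly False a b w (\<lambda>z t. cnj (P z t)) P1 P2"
      "\<And>z t. ((\<lambda>x. P (fst x) (snd x)) has_derivative
      (\<lambda>d. Pz z t * fst d + Pt z t * snd d + cnj (P1 z t * fst d + P2 z t * snd d))) (at (z, t))"
    and 2: "wpoly False a b w (\<lambda>z t. cnj (Q z t)) Q1 Q2"
      "\<And>z t. ((\<lambda>x. Q (fst x) (snd x)) has_derivative
      (\<lambda>d. Qz z t * fst d + Qt z t * snd d + cnj (Q1 z t * fst d + Q2 z t * snd d))) (at (z, t))"
    by blast
  show ?case
  proof (intro exI conjI allI)
    show "wpoly False a b w (\<lambda>z t. cnj (P z t + Q z t)) (\<lambda>z t. P1 z t + Q1 z t) (\<lambda>z t. P2 z t + Q2 z t)"
      by (rule wpoly_eqI[OF wpoly.wpoly_add[OF 1(1) 2(1)]]) auto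
    fix z t
    show "((\<lambda>x. P (fst x) (snd x) + Q (fst x) (snd x)) has_derivative
      (\<lambda>d. (Pz z t + Qz z t) * fst d + (Pt z t + Qt z t) * snd d
         + cnj ((P1 z t + Q1 z t) * fst d + (P2 z t + Q2 z t) * snd d))) (at (z, t))"
      by (rule has_derivative_eq_rhs[OF has_derivative_add[OF 1(2) 2(2)]]) (auto simp: algebra_simps)
  qed
next
  case (wpoly_mono p q i j w c)
  show ?case
  proof (intro exI conjI allI)
    show "wpoly False a b w (\<lambda>z t. cnj (c * z ^ p * cnj z ^ q * t ^ i * cnj t ^ j))
      (\<lambda>z t. cnj c * of_nat q * z ^ (q - 1) * cnj z ^ p * t ^ j * cnj t ^ i)
      (\<lambda>z t. cnj c * of_nat j * z ^ q * cnj z ^ p * t ^ (j - 1) * cnj t ^ i)"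
      by (rule wpoly_eqI[OF wpoly.wpoly_mono[of a q p b j i w False "cnj c"]])
        (use wpoly_mono in \<open>auto simp: algebra_simps\<close>)
    fix z t :: complex
    define f1 f2 g1 g2 where "f1 = of_nat p * z ^ (p - 1) * t ^ i" and "f2 = of_nat i * z ^ p * t ^ (i - 1)"
      and "g1 = of_nat q * z ^ (q - 1) * t ^ j" and "g2 = of_nat j * z ^ q * t ^ (j - 1)"
    have f: "((\<lambda>x. fst x ^ p * snd x ^ i) has_derivative (\<lambda>d. f1 * fst d + f2 * snd d)) (at (z, t))"
      unfolding f1_def f2_def by (rule monomial_deriv)
    have g: "((\<lambda>x. cnj (fst x ^ q * snd x ^ j)) has_derivative (\<lambda>d. cnj (g1 * fst d + g2 * snd d))) (at (z, t))"
      unfolding g1_def g2_def by (rule bounded_linear.has_derivative[OF bounded_linear_cnj monomial_deriv])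
    have "((\<lambda>x. c * (fst x ^ p * snd x ^ i * cnj (fst x ^ q * snd x ^ j))) has_derivative
       (\<lambda>d. c * f1 * cnj (z ^ q * t ^ j) * fst d + c * f2 * cnj (z ^ q * t ^ j) * snd d
          + cnj (cnj c * g1 * cnj (z ^ p * t ^ i) * fst d + cnj c * g2 * cnj (z ^ p * t ^ i) * snd d))) (at (z, t))"
      by (rule has_derivative_eq_rhs[OF has_derivative_mult_right[OF has_derivative_mult[OF f g]]])
        (simp only: fst_conv snd_conv product_deriv_expand)
    moreover have "(\<lambda>x. c * (fst x ^ p * snd x ^ i * cnj (fst x ^ q * snd x ^ j)))
        = (\<lambda>x. c * fst x ^ p * cnj (fst x) ^ q * snd x ^ i * cnj (snd x) ^ j)"
      by (simp add: fun_eq_iff)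
    moreover have "c * f1 * cnj (z ^ q * t ^ j) = c * of_nat p * z ^ (p - 1) * cnj z ^ q * t ^ i * cnj t ^ j"
      "c * f2 * cnj (z ^ q * t ^ j) = c * of_nat i * z ^ p * cnj z ^ q * t ^ (i - 1) * cnj t ^ j"
      "cnj c * g1 * cnj (z ^ p * t ^ i) = cnj c * of_nat q * z ^ (q - 1) * cnj z ^ p * t ^ j * cnj t ^ i"
      "cnj c * g2 * cnj (z ^ p * t ^ i) = cnj c * of_nat j * z ^ q * cnj z ^ p * t ^ (j - 1) * cnj t ^ i"
      by (simp_all add: f1_def f2_def g1_def g2_def)
    ultimately show "((\<lambda>x. c * fst x ^ p * cnj (fst x) ^ q * snd x ^ i * cnj (snd x) ^ j) has_derivative
       (\<lambda>d. c * of_nat p * z ^ (p - 1) * cnj z ^ q * t ^ i * cnj t ^ j * fst d +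
            c * of_nat i * z ^ p * cnj z ^ q * t ^ (i - 1) * cnj t ^ j * snd d +
            cnj (cnj c * of_nat q * z ^ (q - 1) * cnj z ^ p * t ^ j * cnj t ^ i * fst d +
                 cnj c * of_nat j * z ^ q * cnj z ^ p * t ^ (j - 1) * cnj t ^ i * snd d))) (at (z, t))"
      by (simp only:)
  qed
qed

lemma wpoly_hol_deriv:
  assumes "wpoly True a b w P Pz Pt"
  shows "((\<lambda>x. P (fst x) (snd x)) has_derivative (\<lambda>d. Pz z t * fst d + Pt z t * snd d)) (at (z, t))"
  using assms
proof induction
  case (wpoly_add w P Pz Pt Q Qz Qt)
  show ?case by (rule has_derivative_eq_rhs[OF has_derivative_add[OF wpoly_add.IH]]) (auto simp: algebra_simps)
next
  case (wpoly_mono p q i j w c)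
  then have qj: "q = 0" "j = 0" by auto
  have "((\<lambda>x. c * (fst x ^ p * snd x ^ i)) has_derivative
      (\<lambda>d. c * of_nat p * z ^ (p - 1) * t ^ i * fst d + c * of_nat i * z ^ p * t ^ (i - 1) * snd d)) (at (z, t))"
    by (rule has_derivative_eq_rhs[OF has_derivative_mult_right[OF monomial_deriv]])
      (simp add: fun_eq_iff ring_distribs mult.assoc)
  then have "((\<lambda>x. c * fst x ^ p * snd x ^ i) has_derivative
      (\<lambda>d. c * of_nat p * z ^ (p - 1) * t ^ i * fst d + c * of_nat i * z ^ p * t ^ (i - 1) * snd d)) (at (z, t))"
    by (simp only: mult.assoc)
  then show ?case unfolding qj by simp
qed auto

text \<open>For real P the imaginary part of the differential vanishes; evaluated on 1 and \<i> in
  each variable, this identifies the two halves of the differential as conjugate.\<close>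

lemma wpoly_real_deriv:
  assumes "wpoly False a b w P Pz Pt" and real: "\<And>z t. P z t \<in> \<real>"
  shows "((\<lambda>x. P (fst x) (snd x)) has_derivative
    (\<lambda>d. of_real (2 * Re (Pz z t * fst d + Pt z t * snd d)))) (at (z, t))"
proof -
  from wpoly_cnj[OF assms(1)] obtain Qz Qt where
    D: "((\<lambda>x. P (fst x) (snd x)) has_derivative
      (\<lambda>d. Pz z t * fst d + Pt z t * snd d + cnj (Qz z t * fst d + Qt z t * snd d))) (at (z, t))" by blast
  have "((\<lambda>x. Im (P (fst x) (snd x))) has_derivative
      (\<lambda>d. Im (Pz z t * fst d + Pt z t * snd d + cnj (Qz z t * fst d + Qt z t * snd d)))) (at (z, t))"
    by (rule bounded_linear.has_derivative[OF bounded_linear_Im D])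
  moreover have "(\<lambda>x. Im (P (fst x) (snd x))) = (\<lambda>x. 0)" using real by (auto simp: complex_is_Real_iff)
  ultimately have "((\<lambda>x::complex \<times> complex. 0::real) has_derivative
      (\<lambda>d. Im (Pz z t * fst d + Pt z t * snd d + cnj (Qz z t * fst d + Qt z t * snd d)))) (at (z, t))"
    by simp
  from has_derivative_unique[OF this has_derivative_const]
  have I: "Im (Pz z t * fst d + Pt z t * snd d + cnj (Qz z t * fst d + Qt z t * snd d)) = 0" for d
    by (rule fun_cong)
  have "Qz z t = Pz z t"
    using I[of "(1, 0)"] I[of "(\<i>, 0)"] by (simp add: complex_eq_iff)
  moreover have "Qt z t = Pt z t"
    using I[of "(0, 1)"] I[of "(0, \<i>)"] by (simp add: complex_eq_iff)
  ultimately show ?thesis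
    by (intro has_derivative_eq_rhs[OF D]) (auto simp: fun_eq_iff complex_eq_iff)
qed

lemma wpoly_dz:
  assumes "wpoly h a b w P Pz Pt"
  shows "\<exists>X Y. wpoly h a b (w - a) Pz X Y"
  using assms
proof induction
  case (wpoly_zero w)
  show ?case using wpoly.wpoly_zero by blast
next
  case (wpoly_add w P Pz Pt Q Qz Qt)
  then show ?case using wpoly.wpoly_add by blast
next
  case (wpoly_mono p q i j w c)
  show ?case
  proof (cases p)
    case 0
    then show ?thesis using wpoly.wpoly_zero[of h a b "w - a"] by auto
  next
    case (Suc r)
    show ?thesis
      by (intro exI, rule wpoly_eqI[OF wpoly.wpoly_mono[of a r q b i j "w - a" h "c * of_nat p"]])
        (use wpoly_mono Suc in \<open>auto simp: algebra_simps\<close>)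
  qed
qed

lemma wpoly_dt:
  assumes "wpoly h a b w P Pz Pt"
  shows "\<exists>X Y. wpoly h a b (w - b) Pt X Y"
  using assms
proof induction
  case (wpoly_zero w)
  show ?case using wpoly.wpoly_zero by blast
next
  case (wpoly_add w P Pz Pt Q Qz Qt)
  then show ?case using wpoly.wpoly_add by blast
next
  case (wpoly_mono p q i j w c)
  show ?case
  proof (cases i)
    case 0
    then show ?thesis using wpoly.wpoly_zero[of h a b "w - b"] by auto
  next
    case (Suc r)
    show ?thesis
      by (intro exI, rule wpoly_eqI[OF wpoly.wpoly_mono[of a p q b r j "w - b" h "c * of_nat i"]])
        (use wpoly_mono Suc in \<open>auto simp: algebra_simps\<close>)
  qed
qed

lemma wpoly_homogeneous:
  assumes "wpoly h a b w P Pz Pt" "l > 0"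
  shows "P (of_real (l powr a) * z) (of_real (l powr b) * t) = of_real (l powr w) * P z t"
  using assms(1)
proof induction
  case (wpoly_mono p q i j w c)
  have "l powr w = (l powr a) ^ (p + q) * (l powr b) ^ (i + j)"
    using assms(2) wpoly_mono(1)[symmetric]
    by (simp add: powr_add powr_powr[symmetric] powr_realpow power_add)
  then have "complex_of_real (l powr w) = of_real (l powr a) ^ p * of_real (l powr a) ^ q * of_real (l powr b) ^ i * of_real (l powr b) ^ j"
    by (simp add: power_add)
  then show ?case by (simp add: power_mult_distrib mult_ac)
qed (auto simp: algebra_simps)

lemma wpoly_continuous:
  assumes "wpoly h a b w P Pz Pt"
  shows "continuous_on UNIV (\<lambda>x. P (fst x) (snd x))"
  using assms by induction (auto intro!: continuous_intros)

text \<open>This supplies the function G, whose t-derivative is the coefficient of w in the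
  w-component.\<close>

lemma wpoly_integral:
  assumes "wpoly True a b w P Pz Pt"
  shows "\<exists>F Fz. wpoly True a b (w + b) F Fz P"
  using assms
proof induction
  case (wpoly_zero w)
  show ?case using wpoly.wpoly_zero by blast
next
  case (wpoly_add w P Pz Pt Q Qz Qt)
  then show ?case using wpoly.wpoly_add by blast
next
  case (wpoly_mono p q i j w c)
  have w: "a * real (p + 0) + b * real (Suc i + 0) = w + b" using wpoly_mono by (simp add: algebra_simps)
  show ?case
    by (intro exI, rule wpoly_eqI[OF wpoly.wpoly_mono[OF w, of True "c / of_nat (Suc i)"]])
      (use wpoly_mono in \<open>simp_all del: of_nat_Suc\<close>)
qed

lemma wpoly_sum:
  assumes "finite I" "\<And>x. x \<in> I \<Longrightarrow> \<exists>Pz Pt. wpoly h a b w (P x) Pz Pt"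
  shows "\<exists>Pz Pt. wpoly h a b w (\<lambda>z t. \<Sum>x\<in>I. P x z t) Pz Pt"
  using assms
proof (induction I rule: finite_induct)
  case empty
  show ?case using wpoly_zero[of h a b w] by auto
next
  case (insert x I)
  then obtain X Y X' Y' where "wpoly h a b w (P x) X Y" "wpoly h a b w (\<lambda>z t. \<Sum>x\<in>I. P x z t) X' Y'" by blast
  from wpoly_add[OF this] show ?case using insert.hyps by auto
qed

section \<open>Extraction of coefficients and Laurent expansions on the circle\<close>

lemma sum_shift_index:
  fixes F :: "nat \<Rightarrow> 'a::comm_monoid_add"
  assumes "\<And>i. i > L \<Longrightarrow> F i = 0" "\<And>i. i < k \<Longrightarrow> F i = 0"
  shows "(\<Sum>i\<le>L. F i) = (\<Sum>h\<le>L. F (k + h))"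
proof -
  have "(\<Sum>i\<le>L. F i) = sum F {k..L}"
    by (rule sum.mono_neutral_right) (use assms(2) in auto)
  also have "\<dots> = (\<Sum>h | k + h \<le> L. F (k + h))"
    by (rule sum.reindex_bij_witness[of _ "\<lambda>h. k + h" "\<lambda>i. i - k"]) auto
  also have "\<dots> = (\<Sum>h\<le>L. F (k + h))"
    by (rule sum.mono_neutral_left) (use assms(1) in auto)
  finally show ?thesis .
qed

text \<open>Origin of \<open>rows\<close>: expanding t^(i + h) = (x + \<i> y)^(i + h) binomially,
  the term x^i (\<i> y)^h meets y^(J - h) in the coefficient of x^i y^J. Taking real parts before
  comparing coefficients is legitimate because x and y are real.\<close>

lemma re_poly_coeffs:
  fixes s :: "nat \<Rightarrow> nat \<Rightarrow> complex" and q :: "nat \<Rightarrow> real"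
  assumes eq: "\<And>x y::real. Re (\<Sum>i\<le>L. \<Sum>j\<le>L. s i j * (of_real x + \<i> * of_real y) ^ i * of_real y ^ j) = (\<Sum>m\<le>M. q m * y ^ m)"
    and s0: "\<And>i j. i > L \<or> j > L \<Longrightarrow> s i j = 0" and q0: "\<And>m. m > M \<Longrightarrow> q m = 0"
  shows "Re (\<Sum>h\<le>J. of_nat ((i + h) choose h) * \<i> ^ h * s (i + h) (J - h)) = (if i = 0 then q J else 0)"
proof -
  define T where "T i y = (\<Sum>j\<le>L. s i j * of_real y ^ j)" for i and y :: real
  define U where "U k y = (\<Sum>h\<le>L. of_nat ((k + h) choose h) * (\<i> * of_real y) ^ h * T (k + h) y)" for k and y :: real
  have T0: "T i y = 0" if "i > L" for i y using s0 that by (simp add: T_def)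
  have exp: "(\<Sum>i\<le>L. \<Sum>j\<le>L. s i j * (of_real x + \<i> * of_real y) ^ i * of_real y ^ j) = (\<Sum>k\<le>L. U k y * of_real x ^ k)" for x y
  proof -
    have "(\<Sum>i\<le>L. \<Sum>j\<le>L. s i j * (of_real x + \<i> * of_real y) ^ i * of_real y ^ j)
      = (\<Sum>i\<le>L. T i y * (of_real x + \<i> * of_real y) ^ i)"
      by (simp add: T_def sum_distrib_right sum_distrib_left mult_ac)
    also have "\<dots> = (\<Sum>i\<le>L. T i y * (\<Sum>k\<le>L. of_nat (i choose k) * of_real x ^ k * (\<i> * of_real y) ^ (i - k)))"
    proof (rule sum.cong)
      fix i assume "i \<in> {..L}"
      have "(of_real x + \<i> * of_real y) ^ i = (\<Sum>k\<le>i. of_nat (i choose k) * of_real x ^ k * (\<i> * complex_of_real y) ^ (i - k))"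
        by (rule binomial_ring)
      also have "\<dots> = (\<Sum>k\<le>L. of_nat (i choose k) * of_real x ^ k * (\<i> * of_real y) ^ (i - k))"
        by (rule sum.mono_neutral_left) (use \<open>i \<in> {..L}\<close> in auto)
      finally show "T i y * (of_real x + \<i> * of_real y) ^ i = T i y * (\<Sum>k\<le>L. of_nat (i choose k) * of_real x ^ k * (\<i> * of_real y) ^ (i - k))"
        by simp
    qed simp
    also have "\<dots> = (\<Sum>k\<le>L. \<Sum>i\<le>L. T i y * (of_nat (i choose k) * of_real x ^ k * (\<i> * of_real y) ^ (i - k)))"
      unfolding sum_distrib_left by (rule sum.swap)
    also have "\<dots> = (\<Sum>k\<le>L. U k y * of_real x ^ k)"
    proof (rule sum.cong)
      fix k
      have "(\<Sum>i\<le>L. T i y * (of_nat (i choose k) * of_real x ^ k * (\<i> * of_real y) ^ (i - k)))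
         = (\<Sum>h\<le>L. T (k + h) y * (of_nat ((k + h) choose k) * of_real x ^ k * (\<i> * of_real y) ^ (k + h - k)))"
        by (rule sum_shift_index) (auto simp: T0)
      also have "\<dots> = U k y * of_real x ^ k"
        unfolding U_def sum_distrib_right
        by (rule sum.cong) (simp_all add: binomial_symmetric[of k "k + _"] mult_ac)
      finally show "(\<Sum>i\<le>L. T i y * (of_nat (i choose k) * of_real x ^ k * (\<i> * of_real y) ^ (i - k))) = U k y * of_real x ^ k" .
    qed simp
    finally show ?thesis .
  qed
  have ReU: "Re (U k y) = (if k = 0 then \<Sum>m\<le>M. q m * y ^ m else 0)" for k y
  proof (cases "k \<le> L")
    case True
    have "(\<Sum>k\<le>L. (Re (U k y) - (if k = 0 then \<Sum>m\<le>M. q m * y ^ m else 0)) * x ^ k) = 0" for x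
    proof -
      have "Re (\<Sum>k\<le>L. U k y * of_real x ^ k) = (\<Sum>k\<le>L. Re (U k y) * x ^ k)"
        unfolding Re_sum by (rule sum.cong) (simp_all flip: of_real_power)
      then have "(\<Sum>k\<le>L. Re (U k y) * x ^ k) = (\<Sum>m\<le>M. q m * y ^ m)"
        using eq[of x y] unfolding exp by simp
      moreover have "(\<Sum>k\<le>L. (if k = 0 then \<Sum>m\<le>M. q m * y ^ m else 0) * x ^ k) = (\<Sum>m\<le>M. q m * y ^ m)"
        by (simp add: if_distrib[of "\<lambda>v. v * _"] cong: if_cong)
      ultimately show ?thesis by (simp add: left_diff_distrib sum_subtractf)
    qed
    then have "\<forall>k\<le>L. Re (U k y) - (if k = 0 then \<Sum>m\<le>M. q m * y ^ m else 0) = 0"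
      using polyfun_eq_0[of "\<lambda>k. Re (U k y) - (if k = 0 then \<Sum>m\<le>M. q m * y ^ m else 0)" L] by blast
    then show ?thesis using True by simp
  next
    case False
    then show ?thesis by (simp add: U_def T0)
  qed
  define c where "c i J = Re (\<Sum>h\<le>J. of_nat ((i + h) choose h) * \<i> ^ h * s (i + h) (J - h))" for i J
  have "Re (U i y) = (\<Sum>J\<le>L + L. c i J * y ^ J)" for y
  proof -
    have "U i y = (\<Sum>h\<le>L. \<Sum>j\<le>L. of_nat ((i + h) choose h) * \<i> ^ h * s (i + h) j * of_real y ^ (h + j))"
      by (simp add: U_def T_def sum_distrib_left power_mult_distrib power_add mult_ac)
    also have "\<dots> = (\<Sum>(h, j)\<in>{..L} \<times> {..L}. of_nat ((i + h) choose h) * \<i> ^ h * s (i + h) j * of_real y ^ (h + j))"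
      by (rule sum.cartesian_product)
    also have "\<dots> = (\<Sum>(h, j)\<in>{(h, j). h + j \<le> L + L}. of_nat ((i + h) choose h) * \<i> ^ h * s (i + h) j * of_real y ^ (h + j))"
    proof (rule sum.mono_neutral_left)
      show "finite {(h, j). h + j \<le> L + L}"
        by (rule finite_subset[of _ "{..L + L} \<times> {..L + L}"]) auto
      have "of_nat ((i + h) choose h) * \<i> ^ h * s (i + h) j * of_real y ^ (h + j) = 0" if "h > L \<or> j > L" for h j
        using s0[of "i + h" j] that by auto
      note z = this
      show "\<forall>x\<in>{(h, j). h + j \<le> L + L} - {..L} \<times> {..L}.
        (case x of (h, j) \<Rightarrow> of_nat ((i + h) choose h) * \<i> ^ h * s (i + h) j * of_real y ^ (h + j)) = 0"
      proof
        fix x assume x: "x \<in> {(h, j). h + j \<le> L + L} - {..L} \<times> {..L}"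
        obtain h j where hj: "x = (h, j)" by (cases x)
        then have "h > L \<or> j > L" using x by auto
        from z[OF this] show "(case x of (h, j) \<Rightarrow> of_nat ((i + h) choose h) * \<i> ^ h * s (i + h) j * of_real y ^ (h + j)) = 0"
          unfolding hj prod.case .
      qed
    qed auto
    also have "\<dots> = (\<Sum>J\<le>L + L. \<Sum>h\<le>J. of_nat ((i + h) choose h) * \<i> ^ h * s (i + h) (J - h) * of_real y ^ (h + (J - h)))"
      by (rule sum.triangle_reindex_eq)
    also have "\<dots> = (\<Sum>J\<le>L + L. (\<Sum>h\<le>J. of_nat ((i + h) choose h) * \<i> ^ h * s (i + h) (J - h)) * of_real (y ^ J))"
      unfolding sum_distrib_right by (intro sum.cong) auto
    finally have "Re (U i y) = (\<Sum>J\<le>L + L. Re ((\<Sum>h\<le>J. of_nat ((i + h) choose h) * \<i> ^ h * s (i + h) (J - h)) * of_real (y ^ J)))"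
      by (simp only: Re_sum)
    moreover have "Re (x * of_real r) = Re x * r" for x r by simp
    ultimately show ?thesis unfolding c_def by (simp only:)
  qed
  then have eqJ: "(\<Sum>J\<le>L + L. c i J * y ^ J) = (if i = 0 then \<Sum>m\<le>M. q m * y ^ m else 0)" for y
    using ReU[of i y] by simp
  have cz: "c i J = 0" if "J > L + L" for J
  proof -
    have "s (i + h) (J - h) = 0" if "h \<le> J" for h
    proof -
      have "i + h > L \<or> J - h > L" using that \<open>J > L + L\<close> by linarith
      then show ?thesis by (rule s0)
    qed
    then show ?thesis by (simp add: c_def)
  qed
  define N where "N = max (max (L + L) M) J"
  have "(\<Sum>J\<le>N. (c i J - (if i = 0 then q J else 0)) * y ^ J) = 0" for y
  proof -
    have "(\<Sum>J\<le>N. c i J * y ^ J) = (\<Sum>J\<le>L + L. c i J * y ^ J)"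
      by (rule sum.mono_neutral_right) (auto simp: N_def cz)
    moreover have "(\<Sum>J\<le>N. q J * y ^ J) = (\<Sum>J\<le>M. q J * y ^ J)"
      by (rule sum.mono_neutral_right) (auto simp: N_def q0)
    ultimately show ?thesis using eqJ[of y] by (cases "i = 0") (simp_all add: left_diff_distrib sum_subtractf)
  qed
  then have "\<forall>J\<le>N. c i J - (if i = 0 then q J else 0) = 0"
    using polyfun_eq_0[of "\<lambda>J. c i J - (if i = 0 then q J else 0)" N] by blast
  then have "c i J = (if i = 0 then q J else 0)" by (simp add: N_def)
  then show ?thesis by (simp add: c_def)
qed

text \<open>Negative powers of z arise from dividing the t-component by c z^k; the flag
  \<open>h\<close> forbids them. Only values on the circle matter, hence the closure under
  \<open>lpoly_cong\<close>.\<close>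

inductive lpoly :: "bool \<Rightarrow> real \<Rightarrow> real \<Rightarrow> real \<Rightarrow> (complex \<Rightarrow> complex \<Rightarrow> complex) \<Rightarrow> bool" for h a b where
  lpoly_zero: "lpoly h a b w (\<lambda>u t. 0)"
| lpoly_mono: "a * real_of_int p + b * real i = w \<Longrightarrow> (h \<Longrightarrow> p \<ge> 0) \<Longrightarrow> lpoly h a b w (\<lambda>u t. c * u powi p * t ^ i)"
| lpoly_add: "lpoly h a b w P \<Longrightarrow> lpoly h a b w Q \<Longrightarrow> lpoly h a b w (\<lambda>u t. P u t + Q u t)"
| lpoly_cong: "lpoly h a b w P \<Longrightarrow> (\<And>u t. cmod u = 1 \<Longrightarrow> P u t = Q u t) \<Longrightarrow> lpoly h a b w Q"

lemma wpoly_lpoly: "wpoly True a b w P Pz Pt \<Longrightarrow> lpoly h a b w P"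
proof (induction rule: wpoly.induct)
  case (wpoly_mono p q i j w c)
  then have "lpoly h a b w (\<lambda>u t. c * u powi int p * t ^ i)" by (intro lpoly_mono) auto
  then show ?case using wpoly_mono by simp
qed (auto intro: lpoly_zero lpoly_add)

lemma lpoly_mult:
  assumes "lpoly h a b w P" "lpoly h a b w' Q"
  shows "lpoly h a b (w + w') (\<lambda>u t. P u t * Q u t)"
  using assms(1)
proof induction
  case (lpoly_zero w)
  show ?case using lpoly.lpoly_zero by simp
next
  case (lpoly_add w P1 P2)
  show ?case using lpoly.lpoly_add[OF lpoly_add.IH] by (simp add: ring_distribs)
next
  case (lpoly_cong w P1 P2)
  show ?case by (rule lpoly.lpoly_cong[OF lpoly_cong.IH]) (use lpoly_cong in auto)
next
  case (lpoly_mono p i w c)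
  note m = this
  from assms(2) show ?case
  proof induction
    case (lpoly_zero w)
    show ?case using lpoly.lpoly_zero by simp
  next
    case (lpoly_add w P1 P2)
    show ?case using lpoly.lpoly_add[OF lpoly_add.IH] by (simp add: ring_distribs)
  next
    case (lpoly_cong w P1 P2)
    show ?case by (rule lpoly.lpoly_cong[OF lpoly_cong.IH]) (use lpoly_cong in auto)
  next
    case (lpoly_mono p' i' w' c')
    have "lpoly h a b (w + w') (\<lambda>u t. (c * c') * u powi (p + p') * t ^ (i + i'))"
      by (rule lpoly.lpoly_mono) (use m lpoly_mono in \<open>auto simp: algebra_simps\<close>)
    then show ?case
    proof (rule lpoly.lpoly_cong)
      fix u t :: complex assume "cmod u = 1"
      then have "u \<noteq> 0" by auto
      then show "c * c' * u powi (p + p') * t ^ (i + i') = c * u powi p * t ^ i * (c' * u powi p' * t ^ i')"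
        by (simp add: power_int_add power_add)
    qed
  qed
qed

lemma lpoly_cmul:
  assumes "lpoly h a b w P"
  shows "lpoly h a b w (\<lambda>u t. x * P u t)"
proof -
  have "lpoly h a b 0 (\<lambda>u t. x * u powi 0 * t ^ 0)" by (rule lpoly_mono) auto
  from lpoly_mult[OF this assms] show ?thesis by simp
qed

lemma lpoly_diff:
  assumes "lpoly h a b w P" "lpoly h a b w Q"
  shows "lpoly h a b w (\<lambda>u t. P u t - Q u t)"
  using lpoly_add[OF assms(1) lpoly_cmul[OF assms(2), of "-1"]] by simp

text \<open>For a given power of t the weight determines the exponent of z, so each power occurs
  with a single monomial. The floor merely names this exponent for every i; it is exact wherever the
  coefficient is nonzero.\<close>

lemma lpoly_decomp:
  assumes "lpoly h a b w F" "a > 0"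
  shows "\<exists>\<phi> L. (\<forall>i. \<phi> i \<noteq> 0 \<longrightarrow> a * real_of_int \<lfloor>(w - b * real i) / a\<rfloor> + b * real i = w \<and> (h \<longrightarrow> \<lfloor>(w - b * real i) / a\<rfloor> \<ge> 0))
    \<and> (\<forall>i>L. \<phi> i = 0)
    \<and> (\<forall>u t. cmod u = 1 \<longrightarrow> F u t = (\<Sum>i\<le>L. \<phi> i * u powi \<lfloor>(w - b * real i) / a\<rfloor> * t ^ i))"
  using assms(1)
proof induction
  case (lpoly_zero w)
  show ?case by (intro exI[of _ "\<lambda>i. 0"]) auto
next
  case (lpoly_cong w P Q)
  show ?case using lpoly_cong.IH lpoly_cong.hyps(2)
    by (elim exE conjE) (rule exI, rule exI, intro conjI, assumption, assumption, simp)
next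
  case (lpoly_mono p i w c)
  have p: "\<lfloor>(w - b * real i) / a\<rfloor> = p" using lpoly_mono(1) assms(2) by (simp add: lpoly_mono(1)[symmetric])
  show ?case
  proof (intro exI[of _ "\<lambda>j. if j = i then c else 0"] exI[of _ i] conjI allI impI)
    fix u t :: complex
    have "(\<Sum>j\<le>i. (if j = i then c else 0) * u powi \<lfloor>(w - b * real j) / a\<rfloor> * t ^ j)
        = (\<Sum>j\<le>i. if j = i then c * u powi p * t ^ i else 0)"
      by (rule sum.cong) (auto simp: p)
    then show "c * u powi p * t ^ i = (\<Sum>j\<le>i. (if j = i then c else 0) * u powi \<lfloor>(w - b * real j) / a\<rfloor> * t ^ j)"
      by simp
  qed (use p lpoly_mono in \<open>auto split: if_splits\<close>)
next
  case (lpoly_add w P Q)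
  obtain \<phi> L where 1: "\<forall>i. \<phi> i \<noteq> 0 \<longrightarrow> a * real_of_int \<lfloor>(w - b * real i) / a\<rfloor> + b * real i = w \<and> (h \<longrightarrow> \<lfloor>(w - b * real i) / a\<rfloor> \<ge> 0)"
    "\<forall>i>L. \<phi> i = 0" "\<And>u t. cmod u = 1 \<Longrightarrow> P u t = (\<Sum>i\<le>L. \<phi> i * u powi \<lfloor>(w - b * real i) / a\<rfloor> * t ^ i)"
    using lpoly_add.IH(1) by blast
  obtain \<psi> L' where 2: "\<forall>i. \<psi> i \<noteq> 0 \<longrightarrow> a * real_of_int \<lfloor>(w - b * real i) / a\<rfloor> + b * real i = w \<and> (h \<longrightarrow> \<lfloor>(w - b * real i) / a\<rfloor> \<ge> 0)"
    "\<forall>i>L'. \<psi> i = 0" "\<And>u t. cmod u = 1 \<Longrightarrow> Q u t = (\<Sum>i\<le>L'. \<psi> i * u powi \<lfloor>(w - b * real i) / a\<rfloor> * t ^ i)"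
    using lpoly_add.IH(2) by blast
  show ?case
  proof (intro exI[of _ "\<lambda>i. \<phi> i + \<psi> i"] exI[of _ "max L L'"] conjI allI impI)
    fix u t :: complex assume u: "cmod u = 1"
    have "P u t = (\<Sum>i\<le>max L L'. \<phi> i * u powi \<lfloor>(w - b * real i) / a\<rfloor> * t ^ i)"
      unfolding 1(3)[OF u] by (rule sum.mono_neutral_left) (use 1(2) in auto)
    moreover have "Q u t = (\<Sum>i\<le>max L L'. \<psi> i * u powi \<lfloor>(w - b * real i) / a\<rfloor> * t ^ i)"
      unfolding 2(3)[OF u] by (rule sum.mono_neutral_left) (use 2(2) in auto)
    ultimately show "P u t + Q u t = (\<Sum>i\<le>max L L'. (\<phi> i + \<psi> i) * u powi \<lfloor>(w - b * real i) / a\<rfloor> * t ^ i)"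
      by (simp add: ring_distribs sum.distrib)
  next
    fix i assume "\<phi> i + \<psi> i \<noteq> 0"
    then have "\<phi> i \<noteq> 0 \<or> \<psi> i \<noteq> 0" by auto
    then have *: "a * real_of_int \<lfloor>(w - b * real i) / a\<rfloor> + b * real i = w \<and> (h \<longrightarrow> \<lfloor>(w - b * real i) / a\<rfloor> \<ge> 0)"
      using 1(1)[rule_format, of i] 2(1)[rule_format, of i] by (elim disjE) simp_all
    show "a * real_of_int \<lfloor>(w - b * real i) / a\<rfloor> + b * real i = w" by (rule conjunct1[OF *])
    show "\<lfloor>(w - b * real i) / a\<rfloor> \<ge> 0" if h using conjunct2[OF *] that by (rule mp)
  qed (use 1(2) 2(2) in auto)
qed

section \<open>Rectification of a symmetry\<close>

text \<open>
  Holomorphic nondegeneracy of \<open>Im w = P\<close>, tested on weighted homogeneous fields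
  \<open>f \<partial>\<^sub>z + h \<partial>\<^sub>t + g \<partial>\<^sub>w\<close> whose coefficients do not depend on \<open>w\<close>.
\<close>

definition nondegenerate_model :: "real \<Rightarrow> real \<Rightarrow> (complex \<Rightarrow> complex \<Rightarrow> complex) \<Rightarrow> (complex \<Rightarrow> complex \<Rightarrow> complex) \<Rightarrow> bool" where
  "nondegenerate_model a b Pz Pt \<longleftrightarrow> (\<forall>w f fz ft h hz ht g gz gt.
     wpoly True a b (w + a) f fz ft \<longrightarrow> wpoly True a b (w + b) h hz ht \<longrightarrow> wpoly True a b (w + 1) g gz gt \<longrightarrow>
     (\<forall>z t. f z t * Pz z t + h z t * Pt z t = g z t / (2 * \<i>)) \<longrightarrow> (\<forall>z t. f z t = 0 \<and> h z t = 0))"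

text \<open>On the circle z^p cnj z^q has the frequency p - q, and the weight fixes p + q. Half the
  sum of both is p, the eigenvalue of z d/dz, so one table of coefficients serves V and z V_z. The
  variable t is restricted to the imaginary axis, as the functions of interest depend on Im t
  only.\<close>

definition fourier_rep where
  "fourier_rep a b w V Vz A L \<longleftrightarrow>
    (\<forall>j k. A j k \<noteq> 0 \<longrightarrow> (\<exists>p q. a * real (p + q) + b * real j = w \<and> k = int p - int q))
    \<and> (\<forall>j>L. \<forall>k. A j k = 0)
    \<and> (\<forall>u y. cmod u = 1 \<longrightarrow> V u (\<i> * of_real y) = (\<Sum>j\<le>L. ev (A j) u * of_real y ^ j)
        \<and> u * Vz u (\<i> * of_real y)
          = (\<Sum>j\<le>L. ev (\<lambda>k. of_real (((w - b * real j) / a + real_of_int k) / 2) * A j k) u * of_real y ^ j))"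

lemma fourier_repD:
  assumes "fourier_rep a b w V Vz A L"
  shows "A j k \<noteq> 0 \<Longrightarrow> \<exists>p q. a * real (p + q) + b * real j = w \<and> k = int p - int q"
    "j > L \<Longrightarrow> A j k = 0"
    "cmod u = 1 \<Longrightarrow> V u (\<i> * of_real y) = (\<Sum>j\<le>L. ev (A j) u * of_real y ^ j)"
    "cmod u = 1 \<Longrightarrow> u * Vz u (\<i> * of_real y)
          = (\<Sum>j\<le>L. ev (\<lambda>k. of_real (((w - b * real j) / a + real_of_int k) / 2) * A j k) u * of_real y ^ j)"
  using assms unfolding fourier_rep_def by simp_all

lemma wpoly_fourier_rep:
  assumes "wpoly False a b w V Vz Vt" "a > 0"
  shows "\<exists>A L. fourier_rep a b w V Vz A L"
  using assms(1)
proof induction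
  case (wpoly_zero w)
  show ?case unfolding fourier_rep_def by (intro exI[of _ "\<lambda>j k. 0"]) (auto simp: ev_def)
next
  case (wpoly_mono p q i j w c)
  \<comment> \<open>The constant comes from t^i cnj t^j = \<i>^i (-\<i>)^j y^(i + j) at t = \<i>
    y.\<close>
  define C where "C = c * \<i> ^ i * (- \<i>) ^ j"
  define A where "A = (\<lambda>j' k. if j' = i + j \<and> k = int p - int q then C else 0)"
  have ev0: "ev (\<lambda>k. x k * A j' k) u = (if j' = i + j then x (int p - int q) * C * u powi (int p - int q) else 0)" for x j' u
    by (subst ev_superset[of "{int p - int q}"]) (auto simp: A_def)
  have up: "u powi (int p - int q) = u ^ p * cnj u ^ q" if "cmod u = 1" for u
  proof -
    have u: "u \<noteq> 0" using that by auto
    have "cnj u = inverse u" using that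
      by (metis complex_norm_square inverse_unique mult.commute of_real_1 power_one u)
    then show ?thesis using u by (simp add: power_int_diff divide_inverse power_inverse)
  qed
  have ty: "(\<i> * of_real y) ^ i * cnj (\<i> * of_real y) ^ j = \<i> ^ i * (- \<i>) ^ j * of_real y ^ (i + j)" for y
  proof -
    have "cnj (\<i> * of_real y) = (- \<i>) * of_real y" by simp
    then show ?thesis by (simp only: power_mult_distrib power_add mult_ac)
  qed
  have pq: "(w - b * real (i + j)) / a + real_of_int (int p - int q) = 2 * real p"
    using wpoly_mono(1) assms(2) by (simp add: field_simps)
  show ?case unfolding fourier_rep_def
  proof (rule exI[of _ A], rule exI[of _ "i + j"], intro conjI allI impI)
    fix u :: complex and y :: real assume u: "cmod u = 1"
    have "(\<Sum>j'\<le>i + j. ev (A j') u * of_real y ^ j') = C * (u ^ p * cnj u ^ q) * of_real y ^ (i + j)"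
      using ev0[of "\<lambda>k. 1"] by (simp add: if_distrib[of "\<lambda>x. x * _"] up[OF u] cong: if_cong)
    then show "c * u ^ p * cnj u ^ q * (\<i> * of_real y) ^ i * cnj (\<i> * of_real y) ^ j = (\<Sum>j'\<le>i + j. ev (A j') u * of_real y ^ j')"
      using ty[of y] by (simp add: C_def mult_ac)
    have "(\<Sum>j'\<le>i + j. ev (\<lambda>k. of_real (((w - b * real j') / a + real_of_int k) / 2) * A j' k) u * of_real y ^ j')
        = of_nat p * C * (u ^ p * cnj u ^ q) * of_real y ^ (i + j)"
    proof -
      have "complex_of_real (((w - b * real (i + j)) / a + real_of_int (int p - int q)) / 2) = of_nat p"
        unfolding pq by simp
      then have "ev (\<lambda>k. of_real (((w - b * real j') / a + real_of_int k) / 2) * A j' k) u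
          = (if j' = i + j then of_nat p * C * (u ^ p * cnj u ^ q) else 0)" for j'
        unfolding ev0 up[OF u] by auto
      then show ?thesis by (simp add: if_distrib[of "\<lambda>x. x * _"] cong: if_cong)
    qed
    moreover have p1: "u * (of_nat p * u ^ (p - 1)) = of_nat p * u ^ p" by (cases p) auto
    have "u * (c * of_nat p * u ^ (p - 1) * cnj u ^ q * (\<i> * of_real y) ^ i * cnj (\<i> * of_real y) ^ j)
       = (u * (of_nat p * u ^ (p - 1))) * c * cnj u ^ q * ((\<i> * of_real y) ^ i * cnj (\<i> * of_real y) ^ j)"
      by (simp only: mult_ac)
    then have "u * (c * of_nat p * u ^ (p - 1) * cnj u ^ q * (\<i> * of_real y) ^ i * cnj (\<i> * of_real y) ^ j)
       = (of_nat p * u ^ p) * c * cnj u ^ q * ((\<i> * of_real y) ^ i * cnj (\<i> * of_real y) ^ j)"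
      unfolding p1 .
    ultimately show "u * (c * of_nat p * u ^ (p - 1) * cnj u ^ q * (\<i> * of_real y) ^ i * cnj (\<i> * of_real y) ^ j)
      = (\<Sum>j'\<le>i + j. ev (\<lambda>k. of_real (((w - b * real j') / a + real_of_int k) / 2) * A j' k) u * of_real y ^ j')"
      unfolding ty by (simp add: C_def mult_ac)
  next
    fix j' k assume "A j' k \<noteq> 0"
    then have "j' = i + j" "k = int p - int q" by (auto simp: A_def split: if_splits)
    then show "\<exists>p q. a * real (p + q) + b * real j' = w \<and> k = int p - int q" using wpoly_mono(1) by blast
  qed (auto simp: A_def)
next
  case (wpoly_add w P Pz Pt Q Qz Qt)
  obtain A L where A: "fourier_rep a b w P Pz A L" using wpoly_add.IH(1) by blast
  obtain B M where B: "fourier_rep a b w Q Qz B M" using wpoly_add.IH(2) by blast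
  note 1 = fourier_repD[OF A] and 2 = fourier_repD[OF B]
  have fin: "finite {k. C j k \<noteq> (0::complex)}"
    if CC: "\<And>j k. C j k \<noteq> 0 \<Longrightarrow> \<exists>p q. a * real (p + q) + b * real j = w \<and> k = int p - int q" for C j
  proof (rule finite_subset)
    define N where "N = \<lceil>(w - b * real j) / a\<rceil>"
    show "{k. C j k \<noteq> 0} \<subseteq> {-N..N}"
    proof
      fix k assume "k \<in> {k. C j k \<noteq> 0}"
      then obtain p q where pq: "a * real (p + q) + b * real j = w" "k = int p - int q" using CC[of j k] by blast
      have "real (p + q) = (w - b * real j) / a" using pq(1) assms(2) by (simp add: field_simps)
      then have "int (p + q) \<le> N" unfolding N_def by linarith
      then show "k \<in> {-N..N}" using pq(2) by auto
    qed
  qed simp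
  have finA: "finite {k. A j k \<noteq> 0}" for j by (rule fin) (rule 1(1))
  have finB: "finite {k. B j k \<noteq> 0}" for j by (rule fin) (rule 2(1))
  have finxA: "finite {k. x k * A j k \<noteq> 0}" for x j by (rule finite_subset[OF _ finA[of j]]) auto
  have finxB: "finite {k. x k * B j k \<noteq> 0}" for x j by (rule finite_subset[OF _ finB[of j]]) auto
  show ?case unfolding fourier_rep_def
  proof (rule exI[of _ "\<lambda>j k. A j k + B j k"], rule exI[of _ "max L M"], intro conjI allI impI)
    fix u :: complex and y :: real assume u: "cmod u = 1"
    have eA: "ev (A j) u = 0" "ev (\<lambda>k. x k * A j k) u = 0" if "j > L" for j x
      using 1(2)[OF that] by (simp_all add: ev_def)
    have eB: "ev (B j) u = 0" "ev (\<lambda>k. x k * B j k) u = 0" if "j > M" for j x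
      using 2(2)[OF that] by (simp_all add: ev_def)
    have "P u (\<i> * of_real y) = (\<Sum>j\<le>max L M. ev (A j) u * of_real y ^ j)"
      unfolding 1(3)[OF u] by (rule sum.mono_neutral_left) (auto simp: eA not_le)
    moreover have "Q u (\<i> * of_real y) = (\<Sum>j\<le>max L M. ev (B j) u * of_real y ^ j)"
      unfolding 2(3)[OF u] by (rule sum.mono_neutral_left) (auto simp: eB not_le)
    ultimately show "P u (\<i> * of_real y) + Q u (\<i> * of_real y) = (\<Sum>j\<le>max L M. ev (\<lambda>k. A j k + B j k) u * of_real y ^ j)"
      by (simp add: ev_add finA finB ring_distribs sum.distrib)
    have e1: "u * Pz u (\<i> * of_real y) = (\<Sum>j\<le>max L M. ev (\<lambda>k. of_real (((w - b * real j) / a + real_of_int k) / 2) * A j k) u * of_real y ^ j)"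
      unfolding 1(4)[OF u] by (rule sum.mono_neutral_left) (simp_all add: 1(2) ev_def not_le)
    have e2: "u * Qz u (\<i> * of_real y) = (\<Sum>j\<le>max L M. ev (\<lambda>k. of_real (((w - b * real j) / a + real_of_int k) / 2) * B j k) u * of_real y ^ j)"
      unfolding 2(4)[OF u] by (rule sum.mono_neutral_left) (simp_all add: 2(2) ev_def not_le)
    have e3: "ev (\<lambda>k. x k * (A j k + B j k)) u = ev (\<lambda>k. x k * A j k) u + ev (\<lambda>k. x k * B j k) u" for x j
      using ev_add[where c = "\<lambda>k. x k * A j k" and d = "\<lambda>k. x k * B j k", OF finxA finxB, of u]
      by (simp add: ring_distribs)
    show "u * (Pz u (\<i> * of_real y) + Qz u (\<i> * of_real y)) =
      (\<Sum>j\<le>max L M. ev (\<lambda>k. of_real (((w - b * real j) / a + real_of_int k) / 2) * (A j k + B j k)) u * of_real y ^ j)"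
      unfolding distrib_left[of u] e1 e2 e3 by (simp only: distrib_right sum.distrib)
  next
    fix j k assume "A j k + B j k \<noteq> 0"
    then have "A j k \<noteq> 0 \<or> B j k \<noteq> 0" by auto
    then show "\<exists>p q. a * real (p + q) + b * real j = w \<and> k = int p - int q" using 1(1) 2(1) by blast
  qed (use 1(2) 2(2) in auto)
qed

text \<open>
  The field \<open>f \<partial>\<^sub>z + (h + w c z^k) \<partial>\<^sub>t + (g0 + w g1) \<partial>\<^sub>w\<close> is tangent to \<open>Im w = P\<close>; \<open>id1\<close> and \<open>id2\<close> are the
  coefficients of the powers of \<open>Re w\<close> in the tangency equation. The substitution \<open>tau\<close> turns
  \<open>c z^k \<partial>\<^sub>t\<close> into \<open>\<partial>\<^sub>t\<close>, so that \<open>P\<close> becomes \<open>Im G\<close> plus a function of \<open>z\<close> and \<open>Im t\<close>.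
\<close>

locale sym_model =
  fixes a b1 :: real and k :: nat and c :: complex
    and P Pz Pt f fz ft h hz ht g0 g0z g0t g1 g1z g1t :: "complex \<Rightarrow> complex \<Rightarrow> complex"
  assumes a: "0 < a" "a \<le> 1/2" and b1: "b1 \<le> 1/2" and bpos: "b1 - real k * a > 0" and c0: "c \<noteq> 0"
    and nq: "\<not> (k = 0 \<and> a = 1/2 \<and> b1 = 1/2)"
    and wP: "wpoly False a b1 1 P Pz Pt" and realP: "\<And>z t. P z t \<in> \<real>"
    and wf: "wpoly True a b1 (a + 1 - (b1 - real k * a)) f fz ft"
    and wh: "wpoly True a b1 (b1 + 1 - (b1 - real k * a)) h hz ht"
    and wg0: "wpoly True a b1 (2 - (b1 - real k * a)) g0 g0z g0t"
    and wg1: "wpoly True a b1 (1 - (b1 - real k * a)) g1 g1z g1t"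
    and nd: "nondegenerate_model a b1 Pz Pt"
    and id1: "\<And>z t. Im (g1 z t) = 2 * Re (c * z ^ k * Pt z t)"
    and id2: "\<And>z t. Im (g0 z t) + Re (P z t) * Re (g1 z t)
        = 2 * Re (f z t * Pz z t + h z t * Pt z t) - 2 * Re (P z t) * Im (c * z ^ k * Pt z t)"
begin

abbreviation "b \<equiv> b1 - real k * a"
definition "tau z t = c * z ^ k * t"

lemma wtau: "wpoly True a b b1 tau (\<lambda>z t. c * of_nat k * z ^ (k - 1) * t) (\<lambda>z t. c * z ^ k)"
  by (rule wpoly_eqI[OF wpoly_mono[of a k 0 b 1 0 b1 True c]]) (auto simp: tau_def algebra_simps)

lemma w_tau:
  assumes "wpoly fl a b1 w F Fz Ft"
  shows "wpoly fl a b w (\<lambda>z t. F z (tau z t)) (\<lambda>z t. Fz z (tau z t) + Ft z (tau z t) * (c * of_nat k * z ^ (k - 1) * t))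
    (\<lambda>z t. Ft z (tau z t) * (c * z ^ k))"
  by (rule wpoly_eqI[OF wpoly_subst[OF assms wpoly_z wtau]]) auto

end

text \<open>G stays a parameter because it is determined only up to a function of z; this freedom is
  later spent on the normalization \<open>N1\<close>.\<close>

locale sym_model_int = sym_model +
  fixes G Gz :: "complex \<Rightarrow> complex \<Rightarrow> complex"
  assumes wG: "wpoly True a b 1 G Gz (\<lambda>z t. g1 z (tau z t))"
begin

definition "V z t = P z (tau z t) - of_real (Im (G z t))"
definition "Vz z t = Pz z (tau z t) + Pt z (tau z t) * (c * of_nat k * z ^ (k - 1) * t) - Gz z t / (2 * \<i>)"
definition "Vt z t = Pt z (tau z t) * (c * z ^ k) - g1 z (tau z t) / (2 * \<i>)"

lemma wV: "wpoly False a b 1 V Vz Vt"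
proof -
  have ImG: "wpoly False a b 1 (\<lambda>z t. (1 / (2 * \<i>)) * (G z t - cnj (G z t))) (\<lambda>z t. (1 / (2 * \<i>)) * (Gz z t - 0))
     (\<lambda>z t. (1 / (2 * \<i>)) * (g1 z (tau z t) - 0))"
    by (intro wpoly_cmul wpoly_diff wpoly_weaken[OF wG] wpoly_cnj_hol[OF wG])
  have I: "complex_of_real (Im x) = (1 / (2 * \<i>)) * (x - cnj x)" for x by (simp add: complex_eq_iff)
  show ?thesis
    by (rule wpoly_eqI[OF wpoly_diff[OF w_tau[OF wP] ImG]]) (auto simp: V_def Vz_def Vt_def I)
qed

lemma realV: "V z t \<in> \<real>" using realP by (simp add: V_def)

lemma derivV: "((\<lambda>x. V (fst x) (snd x)) has_derivative (\<lambda>d. of_real (2 * Re (Vz z t * fst d + Vt z t * snd d)))) (at (z, t))"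
  by (rule wpoly_real_deriv[OF wV realV])

text \<open>This is \<open>id1\<close> after the substitution. Since the derivative of V along Re t
  is 2 Re \<open>Vt\<close>, V depends on z and Im t only.\<close>

lemma Re_Vt: "Re (Vt z t) = 0"
  using id1[of z "tau z t"] by (simp add: Vt_def mult.commute Re_divide power2_eq_square)

lemma V_Im: "V z t = V z (\<i> * of_real (Im t))"
proof -
  define y where "y = Im t"
  have D: "((\<lambda>s. Re (V z (of_real s + \<i> * of_real y))) has_derivative (\<lambda>d. 0)) (at s)" for s
  proof -
    have "((\<lambda>s::real. (z, of_real s + \<i> * of_real y)) has_derivative (\<lambda>d. (0, of_real d))) (at s)"
      by (auto intro!: derivative_eq_intros)
    from bounded_linear.has_derivative[OF bounded_linear_Re has_derivative_compose[OF this derivV]]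
    show ?thesis using Re_Vt by simp
  qed
  have "Re (V z (of_real (Re t) + \<i> * of_real y)) = Re (V z (of_real 0 + \<i> * of_real y))"
  proof -
    have "times (0::real) = (\<lambda>d. 0)" by auto
    then have "((\<lambda>s. Re (V z (of_real s + \<i> * of_real y))) has_real_derivative 0) (at s)" for s
      unfolding has_field_derivative_def using D by simp
    then show ?thesis by (intro DERIV_isconst_all) blast
  qed
  moreover have "complex_of_real (Re t) + \<i> * of_real y = t" by (simp add: y_def complex_eq_iff)
  ultimately have "Re (V z t) = Re (V z (\<i> * of_real y))" by simp
  then show ?thesis using realV unfolding y_def by (auto simp: complex_eq_iff complex_is_Real_iff)
qed

lemma Vz_Im: "Vz z t = Vz z (\<i> * of_real (Im t))"
proof -
  have D: "((\<lambda>s. V s t) has_derivative (\<lambda>d. of_real (2 * Re (Vz z t * d)))) (at z)" for t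
  proof -
    have "((\<lambda>s::complex. (s, t)) has_derivative (\<lambda>d. (d, 0))) (at z)"
      by (auto intro!: derivative_eq_intros)
    from has_derivative_compose[OF this derivV] show ?thesis by simp
  qed
  have "(\<lambda>s. V s t) = (\<lambda>s. V s (\<i> * of_real (Im t)))" using V_Im by blast
  then have "((\<lambda>s. V s t) has_derivative (\<lambda>d. of_real (2 * Re (Vz z (\<i> * of_real (Im t)) * d)))) (at z)"
    using D by metis
  from has_derivative_unique[OF this D[of t]]
  have e: "complex_of_real (2 * Re (Vz z (\<i> * of_real (Im t)) * d)) = of_real (2 * Re (Vz z t * d))" for d
    by (rule fun_cong)
  show ?thesis using e[of 1] e[of \<i>] unfolding of_real_eq_iff by (simp add: complex_eq_iff)
qed

text \<open>This is \<open>id2\<close> after the substitution, with v = V_y. The term \<eta> is the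
  new t-component: differentiating tau = c z^k t along the field gives h = c z^k \<eta> + k c z^(k -
  1) t F.\<close>

lemma main_identity:
  fixes u t :: complex
  assumes "u \<noteq> 0"
  defines "F \<equiv> f u (tau u t)" and "v \<equiv> - 2 * Im (Vt u t)"
  defines "\<eta> \<equiv> h u (tau u t) / (c * u ^ k) - of_nat k * t * F / u"
  shows "Re (V u t) * v + 2 * Re (F * Vz u t) + Im (\<eta> + G u t) * v
    = Im (g0 u (tau u t) - F * Gz u t - \<eta> * g1 u (tau u t))"
proof -
  define p q where "p = Pz u (tau u t)" and "q = Pt u (tau u t)"
  define g where "g = g1 u (tau u t)"
  define hh where "hh = h u (tau u t)"
  define E where "E = Gz u t"
  have qk: "c * u ^ k * q = Vt u t + g / (2 * \<i>)" by (simp add: Vt_def q_def g_def)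
  have Vt: "Vt u t = - \<i> * of_real (v / 2)" using Re_Vt by (simp add: complex_eq_iff v_def)
  have pp: "p = Vz u t + E / (2 * \<i>) - q * (c * of_nat k * u ^ (k - 1) * t)"
    by (simp add: Vz_def p_def q_def E_def)
  have kk: "of_nat k * u ^ k / u = of_nat k * u ^ (k - 1)" using assms(1) by (cases k) auto
  have "\<eta> * (c * u ^ k * q) = hh * q - F * t * c * q * (of_nat k * u ^ k / u)"
    using assms(1) c0 by (simp add: \<eta>_def hh_def field_simps)
  then have "F * p + hh * q = F * Vz u t + F * E / (2 * \<i>) + \<eta> * (c * u ^ k * q)"
    unfolding kk pp by (simp add: algebra_simps)
  then have sum: "F * p + hh * q = F * Vz u t + F * E / (2 * \<i>) + \<eta> * (- \<i> * of_real (v / 2) + g / (2 * \<i>))"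
    unfolding qk Vt .
  have main: "Im (g0 u (tau u t)) + Re (P u (tau u t)) * Re g
      = 2 * Re (F * p + hh * q) - 2 * Re (P u (tau u t)) * Im (- \<i> * of_real (v / 2) + g / (2 * \<i>))"
    using id2[of u "tau u t"] unfolding p_def[symmetric] q_def[symmetric] g_def[symmetric] hh_def[symmetric] F_def[symmetric] qk Vt .
  have i2: "Im (- \<i> * of_real (v / 2) + g / (2 * \<i>)) = - v / 2 - Re g / 2"
    by (simp add: Im_divide power2_eq_square)
  have i3: "Re (P u (tau u t)) = Re (V u t) + Im (G u t)" by (simp add: V_def)
  have i4: "2 * Re (F * p + hh * q) = 2 * Re (F * Vz u t) + Im (F * E) + v * Im \<eta> + Im (\<eta> * g)"
  proof -
    have r: "2 * Re (x / (2 * \<i>)) = Im x" for x by (simp add: Re_divide power2_eq_square)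
    have e: "\<eta> * (- \<i> * of_real (v / 2) + g / (2 * \<i>)) = of_real (v / 2) * (- \<i> * \<eta>) + (\<eta> * g) / (2 * \<i>)"
      by (simp add: algebra_simps)
    show ?thesis unfolding sum e plus_complex.sel distrib_left[of "2::real"] r by (simp add: field_simps)
  qed
  have Rv: "Re (P u (tau u t)) * Re g
      = 2 * Re (F * Vz u t) + Im (F * E) + v * Im \<eta> + Im (\<eta> * g) + (Re (V u t) + Im (G u t)) * v
        + Re (P u (tau u t)) * Re g - Im (g0 u (tau u t))"
    using main unfolding i4 i2 by (simp add: i3 algebra_simps)
  show ?thesis unfolding g_def[symmetric] E_def[symmetric] minus_complex.sel plus_complex.sel
    using Rv by (simp only: distrib_right) (simp add: mult.commute)
qed

end

section \<open>Identity principle on the circle and changes of coordinates\<close>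

lemma wpoly_zero_outside:
  assumes "wpoly h a b w F Fz Ft" "\<And>z t. z \<noteq> 0 \<Longrightarrow> F z t = 0"
  shows "F z t = 0"
proof (cases "z = 0")
  case True
  have "continuous_on UNIV (\<lambda>z. F z t)"
    using continuous_on_compose2[OF wpoly_continuous[OF assms(1)], of UNIV "\<lambda>z. (z, t)"]
    by (simp add: continuous_on_Pair)
  then have "((\<lambda>z. F z t) \<longlongrightarrow> F 0 t) (at 0)" by (simp add: continuous_on_def)
  moreover have "((\<lambda>z. F z t) \<longlongrightarrow> 0) (at 0)"
    by (rule tendsto_eventually) (auto simp: eventually_at_filter assms(2))
  ultimately have "F 0 t = 0" by (rule LIM_unique)
  then show ?thesis using True by simp
qed (use assms(2) in auto)

text \<open>A weighted dilation moves every point with z nonzero to |z| = 1; the remaining points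
  follow by continuity.\<close>

lemma wpoly_zero_circle:
  assumes "wpoly h a b w F Fz Ft" "a > 0" "\<And>u t. cmod u = 1 \<Longrightarrow> F u t = 0"
  shows "F z t = 0"
proof (rule wpoly_zero_outside[OF assms(1)])
  fix z t :: complex assume z: "z \<noteq> 0"
  define l where "l = cmod z powr (1 / a)"
  have l: "l > 0" "l powr a = cmod z" using z assms(2) by (auto simp: l_def powr_powr)
  have "F z t = F (of_real (l powr a) * (z / of_real (cmod z))) (of_real (l powr b) * (t / of_real (l powr b)))"
    using z l by simp
  also have "\<dots> = of_real (l powr w) * F (z / of_real (cmod z)) (t / of_real (l powr b))"
    by (rule wpoly_homogeneous[OF assms(1) l(1)])
  also have "F (z / of_real (cmod z)) (t / of_real (l powr b)) = 0"
    by (rule assms(3)) (use z in \<open>simp add: norm_divide\<close>)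
  finally show "F z t = 0" by simp
qed

text \<open>
  Tangency of \<open>(f0 + w f1) \<partial>\<^sub>z + (h0 + w h1) \<partial>\<^sub>t + (g0 + w g1) \<partial>\<^sub>w\<close>, a field of weight \<open>w\<close>, to \<open>Im w = P\<close>.
\<close>

definition symmetry where
  "symmetry a b w P Pz Pt f0 f1 h0 h1 g0 g1 \<longleftrightarrow>
     (\<exists>x y. wpoly True a b (w + a) f0 x y) \<and> (\<exists>x y. wpoly True a b (w + a - 1) f1 x y) \<and>
     (\<exists>x y. wpoly True a b (w + b) h0 x y) \<and> (\<exists>x y. wpoly True a b (w + b - 1) h1 x y) \<and>
     (\<exists>x y. wpoly True a b (w + 1) g0 x y) \<and> (\<exists>x y. wpoly True a b w g1 x y) \<and>
     (\<forall>z t. Im (g1 z t) = 2 * Re (f1 z t * Pz z t + h1 z t * Pt z t)) \<and>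
     (\<forall>z t. Im (g0 z t) + Re (P z t :: complex) * Re (g1 z t)
        = 2 * Re (f0 z t * Pz z t + h0 z t * Pt z t) - 2 * Re (P z t) * Im (f1 z t * Pz z t + h1 z t * Pt z t))"

lemma wpoly_swap:
  assumes "wpoly h a b w P Pz Pt"
  shows "wpoly h b a w (\<lambda>z t. P t z) (\<lambda>z t. Pt t z) (\<lambda>z t. Pz t z)"
  using assms
proof induction
  case (wpoly_mono p q i j w c)
  show ?case by (rule wpoly_eqI[OF wpoly.wpoly_mono[of b i j a p q w h c]]) (use wpoly_mono in \<open>auto simp: algebra_simps\<close>)
qed (auto intro: wpoly_zero wpoly_add)

lemma symmetry_swap:
  assumes "symmetry a b w P Pz Pt f0 f1 h0 h1 g0 g1"
  shows "symmetry b a w (\<lambda>z t. P t z) (\<lambda>z t. Pt t z) (\<lambda>z t. Pz t z)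
    (\<lambda>z t. h0 t z) (\<lambda>z t. h1 t z) (\<lambda>z t. f0 t z) (\<lambda>z t. f1 t z) (\<lambda>z t. g0 t z) (\<lambda>z t. g1 t z)"
proof -
  have ex: "\<exists>x y. wpoly True b a w' (\<lambda>z t. F t z) x y" if "\<exists>x y. wpoly True a b w' F x y" for F w'
    using that wpoly_swap by blast
  show ?thesis using assms unfolding symmetry_def
    by (intro conjI ex) (auto simp: add.commute)
qed

lemma nondegenerate_swap:
  assumes "nondegenerate_model a b Pz Pt"
  shows "nondegenerate_model b a (\<lambda>z t. Pt t z) (\<lambda>z t. Pz t z)"
  unfolding nondegenerate_model_def
proof (intro allI impI)
  fix w f fz ft h hz ht g gz gt z t
  assume 1: "wpoly True b a (w + b) f fz ft" "wpoly True b a (w + a) h hz ht" "wpoly True b a (w + 1) g gz gt"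
    "\<forall>z t. f z t * Pt t z + h z t * Pz t z = g z t / (2 * \<i>)"
  have "\<forall>z t. h t z * Pz z t + f t z * Pt z t = g t z / (2 * \<i>)" using 1(4) by (simp add: add.commute)
  then have "\<forall>z t. h t z = 0 \<and> f t z = 0"
    using assms[unfolded nondegenerate_model_def, rule_format, OF wpoly_swap[OF 1(2)] wpoly_swap[OF 1(1)] wpoly_swap[OF 1(3)]]
    by blast
  then show "f z t = 0 \<and> h z t = 0" by blast
qed

lemma wpoly_shift_aux:
  assumes "b = real m * a"
  shows "wpoly h a b b (\<lambda>z t. t + l * z ^ m) (\<lambda>z t. l * of_nat m * z ^ (m - 1)) (\<lambda>z t. 1)"
  by (rule wpoly_eqI[OF wpoly_add[OF wpoly_t wpoly_mono[of a m 0 b 0 0 b h l]]]) (use assms in auto)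

lemma wpoly_shift:
  assumes "wpoly h a b w F Fz Ft" "b = real m * a"
  shows "wpoly h a b w (\<lambda>z t. F z (t + l * z ^ m))
    (\<lambda>z t. Fz z (t + l * z ^ m) + Ft z (t + l * z ^ m) * (l * of_nat m * z ^ (m - 1)))
    (\<lambda>z t. Ft z (t + l * z ^ m))"
  by (rule wpoly_eqI[OF wpoly_subst[OF assms(1) wpoly_z wpoly_shift_aux[OF assms(2)]]]) auto

lemma wpoly_shift_mult:
  assumes "wpoly True a b (w + a) f fz ft" "b = real m * a"
  shows "\<exists>x y. wpoly True a b (w + b) (\<lambda>z t. l * of_nat m * z ^ (m - 1) * f z (t + s * z ^ m)) x y"
proof (cases m)
  case 0
  then show ?thesis using wpoly_zero[of True a b "w + b"] by auto
next
  case (Suc n)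
  have "wpoly True a b (real n * a) (\<lambda>z t. l * of_nat m * z ^ n * cnj z ^ 0 * t ^ 0 * cnj t ^ 0)
    (\<lambda>z t. l * of_nat m * of_nat n * z ^ (n - 1) * cnj z ^ 0 * t ^ 0 * cnj t ^ 0)
    (\<lambda>z t. l * of_nat m * of_nat 0 * z ^ n * cnj z ^ 0 * t ^ (0 - 1) * cnj t ^ 0)"
    by (rule wpoly_mono) auto
  from wpoly_mult[OF this wpoly_shift[OF assms, of s]]
  have "\<exists>x y. wpoly True a b (real n * a + (w + a)) (\<lambda>z t. l * of_nat m * z ^ n * f z (t + s * z ^ m)) x y" by auto
  then show ?thesis using Suc assms(2) by (simp add: algebra_simps)
qed

text \<open>In the sheared coordinate the t-component loses l m z^(m - 1) times the z-component, and
  the pairing of the field with the differential of P is unchanged. The condition b = m a keeps the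
  weights.\<close>

lemma symmetry_shift:
  fixes l :: complex
  assumes "symmetry a b w P Pz Pt f0 f1 h0 h1 g0 g1" "b = real m * a"
  defines "sh F \<equiv> (\<lambda>z t. F z (t + l * z ^ m))"
  shows "symmetry a b w (sh P) (\<lambda>z t. sh Pz z t + sh Pt z t * (l * of_nat m * z ^ (m - 1))) (sh Pt)
    (sh f0) (sh f1) (\<lambda>z t. sh h0 z t - l * of_nat m * z ^ (m - 1) * sh f0 z t)
    (\<lambda>z t. sh h1 z t - l * of_nat m * z ^ (m - 1) * sh f1 z t) (sh g0) (sh g1)"
proof -
  have ex: "\<exists>x y. wpoly True a b w' (sh F) x y" if "\<exists>x y. wpoly True a b w' F x y" for F w'
    using that wpoly_shift[OF _ assms(2)] unfolding sh_def by blast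
  have exh: "\<exists>x y. wpoly True a b (w' + b) (\<lambda>z t. sh H z t - l * of_nat m * z ^ (m - 1) * sh F z t) x y"
    if "\<exists>x y. wpoly True a b (w' + b) H x y" "\<exists>x y. wpoly True a b (w' + a) F x y" for F H w'
    using ex[OF that(1)] that(2) wpoly_shift_mult[OF _ assms(2), of w' F _ _ l l] wpoly_diff unfolding sh_def by blast
  have exh1: "\<exists>x y. wpoly True a b (w + b - 1) (\<lambda>z t. sh h1 z t - l * of_nat m * z ^ (m - 1) * sh f1 z t) x y"
    using exh[of "w - 1" h1 f1] assms(1) unfolding symmetry_def by (simp add: algebra_simps)
  have E: "F z t * (sh Pz z t + sh Pt z t * (l * of_nat m * z ^ (m - 1))) + (H z t - l * of_nat m * z ^ (m - 1) * F z t) * sh Pt z t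
     = F z t * sh Pz z t + H z t * sh Pt z t" for F H z t
    by (simp add: algebra_simps)
  show ?thesis
    using assms(1) unfolding symmetry_def
    by (intro conjI ex exh exh1; (simp only: E)?) (simp_all add: sh_def)
qed

lemma nondegenerate_shift:
  fixes l :: complex
  assumes "nondegenerate_model a b Pz Pt" "b = real m * a"
  defines "sh F \<equiv> (\<lambda>z t. F z (t + l * z ^ m))"
  shows "nondegenerate_model a b (\<lambda>z t. sh Pz z t + sh Pt z t * (l * of_nat m * z ^ (m - 1))) (sh Pt)"
  unfolding nondegenerate_model_def
proof (intro allI impI)
  fix w f fz ft h hz ht g gz gt z t
  assume 1: "wpoly True a b (w + a) f fz ft" "wpoly True a b (w + b) h hz ht" "wpoly True a b (w + 1) g gz gt"
    "\<forall>z t. f z t * (sh Pz z t + sh Pt z t * (l * of_nat m * z ^ (m - 1))) + h z t * sh Pt z t = g z t / (2 * \<i>)"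
  define un where "un F = (\<lambda>z t. F z (t + (- l) * z ^ m))" for F :: "complex \<Rightarrow> complex \<Rightarrow> complex"
  define H where "H = (\<lambda>z t. un h z t + l * of_nat m * z ^ (m - 1) * un f z t)"
  have wun: "\<exists>x y. wpoly True a b w' (un F) x y" if "wpoly True a b w' F Fz Ft" for w' F Fz Ft
    using wpoly_shift[OF that assms(2), of "- l"] unfolding un_def by blast
  obtain x y where wf: "wpoly True a b (w + a) (un f) x y" using wun[OF 1(1)] by blast
  obtain x' y' where wg: "wpoly True a b (w + 1) (un g) x' y'" using wun[OF 1(3)] by blast
  obtain p q where wh: "wpoly True a b (w + b) (un h) p q" using wun[OF 1(2)] by blast
  obtain p' q' where "wpoly True a b (w + b) (\<lambda>z t. l * of_nat m * z ^ (m - 1) * un f z t) p' q'"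
    using wpoly_shift_mult[OF 1(1) assms(2), of l "- l"] unfolding un_def by blast
  from wpoly_add[OF wh this] have wH: "wpoly True a b (w + b) H (\<lambda>z t. p z t + p' z t) (\<lambda>z t. q z t + q' z t)"
    unfolding H_def .
  have "\<forall>z t. un f z t * Pz z t + H z t * Pt z t = un g z t / (2 * \<i>)"
  proof (intro allI)
    fix z t
    show "un f z t * Pz z t + H z t * Pt z t = un g z t / (2 * \<i>)"
      using 1(4)[rule_format, of z "t - l * z ^ m"] by (simp add: un_def H_def sh_def algebra_simps)
  qed
  then have 0: "un f z t = 0 \<and> H z t = 0" for z t
    using assms(1)[unfolded nondegenerate_model_def, rule_format, OF wf wH wg] by blast
  have "un f z (t + l * z ^ m) = 0" "H z (t + l * z ^ m) = 0" using 0 by auto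
  then show "f z t = 0 \<and> h z t = 0" by (simp add: H_def un_def)
qed

lemma real_polyfun_unique:
  fixes p q :: "nat \<Rightarrow> complex"
  assumes "\<And>y::real. (\<Sum>j\<le>n. p j * of_real y ^ j) = (\<Sum>j\<le>n. q j * of_real y ^ j)" "j \<le> n"
  shows "p j = q j"
proof -
  have R: "Re (p j) = Re (q j)" if "\<And>y::real. (\<Sum>j\<le>n. p j * of_real y ^ j) = (\<Sum>j\<le>n. q j * of_real y ^ j)" for p q :: "nat \<Rightarrow> complex"
  proof -
    have e: "Re (\<Sum>j\<le>n. p j * of_real y ^ j) = (\<Sum>j\<le>n. Re (p j) * y ^ j)" for y and p :: "nat \<Rightarrow> complex"
      unfolding Re_sum by (rule sum.cong) (simp_all flip: of_real_power)
    have "(\<Sum>j\<le>n. Re (p j) * y ^ j) = (\<Sum>j\<le>n. Re (q j) * y ^ j)" for y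
      unfolding e[symmetric] that[of y] ..
    then have "(\<Sum>j\<le>n. (Re (p j) - Re (q j)) * y ^ j) = 0" for y
      by (simp add: left_diff_distrib sum_subtractf)
    then have "\<forall>j\<le>n. Re (p j) - Re (q j) = 0"
      using polyfun_eq_0[of "\<lambda>j. Re (p j) - Re (q j)" n] by blast
    then show ?thesis using assms(2) by simp
  qed
  have "Re (p j) = Re (q j)" by (rule R) (rule assms(1))
  moreover have "Re (- \<i> * p j) = Re (- \<i> * q j)"
  proof (rule R)
    fix y :: real
    show "(\<Sum>j\<le>n. - \<i> * p j * of_real y ^ j) = (\<Sum>j\<le>n. - \<i> * q j * of_real y ^ j)"
      using assms(1)[of y] unfolding mult.assoc sum_distrib_left[symmetric] by simp
  qed
  ultimately show ?thesis by (simp add: complex_eq_iff)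
qed

section \<open>The Fourier table of V\<close>

context sym_model_int begin

text \<open>This is \<open>fourier_rep\<close> for the weight 1, with d the exact degree in y
  instead of an upper bound.\<close>

definition "repr A d \<longleftrightarrow>
  (\<forall>j i. A j i \<noteq> 0 \<longrightarrow> (\<exists>p q. a * real (p + q) + b * real j = 1 \<and> i = int p - int q)) \<and>
  (\<forall>j>d. \<forall>i. A j i = 0) \<and> (\<exists>i. A d i \<noteq> 0) \<and>
  (\<forall>u y. cmod u = 1 \<longrightarrow> V u (\<i> * of_real y) = (\<Sum>j\<le>d. ev (A j) u * of_real y ^ j)
     \<and> u * Vz u (\<i> * of_real y) = (\<Sum>j\<le>d. ev (euler_coef a b A j) u * of_real y ^ j))"

text \<open>If V did not involve t, the holomorphic field c z^k \<partial>_t + g1 \<partial>_w would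
  be complex tangent to the model.\<close>

lemma Vt_zero_degenerate:
  assumes "\<And>u t. cmod u = 1 \<Longrightarrow> Vt u t = 0"
  shows False
proof -
  obtain x y where dt: "wpoly False a b1 (1 - b1) Pt x y" using wpoly_dt[OF wP] by blast
  have ck: "wpoly True a b1 (real k * a) (\<lambda>z t. c * z ^ k * cnj z ^ 0 * t ^ 0 * cnj t ^ 0)
    (\<lambda>z t. c * of_nat k * z ^ (k - 1) * cnj z ^ 0 * t ^ 0 * cnj t ^ 0)
    (\<lambda>z t. c * of_nat 0 * z ^ k * cnj z ^ 0 * t ^ (0 - 1) * cnj t ^ 0)"
    by (rule wpoly_mono) auto
  have w: "real k * a + (1 - b1) = 1 - (b1 - real k * a)" by simp
  have D: "\<exists>x y. wpoly False a b1 (1 - (b1 - real k * a)) (\<lambda>z t. c * z ^ k * Pt z t - (1 / (2 * \<i>)) * g1 z t) x y"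
    using wpoly_diff[OF wpoly_mult[OF wpoly_weaken[OF ck] dt, unfolded w] wpoly_cmul[OF wpoly_weaken[OF wg1], where x = "1 / (2 * \<i>)"]]
    by auto
  then obtain x y where D: "wpoly False a b1 (1 - (b1 - real k * a)) (\<lambda>z t. c * z ^ k * Pt z t - (1 / (2 * \<i>)) * g1 z t) x y"
    by blast
  have Z: "c * z ^ k * Pt z t - (1 / (2 * \<i>)) * g1 z t = 0" for z t
  proof (rule wpoly_zero_circle[OF D a(1)])
    fix u t :: complex assume u: "cmod u = 1"
    then have "u \<noteq> 0" by auto
    then have "tau u (t / (c * u ^ k)) = t" using c0 by (simp add: tau_def)
    then show "c * u ^ k * Pt u t - 1 / (2 * \<i>) * g1 u t = 0"
      using assms[OF u, of "t / (c * u ^ k)"] by (simp add: Vt_def mult.commute)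
  qed
  have wck: "wpoly True a b1 (- b + b1) (\<lambda>z t. c * z ^ k) (\<lambda>z t. c * of_nat k * z ^ (k - 1)) (\<lambda>z t. 0)"
    by (rule wpoly_eqI[OF ck]) auto
  have wg: "wpoly True a b1 (- b + 1) g1 g1z g1t"
    by (rule wpoly_eqI[OF wg1]) auto
  have "\<forall>z t. 0 * Pz z t + c * z ^ k * Pt z t = g1 z t / (2 * \<i>)" using Z[unfolded right_minus_eq] by simp
  then have Zk: "\<forall>z t. (0::complex) = 0 \<and> c * z ^ k = 0"
    using nd[unfolded nondegenerate_model_def, rule_format, OF wpoly_zero[of True a b1 "- b + a"] wck wg] by simp
  show False using Zk[rule_format, of 1] c0 by simp
qed

lemma deriv_V:
  "((\<lambda>y. Re (V u (\<i> * of_real y))) has_real_derivative (- 2 * Im (Vt u (\<i> * of_real y)))) (at y)"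
proof -
  have "((\<lambda>y::real. (u, \<i> * of_real y)) has_derivative (\<lambda>d. (0, \<i> * of_real d))) (at y)"
    by (auto intro!: derivative_eq_intros)
  from bounded_linear.has_derivative[OF bounded_linear_Re has_derivative_compose[OF this derivV]]
  have "((\<lambda>y. Re (V u (\<i> * of_real y))) has_derivative (\<lambda>d. 2 * Re (Vt u (\<i> * of_real y) * (\<i> * of_real d)))) (at y)"
    by simp
  moreover have "(\<lambda>d. 2 * Re (Vt u (\<i> * of_real y) * (\<i> * of_real d))) = times (- 2 * Im (Vt u (\<i> * of_real y)))"
    by (auto simp: fun_eq_iff)
  ultimately show ?thesis unfolding has_field_derivative_def by simp
qed

lemma Vt_Im: "Vt u t = Vt u (\<i> * of_real (Im t))"
proof -
  have "Im (Vt u t) = Im (Vt u (\<i> * of_real (Im t)))"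
  proof -
    have D: "((\<lambda>s. Re (V u (s + t))) has_derivative (\<lambda>d. 2 * Re (Vt u t * d))) (at 0)" for t
    proof -
      have "((\<lambda>s::complex. (u, s + t)) has_derivative (\<lambda>d. (0, d))) (at 0)"
        by (auto intro!: derivative_eq_intros)
      moreover have "((\<lambda>x. V (fst x) (snd x)) has_derivative (\<lambda>d. of_real (2 * Re (Vz u t * fst d + Vt u t * snd d)))) (at (u, 0 + t))"
        using derivV[of u t] by simp
      ultimately show ?thesis
        using bounded_linear.has_derivative[OF bounded_linear_Re has_derivative_compose[of "\<lambda>s. (u, s + t)" _ 0 UNIV]] by fastforce
    qed
    have "(\<lambda>s. Re (V u (s + t))) = (\<lambda>s. Re (V u (s + \<i> * of_real (Im t))))"
    proof
      fix s
      have "V u (s + t) = V u (\<i> * of_real (Im (s + t)))" by (rule V_Im)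
      moreover have "V u (s + \<i> * of_real (Im t)) = V u (\<i> * of_real (Im (s + \<i> * of_real (Im t))))" by (rule V_Im)
      ultimately show "Re (V u (s + t)) = Re (V u (s + \<i> * of_real (Im t)))" by simp
    qed
    then have "((\<lambda>s. Re (V u (s + t))) has_derivative (\<lambda>d. 2 * Re (Vt u (\<i> * of_real (Im t)) * d))) (at 0)"
      using D[of "\<i> * of_real (Im t)"] by simp
    from has_derivative_unique[OF this D[of t]]
    have "2 * Re (Vt u (\<i> * of_real (Im t)) * d) = 2 * Re (Vt u t * d)" for d by (rule fun_cong)
    from this[of \<i>] show ?thesis by simp
  qed
  then show ?thesis using Re_Vt by (simp add: complex_eq_iff)
qed

lemma repr_exists: "\<exists>A d. repr A d \<and> d \<ge> 1"
proof -
  obtain A L where AL: "fourier_rep a b 1 V Vz A L"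
    using wpoly_fourier_rep[OF wV a(1)] by blast
  note A = fourier_repD[OF AL]
  have ex: "\<exists>j\<ge>1. \<exists>i. A j i \<noteq> 0"
  proof (rule ccontr)
    assume n: "\<not> ?thesis"
    then have e0: "ev (A j) u = 0" if "j \<ge> 1" for j u using that by (simp add: ev_def)
    have "Vt u t = 0" if u: "cmod u = 1" for u t
    proof -
      have "V u (\<i> * of_real y) = ev (A 0) u" for y
      proof -
        have "(\<Sum>j\<le>L. ev (A j) u * of_real y ^ j) = (\<Sum>j\<in>{0}. ev (A j) u * of_real y ^ j)"
          by (rule sum.mono_neutral_right) (use e0 in auto)
        then show ?thesis using A(3)[OF u, of y] by simp
      qed
      then have "((\<lambda>y. Re (V u (\<i> * of_real y))) has_real_derivative 0) (at (Im t))" by simp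
      from DERIV_unique[OF this deriv_V] have "Im (Vt u (\<i> * of_real (Im t))) = 0" by simp
      then show ?thesis using Vt_Im[of u t] Re_Vt[of u t] by (metis complex_eq_iff zero_complex.sel)
    qed
    then show False by (rule Vt_zero_degenerate)
  qed
  define P where "P j \<longleftrightarrow> (\<exists>i. A j i \<noteq> 0)" for j
  have PL: "P j \<Longrightarrow> j \<le> L" for j using A(2) unfolding P_def by (meson not_le)
  define d where "d = (GREATEST j. P j)"
  obtain j0 where j0: "j0 \<ge> 1" "P j0" using ex unfolding P_def by blast
  have Pd: "P d" unfolding d_def using GreatestI_nat[of P j0 L] j0(2) PL by blast
  have le: "P j \<Longrightarrow> j \<le> d" for j unfolding d_def using Greatest_le_nat[of P j L] PL by blast
  have d1: "d \<ge> 1" using le[OF j0(2)] j0(1) by simp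
  have dL: "d \<le> L" using PL[OF Pd] .
  have z: "A j i = 0" if "j > d" for j i using le[of j] that unfolding P_def by (meson not_le)
  have cut: "(\<Sum>j\<le>L. ev (\<lambda>i. x j i * A j i) u * of_real y ^ j) = (\<Sum>j\<le>d. ev (\<lambda>i. x j i * A j i) u * of_real y ^ j)" for x u and y :: real
    by (rule sum.mono_neutral_right) (use dL z in \<open>auto simp: ev_def\<close>)
  have eul: "euler_coef a b A j = (\<lambda>i. of_real (((1 - b * real j) / a + real_of_int i) / 2) * A j i)" for j
    by (simp add: euler_coef_def ndeg_def fun_eq_iff)
  have "repr A d"
    unfolding repr_def eul
  proof (intro conjI allI impI)
    fix u :: complex and y :: real assume u: "cmod u = 1"
    show "V u (\<i> * of_real y) = (\<Sum>j\<le>d. ev (A j) u * of_real y ^ j)"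
      using A(3)[OF u, of y] cut[of "\<lambda>j i. 1" u y] by simp
    show "u * Vz u (\<i> * of_real y) = (\<Sum>j\<le>d. ev (\<lambda>i. of_real (((1 - b * real j) / a + real_of_int i) / 2) * A j i) u * of_real y ^ j)"
      unfolding A(4)[OF u] by (rule cut)
  qed (use A(1) z Pd P_def in auto)
  then show ?thesis using d1 by blast
qed

lemma repr_deriv:
  assumes "repr A d" "cmod u = 1"
  shows "- 2 * Im (Vt u t) = (\<Sum>j\<le>d. real (j + 1) * Re (ev (A (j + 1)) u) * Im t ^ j)"
proof -
  have V: "Re (V u (\<i> * of_real y)) = (\<Sum>j\<le>d. Re (ev (A j) u) * y ^ j)" for y
  proof -
    have "V u (\<i> * of_real y) = (\<Sum>j\<le>d. ev (A j) u * of_real y ^ j)" using assms unfolding repr_def by blast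
    then show ?thesis by (simp add: Re_sum flip: of_real_power)
  qed
  have "((\<lambda>y. \<Sum>j\<le>d. Re (ev (A j) u) * y ^ j) has_real_derivative (\<Sum>j\<le>d. Re (ev (A j) u) * (real j * Im t ^ (j - 1)))) (at (Im t))"
  proof (rule DERIV_sum)
    fix j
    have "((\<lambda>y. y ^ j) has_real_derivative real j * Im t ^ (j - 1)) (at (Im t))"
      using DERIV_pow[of j "Im t" UNIV] by simp
    then show "((\<lambda>y. Re (ev (A j) u) * y ^ j) has_real_derivative Re (ev (A j) u) * (real j * Im t ^ (j - 1))) (at (Im t))"
      by (rule DERIV_cmult)
  qed
  then have "((\<lambda>y. Re (V u (\<i> * of_real y))) has_real_derivative (\<Sum>j\<le>d. Re (ev (A j) u) * (real j * Im t ^ (j - 1)))) (at (Im t))"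
    unfolding V .
  from DERIV_unique[OF deriv_V this]
  have "- 2 * Im (Vt u t) = (\<Sum>j\<le>d. Re (ev (A j) u) * (real j * Im t ^ (j - 1)))"
    using Vt_Im[of u t] by simp
  also have "\<dots> = (\<Sum>j\<in>{1..d}. Re (ev (A j) u) * (real j * Im t ^ (j - 1)))"
    by (rule sum.mono_neutral_right) auto
  also have "\<dots> = (\<Sum>j<d. real (j + 1) * Re (ev (A (j + 1)) u) * Im t ^ j)"
    by (rule sum.reindex_bij_witness[of _ "\<lambda>j. j + 1" "\<lambda>j. j - 1"]) auto
  also have "\<dots> = (\<Sum>j\<le>d. real (j + 1) * Re (ev (A (j + 1)) u) * Im t ^ j)"
  proof (rule sum.mono_neutral_left)
    have e: "ev (A (d + 1)) u = 0" using assms(1) unfolding repr_def by (simp add: ev_def)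
    show "\<forall>j\<in>{..d} - {..<d}. real (j + 1) * Re (ev (A (j + 1)) u) * Im t ^ j = 0"
    proof
      fix j assume "j \<in> {..d} - {..<d}"
      then have "j = d" by simp
      then show "real (j + 1) * Re (ev (A (j + 1)) u) * Im t ^ j = 0" unfolding \<open>j = d\<close> e by simp
    qed
  qed auto
  finally show ?thesis .
qed

end

text \<open>Polarization: with t = x + \<i> y the identity extends to complex x, then to complex y,
  after which x + \<i> y and x - \<i> y are independent variables.\<close>

lemma bipolynomial_eq_0:
  fixes C :: "nat \<Rightarrow> nat \<Rightarrow> complex"
  assumes "\<And>t. (\<Sum>i\<le>M. \<Sum>l\<le>M. C i l * t ^ i * cnj t ^ l) = 0" and "i \<le> M" "l \<le> M"
  shows "C i l = 0"
proof -
  have inf: "infinite (range complex_of_real)"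
    using finite_imageD[of complex_of_real UNIV] infinite_UNIV_char_0 by (auto simp: inj_on_def)
  have real_roots: "q = 0" if "\<And>x::real. poly q (of_real x) = 0" for q :: "complex poly"
  proof (rule ccontr)
    assume "q \<noteq> 0"
    then have "finite {x. poly q x = 0}" by (rule poly_roots_finite)
    moreover have "range complex_of_real \<subseteq> {x. poly q x = 0}" using that by auto
    ultimately show False using inf finite_subset by blast
  qed
  have 1: "(\<Sum>i\<le>M. \<Sum>l\<le>M. C i l * (x + \<i> * of_real y) ^ i * (x - \<i> * of_real y) ^ l) = 0" for x and y :: real
  proof -
    define q where "q = (\<Sum>i\<le>M. \<Sum>l\<le>M. smult (C i l) ([:\<i> * of_real y, 1:] ^ i * [:- \<i> * of_real y, 1:] ^ l))"
    have pq: "poly q x = (\<Sum>i\<le>M. \<Sum>l\<le>M. C i l * (x + \<i> * of_real y) ^ i * (x - \<i> * of_real y) ^ l)" for x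
      by (simp add: q_def poly_sum algebra_simps)
    have "poly q (of_real x) = 0" for x
      using assms(1)[of "of_real x + \<i> * of_real y"] unfolding pq by simp
    then have "q = 0" by (rule real_roots)
    then show ?thesis using pq[of x] by simp
  qed
  have 2: "(\<Sum>i\<le>M. \<Sum>l\<le>M. C i l * (x + \<i> * y) ^ i * (x - \<i> * y) ^ l) = 0" for x y :: complex
  proof -
    define q where "q = (\<Sum>i\<le>M. \<Sum>l\<le>M. smult (C i l) ([:x, \<i>:] ^ i * [:x, - \<i>:] ^ l))"
    have pq: "poly q y = (\<Sum>i\<le>M. \<Sum>l\<le>M. C i l * (x + \<i> * y) ^ i * (x - \<i> * y) ^ l)" for y
      by (simp add: q_def poly_sum algebra_simps)
    have "poly q (of_real y) = 0" for y using 1[of x y] unfolding pq .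
    then have "q = 0" by (rule real_roots)
    then show ?thesis using pq[of y] by simp
  qed
  have 3: "(\<Sum>i\<le>M. (\<Sum>l\<le>M. C i l * r ^ l) * s ^ i) = 0" for s r
  proof -
    have "(s + r) / 2 + \<i> * ((s - r) / (2 * \<i>)) = s" "(s + r) / 2 - \<i> * ((s - r) / (2 * \<i>)) = r"
      by (simp_all add: field_simps)
    then show ?thesis using 2[of "(s + r) / 2" "(s - r) / (2 * \<i>)"]
      unfolding sum_distrib_right by (simp add: mult_ac)
  qed
  have "(\<Sum>l\<le>M. C i l * r ^ l) = 0" for r
    using 3[of r] polyfun_eq_0[of "\<lambda>i. \<Sum>l\<le>M. C i l * r ^ l" M] assms(2) by blast
  then show ?thesis using polyfun_eq_0[of "\<lambda>l. C i l" M] assms(3) by blast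
qed

text \<open>Powers of t and of cnj t are kept apart here, while \<open>fourier_rep\<close> merges
  them; only so can one see which powers of z^k and cnj z^k accompany a term of P(z, c z^k
  t).\<close>

definition biexpansion where
  "biexpansion a b w P r M \<longleftrightarrow>
    (\<forall>i l. trig_poly (r i l) \<and> (\<forall>x. coef (r i l) x \<noteq> 0 \<longrightarrow> (\<exists>p q. a * real (p + q) + b * real (i + l) = w \<and> x = int p - int q)))
    \<and> (\<forall>i l. i > M \<or> l > M \<longrightarrow> r i l = (\<lambda>u. 0))
    \<and> (\<forall>u t. cmod u = 1 \<longrightarrow> P u t = (\<Sum>i\<le>M. \<Sum>l\<le>M. r i l u * t ^ i * cnj t ^ l))"

lemma biexpansionD:
  assumes "biexpansion a b w P r M"
  shows "trig_poly (r i l)"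
    "coef (r i l) x \<noteq> 0 \<Longrightarrow> \<exists>p q. a * real (p + q) + b * real (i + l) = w \<and> x = int p - int q"
    "i > M \<or> l > M \<Longrightarrow> r i l = (\<lambda>u. 0)"
    "M \<le> N \<Longrightarrow> cmod u = 1 \<Longrightarrow> P u t = (\<Sum>i\<le>N. \<Sum>l\<le>N. r i l u * t ^ i * cnj t ^ l)"
proof -
  note A = assms[unfolded biexpansion_def]
  show "trig_poly (r i l)" by (rule conjunct1[OF spec[OF spec[OF conjunct1[OF A]]]])
  show "\<exists>p q. a * real (p + q) + b * real (i + l) = w \<and> x = int p - int q" if "coef (r i l) x \<noteq> 0"
    using spec[OF conjunct2[OF spec[OF spec[OF conjunct1[OF A]]]]] that by (rule mp)
  show z: "r i l = (\<lambda>u. 0)" if "i > M \<or> l > M" for i l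
    using spec[OF spec[OF conjunct1[OF conjunct2[OF A]]]] that by (rule mp)
  assume N: "M \<le> N" and u: "cmod u = 1"
  have "(\<Sum>i\<le>M. \<Sum>l\<le>M. r i l u * t ^ i * cnj t ^ l) = (\<Sum>i\<le>M. \<Sum>l\<le>N. r i l u * t ^ i * cnj t ^ l)"
    by (rule sum.cong[OF refl], rule sum.mono_neutral_left) (use N in \<open>auto simp: z not_le\<close>)
  also have "\<dots> = (\<Sum>i\<le>N. \<Sum>l\<le>N. r i l u * t ^ i * cnj t ^ l)"
    by (rule sum.mono_neutral_left) (use N in \<open>auto simp: z not_le\<close>)
  finally show "P u t = (\<Sum>i\<le>N. \<Sum>l\<le>N. r i l u * t ^ i * cnj t ^ l)"
    using conjunct2[OF conjunct2[OF A]] u by simp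
qed

lemma wpoly_biexpansion:
  assumes "wpoly False a b w P Pz Pt"
  shows "\<exists>r M. biexpansion a b w P r M"
  using assms
proof induction
  case (wpoly_zero w)
  show ?case unfolding biexpansion_def
    by (rule exI[of _ "\<lambda>i l u. 0"], rule exI[of _ 0]) (simp add: tp_intros coef_simps)
next
  case (wpoly_mono p q i j w c)
  define r where "r = (\<lambda>i' l u. if i' = i \<and> l = j then c * u powi (int p - int q) else 0)"
  have up: "u powi (int p - int q) = u ^ p * cnj u ^ q" if "cmod u = 1" for u
  proof -
    have u: "u \<noteq> 0" using that by auto
    have "cnj u = inverse u" using that
      by (metis complex_norm_square inverse_unique mult.commute of_real_1 power_one u)
    then show ?thesis using u by (simp add: power_int_diff divide_inverse power_inverse)
  qed
  have r: "r i' l = (if i' = i \<and> l = j then (\<lambda>u. c * u powi (int p - int q)) else (\<lambda>u. 0))" for i' l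
    by (auto simp: r_def)
  show ?case unfolding biexpansion_def
  proof (rule exI[of _ r], rule exI[of _ "max i j"], intro conjI allI impI)
    fix i' l
    show "trig_poly (r i' l)" by (auto simp: r intro!: tp_intros)
    fix x assume "coef (r i' l) x \<noteq> 0"
    then have "i' = i" "l = j" "x = int p - int q"
      by (auto simp: r coef_simps tp_intros split: if_splits)
    then show "\<exists>p q. a * real (p + q) + b * real (i' + l) = w \<and> x = int p - int q" using wpoly_mono(1) by blast
  next
    fix u t :: complex assume u: "cmod u = 1"
    have "(\<Sum>i'\<le>max i j. \<Sum>l\<le>max i j. r i' l u * t ^ i' * cnj t ^ l)
      = (\<Sum>i'\<le>max i j. if i' = i then c * u powi (int p - int q) * t ^ i * cnj t ^ j else 0)"
    proof (rule sum.cong[OF refl])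
      fix i'
      have "(\<Sum>l\<le>max i j. r i' l u * t ^ i' * cnj t ^ l)
        = (\<Sum>l\<le>max i j. if l = j then (if i' = i then c * u powi (int p - int q) * t ^ i * cnj t ^ j else 0) else 0)"
        by (rule sum.cong[OF refl]) (auto simp: r_def)
      then show "(\<Sum>l\<le>max i j. r i' l u * t ^ i' * cnj t ^ l) = (if i' = i then c * u powi (int p - int q) * t ^ i * cnj t ^ j else 0)"
        by simp
    qed
    then show "c * u ^ p * cnj u ^ q * t ^ i * cnj t ^ j = (\<Sum>i'\<le>max i j. \<Sum>l\<le>max i j. r i' l u * t ^ i' * cnj t ^ l)"
      using up[OF u] by (simp add: mult_ac)
  qed (auto simp: r)
next
  case (wpoly_add w P Pz Pt Q Qz Qt)
  obtain r M where "biexpansion a b w P r M" using wpoly_add.IH(1) by blast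
  note 1 = biexpansionD[OF this]
  obtain s N where "biexpansion a b w Q s N" using wpoly_add.IH(2) by blast
  note 2 = biexpansionD[OF this]
  show ?case unfolding biexpansion_def
  proof (rule exI[of _ "\<lambda>i l u. r i l u + s i l u"], rule exI[of _ "max M N"], intro conjI allI impI)
    fix i l
    show "trig_poly (\<lambda>u. r i l u + s i l u)" by (intro tp_intros 1(1) 2(1))
    fix x assume "coef (\<lambda>u. r i l u + s i l u) x \<noteq> 0"
    then have "coef (r i l) x \<noteq> 0 \<or> coef (s i l) x \<noteq> 0" by (auto simp: coef_simps 1(1) 2(1))
    then show "\<exists>p q. a * real (p + q) + b * real (i + l) = w \<and> x = int p - int q" using 1(2) 2(2) by blast
  next
    fix i l assume "max M N < i \<or> max M N < l"
    then show "(\<lambda>u. r i l u + s i l u) = (\<lambda>u. 0)" by (auto simp: 1(3) 2(3))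
  next
    fix u t :: complex assume "cmod u = 1"
    then show "P u t + Q u t = (\<Sum>i\<le>max M N. \<Sum>l\<le>max M N. (r i l u + s i l u) * t ^ i * cnj t ^ l)"
      using 1(4)[of "max M N" u t] 2(4)[of "max M N" u t] by (simp add: ring_distribs sum.distrib)
  qed
qed

section \<open>Absence of extremal frequencies for k >= 1\<close>

context sym_model_int begin

lemma reprD:
  assumes "repr A d"
  shows "A j i \<noteq> 0 \<Longrightarrow> \<exists>p q. a * real (p + q) + b * real j = 1 \<and> i = int p - int q"
    "j > d \<Longrightarrow> A j i = 0" "\<exists>i. A d i \<noteq> 0"
    "cmod u = 1 \<Longrightarrow> V u (\<i> * of_real y) = (\<Sum>j\<le>d. ev (A j) u * of_real y ^ j)"
    "cmod u = 1 \<Longrightarrow> u * Vz u (\<i> * of_real y) = (\<Sum>j\<le>d. ev (euler_coef a b A j) u * of_real y ^ j)"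
  using assms unfolding repr_def by simp_all

lemma repr_supp:
  assumes "repr A d" "A j i \<noteq> 0"
  shows "\<bar>real_of_int i\<bar> \<le> ndeg a b j"
proof -
  obtain p q where pq: "a * real (p + q) + b * real j = 1" "i = int p - int q" using reprD(1)[OF assms] by blast
  have "a * real (p + q) = 1 - b * real j" using pq(1) by linarith
  then have "real (p + q) = ndeg a b j" using a(1) by (simp add: ndeg_def field_simps)
  then show ?thesis using pq(2) by auto
qed

lemma repr_fin:
  assumes "repr A d"
  shows "finite {i. A j i \<noteq> 0}"
proof (rule finite_subset)
  show "{i. A j i \<noteq> 0} \<subseteq> {- \<lfloor>ndeg a b j\<rfloor>..\<lfloor>ndeg a b j\<rfloor>}"
  proof
    fix k assume "k \<in> {i. A j i \<noteq> 0}"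
    then have "real_of_int k \<le> ndeg a b j" "real_of_int (-k) \<le> ndeg a b j" using repr_supp[OF assms, of j k] by auto
    then show "k \<in> {- \<lfloor>ndeg a b j\<rfloor>..\<lfloor>ndeg a b j\<rfloor>}" unfolding le_floor_iff[symmetric] by auto
  qed
qed simp

lemma repr_real:
  assumes "repr A d" "cmod u = 1"
  shows "ev (A j) u \<in> \<real>"
proof (cases "j \<le> d")
  case True
  have "ev (A j) u = cnj (ev (A j) u)"
  proof (rule real_polyfun_unique[OF _ True])
    fix y :: real
    have "(\<Sum>j\<le>d. ev (A j) u * of_real y ^ j) = cnj (\<Sum>j\<le>d. ev (A j) u * of_real y ^ j)"
      using reprD(4)[OF assms, of y] realV by (metis Reals_cnj_iff)
    then show "(\<Sum>j\<le>d. ev (A j) u * of_real y ^ j) = (\<Sum>j\<le>d. cnj (ev (A j) u) * of_real y ^ j)" by simp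
  qed
  then show ?thesis by (simp add: Reals_cnj_iff)
next
  case False
  then show ?thesis using reprD(2)[OF assms(1)] by (simp add: ev_def)
qed

lemma repr_V:
  assumes "repr A d" "cmod u = 1"
  shows "V u t = (\<Sum>j\<le>d. ev (A j) u * of_real (Im t) ^ j)"
  using V_Im[of u t] reprD(4)[OF assms] by simp

text \<open>In P(z, c z^k t) the term t^i cnj t^l carries the factor z^(k i) cnj z^(k l). For j >= 2
  the term t cnj t^(j - 1) does not occur in Im G, and both z and cnj z divide its coefficient, so
  the frequency stays strictly below the degree. For j = 1 the coefficient of t excludes the
  frequency -n 1, and Hermitian symmetry excludes n 1.\<close>

lemma repr_singular:
  assumes R: "repr A d" and k: "k \<ge> 1" and j: "j \<ge> 1" and nz: "A j x \<noteq> 0"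
  shows "\<bar>real_of_int x\<bar> < ndeg a b j"
proof -
  have neg: "A j (-x) \<noteq> 0"
    using coef_real[of "ev (A j)" x] repr_real[OF R, of _ j] coef_ev[OF repr_fin[OF R], of j] nz by (auto simp: tp_intros)
  obtain r M where rM: "biexpansion a b1 1 P r M" using wpoly_biexpansion[OF wP] by blast
  note r = biexpansionD[OF rM]
  obtain \<gamma> L where \<gamma>: "\<forall>i. \<gamma> i \<noteq> 0 \<longrightarrow> a * real_of_int \<lfloor>(1 - b * real i) / a\<rfloor> + b * real i = 1 \<and> (False \<longrightarrow> \<lfloor>(1 - b * real i) / a\<rfloor> \<ge> 0)"
    "\<forall>i>L. \<gamma> i = 0" "\<forall>u t. cmod u = 1 \<longrightarrow> G u t = (\<Sum>i\<le>L. \<gamma> i * u powi \<lfloor>(1 - b * real i) / a\<rfloor> * t ^ i)"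
    using lpoly_decomp[OF wpoly_lpoly[OF wG, of False] a(1)] by blast
  define g where "g i = (\<lambda>u. \<gamma> i * u powi \<lfloor>(1 - b * real i) / a\<rfloor>)" for i
  have tg: "trig_poly (g i)" for i unfolding g_def by (intro tp_intros)
  define N where "N = max (max M L) (max d j)"
  have G: "G u t = (\<Sum>i\<le>N. g i u * t ^ i)" if "cmod u = 1" for u t
  proof -
    have "G u t = (\<Sum>i\<le>L. g i u * t ^ i)" using \<gamma>(3) that by (simp add: g_def)
    also have "\<dots> = (\<Sum>i\<le>N. g i u * t ^ i)"
      by (rule sum.mono_neutral_left) (use \<gamma>(2) in \<open>auto simp: N_def g_def not_le\<close>)
    finally show ?thesis .
  qed
  \<comment> \<open>Chosen so that Im t = \<alpha> t - \<alpha> cnj t.\<close>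
  define \<alpha> where "\<alpha> = 1 / (2 * \<i>)"
  define D where "D i l u = of_nat ((i + l) choose i) * \<alpha> ^ i * (- \<alpha>) ^ l * ev (A (i + l)) u" for i l u
  have Vx: "V u t = (\<Sum>i\<le>N. \<Sum>l\<le>N. D i l u * t ^ i * cnj t ^ l)" if u: "cmod u = 1" for u t
  proof -
    have Az: "ev (A i) u = 0" if "i > d" for i using reprD(2)[OF R that] by (simp add: ev_def)
    have It: "of_real (Im t) = \<alpha> * t + (- \<alpha>) * cnj t" by (simp add: \<alpha>_def complex_eq_iff Re_divide Im_divide)
    have "V u t = (\<Sum>i\<le>N + N. ev (A i) u * of_real (Im t) ^ i)"
      unfolding repr_V[OF R u] by (rule sum.mono_neutral_left) (auto simp: N_def Az not_le)
    also have "\<dots> = (\<Sum>i\<le>N + N. \<Sum>h\<le>i. D h (i - h) u * t ^ h * cnj t ^ (i - h))"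
    proof (rule sum.cong[OF refl])
      fix i
      have "ev (A i) u * of_real (Im t) ^ i = ev (A i) u * (\<Sum>h\<le>i. of_nat (i choose h) * (\<alpha> * t) ^ h * ((- \<alpha>) * cnj t) ^ (i - h))"
        unfolding It by (simp only: binomial_ring)
      also have "\<dots> = (\<Sum>h\<le>i. D h (i - h) u * t ^ h * cnj t ^ (i - h))"
        unfolding sum_distrib_left
      proof (rule sum.cong[OF refl])
        fix h assume "h \<in> {..i}"
        then have "h + (i - h) = i" by simp
        then show "ev (A i) u * (of_nat (i choose h) * (\<alpha> * t) ^ h * ((- \<alpha>) * cnj t) ^ (i - h)) = D h (i - h) u * t ^ h * cnj t ^ (i - h)"
          unfolding D_def power_mult_distrib by (simp only: mult_ac)
      qed
      finally show "ev (A i) u * of_real (Im t) ^ i = (\<Sum>h\<le>i. D h (i - h) u * t ^ h * cnj t ^ (i - h))" .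
    qed
    also have "\<dots> = (\<Sum>(h, l)\<in>{(h, l). h + l \<le> N + N}. D h l u * t ^ h * cnj t ^ l)"
      by (rule sum.triangle_reindex_eq[symmetric])
    also have "\<dots> = (\<Sum>(h, l)\<in>{..N} \<times> {..N}. D h l u * t ^ h * cnj t ^ l)"
    proof (rule sum.mono_neutral_right)
      show "finite {(h, l). h + l \<le> N + N}"
        by (rule finite_subset[of _ "{..N + N} \<times> {..N + N}"]) auto
      show "\<forall>x\<in>{(h, l). h + l \<le> N + N} - {..N} \<times> {..N}. (case x of (h, l) \<Rightarrow> D h l u * t ^ h * cnj t ^ l) = 0"
      proof
        fix x assume x: "x \<in> {(h, l). h + l \<le> N + N} - {..N} \<times> {..N}"
        obtain h l where hl: "x = (h, l)" by (cases x)
        then have "h > N \<or> l > N" using x by auto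
        then have "h + l > d" by (auto simp: N_def)
        then show "(case x of (h, l) \<Rightarrow> D h l u * t ^ h * cnj t ^ l) = 0" unfolding hl prod.case D_def by (simp add: Az)
      qed
    qed auto
    also have "\<dots> = (\<Sum>i\<le>N. \<Sum>l\<le>N. D i l u * t ^ i * cnj t ^ l)" by (rule sum.cartesian_product[symmetric])
    finally show ?thesis .
  qed
  \<comment> \<open>The coefficient of t^i cnj t^l in V - P(z, tau) + Im G, which is identically
    zero.\<close>
  define E where "E i l u = D i l u - r i l u * (c * u ^ k) ^ i * cnj (c * u ^ k) ^ l
     + \<alpha> * (if l = 0 then g i u else 0) - \<alpha> * (if i = 0 then cnj (g l u) else 0)" for i l u
  have E0: "E i l u = 0" if u: "cmod u = 1" and il: "i \<le> N" "l \<le> N" for i l u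
  proof (rule bipolynomial_eq_0[OF _ il])
    fix t
    have P: "P u (tau u t) = (\<Sum>i\<le>N. \<Sum>l\<le>N. r i l u * (c * u ^ k) ^ i * cnj (c * u ^ k) ^ l * t ^ i * cnj t ^ l)"
      unfolding r(4)[of N, OF _ u, of "tau u t", simplified N_def[symmetric]] 
      by (subst r(4)[of N, OF _ u]) (auto simp: N_def tau_def power_mult_distrib mult_ac)
    have g1: "(\<Sum>i\<le>N. \<Sum>l\<le>N. (if l = 0 then g i u else 0) * t ^ i * cnj t ^ l) = G u t"
    proof -
      have "(\<Sum>l\<le>N. (if l = 0 then g i u else 0) * t ^ i * cnj t ^ l) = (\<Sum>l\<le>N. if l = 0 then g i u * t ^ i else 0)" for i
        by (rule sum.cong) auto
      then show ?thesis using G[OF u, of t] by simp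
    qed
    have g2: "(\<Sum>i\<le>N. \<Sum>l\<le>N. (if i = 0 then cnj (g l u) else 0) * t ^ i * cnj t ^ l) = cnj (G u t)"
    proof -
      have "(\<Sum>l\<le>N. (if i = 0 then cnj (g l u) else 0) * t ^ i * cnj t ^ l) = (if i = 0 then (\<Sum>l\<le>N. cnj (g l u) * cnj t ^ l) else 0)" for i
        by auto
      then show ?thesis using G[OF u, of t] by simp
    qed
    have Im: "of_real (Im x) = \<alpha> * x - \<alpha> * cnj x" for x by (simp add: \<alpha>_def complex_eq_iff Re_divide Im_divide)
    have "(\<Sum>i\<le>N. \<Sum>l\<le>N. E i l u * t ^ i * cnj t ^ l)
      = (\<Sum>i\<le>N. \<Sum>l\<le>N. D i l u * t ^ i * cnj t ^ l)
       - (\<Sum>i\<le>N. \<Sum>l\<le>N. r i l u * (c * u ^ k) ^ i * cnj (c * u ^ k) ^ l * t ^ i * cnj t ^ l)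
       + \<alpha> * (\<Sum>i\<le>N. \<Sum>l\<le>N. (if l = 0 then g i u else 0) * t ^ i * cnj t ^ l)
       - \<alpha> * (\<Sum>i\<le>N. \<Sum>l\<le>N. (if i = 0 then cnj (g l u) else 0) * t ^ i * cnj t ^ l)"
      unfolding E_def left_diff_distrib distrib_right sum_subtractf sum.distrib sum_distrib_left mult.assoc ..
    also have "\<dots> = V u t - P u (tau u t) + of_real (Im (G u t))"
      unfolding Vx[OF u, of t, symmetric] P[symmetric] g1 g2 Im by simp
    also have "\<dots> = 0" by (simp add: V_def)
    finally show "(\<Sum>i\<le>N. \<Sum>l\<le>N. E i l u * t ^ i * cnj t ^ l) = 0" .
  qed
  have \<alpha>0: "\<alpha> \<noteq> 0" by (simp add: \<alpha>_def)
  have cu: "cnj (u ^ k) = u powi (- int k)" if "cmod u = 1" for u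
  proof -
    have u: "u \<noteq> 0" using that by auto
    have "cnj u = inverse u" using that
      by (metis complex_norm_square inverse_unique mult.commute of_real_1 power_one u)
    then show ?thesis by (simp add: power_int_minus power_inverse)
  qed
  show ?thesis
  proof (cases "j = 1")
    case True
    have side: "real_of_int y > - ndeg a b 1" if y: "A 1 y \<noteq> 0" for y
    proof -
      have "\<alpha> * ev (A 1) u = c * (u powi int k * r 1 0 u) - \<alpha> * g 1 u" if u: "cmod u = 1" for u
        using E0[OF u, of 1 0] True by (simp add: E_def D_def N_def algebra_simps)
      from fun_cong[OF coef_cong[of "\<lambda>u. \<alpha> * ev (A 1) u", OF this], of y]
      have "\<alpha> * A 1 y = c * coef (r 1 0) (y - int k) - \<alpha> * coef (g 1) y"
        by (simp del: power_int_of_nat add: coef_simps tp_intros r(1) tg coef_ev[OF repr_fin[OF R]])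
      then have "coef (r 1 0) (y - int k) \<noteq> 0 \<or> coef (g 1) y \<noteq> 0" using y \<alpha>0 by auto
      then show ?thesis
      proof
        assume "coef (r 1 0) (y - int k) \<noteq> 0"
        then obtain p q where pq: "a * real (p + q) + b1 * real (1 + 0) = 1" "y - int k = int p - int q" using r(2) by blast
        have "a * real (p + q) = 1 - b1" using pq(1) by simp
        then have "real (p + q) = (1 - b1) / a" using a(1) by (simp add: field_simps)
        moreover have "ndeg a b 1 = (1 - b1) / a + real k" using a(1) by (simp add: ndeg_def field_simps)
        moreover have "real_of_int y = real k + real p - real q" using pq(2) by linarith
        ultimately show ?thesis using k by simp
      next
        assume "coef (g 1) y \<noteq> 0"
        then have "\<gamma> 1 \<noteq> 0" "y = \<lfloor>(1 - b * real 1) / a\<rfloor>" unfolding g_def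
          by (auto simp: coef_simps tp_intros split: if_splits)
        then have "a * real_of_int y = 1 - b" using \<gamma>(1)[rule_format, of 1] by simp
        then have "real_of_int y = ndeg a b 1" using a(1) by (simp add: ndeg_def field_simps)
        moreover have "ndeg a b 1 > 0" 
        proof -
          have "real k * a \<ge> 0" using a(1) by simp
          then have "1 - b > 0" using b1 by linarith
          then show ?thesis using a(1) by (simp add: ndeg_def)
        qed
        ultimately show ?thesis by simp
      qed
    qed
    have "real_of_int x > - ndeg a b 1" "real_of_int (- x) > - ndeg a b 1"
      using side[of x] side[of "- x"] nz neg True by simp_all
    then show ?thesis using True by auto
  next
    case False
    then have j2: "j \<ge> 2" using j by simp
    \<comment> \<open>The frequency shift caused by z^k cnj z^(k (j - 1)).\<close>
    define K where "K = int k - int k * int (j - 1)"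
    have "of_nat j * \<alpha> * (- \<alpha>) ^ (j - 1) * ev (A j) u = c * cnj c ^ (j - 1) * (u powi K * r 1 (j - 1) u)" if u: "cmod u = 1" for u
    proof -
      have u0: "u \<noteq> 0" using u by auto
      have p1: "D 1 (j - 1) u = r 1 (j - 1) u * (c * u ^ k) * cnj (c * u ^ k) ^ (j - 1)"
        using E0[OF u, of 1 "j - 1"] j2 by (simp add: E_def N_def)
      have p2: "D 1 (j - 1) u = of_nat j * \<alpha> * (- \<alpha>) ^ (j - 1) * ev (A j) u" using j2 by (simp add: D_def)
      have p3: "u ^ k * cnj (u ^ k) ^ (j - 1) = u powi K"
      proof -
        have "cnj (u ^ k) ^ (j - 1) = u powi (- int k * int (j - 1))"
          unfolding cu[OF u] power_int_mult by simp
        then show ?thesis unfolding K_def using u0 by (simp add: power_int_diff power_int_minus divide_inverse)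
      qed
      have "r 1 (j - 1) u * (c * u ^ k) * cnj (c * u ^ k) ^ (j - 1)
          = c * cnj c ^ (j - 1) * ((u ^ k * cnj (u ^ k) ^ (j - 1)) * r 1 (j - 1) u)"
        by (simp add: power_mult_distrib mult_ac)
      then show ?thesis unfolding p2[symmetric] p1 p3 .
    qed
    from fun_cong[OF coef_cong[of "\<lambda>u. of_nat j * \<alpha> * (- \<alpha>) ^ (j - 1) * ev (A j) u", OF this], of x]
    have "of_nat j * \<alpha> * (- \<alpha>) ^ (j - 1) * A j x = c * cnj c ^ (j - 1) * coef (r 1 (j - 1)) (x - K)"
      by (simp add: coef_simps tp_intros r(1) coef_ev[OF repr_fin[OF R]])
    then have "coef (r 1 (j - 1)) (x - K) \<noteq> 0" using nz \<alpha>0 j by auto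
    then obtain p q where pq: "a * real (p + q) + b1 * real (1 + (j - 1)) = 1" "x - K = int p - int q" using r(2) by blast
    have "a * real (p + q) = 1 - b1 * real j" using pq(1) j by simp
    then have "real (p + q) = (1 - b1 * real j) / a" using a(1) by (simp add: field_simps)
    moreover have "ndeg a b j = (1 - b1 * real j) / a + real k * real j" using a(1) by (simp add: ndeg_def field_simps)
    moreover have "real_of_int x = real p - real q + real_of_int K" using pq(2) by linarith
    moreover have "real_of_int K = 2 * real k - real k * real j"
      using j by (simp add: K_def of_nat_diff algebra_simps)
    moreover have "real k * real j \<ge> 2 * real k" using mult_left_mono[of 2 "real j" "real k"] j2 by (simp add: mult.commute)
    moreover have "real k \<ge> 1" using k by simp
    ultimately show ?thesis unfolding of_nat_add by linarith
  qed
qed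

end

lemma wpoly_holomorphic_monomial:
  assumes "x \<noteq> 0 \<Longrightarrow> a * real p = w"
  shows "\<exists>X Y. wpoly h a b w (\<lambda>z t. x * z ^ p) X Y"
proof (cases "x = 0")
  case True
  then show ?thesis using wpoly_zero[of h a b w] by auto
next
  case False
  then have "wpoly h a b w (\<lambda>z t. x * z ^ p * cnj z ^ 0 * t ^ 0 * cnj t ^ 0)
    (\<lambda>z t. x * of_nat p * z ^ (p - 1) * cnj z ^ 0 * t ^ 0 * cnj t ^ 0)
    (\<lambda>z t. x * of_nat 0 * z ^ p * cnj z ^ 0 * t ^ (0 - 1) * cnj t ^ 0)"
    by (intro wpoly_mono) (use assms in auto)
  then show ?thesis by auto
qed

lemma wpoly_mult_ex:
  assumes "\<exists>x y. wpoly h a b w F x y" "\<exists>x y. wpoly h a b w' H x y"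
  shows "\<exists>x y. wpoly h a b (w + w') (\<lambda>z t. F z t * H z t) x y"
  using assms wpoly_mult by blast

lemma wpoly_add_ex:
  assumes "\<exists>x y. wpoly h a b w F x y" "\<exists>x y. wpoly h a b w H x y"
  shows "\<exists>x y. wpoly h a b w (\<lambda>z t. F z t + H z t) x y"
  using assms wpoly_add by blast

lemma wpoly_diff_ex:
  assumes "\<exists>x y. wpoly h a b w F x y" "\<exists>x y. wpoly h a b w H x y"
  shows "\<exists>x y. wpoly h a b w (\<lambda>z t. F z t - H z t) x y"
  using assms wpoly_diff by blast

lemma wpoly_cmul_ex:
  assumes "\<exists>x y. wpoly h a b w F x y"
  shows "\<exists>x y. wpoly h a b w (\<lambda>z t. c * F z t) x y"
  using assms wpoly_cmul by blast

section \<open>From the tangency equation to the data on the circle\<close>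

context sym_model_int begin

abbreviation "fu u t \<equiv> f u (tau u t)"
definition "eta u t = h u (tau u t) / (c * u ^ k) - of_nat k * t * fu u t / u"
definition "HH u t = eta u t + G u t"
definition "GG u t = g0 u (tau u t) - fu u t * Gz u t - eta u t * g1 u (tau u t)"

lemma lp_f: "lpoly fl a b (a + 1 - b) fu"
  by (rule wpoly_lpoly[OF w_tau[OF wf]])

text \<open>Both divisions by powers of z disappear for k = 0, the second one thanks to its factor
  k; for k >= 1 poles are possible.\<close>

lemma lp_eta: "lpoly (k = 0) a b 1 eta"
proof -
  have "lpoly (k = 0) a b (- (real k * a)) (\<lambda>u t. (1 / c) * u powi (- int k) * t ^ 0)"
    by (rule lpoly_mono) auto
  from lpoly_mult[OF this wpoly_lpoly[OF w_tau[OF wh]]]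
  have h1: "lpoly (k = 0) a b 1 (\<lambda>u t. (1 / c) * u powi (- int k) * t ^ 0 * h u (tau u t))" by simp
  have h1: "lpoly (k = 0) a b 1 (\<lambda>u t. h u (tau u t) / (c * u ^ k))"
  proof (rule lpoly_cong[OF h1])
    fix u t :: complex assume "cmod u = 1"
    then show "(1 / c) * u powi (- int k) * t ^ 0 * h u (tau u t) = h u (tau u t) / (c * u ^ k)"
      by (simp add: power_int_minus divide_inverse)
  qed
  have h2: "lpoly (k = 0) a b 1 (\<lambda>u t. of_nat k * t * fu u t / u)"
  proof (cases "k = 0")
    case True
    then show ?thesis using lpoly_zero by simp
  next
    case False
    have "lpoly (k = 0) a b (b - a) (\<lambda>u t. of_nat k * u powi (-1) * t ^ 1)"
      by (rule lpoly_mono) (use False in auto)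
    from lpoly_mult[OF this lp_f]
    have h2: "lpoly (k = 0) a b 1 (\<lambda>u t. of_nat k * u powi (-1) * t ^ 1 * fu u t)" by simp
    show ?thesis
    proof (rule lpoly_cong[OF h2])
      fix u t :: complex assume "cmod u = 1"
      then show "of_nat k * u powi (-1) * t ^ 1 * fu u t = of_nat k * t * fu u t / u"
        by (simp add: power_int_minus divide_inverse)
    qed
  qed
  show ?thesis using lpoly_diff[OF h1 h2] unfolding eta_def .
qed

lemma lp_HH: "lpoly (k = 0) a b 1 HH"
  using lpoly_add[OF lp_eta wpoly_lpoly[OF wG]] unfolding HH_def .

lemma lp_GG: "lpoly (k = 0) a b (2 - b) GG"
proof -
  obtain x y where Gz: "wpoly True a b (1 - a) Gz x y" using wpoly_dz[OF wG] by blast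
  have 1: "lpoly (k = 0) a b (2 - b) (\<lambda>u t. fu u t * Gz u t)"
    using lpoly_mult[OF lp_f wpoly_lpoly[OF Gz]] by (simp add: algebra_simps)
  have 2: "lpoly (k = 0) a b (2 - b) (\<lambda>u t. eta u t * g1 u (tau u t))"
    using lpoly_mult[OF lp_eta wpoly_lpoly[OF w_tau[OF wg1]]] by (simp add: algebra_simps)
  show ?thesis using lpoly_diff[OF lpoly_diff[OF wpoly_lpoly[OF w_tau[OF wg0]] 1] 2] unfolding GG_def .
qed

lemma main_identity':
  assumes "cmod u = 1"
  shows "Re (V u t) * (- 2 * Im (Vt u t)) / 2 + Re (fu u t * Vz u t) + Im (HH u t) * (- 2 * Im (Vt u t)) / 2 - Im (GG u t) / 2 = 0"
proof -
  have "u \<noteq> 0" using assms by auto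
  from main_identity[OF this, of t] show ?thesis
    unfolding HH_def GG_def eta_def by (simp add: field_simps)
qed

text \<open>\<open>S i j\<close> is the coefficient of t^i y^j in f V_z + H V_y / (2 \<i>) - g / (2
  \<i>), with f, H, g the functions \<open>fu\<close>, \<open>HH\<close>, \<open>GG\<close>; its
  real part equals -V V_y / 2 by \<open>main_identity'\<close>. The nondegeneracy axioms carry a
  hypothetical tangent field back to P, which works for k = 0, where \<open>tau\<close> is just a
  rescaling of t.\<close>

lemma classified:
  assumes R: "repr A d" and d1: "d \<ge> 1"
    and N1: "\<forall>i. k = 0 \<longrightarrow> real_of_int i = ndeg a b 0 \<longrightarrow> A 0 i = 0"
    and N2: "\<forall>i. k = 0 \<longrightarrow> ndeg a b d = 0 \<longrightarrow> d \<ge> 2 \<longrightarrow> real_of_int i = ndeg a b (d - 1) \<longrightarrow> A (d - 1) i = 0"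
  shows "k = 0 \<and> ((d = 2 \<and> b = 1/2 \<and> (\<forall>i. A 1 i = 0) \<and> A 2 0 \<noteq> 0 \<and> (\<forall>i. i \<noteq> 0 \<longrightarrow> A 2 i = 0)
       \<and> A 0 0 \<noteq> 0 \<and> (\<forall>i. i \<noteq> 0 \<longrightarrow> A 0 i = 0))
    \<or> (d = 1 \<and> (\<exists>m>0. real_of_int m = ndeg a b 1 \<and> A 1 m \<noteq> 0 \<and> (\<forall>i. A 1 i \<noteq> 0 \<longrightarrow> i = m \<or> i = -m)
       \<and> (\<forall>i. A 0 i \<noteq> 0 \<longrightarrow> real_of_int i = ndeg a b 0 - 2 * real_of_int m \<or> real_of_int i = - (ndeg a b 0 - 2 * real_of_int m)))))"
proof -
  define xf xh xg where "xf i = \<lfloor>((a + 1 - b) - b * real i) / a\<rfloor>" and "xh i = \<lfloor>(1 - b * real i) / a\<rfloor>"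
    and "xg i = \<lfloor>((2 - b) - b * real i) / a\<rfloor>" for i
  obtain \<phi> Lf where \<phi>: "\<forall>i. \<phi> i \<noteq> 0 \<longrightarrow> a * real_of_int (xf i) + b * real i = a + 1 - b \<and> (True \<longrightarrow> xf i \<ge> 0)"
    "\<forall>i>Lf. \<phi> i = 0" "\<forall>u t. cmod u = 1 \<longrightarrow> fu u t = (\<Sum>i\<le>Lf. \<phi> i * u powi xf i * t ^ i)"
    using lpoly_decomp[OF lp_f[of True] a(1)] unfolding xf_def by blast
  obtain \<beta> Lh where \<beta>: "\<forall>i. \<beta> i \<noteq> 0 \<longrightarrow> a * real_of_int (xh i) + b * real i = 1 \<and> (k = 0 \<longrightarrow> xh i \<ge> 0)"
    "\<forall>i>Lh. \<beta> i = 0" "\<forall>u t. cmod u = 1 \<longrightarrow> HH u t = (\<Sum>i\<le>Lh. \<beta> i * u powi xh i * t ^ i)"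
    using lpoly_decomp[OF lp_HH a(1)] unfolding xh_def by blast
  obtain \<gamma> Lg where \<gamma>: "\<forall>i. \<gamma> i \<noteq> 0 \<longrightarrow> a * real_of_int (xg i) + b * real i = 2 - b \<and> (k = 0 \<longrightarrow> xg i \<ge> 0)"
    "\<forall>i>Lg. \<gamma> i = 0" "\<forall>u t. cmod u = 1 \<longrightarrow> GG u t = (\<Sum>i\<le>Lg. \<gamma> i * u powi xg i * t ^ i)"
    using lpoly_decomp[OF lp_GG a(1)] unfolding xg_def by blast
  \<comment> \<open>The table \<open>euler_coef\<close> describes u V_z instead of V_z, which costs
    one power of u; as f itself is a polynomial, e >= -1.\<close>
  define e where "e i = xf i - 1" for i
  define S where "S i j u = \<phi> i * (u powi e i * ev (euler_coef a b A j) u)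
        + of_nat (j + 1) * \<beta> i / (2 * \<i>) * (u powi xh i * ev (A (j + 1)) u)
        - (if j = 0 then \<gamma> i / (2 * \<i>) else 0) * u powi xg i" for i j u
  define L where "L = max (max Lf Lh) (max Lg d)"
  have Az: "ev (A j) u = 0" "ev (euler_coef a b A j) u = 0" if "j > d" for j u
    using reprD(2)[OF R that] by (simp_all add: ev_def euler_coef_def)
  have AR: "ev (A j) u = of_real (Re (ev (A j) u))" if "cmod u = 1" for j u
    using repr_real[OF R that, of j] by (auto simp: complex_is_Real_iff complex_eq_iff)
  define AS BS where "AS u y = (\<Sum>j\<le>L. of_nat (j + 1) * ev (A (j + 1)) u * of_real y ^ j)"
    and "BS u y = (\<Sum>j\<le>L. ev (euler_coef a b A j) u * of_real y ^ j)" for u and y :: real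
  have BS: "u * Vz u t = BS u (Im t)" if "cmod u = 1" for u t
  proof -
    have "u * Vz u t = (\<Sum>j\<le>d. ev (euler_coef a b A j) u * of_real (Im t) ^ j)"
      using reprD(5)[OF R that, of "Im t"] Vz_Im[of u t] by simp
    also have "\<dots> = BS u (Im t)" unfolding BS_def
      by (rule sum.mono_neutral_left) (auto simp: L_def Az not_le)
    finally show ?thesis .
  qed
  have AS: "of_real (- 2 * Im (Vt u t)) = AS u (Im t)" if u: "cmod u = 1" for u t
  proof -
    have "of_real (- 2 * Im (Vt u t)) = (\<Sum>j\<le>d. of_nat (j + 1) * of_real (Re (ev (A (j + 1)) u)) * of_real (Im t) ^ j)"
      unfolding repr_deriv[OF R u] by simp
    also have "\<dots> = (\<Sum>j\<le>d. of_nat (j + 1) * ev (A (j + 1)) u * of_real (Im t) ^ j)"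
      unfolding AR[OF u, symmetric] ..
    also have "\<dots> = AS u (Im t)" unfolding AS_def
      by (rule sum.mono_neutral_left) (auto simp: L_def Az not_le)
    finally show ?thesis .
  qed
  have S_sum: "(\<Sum>j\<le>L. S i j u * of_real y ^ j)
      = \<phi> i * u powi e i * BS u y + \<beta> i * u powi xh i / (2 * \<i>) * AS u y - \<gamma> i * u powi xg i / (2 * \<i>)" for i u y
  proof -
    have "(\<Sum>j\<le>L. (if j = 0 then \<gamma> i / (2 * \<i>) else 0) * u powi xg i * of_real y ^ j)
        = (\<Sum>j\<le>L. if j = 0 then \<gamma> i / (2 * \<i>) * u powi xg i else 0)"
      by (rule sum.cong) auto
    then have "(\<Sum>j\<le>L. (if j = 0 then \<gamma> i / (2 * \<i>) else 0) * u powi xg i * of_real y ^ j) = \<gamma> i * u powi xg i / (2 * \<i>)"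
      by simp
    moreover have "(\<Sum>j\<le>L. \<phi> i * (u powi e i * ev (euler_coef a b A j) u) * of_real y ^ j) = \<phi> i * u powi e i * BS u y"
      unfolding BS_def sum_distrib_left by (simp only: mult.assoc)
    moreover have "(\<Sum>j\<le>L. of_nat (j + 1) * \<beta> i / (2 * \<i>) * (u powi xh i * ev (A (j + 1)) u) * of_real y ^ j)
        = \<beta> i * u powi xh i / (2 * \<i>) * AS u y"
      unfolding AS_def sum_distrib_left by (rule sum.cong) (simp_all add: mult_ac)
    ultimately show ?thesis
      unfolding S_def left_diff_distrib distrib_right[of _ _ "of_real y ^ _"] sum_subtractf sum.distrib by simp
  qed
  have total: "(\<Sum>i\<le>L. \<Sum>j\<le>L. S i j u * t ^ i * of_real (Im t) ^ j)
      = fu u t * Vz u t + HH u t / (2 * \<i>) * of_real (- 2 * Im (Vt u t)) - GG u t / (2 * \<i>)"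
    if u: "cmod u = 1" for u t
  proof -
    have u0: "u \<noteq> 0" using u by auto
    have F: "fu u t = u * (\<Sum>i\<le>L. \<phi> i * u powi e i * t ^ i)"
    proof -
      have "fu u t = (\<Sum>i\<le>L. \<phi> i * u powi xf i * t ^ i)"
        unfolding \<phi>(3)[rule_format, OF u] by (rule sum.mono_neutral_left) (use \<phi>(2) in \<open>auto simp: L_def not_le\<close>)
      moreover have "\<phi> i * u powi xf i * t ^ i = u * (\<phi> i * u powi e i * t ^ i)" for i
      proof -
        have "u powi xf i = u * u powi e i" using power_int_add[of u 1 "e i"] u0 by (simp add: e_def)
        then show ?thesis by simp
      qed
      ultimately show ?thesis by (simp only: sum_distrib_left)
    qed
    have H: "HH u t = (\<Sum>i\<le>L. \<beta> i * u powi xh i * t ^ i)"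
      unfolding \<beta>(3)[rule_format, OF u] by (rule sum.mono_neutral_left) (use \<beta>(2) in \<open>auto simp: L_def not_le\<close>)
    have Gs: "GG u t = (\<Sum>i\<le>L. \<gamma> i * u powi xg i * t ^ i)"
      unfolding \<gamma>(3)[rule_format, OF u] by (rule sum.mono_neutral_left) (use \<gamma>(2) in \<open>auto simp: L_def not_le\<close>)
    have "(\<Sum>i\<le>L. \<Sum>j\<le>L. S i j u * t ^ i * of_real (Im t) ^ j)
        = (\<Sum>i\<le>L. t ^ i * (\<Sum>j\<le>L. S i j u * of_real (Im t) ^ j))"
      by (simp add: sum_distrib_left mult_ac)
    also have "\<dots> = (\<Sum>i\<le>L. \<phi> i * u powi e i * t ^ i * BS u (Im t)
        + \<beta> i * u powi xh i * t ^ i * (AS u (Im t) / (2 * \<i>)) - \<gamma> i * u powi xg i * t ^ i * (1 / (2 * \<i>)))"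
      unfolding S_sum by (rule sum.cong) (simp_all add: algebra_simps)
    also have "\<dots> = (\<Sum>i\<le>L. \<phi> i * u powi e i * t ^ i) * BS u (Im t)
        + (\<Sum>i\<le>L. \<beta> i * u powi xh i * t ^ i) * (AS u (Im t) / (2 * \<i>)) - (\<Sum>i\<le>L. \<gamma> i * u powi xg i * t ^ i) * (1 / (2 * \<i>))"
      by (simp only: sum.distrib sum_subtractf sum_distrib_right)
    also have "\<dots> = fu u t * Vz u t + HH u t / (2 * \<i>) * AS u (Im t) - GG u t / (2 * \<i>)"
      unfolding F H Gs BS[OF u, symmetric] by (simp add: mult_ac)
    finally show ?thesis unfolding AS[OF u] .
  qed
  define q where "q u m = - (\<Sum>j\<le>m. real (m - j + 1) * Re (ev (A j) u) * Re (ev (A (m - j + 1)) u)) / 2" for u m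
  have prod: "- (Re (V u t) * (- 2 * Im (Vt u t))) / 2 = (\<Sum>m\<le>d + d. q u m * Im t ^ m)" if u: "cmod u = 1" for u t
  proof -
    have V: "Re (V u t) = (\<Sum>j\<le>d. Re (ev (A j) u) * Im t ^ j)"
      unfolding repr_V[OF R u] by (simp add: Re_sum flip: of_real_power)
    have "Re (V u t) * (- 2 * Im (Vt u t))
       = (\<Sum>m\<le>d + d. (\<Sum>j\<le>m. Re (ev (A j) u) * (real (m - j + 1) * Re (ev (A (m - j + 1)) u))) * Im t ^ m)"
      unfolding V repr_deriv[OF R u] by (rule polynomial_product) (use Az in auto)
    also have "\<dots> = (\<Sum>m\<le>d + d. - 2 * (q u m * Im t ^ m))"
    proof (rule sum.cong[OF refl])
      fix m
      have "(\<Sum>j\<le>m. Re (ev (A j) u) * (real (m - j + 1) * Re (ev (A (m - j + 1)) u))) = - 2 * q u m"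
        unfolding q_def by (simp only: mult_ac)
      then show "(\<Sum>j\<le>m. Re (ev (A j) u) * (real (m - j + 1) * Re (ev (A (m - j + 1)) u))) * Im t ^ m = - 2 * (q u m * Im t ^ m)"
        by (simp only: mult.assoc)
    qed
    finally show ?thesis unfolding sum_distrib_left[symmetric] by simp
  qed
  have rows: "Re (\<Sum>h\<le>J. of_nat ((i + h) choose h) * \<i> ^ h * S (i + h) (J - h) u)
        = (if i = 0 then - (\<Sum>j\<le>J. real (J - j + 1) * Re (ev (A j) u) * Re (ev (A (J - j + 1)) u)) / 2 else 0)"
    if u: "cmod u = 1" for i J u
    unfolding q_def[symmetric]
  proof (rule re_poly_coeffs[where L = L and M = "d + d"])
    fix x y :: real
    define t where "t = of_real x + \<i> * of_real y"
    have y: "y = Im t" by (simp add: t_def)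
    have "Re (\<Sum>i\<le>L. \<Sum>j\<le>L. S i j u * t ^ i * of_real (Im t) ^ j)
      = Re (fu u t * Vz u t) + Im (HH u t) * (- 2 * Im (Vt u t)) / 2 - Im (GG u t) / 2"
      unfolding total[OF u] by (simp add: Re_divide Im_divide power2_eq_square)
    also have "\<dots> = - (Re (V u t) * (- 2 * Im (Vt u t))) / 2"
      using main_identity'[OF u, of t] by simp
    also have "\<dots> = (\<Sum>m\<le>d + d. q u m * Im t ^ m)" by (rule prod[OF u])
    finally have "Re (\<Sum>i\<le>L. \<Sum>j\<le>L. S i j u * t ^ i * of_real (Im t) ^ j) = (\<Sum>m\<le>d + d. q u m * Im t ^ m)" .
    then show "Re (\<Sum>i\<le>L. \<Sum>j\<le>L. S i j u * (of_real x + \<i> * of_real y) ^ i * of_real y ^ j) = (\<Sum>m\<le>d + d. q u m * y ^ m)"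
      unfolding y[symmetric] unfolding t_def .
  next
    fix i j assume "L < i \<or> L < j"
    then show "S i j u = 0"
      using \<phi>(2) \<beta>(2) \<gamma>(2) by (auto simp: S_def L_def Az)
  next
    fix m assume m: "m > d + d"
    have "real (m - j + 1) * Re (ev (A j) u) * Re (ev (A (m - j + 1)) u) = 0" if "j \<le> m" for j
    proof -
      have "j > d \<or> m - j + 1 > d" using m that by auto
      then show ?thesis by (auto simp: Az)
    qed
    then have "(\<Sum>j\<le>m. real (m - j + 1) * Re (ev (A j) u) * Re (ev (A (m - j + 1)) u)) = 0"
      by (intro sum.neutral) auto
    then show "q u m = 0" unfolding q_def by simp
  qed
  have xfw: "a * real_of_int (e i) + b * (real i + 1) = 1 \<and> e i \<ge> -1" if "\<phi> i \<noteq> 0" for i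
    using \<phi>(1)[rule_format, OF that] by (auto simp: e_def algebra_simps)
  have xhw: "a * real_of_int (xh i) + b * real i = 1" if "\<beta> i \<noteq> 0" for i
    using \<beta>(1)[rule_format, OF that] by simp
  have xgw: "a * real_of_int (xg i) + b * (real i + 1) = 2" if "\<gamma> i \<noteq> 0" for i
    using \<gamma>(1)[rule_format, OF that] by (simp add: algebra_simps)
  have tau0: "tau z t = c * t" if "k = 0" for z t unfolding tau_def unfolding that by simp
  have Vc: "Vz z (t / c) = Pz z t - Gz z (t / c) / (2 * \<i>)" "Vt z (t / c) = c * Pt z t - g1 z t / (2 * \<i>)"
    if k0: "k = 0" for z t
  proof -
    show "Vz z (t / c) = Pz z t - Gz z (t / c) / (2 * \<i>)"
      unfolding Vz_def tau0[OF k0] unfolding k0 using c0 by simp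
    show "Vt z (t / c) = c * Pt z t - g1 z t / (2 * \<i>)"
      unfolding Vt_def tau0[OF k0] unfolding k0 using c0 by simp
  qed
  have scaled: "\<exists>x y. wpoly True a b1 w (\<lambda>z t. F z (t / c)) x y" if ex: "\<exists>x y. wpoly True a b w F x y" and k0: "k = 0" for F w
  proof -
    have s: "wpoly True a b1 b (\<lambda>z t. 1 / c * t) (\<lambda>z t. 1 / c * 0) (\<lambda>z t. 1 / c * 1)"
      using wpoly_cmul[OF wpoly_t[of True a b1], of "1 / c"] k0 by simp
    obtain x y where "wpoly True a b w F x y" using ex by blast
    from wpoly_subst[OF this wpoly_z s] show ?thesis by auto
  qed
  \<comment> \<open>Vanishing of all \<open>S i j\<close> means that the field with components
    \<phi> i z^p1, \<beta> i z^p2, \<gamma> i z^p3 is complex tangent to Im w = V. In the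
    coordinates of P its t-component is multiplied by c and the derivative of G along it is added to
    the w-component.\<close>
  have ND1: "\<phi> i = 0 \<and> \<beta> i = 0 \<and> \<gamma> i = 0"
    if k0: "k = 0" and S0: "\<And>j u. cmod u = 1 \<Longrightarrow> S i j u = 0" for i
  proof -
    define p1 p2 p3 where "p1 = nat (xf i)" and "p2 = nat (xh i)" and "p3 = nat (xg i)"
    define w where "w = 1 - b - b * real i"
    have w1: "\<phi> i \<noteq> 0 \<Longrightarrow> a * real p1 = w + a" using \<phi>(1)[rule_format, of i] by (auto simp: p1_def w_def)
    have w2: "\<beta> i \<noteq> 0 \<Longrightarrow> a * real p2 = w + b" using \<beta>(1)[rule_format, of i] k0 by (auto simp: p2_def w_def)
    have w3: "\<gamma> i \<noteq> 0 \<Longrightarrow> a * real p3 = w + 1" using \<gamma>(1)[rule_format, of i] k0 by (auto simp: p3_def w_def)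
    obtain Vzx Vzy Vtx Vty where dV: "wpoly False a b (1 - a) Vz Vzx Vzy" "wpoly False a b (1 - b) Vt Vtx Vty"
      using wpoly_dz[OF wV] wpoly_dt[OF wV] by blast
    define \<Phi> where "\<Phi> z t = \<phi> i * z ^ p1 * Vz z t + \<beta> i * z ^ p2 * Vt z t - 1 / (2 * \<i>) * (\<gamma> i * z ^ p3)" for z t
    have "\<exists>x y. wpoly False a b (w + 1) \<Phi> x y"
    proof -
      have "\<exists>x y. wpoly False a b ((w + a) + (1 - a)) (\<lambda>z t. \<phi> i * z ^ p1 * Vz z t) x y"
        by (rule wpoly_mult_ex[OF wpoly_holomorphic_monomial]) (use w1 dV in auto)
      moreover have "\<exists>x y. wpoly False a b ((w + b) + (1 - b)) (\<lambda>z t. \<beta> i * z ^ p2 * Vt z t) x y"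
        by (rule wpoly_mult_ex[OF wpoly_holomorphic_monomial]) (use w2 dV in auto)
      moreover have "\<exists>x y. wpoly False a b (w + 1) (\<lambda>z t. 1 / (2 * \<i>) * (\<gamma> i * z ^ p3)) x y"
        by (rule wpoly_cmul_ex[OF wpoly_holomorphic_monomial]) (use w3 in auto)
      ultimately show ?thesis unfolding \<Phi>_def by (intro wpoly_diff_ex wpoly_add_ex) simp_all
    qed
    then obtain \<Phi>x \<Phi>y where w\<Phi>: "wpoly False a b (w + 1) \<Phi> \<Phi>x \<Phi>y" by blast
    have \<Phi>0: "\<Phi> z t = 0" for z t
    proof (rule wpoly_zero_circle[OF w\<Phi> a(1)])
      fix u t :: complex assume u: "cmod u = 1"
      then have u0: "u \<noteq> 0" by auto
      have 1: "\<phi> i * u ^ p1 * Vz u t = \<phi> i * u powi e i * BS u (Im t)"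
      proof (cases "\<phi> i = 0")
        case False
        then have "xf i = int p1" using \<phi>(1)[rule_format, of i] by (simp add: p1_def)
        then have "u powi e i = u ^ p1 / u" using power_int_diff[of u "int p1" 1] u0 by (simp add: e_def)
        then show ?thesis unfolding BS[OF u, symmetric] using u0 by simp
      qed simp
      have 2: "\<beta> i * u ^ p2 * Vt u t = \<beta> i * u powi xh i / (2 * \<i>) * AS u (Im t)"
      proof (cases "\<beta> i = 0")
        case False
        then have "u powi xh i = u ^ p2" using \<beta>(1)[rule_format, of i] k0 by (simp add: p2_def power_int_def)
        moreover have "Vt u t = of_real (- 2 * Im (Vt u t)) / (2 * \<i>)"
          using Re_Vt[of u t] by (simp add: complex_eq_iff Re_divide Im_divide power2_eq_square)
        ultimately show ?thesis unfolding AS[OF u, symmetric] by simp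
      qed simp
      have 3: "\<gamma> i * u ^ p3 = \<gamma> i * u powi xg i"
        using \<gamma>(1)[rule_format, of i] k0 by (cases "\<gamma> i = 0") (simp_all add: p3_def power_int_def)
      have "\<Phi> u t = (\<Sum>j\<le>L. S i j u * of_real (Im t) ^ j)"
        unfolding \<Phi>_def 1 2 3 S_sum by simp
      then show "\<Phi> u t = 0" using S0[OF u] by simp
    qed
    define F0 H0 where "F0 = (\<lambda>z t::complex. \<phi> i * z ^ p1)" and "H0 = (\<lambda>z t::complex. c * (\<beta> i * z ^ p2))"
    define G0 where "G0 = (\<lambda>z t. \<gamma> i * z ^ p3 + F0 z t * Gz z (t / c) + \<beta> i * z ^ p2 * g1 z t)"
    have wF: "\<exists>x y. wpoly True a b1 (w + a) F0 x y" unfolding F0_def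
      by (rule wpoly_holomorphic_monomial) (use w1 in auto)
    have wH: "\<exists>x y. wpoly True a b1 (w + b1) H0 x y" unfolding H0_def
      by (rule wpoly_cmul_ex, rule wpoly_holomorphic_monomial) (use w2 k0 in auto)
    have wG0: "\<exists>x y. wpoly True a b1 (w + 1) G0 x y"
    proof -
      have 1: "\<exists>x y. wpoly True a b1 (w + 1) (\<lambda>z t. \<gamma> i * z ^ p3) x y"
        by (rule wpoly_holomorphic_monomial) (use w3 in auto)
      have "\<exists>x y. wpoly True a b (1 - a) Gz x y" using wpoly_dz[OF wG] by blast
      from wpoly_mult_ex[OF wF scaled[OF this k0]]
      have 2: "\<exists>x y. wpoly True a b1 (w + 1) (\<lambda>z t. F0 z t * Gz z (t / c)) x y" by simp
      have "\<exists>x y. wpoly True a b1 (w + b1) (\<lambda>z t. \<beta> i * z ^ p2) x y"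
        by (rule wpoly_holomorphic_monomial) (use w2 k0 in auto)
      from wpoly_mult_ex[OF this, of "1 - b" g1] wg1
      have 3: "\<exists>x y. wpoly True a b1 (w + 1) (\<lambda>z t. \<beta> i * z ^ p2 * g1 z t) x y"
        using k0 by (auto simp: algebra_simps)
      show ?thesis unfolding G0_def by (intro wpoly_add_ex 1 2 3)
    qed
    obtain x1 y1 x2 y2 x3 y3 where W: "wpoly True a b1 (w + a) F0 x1 y1" "wpoly True a b1 (w + b1) H0 x2 y2"
      "wpoly True a b1 (w + 1) G0 x3 y3" using wF wH wG0 by blast
    have "\<forall>z t. F0 z t * Pz z t + H0 z t * Pt z t = G0 z t / (2 * \<i>)"
    proof (intro allI)
      fix z t
      have alg: "x * p + c * y * q = (n + x * g + y * k) * r"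
        if "x * (p - g * r) + y * (c * q - k * r) - r * n = 0" for x y p q g k r n :: complex
        using that by (simp add: algebra_simps)
      have "\<Phi> z (t / c) = 0" by (rule \<Phi>0)
      then show "F0 z t * Pz z t + H0 z t * Pt z t = G0 z t / (2 * \<i>)"
        unfolding \<Phi>_def F0_def H0_def G0_def Vc[OF k0] unfolding divide_inverse mult_1_left by (rule alg)
    qed
    then have "F0 1 1 = 0 \<and> H0 1 1 = 0"
      using nd[unfolded nondegenerate_model_def, rule_format, OF W] by blast
    then have p: "\<phi> i = 0" "\<beta> i = 0" using c0 by (simp_all add: F0_def H0_def)
    moreover have "\<gamma> i = 0" using S0[of 1 0] p by (simp add: S_def)
    ultimately show ?thesis by simp
  qed
  \<comment> \<open>If z V_z were zero on the circle, V_z would vanish identically and \<partial>_z,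
    corrected by a w-component from \<open>Gz\<close>, would be tangent.\<close>
  have ND2: "\<exists>j i. euler_coef a b A j i \<noteq> 0" if k0: "k = 0"
  proof (rule ccontr)
    assume "\<not> ?thesis"
    then have "ev (euler_coef a b A j) u = 0" for j u by (simp add: ev_def)
    then have z: "u * Vz u t = 0" if "cmod u = 1" for u t using BS[OF that, of t] by (simp add: BS_def)
    obtain x y where dV: "wpoly False a b (1 - a) Vz x y" using wpoly_dz[OF wV] by blast
    have Vz0: "Vz z t = 0" for z t
    proof (rule wpoly_zero_circle[OF dV a(1)])
      fix u t :: complex assume u: "cmod u = 1"
      then have "u \<noteq> 0" by auto
      then show "Vz u t = 0" using z[OF u, of t] by simp
    qed
    have "\<exists>x y. wpoly True a b (1 - a) Gz x y" using wpoly_dz[OF wG] by blast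
    from scaled[OF this k0] obtain x y where g: "wpoly True a b1 (1 - a) (\<lambda>z t. Gz z (t / c)) x y" by blast
    have W: "wpoly True a b1 (- a + a) (\<lambda>z t. 1) (\<lambda>z t. 0) (\<lambda>z t. 0)"
      "wpoly True a b1 (- a + b1) (\<lambda>z t. 0) (\<lambda>z t. 0) (\<lambda>z t. 0)"
      "wpoly True a b1 (- a + 1) (\<lambda>z t. Gz z (t / c)) x y"
      using wpoly_const[of True a b1 1] wpoly_zero[of True a b1] g by simp_all
    have "\<forall>z t. 1 * Pz z t + 0 * Pt z t = Gz z (t / c) / (2 * \<i>)"
      proof (intro allI)
      fix z t
      show "1 * Pz z t + 0 * Pt z t = Gz z (t / c) / (2 * \<i>)" using Vz0[of z "t / c"] unfolding Vc[OF k0] by (simp add: eq_neg_iff_add_eq_0)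
    qed
    then have "(1::complex) = 0" using nd[unfolded nondegenerate_model_def, rule_format, OF W] by simp
    then show False by simp
  qed
  interpret C: circle_data a b A \<phi> \<beta> \<gamma> e xh xg d "k = 0" S
  proof
    show "0 < a" "a \<le> 1/2" by (rule a)+
    show "0 < b" using bpos .
    have "real k * a \<ge> 0" using a(1) by simp
    then show b2: "b \<le> 1/2" using b1 by linarith
    show "\<not> (a = 1/2 \<and> b = 1/2)"
    proof
      assume h: "a = 1/2 \<and> b = 1/2"
      then have "real k * a \<le> 0" using b1 by linarith
      then have "k = 0" using a(1) by (simp add: mult_le_0_iff)
      then show False using nq h by simp
    qed
    show "\<bar>real_of_int i\<bar> \<le> ndeg a b j" if "A j i \<noteq> 0" for j i by (rule repr_supp[OF R that])
    show "ev (A j) u \<in> \<real>" if "cmod u = 1" for j u by (rule repr_real[OF R that])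
    show "\<exists>L. \<forall>i\<ge>L. \<phi> i = 0 \<and> \<beta> i = 0 \<and> \<gamma> i = 0"
      using \<phi>(2) \<beta>(2) \<gamma>(2) by (intro exI[of _ "Suc L"]) (auto simp: L_def)
    show "d \<ge> 1" by (rule d1)
    show "\<exists>i. A d i \<noteq> 0" by (rule reprD(3)[OF R])
    show "A j i = 0" if "j > d" for j i by (rule reprD(2)[OF R that])
    show "\<bar>real_of_int i\<bar> < ndeg a b j" if "k \<noteq> 0" "j \<ge> 1" "A j i \<noteq> 0" for j i
      using repr_singular[OF R _ that(2,3)] that(1) by simp
  qed (fact xfw xhw xgw rows ND1 ND2 N1[rule_format] N2[rule_format] S_def)+
  show ?thesis using C.classification unfolding C.square_form_def C.linear_form_def conj_disj_distribL .
qed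

end

section \<open>Normal forms\<close>

text \<open>The shear q is allowed to be any entire function fixing 0, so that shears compose. G
  collects the pluriharmonic terms that a change of w will absorb.\<close>

definition normal_form :: "real \<Rightarrow> real \<Rightarrow> (complex \<Rightarrow> complex \<Rightarrow> complex) \<Rightarrow> bool" where
  "normal_form a b P \<longleftrightarrow> (\<exists>c q G Gz Gt. c \<noteq> 0 \<and> q holomorphic_on UNIV \<and> q 0 = 0 \<and> wpoly True a b 1 G Gz Gt \<and>
     ((\<exists>A2 A0 l. A2 \<noteq> 0 \<and> A0 \<noteq> 0 \<and> l \<ge> 1 \<and>
         (\<forall>z t. Re (P z (c * t + q z)) = Im (G z t) + A2 * (Im t)\<^sup>2 + A0 * cmod z ^ (2 * l))) \<or>
      (\<exists>e m. e \<noteq> 0 \<and> m \<ge> 1 \<and> (\<forall>z t. Re (P z (c * t + q z)) = Im (G z t) + Im t * Re (e * z ^ m)))))"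

lemma wpoly_power_ex:
  assumes "\<exists>x y. wpoly h a b w F x y"
  shows "\<exists>x y. wpoly h a b (real n * w) (\<lambda>z t. F z t ^ n) x y"
  using assms wpoly_power by blast

lemma wpoly_Im_ex:
  assumes "\<exists>x y. wpoly True a b w F x y"
  shows "\<exists>x y. wpoly False a b w (\<lambda>z t. of_real (Im (F z t))) x y"
proof -
  obtain x y where F: "wpoly True a b w F x y" using assms by blast
  have I: "complex_of_real (Im x) = (1 / (2 * \<i>)) * (x - cnj x)" for x by (simp add: complex_eq_iff)
  show ?thesis unfolding I using wpoly_cmul[OF wpoly_diff[OF wpoly_weaken[OF F] wpoly_cnj_hol[OF F]], of "1 / (2 * \<i>)"] by blast
qed

lemma wpoly_Re_ex:
  assumes "\<exists>x y. wpoly True a b w F x y"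
  shows "\<exists>x y. wpoly False a b w (\<lambda>z t. of_real (Re (F z t))) x y"
proof -
  have R: "Re x = Im (\<i> * x)" for x by simp
  show ?thesis unfolding R by (rule wpoly_Im_ex[OF wpoly_cmul_ex[OF assms]])
qed

lemma (in sym_model) symmetry_sym_model:
  "symmetry a b1 (1 - (b1 - real k * a)) P Pz Pt f (\<lambda>z t. 0) h (\<lambda>z t. c * z ^ k) g0 g1"
  unfolding symmetry_def
proof (intro conjI allI)
  show "\<exists>x y. wpoly True a b1 (1 - (b1 - real k * a) + a) f x y" using wf by (auto simp: algebra_simps)
  show "\<exists>x y. wpoly True a b1 (1 - (b1 - real k * a) + b1) h x y" using wh by (auto simp: algebra_simps)
  show "\<exists>x y. wpoly True a b1 (1 - (b1 - real k * a) + 1) g0 x y" using wg0 by (auto simp: algebra_simps)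
  show "\<exists>x y. wpoly True a b1 (1 - (b1 - real k * a)) g1 x y" using wg1 by blast
  show "\<exists>x y. wpoly True a b1 (1 - (b1 - real k * a) + a - 1) (\<lambda>z t. 0) x y" using wpoly_zero by blast
  show "\<exists>x y. wpoly True a b1 (1 - (b1 - real k * a) + b1 - 1) (\<lambda>z t. c * z ^ k) x y"
    by (rule wpoly_holomorphic_monomial) simp
qed (simp_all add: id1 id2)

lemma sym_modelI:
  assumes "symmetry a b1 (1 - (b1 - real k * a)) P Pz Pt f (\<lambda>z t. 0) h (\<lambda>z t. c * z ^ k) g0 g1"
    and "0 < a" "a \<le> 1/2" "b1 \<le> 1/2" "b1 - real k * a > 0" "c \<noteq> 0" "\<not> (k = 0 \<and> a = 1/2 \<and> b1 = 1/2)"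
    and "wpoly False a b1 1 P Pz Pt" "\<And>z t. P z t \<in> \<real>" "nondegenerate_model a b1 Pz Pt"
  shows "\<exists>fz ft hz ht g0z g0t g1z g1t. sym_model a b1 k c P Pz Pt f fz ft h hz ht g0 g0z g0t g1 g1z g1t"
proof -
  obtain fz ft hz ht g0z g0t g1z g1t where
    1: "wpoly True a b1 (1 - (b1 - real k * a) + a) f fz ft" "wpoly True a b1 (1 - (b1 - real k * a) + b1) h hz ht"
      "wpoly True a b1 (1 - (b1 - real k * a) + 1) g0 g0z g0t" "wpoly True a b1 (1 - (b1 - real k * a)) g1 g1z g1t"
    using assms(1) unfolding symmetry_def by (elim conjE exE) blast
  have 2: "Im (g1 z t) = 2 * Re (c * z ^ k * Pt z t)"
    "Im (g0 z t) + Re (P z t) * Re (g1 z t)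
        = 2 * Re (f z t * Pz z t + h z t * Pt z t) - 2 * Re (P z t) * Im (c * z ^ k * Pt z t)" for z t
    using assms(1) unfolding symmetry_def by simp_all
  have "sym_model a b1 k c P Pz Pt f fz ft h hz ht g0 g0z g0t g1 g1z g1t"
  proof
    show "wpoly True a b1 (a + 1 - (b1 - real k * a)) f fz ft" using 1(1) by (simp add: algebra_simps)
    show "wpoly True a b1 (b1 + 1 - (b1 - real k * a)) h hz ht" using 1(2) by (simp add: algebra_simps)
    show "wpoly True a b1 (2 - (b1 - real k * a)) g0 g0z g0t" using 1(3) by (simp add: algebra_simps)
  qed (fact 1 2 assms)+
  then show ?thesis by blast
qed

section \<open>Reconstruction of P and the two normalizations\<close>

context sym_model_int begin

lemma repr_unique:
  assumes R: "repr A d"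
    and F: "\<And>u y. cmod u = 1 \<Longrightarrow> V u (\<i> * of_real y) = (\<Sum>j\<le>n. F j u * of_real y ^ j)"
  shows "j \<le> n \<Longrightarrow> trig_poly (F j) \<Longrightarrow> A j i = coef (F j) i" and "j > n \<Longrightarrow> A j i = 0"
proof -
  have e: "ev (A j) u = (if j \<le> n then F j u else 0)" if u: "cmod u = 1" for u j
  proof (cases "j \<le> max n d")
    case True
    show ?thesis
    proof (rule real_polyfun_unique[OF _ True])
      fix y :: real
      have "(\<Sum>j\<le>max n d. ev (A j) u * of_real y ^ j) = (\<Sum>j\<le>d. ev (A j) u * of_real y ^ j)"
        by (rule sum.mono_neutral_right) (use reprD(2)[OF R] in \<open>auto simp: ev_def not_le\<close>)
      also have "\<dots> = (\<Sum>j\<le>n. F j u * of_real y ^ j)" using reprD(4)[OF R u, of y] F[OF u, of y] by simp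
      also have "\<dots> = (\<Sum>j\<le>n. (if j \<le> n then F j u else 0) * of_real y ^ j)" by (rule sum.cong) auto
      also have "\<dots> = (\<Sum>j\<le>max n d. (if j \<le> n then F j u else 0) * of_real y ^ j)"
        by (rule sum.mono_neutral_left) auto
      finally show "(\<Sum>j\<le>max n d. ev (A j) u * of_real y ^ j) = (\<Sum>j\<le>max n d. (if j \<le> n then F j u else 0) * of_real y ^ j)" .
    qed
  next
    case False
    then show ?thesis using reprD(2)[OF R, of j] by (simp add: ev_def)
  qed
  show "A j i = coef (F j) i" if "j \<le> n"
  proof -
    have "coef (ev (A j)) = coef (F j)" by (rule coef_cong) (use e that in simp)
    then show ?thesis using coef_ev[OF repr_fin[OF R]] by simp
  qed
  show "A j i = 0" if "j > n"
    by (rule ev_eq_0[OF repr_fin[OF R]]) (use e that in simp)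
qed

lemma normal_form1:
  assumes R: "repr A 2" and k0: "k = 0" and b2: "b = 1/2" and A1: "\<And>i. A 1 i = 0" and A2: "A 2 0 \<noteq> 0" "\<And>i. i \<noteq> 0 \<Longrightarrow> A 2 i = 0"
    and A0: "A 0 0 \<noteq> 0" "\<And>i. i \<noteq> 0 \<Longrightarrow> A 0 i = 0"
  shows "normal_form a b1 P"
proof -
  have bb: "b1 - real k * a = b1" using k0 by simp
  have tau0: "tau z t = c * t" for z t unfolding tau_def unfolding k0 by simp
  \<comment> \<open>The frequency 0 forces equal powers of z and cnj z, hence 2 a l = 1.\<close>
  obtain l q where "a * real (l + q) + b * real 0 = 1" "0 = int l - int q" using reprD(1)[OF R A0(1)] by blast
  then have l: "real l * (a + a) = 1" by (simp add: algebra_simps)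
  then have l1: "l \<ge> 1" by (cases l) auto
  have E: "ev (A j) u = A j 0" if "\<And>i. i \<noteq> 0 \<Longrightarrow> A j i = 0" for j u
    by (subst ev_superset[of "{0}"]) (use that in auto)
  have E1: "ev (A 1) u = 0" for u unfolding ev_def A1 by simp
  define \<alpha>2 \<alpha>0 where "\<alpha>2 = Re (A 2 0)" and "\<alpha>0 = Re (A 0 0)"
  have "A 2 0 \<in> \<real>" "A 0 0 \<in> \<real>" using repr_real[OF R, of 1 2] repr_real[OF R, of 1 0] E[OF A2(2), of 1] E[OF A0(2), of 1] by simp_all
  then have al: "A 2 0 = of_real \<alpha>2" "A 0 0 = of_real \<alpha>0" by (simp_all add: \<alpha>2_def \<alpha>0_def)
  define F :: "complex \<Rightarrow> complex \<Rightarrow> complex"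
    where "F z t = of_real \<alpha>2 * of_real (Im t) ^ 2 + of_real \<alpha>0 * (z * cnj z) ^ l" for z t
  have "\<exists>x y. wpoly False a b 1 F x y"
  proof -
    have "\<exists>x y. wpoly False a b (real 2 * b) (\<lambda>z t. of_real \<alpha>2 * of_real (Im t) ^ 2) x y"
      by (intro wpoly_cmul_ex wpoly_power_ex wpoly_Im_ex) (use wpoly_t in blast)
    moreover have "\<exists>x y. wpoly False a b (real l * (a + a)) (\<lambda>z t. of_real \<alpha>0 * (z * cnj z) ^ l) x y"
      by (intro wpoly_cmul_ex wpoly_power_ex wpoly_mult_ex) (use wpoly_z wpoly_cnj_hol[OF wpoly_z] in blast)+
    moreover have r2: "real 2 * b = 1" using b2 by simp
    ultimately have 1: "\<exists>x y. wpoly False a b 1 (\<lambda>z t. of_real \<alpha>2 * of_real (Im t) ^ 2) x y"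
      and 2: "\<exists>x y. wpoly False a b 1 (\<lambda>z t. of_real \<alpha>0 * (z * cnj z) ^ l) x y"
      by (simp_all only: l r2)
    from wpoly_add_ex[OF 1 2] show ?thesis unfolding F_def .
  qed
  then obtain x y where wF: "wpoly False a b 1 F x y" by blast
  have D: "V z t - F z t = 0" for z t
  proof (rule wpoly_zero_circle[OF wpoly_diff[OF wV wF] a(1)])
    fix u t :: complex assume u: "cmod u = 1"
    then have "u * cnj u = 1" by (simp add: complex_norm_square[symmetric])
    moreover have "V u t = A 0 0 + A 2 0 * of_real (Im t) ^ 2"
      unfolding repr_V[OF R u] using E1 E[OF A2(2)] E[OF A0(2)] by (simp add: numeral_2_eq_2 eval_nat_numeral)
    ultimately show "V u t - F u t = 0" by (simp add: F_def al)
  qed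
  have "Re (P z (c * t + 0)) = Im (G z t) + \<alpha>2 * (Im t)\<^sup>2 + \<alpha>0 * cmod z ^ (2 * l)" for z t
  proof -
    have "z * cnj z = of_real ((cmod z)\<^sup>2)" by (rule complex_norm_square[symmetric])
    then have "F z t = of_real (\<alpha>2 * (Im t)\<^sup>2 + \<alpha>0 * cmod z ^ (2 * l))" by (simp add: F_def power_mult)
    moreover have "P z (c * t) = V z t + of_real (Im (G z t))" by (simp add: V_def tau0)
    ultimately show ?thesis using D[of z t] by simp
  qed
  moreover have "\<alpha>2 \<noteq> 0" "\<alpha>0 \<noteq> 0" using A2(1) A0(1) al by auto
  ultimately show ?thesis unfolding normal_form_def using wG[unfolded bb] c0 l1
    by (intro exI[of _ c] exI[of _ "\<lambda>z. 0"] exI[of _ G] exI[of _ Gz] exI[of _ "\<lambda>z t. g1 z (tau z t)"] conjI disjI1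
        exI[of _ \<alpha>2] exI[of _ \<alpha>0] exI[of _ l]) auto
qed

text \<open>The term left in A 0 is a multiple of z^p cnj z^n with a p = b. By Im x Re (2 y) = Im (x
  y) + Im (x cnj y), with x = h z^p and y = e z^n, it is what the shear t -> t + h z^p adds to Im t
  Re (2 e z^n), up to a pluriharmonic term.\<close>

lemma normal_form2:
  assumes R: "repr A 1" and k0: "k = 0" and m: "m > 0" "real_of_int m = ndeg a b 1" "A 1 m \<noteq> 0" 
    and A1: "\<And>i. A 1 i \<noteq> 0 \<Longrightarrow> i = m \<or> i = - m"
    and A0: "\<And>i. A 0 i \<noteq> 0 \<Longrightarrow> real_of_int i = ndeg a b 0 - 2 * real_of_int m \<or> real_of_int i = - (ndeg a b 0 - 2 * real_of_int m)"
  shows "normal_form a b1 P"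
proof -
  have bb: "b1 - real k * a = b1" using k0 by simp
  have tau0: "tau z t = c * t" for z t unfolding tau_def unfolding k0 by simp
  have herm: "A j (- i) = cnj (A j i)" for j i
    using coef_real[of "ev (A j)" i] repr_real[OF R, of _ j] coef_ev[OF repr_fin[OF R], of j] by (simp add: tp_intros)
  define n e where "n = nat m" and "e = A 1 m"
  have nm: "m = int n" "n \<ge> 1" using m by (simp_all add: n_def)
  have an: "a * real n = 1 - b" using m(2) a(1) by (simp add: nm ndeg_def field_simps)
  have two: "ev (\<lambda>i. B i) u = 2 * of_real (Re (B s * u powi s))"
    if "cmod u = 1" "s \<noteq> 0" "\<And>i. B i \<noteq> 0 \<Longrightarrow> i = s \<or> i = - s" "B (- s) = cnj (B s)" for B u s
  proof -
    have "ev B u = (\<Sum>i\<in>{s, - s}. B i * u powi i)" by (rule ev_superset) (use that in auto)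
    also have "\<dots> = B s * u powi s + cnj (B s * u powi s)"
    proof -
      have "cnj u = inverse u" using that(1)
        by (metis complex_norm_square inverse_unique mult.commute of_real_1 power_one)
      moreover have "cnj (u powi s) = cnj u powi s" by (simp add: power_int_def)
      ultimately have "cnj (u powi s) = u powi (- s)" by (simp add: power_int_minus power_int_inverse)
      then show ?thesis using that(2,4) by simp
    qed
    also have "\<dots> = of_real (2 * Re (B s * u powi s))" by (rule complex_add_cnj)
    finally show ?thesis by simp
  qed
  have E1: "ev (A 1) u = 2 * of_real (Re (e * u ^ n))" if u: "cmod u = 1" for u
    using two[of u m "A 1", OF u] m A1 herm[of 1 m] by (simp add: e_def nm)
  obtain h p where hp: "h \<noteq> 0 \<Longrightarrow> b = real p * a"
    "\<And>u. cmod u = 1 \<Longrightarrow> ev (A 0) u = of_real (Im (h * cnj e * (u ^ p * cnj u ^ n)))"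
  proof (cases "\<exists>i. A 0 i \<noteq> 0")
    case False
    then show ?thesis using that[of 0 0] by (simp add: ev_def)
  next
    case True
    then obtain s where s: "A 0 s \<noteq> 0" "real_of_int s = ndeg a b 0 - 2 * real_of_int m"
    proof -
      obtain i where i: "A 0 i \<noteq> 0" using True by blast
      then have "A 0 (- i) \<noteq> 0" by (simp add: herm)
      then show ?thesis using i A0[OF i] that[of i] that[of "- i"] by auto
    qed
    obtain p q where pq: "a * real (p + q) + b * real 0 = 1" "s = int p - int q" using reprD(1)[OF R s(1)] by blast
    have "ndeg a b 0 = real (p + q)" using pq(1) a(1) by (simp add: ndeg_def field_simps)
    then have qn: "q = n" using s(2) unfolding pq(2) nm(1) by simp
    have bp: "b = real p * a" using pq(1) an unfolding qn by (simp add: algebra_simps)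
    have us: "u powi s = u ^ p * cnj u ^ n" if "cmod u = 1" for u
    proof -
      have u: "u \<noteq> 0" using that by auto
      have "cnj u = inverse u" using that
        by (metis complex_norm_square inverse_unique mult.commute of_real_1 power_one)
      then show ?thesis using u by (simp add: pq(2) qn power_int_diff divide_inverse power_inverse)
    qed
    have su: "i = s \<or> i = - s" if "A 0 i \<noteq> 0" for i using A0[OF that] s(2) by linarith
    \<comment> \<open>The frequency 0 is its own mirror image and would be counted twice in 2
      Re.\<close>
    define e' where "e' = (if s = 0 then A 0 0 / 2 else A 0 s)"
    have "ev (A 0) u = 2 * of_real (Re (e' * u powi s))" if u: "cmod u = 1" for u
    proof (cases "s = 0")
      case True
      have "A 0 0 = of_real (Re (A 0 0))" using herm[of 0 0] by (simp add: complex_eq_iff)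
      moreover have "ev (A 0) u = A 0 0" by (subst ev_superset[of "{0}"]) (use su True in auto)
      ultimately show ?thesis using True by (simp add: e'_def)
    next
      case False
      then show ?thesis using two[of u s "A 0", OF u False su herm] by (simp add: e'_def)
    qed
    moreover have e0: "cnj e \<noteq> 0" using m(3) by (simp add: e_def)
    ultimately show ?thesis using that[of "2 * \<i> * e' / cnj e" p] bp us by (simp add: mult.assoc)
  qed
  define q where "q z = c * (- h * z ^ p)" for z
  define F :: "complex \<Rightarrow> complex \<Rightarrow> complex"
    where "F z t = of_real (Im (t + h * z ^ p)) * of_real (Re (2 * e * z ^ n)) - of_real (Im (h * e * z ^ (p + n)))" for z t
  have mono: "\<exists>X Y. wpoly True a b b (\<lambda>z t. x * z ^ p) X Y" if "h = 0 \<Longrightarrow> x = 0" for x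
    by (rule wpoly_holomorphic_monomial) (metis hp(1) that mult.commute)
  have mono2: "\<exists>x y. wpoly True a b 1 (\<lambda>z t. h * e * z ^ (p + n)) x y"
    by (rule wpoly_holomorphic_monomial) (use hp(1) an in \<open>auto simp: algebra_simps\<close>)
  have "\<exists>x y. wpoly False a b 1 F x y"
  proof -
    have 1: "\<exists>x y. wpoly True a b b (\<lambda>z t. t + h * z ^ p) x y"
      using wpoly_t[of True a b] by (intro wpoly_add_ex mono) blast+
    have 2: "\<exists>x y. wpoly True a b (1 - b) (\<lambda>z t. 2 * e * z ^ n) x y"
      by (rule wpoly_holomorphic_monomial) (use an in auto)
    have "\<exists>x y. wpoly False a b (b + (1 - b)) (\<lambda>z t. of_real (Im (t + h * z ^ p)) * of_real (Re (2 * e * z ^ n))) x y"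
      by (intro wpoly_mult_ex wpoly_Im_ex wpoly_Re_ex 1 2)
    then have 3: "\<exists>x y. wpoly False a b 1 (\<lambda>z t. of_real (Im (t + h * z ^ p)) * of_real (Re (2 * e * z ^ n))) x y"
      by simp
    show ?thesis unfolding F_def by (intro wpoly_diff_ex 3 wpoly_Im_ex mono2)
  qed
  then obtain x y where wF: "wpoly False a b 1 F x y" by blast
  have D: "V z t - F z t = 0" for z t
  proof (rule wpoly_zero_circle[OF wpoly_diff[OF wV wF] a(1)])
    fix u t :: complex assume u: "cmod u = 1"
    have V: "V u t = ev (A 0) u + ev (A 1) u * of_real (Im t)"
      unfolding repr_V[OF R u] by simp
    have "Im (h * u ^ p) * Re (2 * e * u ^ n) = Im (h * e * u ^ (p + n)) + Im (h * cnj e * (u ^ p * cnj u ^ n))"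
    proof -
      have id: "Im x * Re (2 * y) = Im (x * y) + Im (x * cnj y)" for x y by (simp add: algebra_simps)
      show ?thesis using id[of "h * u ^ p" "e * u ^ n"] by (simp add: mult_ac power_add)
    qed
    moreover have Re2: "Re (2 * e * u ^ n) = 2 * Re (e * u ^ n)" by (simp add: mult.assoc)
    ultimately have "F u t = of_real (Im (h * cnj e * (u ^ p * cnj u ^ n)) + Im t * Re (2 * e * u ^ n))"
      unfolding F_def of_real_mult[symmetric] of_real_diff[symmetric] plus_complex.sel distrib_right by simp
    also have "\<dots> = V u t" unfolding V E1[OF u] hp(2)[OF u] Re2 by simp
    finally show "V u t - F u t = 0" by simp
  qed
  define G' where "G' z t = G z (t + (- h) * z ^ p) - h * e * z ^ (p + n)" for z t
  have "\<exists>x y. wpoly True a b 1 (\<lambda>z t. G z (t + (- h) * z ^ p)) x y"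
  proof (cases "h = 0")
    case True
    then show ?thesis using wG by auto
  next
    case False
    from wpoly_shift[OF wG hp(1)[OF False]] show ?thesis by blast
  qed
  from wpoly_diff_ex[OF this mono2] obtain x y where wG': "wpoly True a b1 1 G' x y"
    unfolding G'_def[symmetric] bb by blast
  have "Re (P z (c * t + q z)) = Im (G' z t) + Im t * Re (2 * e * z ^ n)" for z t
  proof -
    define s where "s = t + (- h) * z ^ p"
    have "P z (c * t + q z) = P z (c * s)" by (simp add: s_def q_def algebra_simps)
    also have "\<dots> = V z s + of_real (Im (G z s))" by (simp add: V_def tau0)
    also have "V z s = F z s" using D[of z s] by simp
    also have "F z s = of_real (Im t) * of_real (Re (2 * e * z ^ n)) - of_real (Im (h * e * z ^ (p + n)))"
      by (simp add: F_def s_def)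
    finally show ?thesis unfolding G'_def s_def by simp
  qed
  moreover have "q 0 = 0"
  proof (cases "h = 0")
    case False
    then have "p \<noteq> 0" using hp(1) bpos by (intro notI) simp
    then show ?thesis by (simp add: q_def)
  qed (simp add: q_def)
  moreover have "q holomorphic_on UNIV" unfolding q_def by (intro holomorphic_intros)
  moreover have "2 * e \<noteq> 0" using m(3) by (simp add: e_def)
  ultimately show ?thesis unfolding normal_form_def using wG' c0 nm(2)
    by (intro exI[of _ c] exI[of _ q] exI[of _ G'] exI[of _ x] exI[of _ y] conjI disjI2
        exI[of _ "2 * e"] exI[of _ n]) auto
qed

lemma normal_form_of_normalized:
  assumes R: "repr A d" and d1: "d \<ge> 1"
    and N1: "\<forall>i. k = 0 \<longrightarrow> real_of_int i = ndeg a b 0 \<longrightarrow> A 0 i = 0"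
    and N2: "\<forall>i. k = 0 \<longrightarrow> ndeg a b d = 0 \<longrightarrow> d \<ge> 2 \<longrightarrow> real_of_int i = ndeg a b (d - 1) \<longrightarrow> A (d - 1) i = 0"
  shows "normal_form a b1 P"
  using classified[OF assms]
proof (elim conjE disjE exE)
  assume "k = 0" "d = 2" "b = 1/2" "\<forall>i. A 1 i = 0" "A 2 0 \<noteq> 0" "\<forall>i. i \<noteq> 0 \<longrightarrow> A 2 i = 0"
    "A 0 0 \<noteq> 0" "\<forall>i. i \<noteq> 0 \<longrightarrow> A 0 i = 0"
  then show ?thesis using R by (intro normal_form1[of A]) simp_all
next
  fix m assume "k = 0" "d = 1" "0 < m" "real_of_int m = ndeg a b 1" "A 1 m \<noteq> 0"
    "\<forall>i. A 1 i \<noteq> 0 \<longrightarrow> i = m \<or> i = - m"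
    "\<forall>i. A 0 i \<noteq> 0 \<longrightarrow> real_of_int i = ndeg a b 0 - 2 * real_of_int m \<or> real_of_int i = - (ndeg a b 0 - 2 * real_of_int m)"
  then show ?thesis using R by (intro normal_form2[of A m]) simp_all
qed

text \<open>\<open>N1\<close> is reached by adding a holomorphic monomial in z to G. This alters A 0
  only and so leaves \<open>N2\<close> intact, which concerns the index d - 1 >= 1.\<close>

lemma normal_form_of_repr:
  assumes R: "repr A d" and d1: "d \<ge> 1"
    and N2: "\<And>i. k = 0 \<Longrightarrow> ndeg a b d = 0 \<Longrightarrow> d \<ge> 2 \<Longrightarrow> real_of_int i = ndeg a b (d - 1) \<Longrightarrow> A (d - 1) i = 0"
  shows "normal_form a b1 P"
proof (cases "\<exists>i. k = 0 \<and> real_of_int i = ndeg a b 0")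
  case False
  then show ?thesis by (intro normal_form_of_normalized[OF R d1]) (use N2 in auto)
next
  case True
  then obtain i where k0: "k = 0" and i: "real_of_int i = ndeg a b 0" by blast
  \<comment> \<open>Im (\<delta> z^N) has the coefficient \<delta> / (2 \<i>) at the frequency N,
    which must cancel A 0 i.\<close>
  define N \<delta> where "N = nat i" and "\<delta> = 2 * \<i> * A 0 i"
  have "ndeg a b 0 > 0" using a(1) by (simp add: ndeg_def)
  then have iN: "i = int N" "N > 0" using i by (simp_all add: N_def)
  then have aN: "a * real N = 1" using i a(1) by (simp add: ndeg_def field_simps)
  have mono: "wpoly True a b 1 (\<lambda>z t. \<delta> * z ^ N) (\<lambda>z t. \<delta> * of_nat N * z ^ (N - 1)) (\<lambda>z t. 0)"
    by (rule wpoly_eqI[OF wpoly_mono[of a N 0 b 0 0 1 True \<delta>]]) (use aN in auto)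
  interpret M: sym_model_int a b1 k c P Pz Pt f fz ft h hz ht g0 g0z g0t g1 g1z g1t
    "\<lambda>z t. G z t + \<delta> * z ^ N" "\<lambda>z t. Gz z t + \<delta> * of_nat N * z ^ (N - 1)"
    by unfold_locales (rule wpoly_eqI[OF wpoly_add[OF wG mono]], auto)
  obtain A' d' where R': "M.repr A' d'" "d' \<ge> 1" using M.repr_exists by blast
  define F where "F j u = (if j = 0 then ev (A 0) u - of_real (Im (\<delta> * u ^ N)) else ev (A j) u)" for j u
  have tpN: "trig_poly (\<lambda>u. \<delta> * u ^ N)"
    using tp_cmul[OF tp_powi[of "int N"], of \<delta>] by simp
  have tp: "trig_poly (F j)" for j
  proof (cases "j = 0")
    case True
    show ?thesis unfolding F_def True if_P[OF refl] by (intro tp_diff tp_ev coef_of_real_Im(2)[OF tpN])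
  next
    case False
    then have "F j = ev (A j)" by (auto simp: F_def)
    then show ?thesis by (simp only: tp_ev)
  qed
  have VF: "M.V u (\<i> * of_real y) = (\<Sum>j\<le>d. F j u * of_real y ^ j)" if u: "cmod u = 1" for u y
  proof -
    have "M.V u (\<i> * of_real y) = V u (\<i> * of_real y) - of_real (Im (\<delta> * u ^ N))"
      by (simp add: M.V_def V_def)
    also have "\<dots> = (\<Sum>j\<le>d. ev (A j) u * of_real y ^ j) - (\<Sum>j\<le>d. if j = 0 then of_real (Im (\<delta> * u ^ N)) else 0)"
      unfolding reprD(4)[OF R u] by simp
    also have "\<dots> = (\<Sum>j\<le>d. F j u * of_real y ^ j)"
      unfolding sum_subtractf[symmetric] by (rule sum.cong) (auto simp: F_def)
    finally show ?thesis .
  qed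
  note U = M.repr_unique[OF R'(1) VF]
  have cj: "A' j i' = A j i'" if "j \<ge> 1" for j i'
  proof (cases "j \<le> d")
    case True
    have "coef (F j) = A j" using coef_ev[OF repr_fin[OF R], of j] that by (simp add: F_def[abs_def])
    then show ?thesis using U(1)[OF _ True tp] by simp
  next
    case False
    then show ?thesis using U(2)[of j i'] reprD(2)[OF R, of j i'] by simp
  qed
  have dd: "d' = d"
  proof (rule antisym)
    show "d' \<le> d" using M.reprD(3)[OF R'(1)] cj[OF R'(2)] reprD(2)[OF R, of d'] not_le by auto
    show "d \<le> d'" using reprD(3)[OF R] cj[OF d1] M.reprD(2)[OF R'(1), of d] not_le by auto
  qed
  have c0': "A' 0 i = 0"
  proof -
    have "coef (\<lambda>u. \<delta> * u ^ N) j = (if j = int N then \<delta> else 0)" for j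
      using coef_cmul[OF tp_powi[of "int N"], of \<delta> j] coef_powi[of "int N" j] by simp
    then have "coef (\<lambda>u. of_real (Im (\<delta> * u ^ N))) i = \<delta> / (2 * \<i>)"
      unfolding coef_of_real_Im(1)[OF tpN] using iN by simp
    then have "coef (F 0) i = A 0 i - \<delta> / (2 * \<i>)"
      using coef_diff[OF tp_ev coef_of_real_Im(2)[OF tpN], of "A 0" i] coef_ev[OF repr_fin[OF R], of 0]
      by (simp add: F_def[abs_def])
    then show ?thesis using U(1)[OF _ _ tp, of 0 i] by (simp add: \<delta>_def)
  qed
  show ?thesis
  proof (rule M.normal_form_of_normalized[OF R']; intro allI impI)
    fix j assume "real_of_int j = ndeg a b 0"
    then have "j = i" using i by linarith
    then show "A' 0 j = 0" using c0' by simp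
  next
    fix j assume *: "k = 0" "ndeg a b d' = 0" "2 \<le> d'" "real_of_int j = ndeg a b (d' - 1)"
    then show "A' (d' - 1) j = 0" using N2[of j] cj[of "d' - 1" j] unfolding dd by simp
  qed
qed

end

lemma normal_form_shift:
  assumes "normal_form a b (\<lambda>z t. P z (t + l * z ^ m))" "m > 0"
  shows "normal_form a b P"
proof -
  obtain c q G Gz Gt where 1: "c \<noteq> 0" "q holomorphic_on UNIV" "q 0 = 0" "wpoly True a b 1 G Gz Gt"
    and 2: "(\<exists>A2 A0 k. A2 \<noteq> 0 \<and> A0 \<noteq> 0 \<and> k \<ge> 1 \<and>
         (\<forall>z t. Re (P z ((c * t + q z) + l * z ^ m)) = Im (G z t) + A2 * (Im t)\<^sup>2 + A0 * cmod z ^ (2 * k))) \<or>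
      (\<exists>e n. e \<noteq> 0 \<and> n \<ge> 1 \<and> (\<forall>z t. Re (P z ((c * t + q z) + l * z ^ m)) = Im (G z t) + Im t * Re (e * z ^ n)))"
    using assms(1) unfolding normal_form_def by (elim exE conjE) blast
  have E: "c * t + (q z + l * z ^ m) = (c * t + q z) + l * z ^ m" for z t by simp
  note F = 2[folded E]
  have "(\<lambda>z. q z + l * z ^ m) holomorphic_on UNIV" using 1(2) by (intro holomorphic_intros)
  moreover have "q 0 + l * 0 ^ m = 0" using 1(3) assms(2) by simp
  ultimately show ?thesis
    unfolding normal_form_def using 1(1,4) F
    by (intro exI[of _ c] exI[of _ "\<lambda>z. q z + l * z ^ m"] exI[of _ G] exI[of _ Gz] exI[of _ Gt] conjI)
qed

text \<open>\<open>N2\<close> is needed only if n d = 0, when A d is constant. A shear t -> t + h'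
  z^m then adds d (A d 0) Im (h' z^m) to A (d - 1), enough to cancel its extremal frequency. The
  sheared P carries a symmetry of the same shape, so the earlier result applies to it.\<close>

lemma (in sym_model) normal_form: "normal_form a b1 P"
proof -
  obtain G Gz where G: "wpoly True a (b1 - real k * a) 1 G Gz (\<lambda>z t. g1 z (tau z t))"
    using wpoly_integral[OF w_tau[OF wg1]] by auto
  interpret M: sym_model_int a b1 k c P Pz Pt f fz ft h hz ht g0 g0z g0t g1 g1z g1t G Gz
    by unfold_locales (rule G)
  obtain A d where R: "M.repr A d" "d \<ge> 1" using M.repr_exists by blast
  show ?thesis
  proof (cases "\<exists>i. k = 0 \<and> ndeg a b d = 0 \<and> d \<ge> 2 \<and> real_of_int i = ndeg a b (d - 1)")
    case False
    then show ?thesis by (intro M.normal_form_of_repr[OF R]) auto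
  next
    case True
    then obtain i where k0: "k = 0" and nd0: "ndeg a b d = 0" and d2: "d \<ge> 2" and i: "real_of_int i = ndeg a b (d - 1)" by blast
    have bb: "b = b1" using k0 by simp
    have tau0: "tau z t = c * t" for z t unfolding tau_def unfolding k0 by simp
    have ib: "real_of_int i = b1 / a" using i nd0 d2 a(1) bb by (simp add: ndeg_def of_nat_diff field_simps)
    define m where "m = nat i"
    have "real_of_int i > 0" unfolding ib using bpos bb a(1) by simp
    moreover have "b1 = real_of_int i * a" unfolding ib using a(1) by simp
    ultimately have im: "i = int m" "m > 0" "b1 = real m * a" by (simp_all add: m_def)
    have "A d i = 0" if "i \<noteq> 0" for i using M.repr_supp[OF R(1), of d i] nd0 that by auto
    then have Ad: "ev (A d) u = A d 0" for u by (subst ev_superset[of "{0}"]) auto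
    have ad0: "A d 0 \<noteq> 0" using M.reprD(3)[OF R(1)] \<open>\<And>i. i \<noteq> 0 \<Longrightarrow> A d i = 0\<close> by metis
    \<comment> \<open>Solves A (d - 1) i + d (A d 0) h' / (2 \<i>) = 0. Below, \<open>l\<close> is
      the same shear seen in the coordinate tau = c t of P.\<close>
    define h' where "h' = - (2 * \<i> * A (d - 1) i / (of_nat d * A d 0))"
    define l where "l = c * h'"
    let ?sh = "\<lambda>F z t. F z (t + l * z ^ m)"
    have wP': "wpoly False a b1 1 (?sh P) (\<lambda>z t. ?sh Pz z t + ?sh Pt z t * (l * of_nat m * z ^ (m - 1))) (?sh Pt)"
      by (rule wpoly_shift[OF wP im(3)])
    have nd': "nondegenerate_model a b1 (\<lambda>z t. ?sh Pz z t + ?sh Pt z t * (l * of_nat m * z ^ (m - 1))) (?sh Pt)"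
      by (rule nondegenerate_shift[OF nd im(3)])
    have s': "symmetry a b1 (1 - (b1 - real k * a)) (?sh P) (\<lambda>z t. ?sh Pz z t + ?sh Pt z t * (l * of_nat m * z ^ (m - 1))) (?sh Pt)
        (?sh f) (\<lambda>z t. 0) (\<lambda>z t. ?sh h z t - l * of_nat m * z ^ (m - 1) * ?sh f z t) (\<lambda>z t. c * z ^ k) (?sh g0) (?sh g1)"
      using symmetry_shift[OF symmetry_sym_model im(3), of l] by simp
    from sym_modelI[OF s' a b1 bpos c0 nq wP' realP nd']
    obtain fz' ft' hz' ht' g0z' g0t' g1z' g1t' where
      sm: "sym_model a b1 k c (?sh P) (\<lambda>z t. ?sh Pz z t + ?sh Pt z t * (l * of_nat m * z ^ (m - 1))) (?sh Pt)
        (?sh f) fz' ft' (\<lambda>z t. ?sh h z t - l * of_nat m * z ^ (m - 1) * ?sh f z t) hz' ht' (?sh g0) g0z' g0t' (?sh g1) g1z' g1t'"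
      by blast
    interpret S: sym_model a b1 k c "?sh P" "\<lambda>z t. ?sh Pz z t + ?sh Pt z t * (l * of_nat m * z ^ (m - 1))" "?sh Pt"
        "?sh f" fz' ft' "\<lambda>z t. ?sh h z t - l * of_nat m * z ^ (m - 1) * ?sh f z t" hz' ht' "?sh g0" g0z' g0t' "?sh g1" g1z' g1t'
      by (rule sm)
    have bm: "b1 - real k * a = real m * a" using k0 im(3) by simp
    interpret M': sym_model_int a b1 k c "?sh P" "\<lambda>z t. ?sh Pz z t + ?sh Pt z t * (l * of_nat m * z ^ (m - 1))" "?sh Pt"
        "?sh f" fz' ft' "\<lambda>z t. ?sh h z t - l * of_nat m * z ^ (m - 1) * ?sh f z t" hz' ht' "?sh g0" g0z' g0t' "?sh g1" g1z' g1t'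
        "\<lambda>z t. G z (t + h' * z ^ m)" "\<lambda>z t. Gz z (t + h' * z ^ m) + g1 z (tau z (t + h' * z ^ m)) * (h' * of_nat m * z ^ (m - 1))"
      by unfold_locales
        (rule wpoly_eqI[OF wpoly_shift[OF G bm, of h']]; simp add: tau0 l_def algebra_simps)
    obtain A' d' where R': "M'.repr A' d'" "d' \<ge> 1" using M'.repr_exists by blast
    define s where "s u = complex_of_real (Im (h' * u ^ m))" for u
    \<comment> \<open>The coefficient of y^i in V after y is replaced by y + Im (h' u^m).\<close>
    define F where "F i u = (\<Sum>j\<le>d. of_nat (j choose i) * (ev (A j) u * s u ^ (j - i)))" for i u
    have tpm: "trig_poly (\<lambda>u. h' * u ^ m)" using tp_cmul[OF tp_powi[of "int m"], of h'] by simp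
    have tps: "trig_poly (\<lambda>u. s u ^ j)" for j
    proof (induction j)
      case (Suc j)
      have "s = (\<lambda>u. of_real (Im (h' * u ^ m)))" by (rule ext) (rule s_def)
      then have "trig_poly s" using coef_of_real_Im(2)[OF tpm] by (simp only:)
      then show ?case unfolding power_Suc by (rule tp_mult[OF _ Suc])
    qed (simp add: tp_const)
    have tp: "trig_poly (F j)" for j unfolding F_def by (intro tp_intros tp_mult tps)
    have VF: "M'.V u (\<i> * of_real y) = (\<Sum>i\<le>d. F i u * of_real y ^ i)" if u: "cmod u = 1" for u y
    proof -
      have "M'.V u (\<i> * of_real y) = M.V u (\<i> * of_real y + h' * u ^ m)"
        unfolding M'.V_def M.V_def tau0 by (simp add: l_def algebra_simps)
      also have "\<dots> = (\<Sum>j\<le>d. ev (A j) u * (of_real y + s u) ^ j)"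
        unfolding M.repr_V[OF R(1) u] s_def by simp
      also have "\<dots> = (\<Sum>j\<le>d. \<Sum>i\<le>d. of_nat (j choose i) * (ev (A j) u * s u ^ (j - i)) * of_real y ^ i)"
      proof (rule sum.cong[OF refl])
        fix j assume j: "j \<in> {..d}"
        have "(of_real y + s u) ^ j = (\<Sum>i\<le>j. of_nat (j choose i) * of_real y ^ i * s u ^ (j - i))"
          by (rule binomial_ring)
        also have "\<dots> = (\<Sum>i\<le>d. of_nat (j choose i) * of_real y ^ i * s u ^ (j - i))"
          by (rule sum.mono_neutral_left) (use j in auto)
        finally show "ev (A j) u * (of_real y + s u) ^ j
            = (\<Sum>i\<le>d. of_nat (j choose i) * (ev (A j) u * s u ^ (j - i)) * of_real y ^ i)"
          by (simp add: sum_distrib_left mult_ac)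
      qed
      also have "\<dots> = (\<Sum>i\<le>d. F i u * of_real y ^ i)"
        unfolding F_def sum_distrib_right by (rule sum.swap)
      finally show ?thesis .
    qed
    note U = M'.repr_unique[OF R'(1) VF]
    have Fd: "F d u = ev (A d) u" for u
    proof -
      have "F d u = (\<Sum>j\<in>{d}. of_nat (j choose d) * (ev (A j) u * s u ^ (j - d)))"
        unfolding F_def by (rule sum.mono_neutral_right) auto
      then show ?thesis by simp
    qed
    have Fd1: "F (d - 1) u = ev (A (d - 1)) u + of_nat d * A d 0 * s u" for u
    proof -
      have dd: "{..d} = insert d (insert (d - 1) {..<d - 1})" using d2 by auto
      have "F (d - 1) u = (\<Sum>j\<in>{d, d - 1}. of_nat (j choose (d - 1)) * (ev (A j) u * s u ^ (j - (d - 1))))"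
        unfolding F_def dd by (rule sum.mono_neutral_right) auto
      also have "\<dots> = of_nat (d choose (d - 1)) * (ev (A d) u * s u ^ (d - (d - 1))) + ev (A (d - 1)) u"
        using d2 by simp
      also have "d choose (d - 1) = d" using binomial_symmetric[of 1 d] d2 by simp
      finally show ?thesis using d2 by (simp add: Ad)
    qed
    have "A' d = A d"
      using U(1)[OF _ _ tp, of d] coef_ev[OF M.repr_fin[OF R(1)], of d] by (simp add: Fd[abs_def] ext)
    then have dd: "d' = d"
      using U(2)[of d'] M'.reprD(2,3)[OF R'(1)] ad0 by (metis linorder_neqE_nat)
    have "coef (F (d - 1)) i = 0"
    proof -
      have "coef (\<lambda>u. h' * u ^ m) j = (if j = int m then h' else 0)" for j
        using coef_cmul[OF tp_powi[of "int m"], of h' j] coef_powi[of "int m" j] by simp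
      then have "coef s i = h' / (2 * \<i>)"
        unfolding s_def coef_of_real_Im(1)[OF tpm] using im by simp
      moreover have tp1: "trig_poly s" using tps[of 1] by simp
      moreover have "F (d - 1) = (\<lambda>u. ev (A (d - 1)) u + of_nat d * A d 0 * s u)" by (rule ext) (rule Fd1)
      ultimately have "coef (F (d - 1)) i = A (d - 1) i + of_nat d * A d 0 * (h' / (2 * \<i>))"
        using coef_add[OF tp_ev tp_cmul[OF tp1], of "A (d - 1)" "of_nat d * A d 0" i] coef_cmul[OF tp1, of "of_nat d * A d 0" i]
          coef_ev[OF M.repr_fin[OF R(1)], of "d - 1"] by (simp only:)
      then show ?thesis using ad0 d2 by (simp add: h'_def field_simps)
    qed
    then have z: "A' (d - 1) i = 0" using U(1)[OF _ _ tp, of "d - 1" i] by simp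
    have "normal_form a b1 (?sh P)"
    proof (rule M'.normal_form_of_repr[OF R'])
      fix j assume "real_of_int j = ndeg a b (d' - 1)"
      then have "j = i" using i dd by simp
      then show "A' (d' - 1) j = 0" using z dd by simp
    qed
    then show ?thesis by (rule normal_form_shift[OF _ im(2)])
  qed
qed

section \<open>Polynomial automorphisms\<close>

definition hol3 :: "(complex ^ 3 \<Rightarrow> complex) \<Rightarrow> bool" where
  "hol3 f \<longleftrightarrow> (\<forall>p. \<exists>L. (f has_derivative L) (at p) \<and> (\<forall>c v. L (c *s v) = c * L v))"

definition vec3 :: "complex \<Rightarrow> complex \<Rightarrow> complex \<Rightarrow> complex ^ 3" where
  "vec3 x y w = axis 1 x + axis 2 y + axis 3 w"

lemma vec3_nth [simp]: "vec3 x y w $ 1 = x" "vec3 x y w $ 2 = y" "vec3 x y w $ 3 = w"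
  by (simp_all add: vec3_def axis_def)

lemma vec3_eqI: "x = p $ 1 \<Longrightarrow> y = p $ 2 \<Longrightarrow> w = p $ 3 \<Longrightarrow> vec3 x y w = p"
  by (simp add: vec_eq_iff forall_3)

lemma hol3_coord: "hol3 (\<lambda>p. p $ i)"
  unfolding hol3_def
proof
  fix p :: "complex ^ 3"
  have "((\<lambda>p. p $ i) has_derivative (\<lambda>v. v $ i)) (at p)"
    by (rule bounded_linear_imp_has_derivative) (rule bounded_linear_vec_nth)
  then show "\<exists>L. ((\<lambda>p. p $ i) has_derivative L) (at p) \<and> (\<forall>c v. L (c *s v) = c * L v)"
    by (intro exI[of _ "\<lambda>v. v $ i"]) auto
qed

lemma hol3_const: "hol3 (\<lambda>p. c)"
  unfolding hol3_def by (intro allI exI[of _ "\<lambda>v. 0"]) auto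

lemma hol3_add: "hol3 f \<Longrightarrow> hol3 g \<Longrightarrow> hol3 (\<lambda>p. f p + g p)"
  unfolding hol3_def
proof
  fix p assume "\<forall>p. \<exists>L. (f has_derivative L) (at p) \<and> (\<forall>c v. L (c *s v) = c * L v)"
    "\<forall>p. \<exists>L. (g has_derivative L) (at p) \<and> (\<forall>c v. L (c *s v) = c * L v)"
  then obtain L M where "(f has_derivative L) (at p)" "\<forall>c v. L (c *s v) = c * L v"
    "(g has_derivative M) (at p)" "\<forall>c v. M (c *s v) = c * M v" by blast
  then show "\<exists>L. ((\<lambda>p. f p + g p) has_derivative L) (at p) \<and> (\<forall>c v. L (c *s v) = c * L v)"
    by (intro exI[of _ "\<lambda>v. L v + M v"]) (auto intro: has_derivative_add simp: algebra_simps)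
qed

lemma hol3_mult: "hol3 f \<Longrightarrow> hol3 g \<Longrightarrow> hol3 (\<lambda>p. f p * g p)"
  unfolding hol3_def
proof
  fix p assume "\<forall>p. \<exists>L. (f has_derivative L) (at p) \<and> (\<forall>c v. L (c *s v) = c * L v)"
    "\<forall>p. \<exists>L. (g has_derivative L) (at p) \<and> (\<forall>c v. L (c *s v) = c * L v)"
  then obtain L M where "(f has_derivative L) (at p)" "\<forall>c v. L (c *s v) = c * L v"
    "(g has_derivative M) (at p)" "\<forall>c v. M (c *s v) = c * M v" by blast
  then show "\<exists>L. ((\<lambda>p. f p * g p) has_derivative L) (at p) \<and> (\<forall>c v. L (c *s v) = c * L v)"
    by (intro exI[of _ "\<lambda>v. f p * M v + L v * g p"]) (auto simp: distrib_left mult_ac intro!: has_derivative_eq_rhs[OF has_derivative_mult])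
qed

lemma hol3_cmul: "hol3 f \<Longrightarrow> hol3 (\<lambda>p. c * f p)"
  by (rule hol3_mult[OF hol3_const])

lemma hol3_diff: "hol3 f \<Longrightarrow> hol3 g \<Longrightarrow> hol3 (\<lambda>p. f p - g p)"
  using hol3_add[of f "\<lambda>p. - 1 * g p"] hol3_cmul[of g "- 1"] by simp

lemma hol3_power: "hol3 f \<Longrightarrow> hol3 (\<lambda>p. f p ^ n)"
  by (induction n) (auto intro: hol3_const hol3_mult)

lemmas hol3_intros = hol3_coord hol3_const hol3_add hol3_mult hol3_diff hol3_power

lemma hol3_compose:
  assumes "q holomorphic_on UNIV" "hol3 f"
  shows "hol3 (\<lambda>p. q (f p))"
  unfolding hol3_def
proof
  fix p
  obtain L where L: "(f has_derivative L) (at p)" "\<forall>c v. L (c *s v) = c * L v"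
    using assms(2) unfolding hol3_def by blast
  obtain q' where "(q has_field_derivative q') (at (f p))"
    using assms(1) unfolding holomorphic_on_def field_differentiable_def by auto
  then have "(q has_derivative times q') (at (f p))" unfolding has_field_derivative_def .
  from has_derivative_compose[OF L(1) this]
  show "\<exists>L. ((\<lambda>p. q (f p)) has_derivative L) (at p) \<and> (\<forall>c v. L (c *s v) = c * L v)"
    by (intro exI[of _ "\<lambda>v. q' * L v"]) (simp add: L(2))
qed

lemma hol3_wpoly:
  assumes "wpoly True a b w F Fz Ft" "hol3 f" "hol3 g"
  shows "hol3 (\<lambda>p. F (f p) (g p))"
  unfolding hol3_def
proof
  fix p
  obtain L where L: "(f has_derivative L) (at p)" "\<forall>c v. L (c *s v) = c * L v"
    using assms(2) unfolding hol3_def by blast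
  obtain M where M: "(g has_derivative M) (at p)" "\<forall>c v. M (c *s v) = c * M v"
    using assms(3) unfolding hol3_def by blast
  from has_derivative_compose[OF has_derivative_Pair[OF L(1) M(1)] wpoly_hol_deriv[OF assms(1)]]
  show "\<exists>L. ((\<lambda>p. F (f p) (g p)) has_derivative L) (at p) \<and> (\<forall>c v. L (c *s v) = c * L v)"
    by (intro exI[of _ "\<lambda>v. Fz (f p) (g p) * L v + Ft (f p) (g p) * M v"]) (simp add: L(2) M(2) algebra_simps)
qed

lemma has_derivative_vec3:
  assumes "(f has_derivative L) (at p)" "(g has_derivative M) (at p)" "(h has_derivative N) (at p)"
  shows "((\<lambda>p. vec3 (f p) (g p) (h p)) has_derivative (\<lambda>v. vec3 (L v) (M v) (N v))) (at p)"
proof -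
  have bl: "bounded_linear (axis i :: complex \<Rightarrow> complex ^ 3)" for i
    unfolding linear_conv_bounded_linear[symmetric]
    by (rule linearI) (simp_all add: vec_eq_iff axis_def)
  show ?thesis unfolding vec3_def
    by (intro has_derivative_add bounded_linear.has_derivative[OF bl] assms)
qed

lemma holomorphic_map_vec3:
  assumes "hol3 f" "hol3 g" "hol3 h"
  shows "holomorphic_map_on (\<lambda>p. vec3 (f p) (g p) (h p)) UNIV"
  unfolding holomorphic_map_on_def
proof
  fix p
  obtain L M N where L: "(f has_derivative L) (at p)" "\<forall>c v. L (c *s v) = c * L v"
    and M: "(g has_derivative M) (at p)" "\<forall>c v. M (c *s v) = c * M v"
    and N: "(h has_derivative N) (at p)" "\<forall>c v. N (c *s v) = c * N v"
    using assms unfolding hol3_def by meson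
  have "((\<lambda>p. vec3 (f p) (g p) (h p)) has_derivative (\<lambda>v. vec3 (L v) (M v) (N v))) (at p)"
    by (rule has_derivative_vec3[OF L(1) M(1) N(1)])
  moreover have "vec3 (L (c *s v)) (M (c *s v)) (N (c *s v)) = c *s vec3 (L v) (M v) (N v)" for c v
    by (rule vec3_eqI) (simp_all add: L(2) M(2) N(2))
  ultimately show "\<exists>L. ((\<lambda>p. vec3 (f p) (g p) (h p)) has_derivative L) (at p) \<and> (\<forall>c v. L (c *s v) = c *s L v)"
    by blast
qed

text \<open>All coordinate changes of the final reduction are automorphisms of the whole space
  fixing 0, so they compose without shrinking neighbourhoods.\<close>

definition globally_equivalent :: "(complex ^ 3) set \<Rightarrow> (complex ^ 3) set \<Rightarrow> bool" where
  "globally_equivalent M N \<longleftrightarrow> (\<exists>F F'. holomorphic_map_on F UNIV \<and> holomorphic_map_on F' UNIV \<and>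
     (\<forall>p. F' (F p) = p) \<and> (\<forall>p. F (F' p) = p) \<and> F 0 = 0 \<and> (\<forall>p. p \<in> M \<longleftrightarrow> F p \<in> N))"

lemma globally_equivalent_at_0:
  assumes "globally_equivalent M N"
  shows "biholomorphically_equivalent_at_0 M N"
proof -
  obtain F F' where 1: "holomorphic_map_on F UNIV" "holomorphic_map_on F' UNIV"
    "\<And>p. F' (F p) = p" "\<And>p. F (F' p) = p" "F 0 = 0" "\<And>p. p \<in> M \<longleftrightarrow> F p \<in> N"
    using assms unfolding globally_equivalent_def by blast
  have bij: "bij F" by (rule o_bij[of F']) (auto simp: 1)
  have "inv F = F'" by (rule inv_equality) (auto simp: 1)
  then have "biholomorphic_map UNIV UNIV F"
    using 1 bij unfolding biholomorphic_map_def by simp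
  moreover have "F ` M = N"
  proof
    show "N \<subseteq> F ` M" using 1(4,6) by (metis image_eqI subsetI)
  qed (use 1(6) in auto)
  ultimately show ?thesis unfolding biholomorphically_equivalent_at_0_def using 1(5)
    by (intro exI[of _ UNIV] exI[of _ F]) simp
qed

lemma holomorphic_map_compose:
  assumes "holomorphic_map_on F UNIV" "holomorphic_map_on H UNIV"
  shows "holomorphic_map_on (\<lambda>p. H (F p)) UNIV"
  unfolding holomorphic_map_on_def
proof
  fix p
  obtain L M where L: "(F has_derivative L) (at p)" "\<forall>c v. L (c *s v) = c *s L v"
    "(H has_derivative M) (at (F p))" "\<forall>c v. M (c *s v) = c *s M v"
    using assms unfolding holomorphic_map_on_def by (meson UNIV_I)
  from has_derivative_compose[OF L(1,3)] L(2,4)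
  show "\<exists>L. ((\<lambda>p. H (F p)) has_derivative L) (at p) \<and> (\<forall>c v. L (c *s v) = c *s L v)"
    by (intro exI[of _ "\<lambda>v. M (L v)"]) simp
qed

lemma globally_equivalent_trans [trans]:
  assumes "globally_equivalent A B" "globally_equivalent B C"
  shows "globally_equivalent A C"
proof -
  obtain F F' where 1: "holomorphic_map_on F UNIV" "holomorphic_map_on F' UNIV"
    "\<And>p. F' (F p) = p" "\<And>p. F (F' p) = p" "F 0 = 0" "\<And>p. p \<in> A \<longleftrightarrow> F p \<in> B"
    using assms(1) unfolding globally_equivalent_def by blast
  obtain H H' where 2: "holomorphic_map_on H UNIV" "holomorphic_map_on H' UNIV"
    "\<And>p. H' (H p) = p" "\<And>p. H (H' p) = p" "H 0 = 0" "\<And>p. p \<in> B \<longleftrightarrow> H p \<in> C"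
    using assms(2) unfolding globally_equivalent_def by blast
  show ?thesis unfolding globally_equivalent_def
    by (intro exI[of _ "\<lambda>p. H (F p)"] exI[of _ "\<lambda>p. F' (H' p)"] conjI allI
        holomorphic_map_compose[OF 1(1) 2(1)] holomorphic_map_compose[OF 2(2) 1(2)]) (simp_all add: 1 2)
qed

section \<open>Elementary equivalences and reduction to the models\<close>

definition hypersurface :: "(complex \<Rightarrow> complex \<Rightarrow> real) \<Rightarrow> (complex ^ 3) set" where
  "hypersurface R = {p. Im (p $ 3) = R (p $ 1) (p $ 2)}"

lemma hypersurface_equivalentI:
  assumes "hol3 f" "hol3 g" "hol3 h" "hol3 f'" "hol3 g'" "hol3 h'"
    and "\<And>p. vec3 (f' (vec3 (f p) (g p) (h p))) (g' (vec3 (f p) (g p) (h p))) (h' (vec3 (f p) (g p) (h p))) = p"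
    and "\<And>p. vec3 (f (vec3 (f' p) (g' p) (h' p))) (g (vec3 (f' p) (g' p) (h' p))) (h (vec3 (f' p) (g' p) (h' p))) = p"
    and "f 0 = 0" "g 0 = 0" "h 0 = 0"
    and "\<And>p. Im (p $ 3) = R (p $ 1) (p $ 2) \<longleftrightarrow> Im (h p) = S (f p) (g p)"
  shows "globally_equivalent (hypersurface R) (hypersurface S)"
  unfolding globally_equivalent_def
proof (intro exI conjI allI)
  show "holomorphic_map_on (\<lambda>p. vec3 (f p) (g p) (h p)) UNIV" "holomorphic_map_on (\<lambda>p. vec3 (f' p) (g' p) (h' p)) UNIV"
    by (intro holomorphic_map_vec3 assms)+
  show "vec3 (f 0) (g 0) (h 0) = 0" by (rule vec3_eqI) (simp_all add: assms)
qed (use assms in \<open>simp_all add: hypersurface_def\<close>)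

lemma hypersurface_shear:
  assumes "c \<noteq> 0" "q holomorphic_on UNIV" "q 0 = 0"
  shows "globally_equivalent (hypersurface R) (hypersurface (\<lambda>z t. R z (c * t + q z)))"
proof (rule hypersurface_equivalentI[of "\<lambda>p. p $ 1" "\<lambda>p. (1 / c) * (p $ 2 - q (p $ 1))" "\<lambda>p. p $ 3" "\<lambda>p. p $ 1" "\<lambda>p. c * p $ 2 + q (p $ 1)" "\<lambda>p. p $ 3"])
qed ((intro hol3_intros hol3_compose[OF assms(2)]; fail) | use assms in \<open>auto intro!: vec3_eqI\<close>)+

lemma hypersurface_add:
  assumes "hol3 (\<lambda>p. G (p $ 1) (p $ 2))" "G 0 0 = 0"
  shows "globally_equivalent (hypersurface (\<lambda>z t. Im (G z t) + R z t)) (hypersurface R)"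
proof (rule hypersurface_equivalentI[of "\<lambda>p. p $ 1" "\<lambda>p. p $ 2" "\<lambda>p. p $ 3 - G (p $ 1) (p $ 2)" "\<lambda>p. p $ 1" "\<lambda>p. p $ 2" "\<lambda>p. p $ 3 + G (p $ 1) (p $ 2)"])
qed ((intro hol3_intros assms(1); fail) | use assms in \<open>auto intro!: vec3_eqI\<close>)+

lemma hypersurface_scale:
  assumes "\<alpha> \<noteq> 0" "\<beta> \<noteq> 0" "\<gamma> \<noteq> 0" "\<And>z t. S (\<alpha> * z) (\<beta> * t) = \<gamma> * R z t"
  shows "globally_equivalent (hypersurface R) (hypersurface S)"
proof (rule hypersurface_equivalentI[of "\<lambda>p. \<alpha> * p $ 1" "\<lambda>p. \<beta> * p $ 2" "\<lambda>p. of_real \<gamma> * p $ 3" "\<lambda>p. (1 / \<alpha>) * p $ 1" "\<lambda>p. (1 / \<beta>) * p $ 2" "\<lambda>p. of_real (1 / \<gamma>) * p $ 3"])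
qed ((intro hol3_intros; fail) | use assms in \<open>auto intro!: vec3_eqI\<close>)+

lemma hypersurface_swap: "globally_equivalent (hypersurface R) (hypersurface (\<lambda>z t. R t z))"
proof (rule hypersurface_equivalentI[of "\<lambda>p. p $ 2" "\<lambda>p. p $ 1" "\<lambda>p. p $ 3" "\<lambda>p. p $ 2" "\<lambda>p. p $ 1" "\<lambda>p. p $ 3"])
qed ((intro hol3_intros; fail) | auto intro!: vec3_eqI)+

definition equivalent_to_model :: "(complex ^ 3) set \<Rightarrow> bool" where
  "equivalent_to_model M \<longleftrightarrow> (\<exists>l::nat. l > 0 \<and>
     (globally_equivalent M {p. Im (p $ 3) = Re (p $ 1 * cnj (p $ 2) ^ l)} \<or>
      globally_equivalent M {p. Im (p $ 3) = (cmod (p $ 1))\<^sup>2 + cmod (p $ 2) ^ (2 * l)} \<or>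
      globally_equivalent M {p. Im (p $ 3) = (cmod (p $ 1))\<^sup>2 - cmod (p $ 2) ^ (2 * l)}))"

lemma equivalent_to_model_trans:
  assumes "globally_equivalent M N" "equivalent_to_model N"
  shows "equivalent_to_model M"
  using assms(2) globally_equivalent_trans[OF assms(1)] unfolding equivalent_to_model_def by blast

text \<open>Scaling z and t normalizes the moduli of A and B, and scaling w by sgn A makes the first
  sign positive; the relative sign is what remains.\<close>

lemma diagonal_model:
  assumes "A \<noteq> 0" "B \<noteq> 0" "l \<ge> 1"
  shows "equivalent_to_model (hypersurface (\<lambda>z t. A * (cmod z)\<^sup>2 + B * cmod t ^ (2 * l)))"
proof -
  define \<alpha> \<beta> where "\<alpha> = complex_of_real (sqrt \<bar>A\<bar>)" and "\<beta> = complex_of_real (root (2 * l) \<bar>B\<bar>)"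
  have \<alpha>: "\<alpha> \<noteq> 0" "(cmod \<alpha>)\<^sup>2 = \<bar>A\<bar>" using assms by (simp_all add: \<alpha>_def)
  have \<beta>: "\<beta> \<noteq> 0" "cmod \<beta> ^ (2 * l) = \<bar>B\<bar>"
    using assms real_root_pow_pos2[of "2 * l" "\<bar>B\<bar>"] by (simp_all add: \<beta>_def real_root_ge_zero)
  have s: "(cmod (\<alpha> * z))\<^sup>2 = \<bar>A\<bar> * (cmod z)\<^sup>2" "cmod (\<beta> * t) ^ (2 * l) = \<bar>B\<bar> * cmod t ^ (2 * l)" for z t
    using \<alpha>(2) \<beta>(2) by (simp_all add: norm_mult power_mult_distrib)
  have sg: "\<bar>x\<bar> = sgn x * x" for x :: real by (simp add: sgn_if)
  consider "sgn B = sgn A" | "sgn B = - sgn A" 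
  proof -
    have "sgn B = sgn A \<or> sgn B = - sgn A" using assms by (simp add: sgn_if)
    then show ?thesis using that by blast
  qed
  then show ?thesis
  proof cases
    case 1
    have "globally_equivalent (hypersurface (\<lambda>z t. A * (cmod z)\<^sup>2 + B * cmod t ^ (2 * l))) (hypersurface (\<lambda>z t. (cmod z)\<^sup>2 + cmod t ^ (2 * l)))"
      by (rule hypersurface_scale[OF \<alpha>(1) \<beta>(1), of "sgn A"]) (use assms 1 in \<open>simp_all only: s sg sgn_0_0 not_False_eq_True distrib_left mult.assoc\<close>)
    then show ?thesis unfolding equivalent_to_model_def hypersurface_def using assms(3) by (intro exI[of _ l]) auto
  next
    case 2
    have "globally_equivalent (hypersurface (\<lambda>z t. A * (cmod z)\<^sup>2 + B * cmod t ^ (2 * l))) (hypersurface (\<lambda>z t. (cmod z)\<^sup>2 - cmod t ^ (2 * l)))"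
      by (rule hypersurface_scale[OF \<alpha>(1) \<beta>(1), of "sgn A"]) (use assms in \<open>simp_all only: s sg 2 sgn_0_0 not_False_eq_True distrib_left mult.assoc mult_minus_left diff_minus_eq_add\<close>)
    then show ?thesis unfolding equivalent_to_model_def hypersurface_def using assms(3) by (intro exI[of _ l]) auto
  qed
qed

lemma mixed_model:
  assumes "e \<noteq> 0" "l \<ge> 1"
  shows "equivalent_to_model (hypersurface (\<lambda>z t. Re (e * z * cnj t ^ l)))"
proof -
  have "globally_equivalent (hypersurface (\<lambda>z t. Re (e * z * cnj t ^ l))) (hypersurface (\<lambda>z t. Re (z * cnj t ^ l)))"
    by (rule hypersurface_scale[of e 1 1]) (use assms in auto)
  then show ?thesis unfolding equivalent_to_model_def hypersurface_def using assms(2) by (intro exI[of _ l]) auto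
qed

text \<open>If B is nonzero, completing the square in t leaves the coefficient A - |e|^2 / (4 B),
  nonzero by the determinant condition. If only A is nonzero, the variables are swapped; if both
  vanish, the form is the mixed model with l = 1.\<close>

lemma hermitian_model:
  assumes "4 * A * B \<noteq> (cmod e)\<^sup>2"
  shows "equivalent_to_model (hypersurface (\<lambda>z t. A * (cmod z)\<^sup>2 + B * (cmod t)\<^sup>2 + Re (e * z * cnj t)))"
proof -
  have main: "equivalent_to_model (hypersurface (\<lambda>z t. A * (cmod z)\<^sup>2 + B * (cmod t)\<^sup>2 + Re (e * z * cnj t)))"
    if AB: "B \<noteq> 0" "4 * A * B \<noteq> (cmod e)\<^sup>2" for A B e
  proof -
    define s where "s = - e / (2 * of_real B)"
    have "globally_equivalent (hypersurface (\<lambda>z t. A * (cmod z)\<^sup>2 + B * (cmod t)\<^sup>2 + Re (e * z * cnj t)))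
        (hypersurface (\<lambda>z t. A * (cmod z)\<^sup>2 + B * (cmod (1 * t + s * z))\<^sup>2 + Re (e * z * cnj (1 * t + s * z))))"
      by (rule hypersurface_shear) (auto intro: holomorphic_intros)
    moreover have "A * (cmod z)\<^sup>2 + B * (cmod (1 * t + s * z))\<^sup>2 + Re (e * z * cnj (1 * t + s * z))
        = (A - (cmod e)\<^sup>2 / (4 * B)) * (cmod z)\<^sup>2 + B * cmod t ^ (2 * 1)" for z t
    proof -
      define x where "x = e * z"
      have sz: "s * z = - x / of_real (2 * B)" by (simp add: s_def x_def)
      have ex: "(cmod e)\<^sup>2 * (cmod z)\<^sup>2 = (Re x)\<^sup>2 + (Im x)\<^sup>2"
        unfolding x_def cmod_power2[symmetric] by (simp add: norm_mult power_mult_distrib)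
      have "B * (cmod (t + s * z))\<^sup>2 + Re (x * cnj (t + s * z)) = B * (cmod t)\<^sup>2 - ((Re x)\<^sup>2 + (Im x)\<^sup>2) / (4 * B)"
        unfolding sz cmod_power2 using AB(1) by (simp add: field_simps power2_eq_square)
      then show ?thesis
        unfolding ex[symmetric] unfolding x_def left_diff_distrib times_divide_eq_left mult_1_left mult_1_right by linarith
    qed
    ultimately have E: "globally_equivalent (hypersurface (\<lambda>z t. A * (cmod z)\<^sup>2 + B * (cmod t)\<^sup>2 + Re (e * z * cnj t)))
        (hypersurface (\<lambda>z t. (A - (cmod e)\<^sup>2 / (4 * B)) * (cmod z)\<^sup>2 + B * cmod t ^ (2 * 1)))" by simp
    have "A - (cmod e)\<^sup>2 / (4 * B) \<noteq> 0" using AB by (simp add: field_simps)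
    from equivalent_to_model_trans[OF E diagonal_model[OF this AB(1)]] show ?thesis by simp
  qed
  consider "B \<noteq> 0" | "A \<noteq> 0" | "A = 0" "B = 0" by blast
  then show ?thesis
  proof cases
    case 1
    then show ?thesis using assms by (intro main)
  next
    case 2
    have eq: "A * (cmod t)\<^sup>2 + B * (cmod z)\<^sup>2 + Re (e * t * cnj z)
        = B * (cmod z)\<^sup>2 + A * (cmod t)\<^sup>2 + Re (cnj e * z * cnj t)" for z t
      by (simp add: algebra_simps)
    have "equivalent_to_model (hypersurface (\<lambda>z t. B * (cmod z)\<^sup>2 + A * (cmod t)\<^sup>2 + Re (cnj e * z * cnj t)))"
      by (rule main) (use 2 assms in \<open>simp_all add: mult_ac\<close>)
    moreover have "(\<lambda>z t. A * (cmod t)\<^sup>2 + B * (cmod z)\<^sup>2 + Re (e * t * cnj z))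
        = (\<lambda>z t. B * (cmod z)\<^sup>2 + A * (cmod t)\<^sup>2 + Re (cnj e * z * cnj t))"
      by (intro ext, rule eq)
    ultimately have "equivalent_to_model (hypersurface (\<lambda>z t. A * (cmod t)\<^sup>2 + B * (cmod z)\<^sup>2 + Re (e * t * cnj z)))"
      by (rule ssubst[of _ _ "\<lambda>R. equivalent_to_model (hypersurface R)", rotated])
    then show ?thesis by (rule equivalent_to_model_trans[OF hypersurface_swap])
  next
    case 3
    then show ?thesis using assms mixed_model[of e 1] by simp
  qed
qed

lemma wpoly_zero_at_0:
  assumes "wpoly h a b w F Fz Ft" "w > 0"
  shows "F 0 0 = 0"
  using assms
proof induction
  case (wpoly_mono p q i j w c)
  then have "p \<noteq> 0 \<or> q \<noteq> 0 \<or> i \<noteq> 0 \<or> j \<noteq> 0" by (cases "p = 0 \<and> q = 0 \<and> i = 0 \<and> j = 0") auto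
  then show ?case by auto
qed auto

text \<open>Two identities isolate what w can absorb: (Im t)^2 = |t|^2 / 2 - Im (\<i> t^2) / 2 and
  Im t Re y = Im (t y) / 2 + Re (-\<i> t cnj y) / 2. The final swap is due to the models having the
  power l on the second variable.\<close>

lemma normal_form_model:
  assumes "normal_form a b P"
  shows "equivalent_to_model (hypersurface (\<lambda>z t. Re (P z t)))"
proof -
  obtain c q G Gz Gt where 1: "c \<noteq> 0" "q holomorphic_on UNIV" "q 0 = 0" "wpoly True a b 1 G Gz Gt"
    and 2: "(\<exists>A2 A0 l. A2 \<noteq> 0 \<and> A0 \<noteq> 0 \<and> l \<ge> 1 \<and>
         (\<forall>z t. Re (P z (c * t + q z)) = Im (G z t) + A2 * (Im t)\<^sup>2 + A0 * cmod z ^ (2 * l))) \<or>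
      (\<exists>e m. e \<noteq> 0 \<and> m \<ge> 1 \<and> (\<forall>z t. Re (P z (c * t + q z)) = Im (G z t) + Im t * Re (e * z ^ m)))"
    using assms unfolding normal_form_def by (elim exE conjE) blast
  have G: "hol3 (\<lambda>p. G (p $ 1) (p $ 2))" by (rule hol3_wpoly[OF 1(4) hol3_coord hol3_coord])
  have G0: "G 0 0 = 0" by (rule wpoly_zero_at_0[OF 1(4)]) simp
  have S: "globally_equivalent (hypersurface (\<lambda>z t. Re (P z t))) (hypersurface (\<lambda>z t. Re (P z (c * t + q z))))"
    by (rule hypersurface_shear[OF 1(1-3)])
  have E: "equivalent_to_model (hypersurface (\<lambda>z t. Re (P z t)))"
    if H: "hol3 (\<lambda>p. H (p $ 1) (p $ 2))" "H 0 0 = 0"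
      and e: "\<And>z t. Re (P z (c * t + q z)) = Im (G z t + H z t) + R t z" and m: "equivalent_to_model (hypersurface R)" for H R
  proof (rule equivalent_to_model_trans[OF S])
    have "globally_equivalent (hypersurface (\<lambda>z t. Im (G z t + H z t) + R t z)) (hypersurface (\<lambda>z t. R t z))"
      by (rule hypersurface_add[of "\<lambda>z t. G z t + H z t"]) (use hol3_add[OF G H(1)] G0 H(2) in auto)
    also have "globally_equivalent (hypersurface (\<lambda>z t. R t z)) (hypersurface R)" using hypersurface_swap[of "\<lambda>z t. R t z"] by simp
    finally show "equivalent_to_model (hypersurface (\<lambda>z t. Re (P z (c * t + q z))))"
      unfolding e by (rule equivalent_to_model_trans[OF _ m])
  qed
  from 2 show ?thesis
  proof (elim disjE exE conjE)
    fix A2 A0 l assume A: "A2 \<noteq> 0" "A0 \<noteq> 0" "l \<ge> 1"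
      "\<forall>z t. Re (P z (c * t + q z)) = Im (G z t) + A2 * (Im t)\<^sup>2 + A0 * cmod z ^ (2 * l)"
    show ?thesis
    proof (rule E[of "\<lambda>z t. of_real (- A2 / 2) * (\<i> * t ^ 2)" "\<lambda>z t. A2 / 2 * (cmod z)\<^sup>2 + A0 * cmod t ^ (2 * l)"])
      show "hol3 (\<lambda>p. of_real (- A2 / 2) * (\<i> * p $ 2 ^ 2))" by (intro hol3_intros)
      show "equivalent_to_model (hypersurface (\<lambda>z t. A2 / 2 * (cmod z)\<^sup>2 + A0 * cmod t ^ (2 * l)))"
        by (rule diagonal_model) (use A in auto)
      show "Re (P z (c * t + q z)) = Im (G z t + of_real (- A2 / 2) * (\<i> * t ^ 2)) + (A2 / 2 * (cmod t)\<^sup>2 + A0 * cmod z ^ (2 * l))" for z t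
      proof -
        have "Im (of_real (- A2 / 2) * (\<i> * t ^ 2)) + A2 / 2 * (cmod t)\<^sup>2 = A2 * (Im t)\<^sup>2"
          unfolding cmod_power2 by (simp add: power2_eq_square field_simps)
        then show ?thesis using A(4) by simp
      qed
    qed simp
  next
    fix e m assume A: "e \<noteq> 0" "m \<ge> 1" "\<forall>z t. Re (P z (c * t + q z)) = Im (G z t) + Im t * Re (e * z ^ m)"
    show ?thesis
    proof (rule E[of "\<lambda>z t. (1 / 2) * (t * (e * z ^ m))" "\<lambda>z t. Re ((- \<i> / 2 * cnj e) * z * cnj t ^ m)"])
      show "hol3 (\<lambda>p. (1 / 2) * (p $ 2 * (e * p $ 1 ^ m)))" by (intro hol3_intros)
      show "equivalent_to_model (hypersurface (\<lambda>z t. Re ((- \<i> / 2 * cnj e) * z * cnj t ^ m)))"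
        by (rule mixed_model) (use A in auto)
      show "Re (P z (c * t + q z)) = Im (G z t + (1 / 2) * (t * (e * z ^ m))) + Re ((- \<i> / 2 * cnj e) * t * cnj z ^ m)" for z t
      proof -
        have "Re ((- \<i> / 2 * cnj e) * t * cnj z ^ m) = Re (- \<i> / 2 * (t * cnj (e * z ^ m)))" by (simp add: mult_ac)
        moreover have id: "Im t * Re y = Im ((1 / 2) * (t * y)) + Re (- \<i> / 2 * (t * cnj y))" for y by (simp add: field_simps)
        ultimately show ?thesis
          using A(3)[rule_format, of z t] id[of "e * z ^ m"] unfolding plus_complex.sel by linarith
      qed
    qed (use A in simp)
  qed
qed

section \<open>Both weights equal to 1/2\<close>

lemma quadratic_wpoly:
  assumes "wpoly False (1/2) (1/2) w P Pz Pt" "w = 1"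
  shows "\<exists>\<alpha> \<beta> \<gamma> \<delta> q1 q2 q3 r1 r2 r3. \<forall>z t.
     P z t = \<alpha> * z * cnj z + \<beta> * z * cnj t + \<gamma> * t * cnj z + \<delta> * t * cnj t
       + (q1 * z ^ 2 + q2 * z * t + q3 * t ^ 2) + (r1 * cnj z ^ 2 + r2 * cnj z * cnj t + r3 * cnj t ^ 2) \<and>
     Pz z t = \<alpha> * cnj z + \<beta> * cnj t + (2 * q1 * z + q2 * t) \<and> Pt z t = \<gamma> * cnj z + \<delta> * cnj t + (q2 * z + 2 * q3 * t)"
  using assms
proof induction
  case (wpoly_zero w)
  show ?case by (intro exI[of _ 0]) simp
next
  case (wpoly_add w P Pz Pt Q Qz Qt)
  obtain \<alpha> \<beta> \<gamma> \<delta> q1 q2 q3 r1 r2 r3 where 1: "\<And>z t.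
     P z t = \<alpha> * z * cnj z + \<beta> * z * cnj t + \<gamma> * t * cnj z + \<delta> * t * cnj t
       + (q1 * z ^ 2 + q2 * z * t + q3 * t ^ 2) + (r1 * cnj z ^ 2 + r2 * cnj z * cnj t + r3 * cnj t ^ 2)"
     "\<And>z t. Pz z t = \<alpha> * cnj z + \<beta> * cnj t + (2 * q1 * z + q2 * t)" "\<And>z t. Pt z t = \<gamma> * cnj z + \<delta> * cnj t + (q2 * z + 2 * q3 * t)"
    using wpoly_add.IH(1)[OF wpoly_add.prems] by metis
  obtain \<alpha>' \<beta>' \<gamma>' \<delta>' q1' q2' q3' r1' r2' r3' where 2: "\<And>z t.
     Q z t = \<alpha>' * z * cnj z + \<beta>' * z * cnj t + \<gamma>' * t * cnj z + \<delta>' * t * cnj t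
       + (q1' * z ^ 2 + q2' * z * t + q3' * t ^ 2) + (r1' * cnj z ^ 2 + r2' * cnj z * cnj t + r3' * cnj t ^ 2)"
     "\<And>z t. Qz z t = \<alpha>' * cnj z + \<beta>' * cnj t + (2 * q1' * z + q2' * t)" "\<And>z t. Qt z t = \<gamma>' * cnj z + \<delta>' * cnj t + (q2' * z + 2 * q3' * t)"
    using wpoly_add.IH(2)[OF wpoly_add.prems] by metis
  show ?case
    by (rule exI[of _ "\<alpha> + \<alpha>'"], rule exI[of _ "\<beta> + \<beta>'"], rule exI[of _ "\<gamma> + \<gamma>'"], rule exI[of _ "\<delta> + \<delta>'"],
        rule exI[of _ "q1 + q1'"], rule exI[of _ "q2 + q2'"], rule exI[of _ "q3 + q3'"],
        rule exI[of _ "r1 + r1'"], rule exI[of _ "r2 + r2'"], rule exI[of _ "r3 + r3'"])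
      (simp add: 1 2 algebra_simps)
next
  case (wpoly_mono p q i j w c)
  have s: "real (p + q) + real (i + j) = 2"
  proof -
    have "x + y = 2" if "1 / 2 * x + 1 / 2 * y = v" "v = 1" for x y v :: real using that by (simp add: field_simps)
    from this[OF wpoly_mono(1) wpoly_mono.prems] show ?thesis .
  qed
  define m where "m x y u v = (if p = x \<and> q = y \<and> i = u \<and> j = v then c else 0)" for x y u v :: nat
  have "p + q + (i + j) = 2" using s by linarith
  then have disj: "p = 1 \<and> q = 1 \<and> i = 0 \<and> j = 0 \<or> p = 1 \<and> q = 0 \<and> i = 0 \<and> j = 1 \<or> p = 0 \<and> q = 1 \<and> i = 1 \<and> j = 0 \<or> p = 0 \<and> q = 0 \<and> i = 1 \<and> j = 1 \<or> p = 2 \<and> q = 0 \<and> i = 0 \<and> j = 0 \<or> p = 1 \<and> q = 0 \<and> i = 1 \<and> j = 0 \<or> p = 0 \<and> q = 0 \<and> i = 2 \<and> j = 0 \<or> p = 0 \<and> q = 2 \<and> i = 0 \<and> j = 0 \<or> p = 0 \<and> q = 1 \<and> i = 0 \<and> j = 1 \<or> p = 0 \<and> q = 0 \<and> i = 0 \<and> j = 2"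
    by presburger
  show ?case
    by (rule exI[of _ "m 1 1 0 0"], rule exI[of _ "m 1 0 0 1"], rule exI[of _ "m 0 1 1 0"], rule exI[of _ "m 0 0 1 1"],
        rule exI[of _ "m 2 0 0 0"], rule exI[of _ "m 1 0 1 0"], rule exI[of _ "m 0 0 2 0"], rule exI[of _ "m 0 2 0 0"],
        rule exI[of _ "m 0 1 0 1"], rule exI[of _ "m 0 0 0 2"])
      (insert disj, elim disjE conjE; simp add: m_def)
qed

text \<open>A kernel vector of a degenerate Hermitian part gives a constant field which, with a
  linear holomorphic w-component, would be complex tangent.\<close>

lemma quadratic_model:
  assumes wP: "wpoly False (1/2) (1/2) 1 P Pz Pt" and real: "\<And>z t. P z t \<in> \<real>"
    and nd: "nondegenerate_model (1/2) (1/2) Pz Pt"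
  shows "equivalent_to_model (hypersurface (\<lambda>z t. Re (P z t)))"
proof -
  obtain \<alpha> \<beta> \<gamma> \<delta> q1 q2 q3 r1 r2 r3 where 1: "\<And>z t.
     P z t = \<alpha> * z * cnj z + \<beta> * z * cnj t + \<gamma> * t * cnj z + \<delta> * t * cnj t
       + (q1 * z ^ 2 + q2 * z * t + q3 * t ^ 2) + (r1 * cnj z ^ 2 + r2 * cnj z * cnj t + r3 * cnj t ^ 2)"
     "\<And>z t. Pz z t = \<alpha> * cnj z + \<beta> * cnj t + (2 * q1 * z + q2 * t)" "\<And>z t. Pt z t = \<gamma> * cnj z + \<delta> * cnj t + (q2 * z + 2 * q3 * t)"
    using quadratic_wpoly[OF wP] by metis
  \<comment> \<open>Passing from (z, t) to (\<i> z, \<i> t) changes the sign of the pluriharmonic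
    quadratic terms and preserves the others, so the mean is the Hermitian part.\<close>
  have H: "\<alpha> * z * cnj z + \<beta> * z * cnj t + \<gamma> * t * cnj z + \<delta> * t * cnj t \<in> \<real>" for z t
  proof -
    have eq: "\<alpha> * z * cnj z + \<beta> * z * cnj t + \<gamma> * t * cnj z + \<delta> * t * cnj t = (P z t + P (\<i> * z) (\<i> * t)) / of_real 2"
      unfolding 1 by (simp add: power_mult_distrib algebra_simps)
    show ?thesis unfolding eq by (intro Reals_divide Reals_add real Reals_of_real)
  qed
  have \<alpha>: "Im \<alpha> = 0" using H[of 1 0] by (simp add: complex_is_Real_iff)
  have \<delta>: "Im \<delta> = 0" using H[of 0 1] by (simp add: complex_is_Real_iff)
  have \<gamma>: "\<gamma> = cnj \<beta>"
    using H[of 1 1] H[of \<i> 1] \<alpha> \<delta> by (simp add: complex_is_Real_iff complex_eq_iff)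
  define A B where "A = Re \<alpha>" and "B = Re \<delta>"
  have AB: "\<alpha> = of_real A" "\<delta> = of_real B" using \<alpha> \<delta> by (simp_all add: A_def B_def complex_eq_iff)
  have ne: "4 * A * B \<noteq> (cmod (2 * \<beta>))\<^sup>2"
  proof
    assume "4 * A * B = (cmod (2 * \<beta>))\<^sup>2"
    then have "A * B = (cmod \<beta>)\<^sup>2" by (simp add: norm_mult power_mult_distrib)
    then have "of_real (A * B) = complex_of_real ((cmod \<beta>)\<^sup>2)" by (simp only:)
    then have det: "\<alpha> * \<delta> = \<beta> * \<gamma>" unfolding AB \<gamma> complex_norm_square by simp
    obtain x y where xy: "x * \<alpha> + y * \<gamma> = 0" "x * \<beta> + y * \<delta> = 0" "\<not> (x = 0 \<and> y = 0)"
    proof (cases "\<alpha> = 0 \<and> \<gamma> = 0")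
      case True
      then show ?thesis using that[of 1 0] that[of \<delta> "- \<beta>"] \<gamma> by auto
    next
      case False
      then show ?thesis using that[of \<gamma> "- \<alpha>"] det by (auto simp: mult_ac)
    qed
    define g where "g z t = 2 * \<i> * (x * (2 * q1 * z + q2 * t) + y * (q2 * z + 2 * q3 * t))" for z t
    have W: "wpoly True (1/2) (1/2) (- 1/2 + 1/2) (\<lambda>z t. x) (\<lambda>z t. 0) (\<lambda>z t. 0)"
      "wpoly True (1/2) (1/2) (- 1/2 + 1/2) (\<lambda>z t. y) (\<lambda>z t. 0) (\<lambda>z t. 0)"
      using wpoly_const[of True "1/2" "1/2"] by simp_all
    have "\<exists>x y. wpoly True (1/2) (1/2) (1/2) g x y" unfolding g_def
    proof -
      have l: "\<exists>x y. wpoly True (1/2) (1/2) (1/2) (\<lambda>z t. p * z + q * t) x y" for p q :: complex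
        by (intro wpoly_add_ex wpoly_cmul_ex) (use wpoly_z wpoly_t in blast)+
      show "\<exists>xa ya. wpoly True (1/2) (1/2) (1/2) (\<lambda>z t. 2 * \<i> * (x * (2 * q1 * z + q2 * t) + y * (q2 * z + 2 * q3 * t))) xa ya"
        by (intro wpoly_cmul_ex wpoly_add_ex l)
    qed
    then obtain gx gy where W3: "wpoly True (1/2) (1/2) (- 1/2 + 1) g gx gy" by auto
    have "\<forall>z t. x * Pz z t + y * Pt z t = g z t / (2 * \<i>)"
    proof (intro allI)
      fix z t
      have "x * Pz z t + y * Pt z t = (x * \<alpha> + y * \<gamma>) * cnj z + (x * \<beta> + y * \<delta>) * cnj t
          + (x * (2 * q1 * z + q2 * t) + y * (q2 * z + 2 * q3 * t))"
        unfolding 1 by (simp add: algebra_simps)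
      then show "x * Pz z t + y * Pt z t = g z t / (2 * \<i>)" by (simp add: xy g_def)
    qed
    then show False using nd[unfolded nondegenerate_model_def, rule_format, OF W W3] xy(3) by blast
  qed
  define G where "G z t = \<i> * ((q1 + cnj r1) * z ^ 2 + (q2 + cnj r2) * z * t + (q3 + cnj r3) * t ^ 2)" for z t
  have E: "Re (P z t) = Im (G z t) + (A * (cmod z)\<^sup>2 + B * (cmod t)\<^sup>2 + Re (2 * \<beta> * z * cnj t))" for z t
  proof -
    have r: "Re (x * cnj y) = Re (cnj x * y)" for x y by simp
    have "Re (\<alpha> * z * cnj z) = A * (cmod z)\<^sup>2" "Re (\<delta> * t * cnj t) = B * (cmod t)\<^sup>2"
      unfolding AB cmod_power2 by (simp_all add: power2_eq_square algebra_simps)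
    moreover have "Re (\<beta> * z * cnj t + \<gamma> * t * cnj z) = Re (2 * \<beta> * z * cnj t)"
      unfolding \<gamma> by (simp add: algebra_simps)
    moreover have "Re (r1 * cnj z ^ 2 + r2 * cnj z * cnj t + r3 * cnj t ^ 2) = Re (cnj r1 * z ^ 2 + cnj r2 * z * t + cnj r3 * t ^ 2)"
      using r[of r1 "z ^ 2"] r[of r2 "z * t"] r[of r3 "t ^ 2"] by (simp only: plus_complex.sel complex_cnj_power complex_cnj_mult mult.assoc)
    moreover have "Im (G z t) = Re (q1 * z ^ 2 + q2 * z * t + q3 * t ^ 2) + Re (cnj r1 * z ^ 2 + cnj r2 * z * t + cnj r3 * t ^ 2)"
      unfolding G_def distrib_right by simp
    ultimately show ?thesis unfolding 1 plus_complex.sel by linarith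
  qed
  have "globally_equivalent (hypersurface (\<lambda>z t. Re (P z t))) (hypersurface (\<lambda>z t. A * (cmod z)\<^sup>2 + B * (cmod t)\<^sup>2 + Re (2 * \<beta> * z * cnj t)))"
    unfolding E
  proof (rule hypersurface_add)
    show "hol3 (\<lambda>p. G (p $ 1) (p $ 2))" unfolding G_def by (intro hol3_intros)
  qed (simp add: G_def)
  then show ?thesis by (rule equivalent_to_model_trans[OF _ hermitian_model[OF ne]])
qed

section \<open>From vector fields to symmetries\<close>

text \<open>Every point is contracted to 0 by weighted dilations, so a homogeneous relation known
  near 0 can be tested at any point.\<close>

lemma nhds_weighted_dilation:
  fixes a b :: real
  assumes "a > 0" "b > 0" "\<forall>\<^sub>F p in nhds 0. R p"
  shows "\<exists>l>0. R (vec3 (of_real (l powr a) * z) (of_real (l powr b) * t) (of_real l * w))"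
proof -
  let ?D = "\<lambda>l::real. vec3 (of_real (l powr a) * z) (of_real (l powr b) * t) (of_real l * w)"
  have id: "((\<lambda>l::real. l) \<longlongrightarrow> 0) (at_right 0)" by (rule tendsto_ident_at)
  have pw: "((\<lambda>l::real. l powr c) \<longlongrightarrow> 0) (at_right 0)" if "c > 0" for c
    by (rule tendsto_zero_powrI[OF id tendsto_const _ that]) (auto simp: eventually_at_filter)
  have s: "((\<lambda>l. of_real (f l) * x :: complex) \<longlongrightarrow> 0) (at_right 0)" if "(f \<longlongrightarrow> 0) (at_right (0::real))" for f x
    using tendsto_mult[OF tendsto_of_real[OF that] tendsto_const[of x]] by simp
  have "(?D \<longlongrightarrow> 0) (at_right 0)"
  proof (rule vec_tendstoI)
    fix i :: 3
    show "((\<lambda>l. ?D l $ i) \<longlongrightarrow> 0 $ i) (at_right 0)"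
      using exhaust_3[of i] s[OF pw[OF assms(1)], of z] s[OF pw[OF assms(2)], of t] s[OF id, of w] by auto
  qed
  then have "\<forall>\<^sub>F l in at_right 0. R (?D l)"
    using assms(3) by (simp add: filterlim_def le_filter_def eventually_filtermap)
  moreover have "\<forall>\<^sub>F l::real in at_right 0. l > 0" by (simp add: eventually_at_filter)
  ultimately have "\<forall>\<^sub>F l in at_right 0. l > 0 \<and> R (?D l)" by (rule eventually_conj[rotated])
  then show ?thesis using eventually_happens[of _ "at_right (0::real)"] trivial_limit_at_right_real by blast
qed

lemma wpoly_zpoly_eval:
  assumes "weighted_homogeneous (\<mu>1, \<mu>2) 1 P"
  shows "\<exists>Pz Pt. wpoly False (real_of_rat \<mu>1) (real_of_rat \<mu>2) 1 (zpoly_eval P) Pz Pt"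
proof -
  have "\<exists>Pz Pt. wpoly False (real_of_rat \<mu>1) (real_of_rat \<mu>2) 1 (\<lambda>z t. \<Sum>x\<in>Poly_Mapping.keys P. (\<lambda>((a1, a2), (b1, b2)).
      Poly_Mapping.lookup P ((a1, a2), (b1, b2)) * z ^ a1 * t ^ a2 * cnj z ^ b1 * cnj t ^ b2) x) Pz Pt"
  proof (rule wpoly_sum)
    fix x assume x: "x \<in> Poly_Mapping.keys P"
    obtain p i q j where xe: "x = ((p, i), (q, j))" by (metis prod.exhaust)
    have "of_nat (p + q) * \<mu>1 + of_nat (i + j) * \<mu>2 = 1"
      using assms x unfolding weighted_homogeneous_def xe by auto
    then have "real_of_rat (of_nat (p + q) * \<mu>1 + of_nat (i + j) * \<mu>2) = 1" by simp
    then have w: "real_of_rat \<mu>1 * real (p + q) + real_of_rat \<mu>2 * real (i + j) = 1"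
      by (simp only: of_rat_add of_rat_mult of_rat_of_nat_eq mult.commute)
    show "\<exists>Pz Pt. wpoly False (real_of_rat \<mu>1) (real_of_rat \<mu>2) 1 (\<lambda>z t. (\<lambda>((a1, a2), (b1, b2)).
      Poly_Mapping.lookup P ((a1, a2), (b1, b2)) * z ^ a1 * t ^ a2 * cnj z ^ b1 * cnj t ^ b2) x) Pz Pt"
      by (intro exI, rule wpoly_eqI[OF wpoly_mono[OF w, of False "Poly_Mapping.lookup P x"]]) (auto simp: xe mult_ac)
  qed simp
  then show ?thesis unfolding zpoly_eval_def[abs_def] .
qed

lemma vf_apply_model:
  assumes wP: "wpoly False a b 1 (zpoly_eval P) Pz Pt" and real: "\<And>z t. zpoly_eval P z t \<in> \<real>"
  shows "vf_apply X (model_defining_function P) p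
    = X p $ 3 / (2 * \<i>) - (X p $ 1 * Pz (p $ 1) (p $ 2) + X p $ 2 * Pt (p $ 1) (p $ 2))"
proof -
  define q1 q2 where "q1 = Pz (p $ 1) (p $ 2)" and "q2 = Pt (p $ 1) (p $ 2)"
  have c: "((\<lambda>p. p $ i) has_derivative (\<lambda>v. v $ i)) (at p)" for i :: 3
    by (rule bounded_linear_imp_has_derivative) (rule bounded_linear_vec_nth)
  have D: "(model_defining_function P has_derivative (\<lambda>v. Im (v $ 3) - 2 * Re (q1 * v $ 1 + q2 * v $ 2))) (at p)"
    unfolding model_defining_function_def[abs_def]
  proof (rule has_derivative_diff)
    show "((\<lambda>p. Im (p $ 3)) has_derivative (\<lambda>v. Im (v $ 3))) (at p)"
      by (rule bounded_linear.has_derivative[OF bounded_linear_Im c])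
    have "((\<lambda>p. zpoly_eval P (p $ 1) (p $ 2)) has_derivative (\<lambda>v. of_real (2 * Re (q1 * v $ 1 + q2 * v $ 2)))) (at p)"
      using has_derivative_compose[OF has_derivative_Pair[OF c[of 1] c[of 2]] wpoly_real_deriv[OF wP real]]
      by (simp add: q1_def q2_def)
    from bounded_linear.has_derivative[OF bounded_linear_Re this]
    show "((\<lambda>p. Re (zpoly_eval P (p $ 1) (p $ 2))) has_derivative (\<lambda>v. 2 * Re (q1 * v $ 1 + q2 * v $ 2))) (at p)"
      by simp
  qed
  have W: "wirtinger_deriv (model_defining_function P) p 1 = - q1" "wirtinger_deriv (model_defining_function P) p 2 = - q2"
    "wirtinger_deriv (model_defining_function P) p 3 = 1 / (2 * \<i>)"
    unfolding wirtinger_deriv_def frechet_derivative_at[OF D, symmetric]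
    by (simp_all add: axis_def complex_eq_iff Re_divide Im_divide power2_eq_square)
  show ?thesis unfolding vf_apply_def sum_3 W q1_def q2_def by (simp add: algebra_simps)
qed

text \<open>A homogeneous polynomial field is an admissible germ; it vanishes near 0 and then, by
  dilation, everywhere.\<close>

lemma nondegenerate_model_zpoly:
  assumes wP: "wpoly False a b 1 (zpoly_eval P) Pz Pt" and real: "\<And>z t. zpoly_eval P z t \<in> \<real>"
    and ab: "a > 0" "b > 0" and nd: "holomorphically_nondegenerate P"
  shows "nondegenerate_model a b Pz Pt"
  unfolding nondegenerate_model_def
proof (intro allI impI)
  fix w f fz ft h hz ht g gz gt z t
  assume 1: "wpoly True a b (w + a) f fz ft" "wpoly True a b (w + b) h hz ht" "wpoly True a b (w + 1) g gz gt"
    "\<forall>z t. f z t * Pz z t + h z t * Pt z t = g z t / (2 * \<i>)"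
  define X where "X p = vec3 (f (p $ 1) (p $ 2)) (h (p $ 1) (p $ 2)) (g (p $ 1) (p $ 2))" for p :: "complex ^ 3"
  have "holomorphic_map_on X UNIV" unfolding X_def
    by (intro holomorphic_map_vec3 hol3_wpoly[OF 1(1)] hol3_wpoly[OF 1(2)] hol3_wpoly[OF 1(3)] hol3_coord)
  then have "holomorphic_vf_germ_at_0 X" unfolding holomorphic_vf_germ_at_0_def by (intro exI[of _ UNIV]) simp
  moreover have "vf_apply X (model_defining_function P) p = 0" for p
    unfolding vf_apply_model[OF wP real] using 1(4) by (simp add: X_def)
  ultimately have X0: "\<forall>\<^sub>F p in nhds 0. X p = 0"
    using nd unfolding holomorphically_nondegenerate_def by simp
  from nhds_weighted_dilation[OF ab X0, of z t 0] obtain l where l: "l > 0"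
    "X (vec3 (of_real (l powr a) * z) (of_real (l powr b) * t) (of_real l * 0)) = 0" by blast
  then have "f (of_real (l powr a) * z) (of_real (l powr b) * t) = 0" "h (of_real (l powr a) * z) (of_real (l powr b) * t) = 0"
    by (simp_all add: X_def vec_eq_iff forall_3)
  then show "f z t = 0 \<and> h z t = 0"
    using l(1) by (simp add: wpoly_homogeneous[OF 1(1) l(1)] wpoly_homogeneous[OF 1(2) l(1)])
qed

text \<open>A single factor z would already cost the weight a, and the weight then fixes the
  exponent of t.\<close>

lemma wpoly_holomorphic_low_weight:
  assumes "wpoly h a b w F Fz Ft" "h" "w < a" "a > 0" "b > 0"
  shows "\<exists>c k. (\<forall>z t. F z t = c * t ^ k) \<and> (c \<noteq> 0 \<longrightarrow> b * real k = w)"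
  using assms
proof induction
  case (wpoly_zero w)
  show ?case by (intro exI[of _ 0]) simp
next
  case (wpoly_mono p q i j w c)
  have q: "q = 0" "j = 0" using wpoly_mono by auto
  have "p = 0"
  proof (rule ccontr)
    assume "p \<noteq> 0"
    then have "a * real p \<ge> a * 1" using wpoly_mono.prems by (intro mult_left_mono) auto
    moreover have "b * real i \<ge> 0" using wpoly_mono.prems by simp
    moreover have "a * real p + b * real i = w" using wpoly_mono.hyps q by simp
    ultimately show False using wpoly_mono.prems by linarith
  qed
  then show ?case using wpoly_mono.hyps q by (intro exI[of _ c] exI[of _ i]) simp
next
  case (wpoly_add w P Pz Pt Q Qz Qt)
  obtain c k where 1: "\<forall>z t. P z t = c * t ^ k" "c \<noteq> 0 \<longrightarrow> b * real k = w" using wpoly_add.IH(1) wpoly_add.prems by blast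
  obtain d m where 2: "\<forall>z t. Q z t = d * t ^ m" "d \<noteq> 0 \<longrightarrow> b * real m = w" using wpoly_add.IH(2) wpoly_add.prems by blast
  consider "c = 0" | "d = 0" | "c \<noteq> 0" "d \<noteq> 0" by blast
  then show ?case
  proof cases
    case 1
    then show ?thesis using \<open>\<forall>z t. P z t = _\<close> 2 by (intro exI[of _ d] exI[of _ m]) simp
  next
    case 2
    then show ?thesis using 1 \<open>\<forall>z t. Q z t = _\<close> by (intro exI[of _ c] exI[of _ k]) simp
  next
    case 3
    then have "b * real k = b * real m" using 1 2 by simp
    then have "k = m" using wpoly_add.prems by simp
    then show ?thesis using 1 2 3 by (intro exI[of _ "c + d"] exI[of _ k]) (simp add: distrib_right)
  qed
qed

text \<open>The differential is complex linear and real-valued, hence zero; the constant value is 0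
  because the weight is positive.\<close>

lemma wpoly_real_holomorphic:
  assumes F: "wpoly True a b w F Fz Ft" and w: "w > 0" and real: "\<And>z t. Im (F z t) = 0"
  shows "F z t = 0"
proof -
  have rF: "F z t \<in> \<real>" for z t using real by (simp add: complex_is_Real_iff)
  have D: "((\<lambda>x. F (fst x) (snd x)) has_derivative (\<lambda>d. 0)) (at x)" for x
  proof -
    obtain z t where x: "x = (z, t)" by (cases x)
    have "(\<lambda>d. Fz z t * fst d + Ft z t * snd d) = (\<lambda>d. of_real (2 * Re (Fz z t * fst d + Ft z t * snd d)))"
      by (rule has_derivative_unique[OF wpoly_hol_deriv[OF F] wpoly_real_deriv[OF wpoly_weaken[OF F] rF]])
    then have e: "Im (Fz z t * x + Ft z t * y) = 0" for x y
      by (metis (no_types, lifting) Im_complex_of_real fst_conv snd_conv)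
    have "Fz z t = 0" "Ft z t = 0" using e[of 1 0] e[of \<i> 0] e[of 0 1] e[of 0 \<i>] by (simp_all add: complex_eq_iff)
    then show ?thesis using wpoly_hol_deriv[OF F, of z t] unfolding x by simp
  qed
  have "\<exists>c. \<forall>x\<in>UNIV. F (fst x) (snd x) = c"
    by (rule has_derivative_zero_constant) (use D in simp_all)
  then have "F z t = F 0 0" by (metis UNIV_I fst_conv snd_conv)
  then show ?thesis using wpoly_zero_at_0[OF F w] by simp
qed

text \<open>The coefficients of w have weights \<kappa> + a - 1 < a and \<kappa> + b - 1 < b <= a,
  which leaves c t^k for the z-component and a constant \<beta> for the t-component. If \<beta> = 0,
  swapping the variables gives the required shape; if both are nonzero, then a = (k + 1) b and a
  shear of z by a multiple of t^(k + 1) removes c t^k.\<close>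

lemma equivalent_to_model_of_symmetry:
  assumes ab: "0 < b" "b \<le> a" "a \<le> 1/2" and \<kappa>: "0 < \<kappa>" "\<kappa> < 1"
    and wP: "wpoly False a b 1 P Pz Pt" and real: "\<And>z t. P z t \<in> \<real>" and nd: "nondegenerate_model a b Pz Pt"
    and sym: "symmetry a b \<kappa> P Pz Pt f0 f1 h0 h1 g0 g1" and nz: "\<exists>z t. f1 z t \<noteq> 0 \<or> h1 z t \<noteq> 0"
  shows "equivalent_to_model (hypersurface (\<lambda>z t. Re (P z t)))"
proof (cases "a = 1/2 \<and> b = 1/2")
  case True
  then have h: "a = 1/2" "b = 1/2" by auto
  show ?thesis by (rule quadratic_model[OF wP[unfolded h] real nd[unfolded h]])
next
  case False
  have a0: "a > 0" using ab by simp
  have half: "b \<le> 1/2" using ab by simp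
  have model: "equivalent_to_model (hypersurface (\<lambda>z t. Re (Q z t)))"
    if S: "symmetry x y \<kappa> Q Qz Qt p0 (\<lambda>z t. 0) q0 (\<lambda>z t. c * z ^ k) r0 r1"
      and k: "\<kappa> = 1 - (y - real k * x)" and H: "0 < x" "x \<le> 1/2" "y \<le> 1/2" "c \<noteq> 0" "\<not> (x = 1/2 \<and> y = 1/2)"
      and H2: "wpoly False x y 1 Q Qz Qt" "\<And>z t. Q z t \<in> \<real>" "nondegenerate_model x y Qz Qt"
    for x y Q Qz Qt p0 q0 r0 r1 c k
  proof -
    have S': "symmetry x y (1 - (y - real k * x)) Q Qz Qt p0 (\<lambda>z t. 0) q0 (\<lambda>z t. c * z ^ k) r0 r1"
      using S k by simp
    have pos: "0 < y - real k * x" using k \<kappa> by simp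
    have nq: "\<not> (k = 0 \<and> x = 1/2 \<and> y = 1/2)" using H(5) by blast
    from sym_modelI[OF S' H(1-3) pos H(4) nq H2]
    obtain fz ft hz ht g0z g0t g1z g1t where "sym_model x y k c Q Qz Qt p0 fz ft q0 hz ht r0 g0z g0t r1 g1z g1t"
      by blast
    then show ?thesis by (rule normal_form_model[OF sym_model.normal_form])
  qed
  obtain x y where "wpoly True a b (\<kappa> + a - 1) f1 x y" using sym unfolding symmetry_def by blast
  from wpoly_holomorphic_low_weight[OF this] obtain c k where
    f1: "\<And>z t. f1 z t = c * t ^ k" and k: "c \<noteq> 0 \<Longrightarrow> b * real k = \<kappa> + a - 1" using ab \<kappa> a0 by auto
  obtain x y where "wpoly True a b (\<kappa> + b - 1) h1 x y" using sym unfolding symmetry_def by blast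
  from wpoly_holomorphic_low_weight[OF this] obtain \<beta> m where
    h1: "\<And>z t. h1 z t = \<beta> * t ^ m" and m: "\<beta> \<noteq> 0 \<Longrightarrow> b * real m = \<kappa> + b - 1" using ab \<kappa> a0 by auto
  have m0: "m = 0" if "\<beta> \<noteq> 0"
  proof (rule ccontr)
    assume "m \<noteq> 0"
    then have "b * real m \<ge> b * 1" using ab by (intro mult_left_mono) auto
    then show False using m[OF that] \<kappa> by simp
  qed
  have sw: "symmetry b a \<kappa> (\<lambda>z t. P t z) (\<lambda>z t. Pt t z) (\<lambda>z t. Pz t z)
    (\<lambda>z t. h0 t z) (\<lambda>z t. h1 t z) (\<lambda>z t. f0 t z) (\<lambda>z t. c * z ^ k) (\<lambda>z t. g0 t z) (\<lambda>z t. g1 t z)"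
    using symmetry_swap[OF sym] unfolding f1 .
  have swP: "wpoly False b a 1 (\<lambda>z t. P t z) (\<lambda>z t. Pt t z) (\<lambda>z t. Pz t z)" by (rule wpoly_swap[OF wP])
  note swN = nondegenerate_swap[OF nd]
  consider "\<beta> = 0" | "\<beta> \<noteq> 0" "c = 0" | "\<beta> \<noteq> 0" "c \<noteq> 0" by blast
  then show ?thesis
  proof cases
    case 1
    then have c0: "c \<noteq> 0" using nz f1 h1 by auto
    have "symmetry b a \<kappa> (\<lambda>z t. P t z) (\<lambda>z t. Pt t z) (\<lambda>z t. Pz t z)
      (\<lambda>z t. h0 t z) (\<lambda>z t. 0) (\<lambda>z t. f0 t z) (\<lambda>z t. c * z ^ k) (\<lambda>z t. g0 t z) (\<lambda>z t. g1 t z)"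
      using sw unfolding h1 1 by simp
    then have "equivalent_to_model (hypersurface (\<lambda>z t. Re (P t z)))"
      by (rule model) (use c0 k ab half False swP swN real in \<open>auto simp: mult.commute\<close>)
    then show ?thesis by (rule equivalent_to_model_trans[OF hypersurface_swap])
  next
    case 2
    have "f1 = (\<lambda>z t. 0)" "h1 = (\<lambda>z t. \<beta> * z ^ 0)" using f1 h1 2 m0 by (auto simp: fun_eq_iff)
    then have "symmetry a b \<kappa> P Pz Pt f0 (\<lambda>z t. 0) h0 (\<lambda>z t. \<beta> * z ^ 0) g0 g1" using sym by simp
    then show ?thesis
      by (rule model) (use 2 m m0 a0 ab half False wP nd real in auto)
  next
    case 3
    have am: "a = real (Suc k) * b" using k[OF 3(2)] m[OF 3(1)] m0[OF 3(1)] by (simp add: algebra_simps)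
    \<comment> \<open>Along the constant component \<beta> the function l z^(k + 1) changes at the
      rate l (k + 1) \<beta> z^k in the swapped variables, which has to equal c z^k.\<close>
    define l where "l = c / (of_nat (Suc k) * \<beta>)"
    have lc: "c * z ^ k - l * of_nat (Suc k) * z ^ (Suc k - 1) * \<beta> = 0" for z
      using 3 by (simp add: l_def field_simps del: of_nat_Suc)
    let ?sh = "\<lambda>F z t. F z (t + l * z ^ Suc k)"
    have h1': "h1 = (\<lambda>z t. \<beta>)" using h1 m0[OF 3(1)] by (simp add: fun_eq_iff)
    let ?P = "\<lambda>z t. P (t + l * z ^ Suc k) z"
    let ?Pz = "\<lambda>z t. Pt (t + l * z ^ Suc k) z + Pz (t + l * z ^ Suc k) z * (l * of_nat (Suc k) * z ^ (Suc k - 1))"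
    let ?Pt = "\<lambda>z t. Pz (t + l * z ^ Suc k) z"
    have "\<exists>p0 q0 r0 r1. symmetry b a \<kappa> ?P ?Pz ?Pt p0 (\<lambda>z t. \<beta>) q0 (\<lambda>z t. 0) r0 r1"
      using symmetry_shift[OF sw am, of l] unfolding h1' lc by blast
    then obtain p0 q0 r0 r1 where S: "symmetry b a \<kappa> ?P ?Pz ?Pt p0 (\<lambda>z t. \<beta>) q0 (\<lambda>z t. 0) r0 r1" by blast
    have w: "wpoly False b a 1 ?P ?Pz ?Pt" by (rule wpoly_shift[OF swP am])
    have n: "nondegenerate_model b a ?Pz ?Pt" by (rule nondegenerate_shift[OF swN am])
    have "symmetry a b \<kappa> (\<lambda>z t. ?P t z) (\<lambda>z t. ?Pt t z) (\<lambda>z t. ?Pz t z) (\<lambda>z t. q0 t z) (\<lambda>z t. 0)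
      (\<lambda>z t. p0 t z) (\<lambda>z t. \<beta> * z ^ 0) (\<lambda>z t. r0 t z) (\<lambda>z t. r1 t z)"
      using symmetry_swap[OF S] by simp
    then have "equivalent_to_model (hypersurface (\<lambda>z t. Re (?P t z)))"
      by (rule model) (use 3 m m0 a0 ab half False wpoly_swap[OF w] nondegenerate_swap[OF n] real in auto)
    then have "equivalent_to_model (hypersurface (\<lambda>z t. Re (?P z t)))" by (rule equivalent_to_model_trans[OF hypersurface_swap])
    moreover have "globally_equivalent (hypersurface (\<lambda>z t. Re (P t z))) (hypersurface (\<lambda>z t. Re (P (1 * t + l * z ^ Suc k) z)))"
      by (rule hypersurface_shear[where R = "\<lambda>z t. Re (P t z)"]) (auto intro!: holomorphic_intros)
    ultimately have "equivalent_to_model (hypersurface (\<lambda>z t. Re (P t z)))"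
      using equivalent_to_model_trans by simp
    then show ?thesis by (rule equivalent_to_model_trans[OF hypersurface_swap])
  qed
qed

text \<open>A total weight below 2 leaves no room for w^2.\<close>

lemma vf_component_decomposition:
  fixes Q :: "(nat \<times> nat \<times> nat) \<Rightarrow>\<^sub>0 complex"
  assumes w: "\<forall>a1 a2 m. (a1, a2, m) \<in> Poly_Mapping.keys Q \<longrightarrow> of_nat a1 * \<mu>1 + of_nat a2 * \<mu>2 + of_nat m - \<nu> = \<kappa>"
    and pos: "\<mu>1 \<ge> 0" "\<mu>2 \<ge> 0" and lt: "\<kappa> + \<nu> < 2"
  shows "\<exists>F0 F0z F0t F1 F1z F1t.
    wpoly True (real_of_rat \<mu>1) (real_of_rat \<mu>2) (real_of_rat \<kappa> + real_of_rat \<nu>) F0 F0z F0t \<and>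
    wpoly True (real_of_rat \<mu>1) (real_of_rat \<mu>2) (real_of_rat \<kappa> + real_of_rat \<nu> - 1) F1 F1z F1t \<and>
    (\<forall>z t x. (\<Sum>(a1, a2, m) \<in> Poly_Mapping.keys Q. Poly_Mapping.lookup Q (a1, a2, m) * z ^ a1 * t ^ a2 * x ^ m)
      = F0 z t + x * F1 z t)"
proof -
  define F where "F n = (\<lambda>z t. \<Sum>y\<in>{y \<in> Poly_Mapping.keys Q. snd (snd y) = n}.
    Poly_Mapping.lookup Q y * z ^ fst y * t ^ fst (snd y))" for n :: nat
  have wF: "\<exists>X Y. wpoly True (real_of_rat \<mu>1) (real_of_rat \<mu>2) (real_of_rat \<kappa> + real_of_rat \<nu> - real n) (F n) X Y" for n
    unfolding F_def
  proof (rule wpoly_sum)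
    fix y assume y: "y \<in> {y \<in> Poly_Mapping.keys Q. snd (snd y) = n}"
    obtain p i where ye: "y = (p, i, n)" using y by (metis (mono_tags, lifting) mem_Collect_eq prod.collapse)
    have "of_nat p * \<mu>1 + of_nat i * \<mu>2 = \<kappa> + \<nu> - of_nat n" using w y unfolding ye by (auto simp: algebra_simps)
    then have "real_of_rat (of_nat p * \<mu>1 + of_nat i * \<mu>2) = real_of_rat (\<kappa> + \<nu> - of_nat n)" by simp
    then have wt: "real_of_rat \<mu>1 * real (p + 0) + real_of_rat \<mu>2 * real (i + 0) = real_of_rat \<kappa> + real_of_rat \<nu> - real n"
      by (simp add: of_rat_add of_rat_diff of_rat_mult mult.commute)
    show "\<exists>X Y. wpoly True (real_of_rat \<mu>1) (real_of_rat \<mu>2) (real_of_rat \<kappa> + real_of_rat \<nu> - real n)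
        (\<lambda>z t. Poly_Mapping.lookup Q y * z ^ fst y * t ^ fst (snd y)) X Y"
      by (intro exI, rule wpoly_eqI[OF wpoly_mono[OF wt, of True "Poly_Mapping.lookup Q y"]]) (auto simp: ye)
  qed simp
  have m: "m = 0 \<or> m = 1" if "(p, i, m) \<in> Poly_Mapping.keys Q" for p i m
  proof -
    have e: "of_nat p * \<mu>1 + of_nat i * \<mu>2 + of_nat m = \<kappa> + \<nu>" using w that by (auto simp: algebra_simps)
    have "of_nat p * \<mu>1 \<ge> 0" "of_nat i * \<mu>2 \<ge> 0" using pos by simp_all
    then have "(of_nat m :: rat) < of_nat 2" using e lt by simp
    then show ?thesis unfolding of_nat_less_iff by auto
  qed
  have "(\<Sum>(a1, a2, m) \<in> Poly_Mapping.keys Q. Poly_Mapping.lookup Q (a1, a2, m) * z ^ a1 * t ^ a2 * x ^ m)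
      = F 0 z t + x * F 1 z t" for z t x
  proof -
    have "(\<Sum>(a1, a2, m) \<in> Poly_Mapping.keys Q. Poly_Mapping.lookup Q (a1, a2, m) * z ^ a1 * t ^ a2 * x ^ m)
        = (\<Sum>y\<in>{y \<in> Poly_Mapping.keys Q. snd (snd y) = 0} \<union> {y \<in> Poly_Mapping.keys Q. snd (snd y) = 1}.
            Poly_Mapping.lookup Q y * z ^ fst y * t ^ fst (snd y) * x ^ snd (snd y))"
      by (rule sum.cong) (auto dest: m)
    also have "\<dots> = (\<Sum>y\<in>{y \<in> Poly_Mapping.keys Q. snd (snd y) = 0}. Poly_Mapping.lookup Q y * z ^ fst y * t ^ fst (snd y) * x ^ snd (snd y))
        + (\<Sum>y\<in>{y \<in> Poly_Mapping.keys Q. snd (snd y) = 1}. Poly_Mapping.lookup Q y * z ^ fst y * t ^ fst (snd y) * x ^ snd (snd y))"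
      by (rule sum.union_disjoint) auto
    also have "\<dots> = F 0 z t + x * F 1 z t"
      unfolding F_def sum_distrib_left by (intro arg_cong2[where f = "(+)"] sum.cong) (auto simp: mult_ac)
    finally show ?thesis .
  qed
  moreover obtain X Y where "wpoly True (real_of_rat \<mu>1) (real_of_rat \<mu>2) (real_of_rat \<kappa> + real_of_rat \<nu>) (F 0) X Y"
    using wF[of 0] by auto
  moreover obtain X' Y' where "wpoly True (real_of_rat \<mu>1) (real_of_rat \<mu>2) (real_of_rat \<kappa> + real_of_rat \<nu> - 1) (F 1) X' Y'"
    using wF[of 1] by auto
  ultimately show ?thesis by blast
qed

lemma commute_W_of_w_independent:
  assumes F: "wpoly True a b w F Fz Ft" "wpoly True a b w' G Gz Gt" "wpoly True a b w'' H Hz Ht"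
    and ev: "\<forall>\<^sub>F p in nhds 0. X p = vec3 (F (p $ 1) (p $ 2)) (G (p $ 1) (p $ 2)) (H (p $ 1) (p $ 2))"
  shows "commute_at_0 X W_field"
proof -
  obtain S where S: "open S" "0 \<in> S" "\<And>p. p \<in> S \<Longrightarrow> X p = vec3 (F (p $ 1) (p $ 2)) (G (p $ 1) (p $ 2)) (H (p $ 1) (p $ 2))"
    using ev unfolding eventually_nhds by blast
  have br: "lie_bracket X W_field p = 0" if p: "p \<in> S" for p
  proof -
    have c: "((\<lambda>p. p $ i) has_derivative (\<lambda>v. v $ i)) (at p)" for i :: 3
      by (rule bounded_linear_imp_has_derivative) (rule bounded_linear_vec_nth)
    have comp: "((\<lambda>p. K (p $ 1) (p $ 2)) has_derivative (\<lambda>v. Kz (p $ 1) (p $ 2) * v $ 1 + Kt (p $ 1) (p $ 2) * v $ 2)) (at p)"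
      if "wpoly True a b y K Kz Kt" for y K Kz Kt
      using has_derivative_compose[OF has_derivative_Pair[OF c[of 1] c[of 2]] wpoly_hol_deriv[OF that]] by simp
    have "(X has_derivative (\<lambda>v. vec3 (Fz (p $ 1) (p $ 2) * v $ 1 + Ft (p $ 1) (p $ 2) * v $ 2)
        (Gz (p $ 1) (p $ 2) * v $ 1 + Gt (p $ 1) (p $ 2) * v $ 2) (Hz (p $ 1) (p $ 2) * v $ 1 + Ht (p $ 1) (p $ 2) * v $ 2))) (at p)"
      by (rule has_derivative_transform_within_open[OF has_derivative_vec3[OF comp[OF F(1)] comp[OF F(2)] comp[OF F(3)]] S(1) p])
        (simp add: S(3))
    from frechet_derivative_at[OF this, symmetric]
    have "frechet_derivative X (at p) (axis 3 1) = 0" by (simp add: axis_def vec_eq_iff forall_3)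
    moreover have "frechet_derivative W_field (at p) = (\<lambda>v. 0)" unfolding W_field_def by (rule frechet_derivative_const)
    ultimately show ?thesis unfolding lie_bracket_def by (simp add: W_field_def)
  qed
  then show ?thesis unfolding commute_at_0_def eventually_nhds using S(1,2) by blast
qed

text \<open>The tangency expression is homogeneous of weight \<kappa> + 1 in z, t, w, so its
  vanishing near 0 spreads to the whole hypersurface, where its real part is of degree one in Re w
  and splits into two identities. If f1 and h1 were zero, g1 would be holomorphic with real values,
  hence zero, and X would commute with \<partial>_w.\<close>

lemma dim_gn_symmetry:
  assumes wP: "wpoly False (real_of_rat \<mu>1) (real_of_rat \<mu>2) 1 (zpoly_eval P) Pz Pt" and real: "\<And>z t. zpoly_eval P z t \<in> \<real>"
    and mu: "\<mu>1 > 0" "\<mu>2 > 0" "\<mu>1 \<le> 1/2" "\<mu>2 \<le> 1/2" and gn: "dim_gn_positive P (\<mu>1, \<mu>2)"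
  shows "\<exists>\<kappa> f0 f1 h0 h1 g0 g1. 0 < \<kappa> \<and> \<kappa> < 1 \<and>
    symmetry (real_of_rat \<mu>1) (real_of_rat \<mu>2) \<kappa> (zpoly_eval P) Pz Pt f0 f1 h0 h1 g0 g1 \<and> (\<exists>z t. f1 z t \<noteq> 0 \<or> h1 z t \<noteq> 0)"
proof -
  let ?a = "real_of_rat \<mu>1" and ?b = "real_of_rat \<mu>2"
  have ab: "?a > 0" "?b > 0" using mu by simp_all
  obtain \<kappa> X where \<kappa>: "0 < \<kappa>" "\<kappa> < 1" and X: "X \<in> aut P" "vf_of_weight (\<mu>1, \<mu>2) \<kappa> X" "\<not> commute_at_0 X W_field"
    using gn unfolding dim_gn_positive_def aut_component_def by auto
  let ?k = "real_of_rat \<kappa>"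
  have k01: "0 < ?k" "?k < 1" using \<kappa> by simp_all
  have comp: "\<exists>F0 F0z F0t F1 F1z F1t.
    wpoly True ?a ?b (?k + real_of_rat (coord_weight (\<mu>1, \<mu>2) j)) F0 F0z F0t \<and>
    wpoly True ?a ?b (?k + real_of_rat (coord_weight (\<mu>1, \<mu>2) j) - 1) F1 F1z F1t \<and>
    (\<forall>\<^sub>F p in nhds 0. X p $ j = F0 (p $ 1) (p $ 2) + p $ 3 * F1 (p $ 1) (p $ 2))" for j
  proof -
    obtain Q :: "(nat \<times> nat \<times> nat) \<Rightarrow>\<^sub>0 complex" where
      Q: "\<forall>a1 a2 m. (a1, a2, m) \<in> Poly_Mapping.keys Q \<longrightarrow> of_nat a1 * \<mu>1 + of_nat a2 * \<mu>2 + of_nat m - coord_weight (\<mu>1, \<mu>2) j = \<kappa>"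
        "\<forall>\<^sub>F p in nhds 0. X p $ j = (\<Sum>(a1, a2, m) \<in> Poly_Mapping.keys Q.
            Poly_Mapping.lookup Q (a1, a2, m) * (p $ 1) ^ a1 * (p $ 2) ^ a2 * (p $ 3) ^ m)"
      using X(2) unfolding vf_of_weight_def fst_conv snd_conv by blast
    have "\<kappa> + coord_weight (\<mu>1, \<mu>2) j < 2" using \<kappa> mu by (auto simp: coord_weight_def)
    with mu obtain F0 F0z F0t F1 F1z F1t where
      1: "wpoly True ?a ?b (?k + real_of_rat (coord_weight (\<mu>1, \<mu>2) j)) F0 F0z F0t"
        "wpoly True ?a ?b (?k + real_of_rat (coord_weight (\<mu>1, \<mu>2) j) - 1) F1 F1z F1t"
      and 2: "\<forall>z t x. (\<Sum>(a1, a2, m) \<in> Poly_Mapping.keys Q. Poly_Mapping.lookup Q (a1, a2, m) * z ^ a1 * t ^ a2 * x ^ m)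
        = F0 z t + x * F1 z t"
      using vf_component_decomposition[OF Q(1)] by auto
    show ?thesis using 1 Q(2) unfolding 2[rule_format] by blast
  qed
  have cw: "coord_weight (\<mu>1, \<mu>2) 1 = \<mu>1" "coord_weight (\<mu>1, \<mu>2) 2 = \<mu>2" "coord_weight (\<mu>1, \<mu>2) 3 = 1"
    by (simp_all add: coord_weight_def)
  obtain f0 f0z f0t f1 f1z f1t where f: "wpoly True ?a ?b (?k + ?a) f0 f0z f0t" "wpoly True ?a ?b (?k + ?a - 1) f1 f1z f1t"
    "\<forall>\<^sub>F p in nhds 0. X p $ 1 = f0 (p $ 1) (p $ 2) + p $ 3 * f1 (p $ 1) (p $ 2)"
    using comp[of 1] unfolding cw by blast
  obtain h0 h0z h0t h1 h1z h1t where h: "wpoly True ?a ?b (?k + ?b) h0 h0z h0t" "wpoly True ?a ?b (?k + ?b - 1) h1 h1z h1t"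
    "\<forall>\<^sub>F p in nhds 0. X p $ 2 = h0 (p $ 1) (p $ 2) + p $ 3 * h1 (p $ 1) (p $ 2)"
    using comp[of 2] unfolding cw by blast
  obtain g0 g0z g0t g1 g1z g1t where "wpoly True ?a ?b (?k + real_of_rat 1) g0 g0z g0t" "wpoly True ?a ?b (?k + real_of_rat 1 - 1) g1 g1z g1t"
    and g3: "\<forall>\<^sub>F p in nhds 0. X p $ 3 = g0 (p $ 1) (p $ 2) + p $ 3 * g1 (p $ 1) (p $ 2)"
    using comp[of 3] unfolding cw by blast
  then have g: "wpoly True ?a ?b (?k + 1) g0 g0z g0t" "wpoly True ?a ?b ?k g1 g1z g1t" by simp_all
  define E where "E z t w = (g0 z t + w * g1 z t) / (2 * \<i>)
    - ((f0 z t + w * f1 z t) * Pz z t + (h0 z t + w * h1 z t) * Pt z t)" for z t w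
  have "\<forall>\<^sub>F p in nhds 0. p \<in> model_hypersurface P \<longrightarrow> Re (vf_apply X (model_defining_function P) p) = 0"
    using X(1) unfolding aut_def by blast
  with f(3) h(3) g3 have R: "\<forall>\<^sub>F p :: complex ^ 3 in nhds 0. Im (p $ 3) = Re (zpoly_eval P (p $ 1) (p $ 2)) \<longrightarrow> Re (E (p $ 1) (p $ 2) (p $ 3)) = 0"
  proof eventually_elim
    case (elim p)
    then show ?case unfolding vf_apply_model[OF wP real] E_def model_hypersurface_def by simp
  qed
  obtain x1 y1 where Pz: "wpoly False ?a ?b (1 - ?a) Pz x1 y1" using wpoly_dz[OF wP] by blast
  obtain x2 y2 where Pt: "wpoly False ?a ?b (1 - ?b) Pt x2 y2" using wpoly_dt[OF wP] by blast
  have scale: "E (of_real (l powr ?a) * z) (of_real (l powr ?b) * t) (of_real l * w) = of_real (l powr (?k + 1)) * E z t w"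
    if l: "l > 0" for l z t w
  proof -
    note hom = wpoly_homogeneous[OF _ l]
    define L where "L = complex_of_real l"
    have L0: "L \<noteq> 0" using l by (simp add: L_def)
    have pw: "complex_of_real (l powr (x + y)) = of_real (l powr x) * of_real (l powr y)" for x y by (simp add: powr_add)
    have pd: "complex_of_real (l powr (x - 1)) = of_real (l powr x) / L" for x using l by (simp add: powr_diff L_def)
    have pd': "complex_of_real (l powr (1 - x)) = L / of_real (l powr x)" for x using l by (simp add: powr_diff L_def)
    have p1: "complex_of_real (l powr 1) = L" using l by (simp add: L_def)
    have nz: "complex_of_real (l powr x) \<noteq> 0" for x using l by simp
    show ?thesis
      unfolding E_def hom[OF f(1)] hom[OF f(2)] hom[OF h(1)] hom[OF h(2)] hom[OF g(1)] hom[OF g(2)] hom[OF Pz] hom[OF Pt]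
        pd pd' pw p1 L_def[symmetric]
      using L0 nz[of ?a] nz[of ?b] by (simp add: field_simps)
  qed
  \<comment> \<open>Here w = u + \<i> P(z, t) parametrizes the hypersurface; the dilated point lies
    on it as well and is close to 0.\<close>
  have RE: "Re (E z t (of_real u + \<i> * zpoly_eval P z t)) = 0" for z t u
  proof -
    obtain l where l: "l > 0" and "Im (of_real l * (of_real u + \<i> * zpoly_eval P z t))
          = Re (zpoly_eval P (of_real (l powr ?a) * z) (of_real (l powr ?b) * t)) \<longrightarrow>
        Re (E (of_real (l powr ?a) * z) (of_real (l powr ?b) * t) (of_real l * (of_real u + \<i> * zpoly_eval P z t))) = 0"
      using nhds_weighted_dilation[OF ab R, of z t "of_real u + \<i> * zpoly_eval P z t"] by auto
    then have "Re (of_real (l powr (?k + 1)) * E z t (of_real u + \<i> * zpoly_eval P z t)) = 0"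
      unfolding scale[OF l] wpoly_homogeneous[OF wP l] using l by simp
    then show ?thesis using l by simp
  qed
  have id: "Im (g0 z t + (of_real u + \<i> * zpoly_eval P z t) * g1 z t)
      = 2 * Re (f0 z t * Pz z t + h0 z t * Pt z t + (of_real u + \<i> * zpoly_eval P z t) * (f1 z t * Pz z t + h1 z t * Pt z t))" for z t u
  proof -
    have r: "2 * Re (x / (2 * \<i>)) = Im x" for x by (simp add: Re_divide power2_eq_square)
    have "E z t w = (g0 z t + w * g1 z t) / (2 * \<i>) - (f0 z t * Pz z t + h0 z t * Pt z t + w * (f1 z t * Pz z t + h1 z t * Pt z t))" for w
      by (simp add: E_def algebra_simps)
    then show ?thesis using RE[of z t u] r[of "g0 z t + (of_real u + \<i> * zpoly_eval P z t) * g1 z t"] by simp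
  qed
  have Im0: "Im (zpoly_eval P z t) = 0" for z t using real[of z t] by (simp add: complex_is_Real_iff)
  have id1: "Im (g1 z t) = 2 * Re (f1 z t * Pz z t + h1 z t * Pt z t)" for z t
  proof -
    define A B where "A = f0 z t * Pz z t + h0 z t * Pt z t" and "B = f1 z t * Pz z t + h1 z t * Pt z t"
    show ?thesis using id[of z t 1] id[of z t 0] unfolding A_def[symmetric] B_def[symmetric] by (simp add: algebra_simps)
  qed
  have id2: "Im (g0 z t) + Re (zpoly_eval P z t) * Re (g1 z t)
      = 2 * Re (f0 z t * Pz z t + h0 z t * Pt z t) - 2 * Re (zpoly_eval P z t) * Im (f1 z t * Pz z t + h1 z t * Pt z t)" for z t
  proof -
    define A B where "A = f0 z t * Pz z t + h0 z t * Pt z t" and "B = f1 z t * Pz z t + h1 z t * Pt z t"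
    show ?thesis using id[of z t 0] unfolding A_def[symmetric] B_def[symmetric] by (simp add: Im0 algebra_simps)
  qed
  have "symmetry ?a ?b ?k (zpoly_eval P) Pz Pt f0 f1 h0 h1 g0 g1"
    unfolding symmetry_def using f(1,2) h(1,2) g id1 id2 by blast
  moreover have "\<exists>z t. f1 z t \<noteq> 0 \<or> h1 z t \<noteq> 0"
  proof (rule ccontr)
    assume "\<not> ?thesis"
    then have z: "f1 z t = 0" "h1 z t = 0" for z t by auto
    have g10: "g1 z t = 0" for z t
      by (rule wpoly_real_holomorphic[OF g(2) k01(1)]) (simp add: id1 z)
    have "\<forall>\<^sub>F p in nhds 0. X p = vec3 (f0 (p $ 1) (p $ 2)) (h0 (p $ 1) (p $ 2)) (g0 (p $ 1) (p $ 2))"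
      using f(3) h(3) g3 by eventually_elim (simp add: z g10 vec_eq_iff forall_3)
    from commute_W_of_w_independent[OF f(1) h(1) g(1) this] show False using X(3) by simp
  qed
  ultimately show ?thesis using k01 by blast
qed

theorem theorem1p2:
  fixes P :: zpoly and \<mu>1 \<mu>2 :: rat
  assumes "real_valued P"
    and "weighted_homogeneous (\<mu>1, \<mu>2) 1 P"
    and "no_pluriharmonic_terms P"
    and "multitype_weight (model_hypersurface P) 0 (\<mu>1, \<mu>2)"
    and "\<mu>1 \<noteq> 0" and "\<mu>2 \<noteq> 0"
    and "holomorphically_nondegenerate P"
    and "dim_gn_positive P (\<mu>1, \<mu>2)"
  shows "\<exists>l::nat. l > 0 \<and>
     (biholomorphically_equivalent_at_0 (model_hypersurface P)
        {p. Im (p $ 3) = Re (p $ 1 * cnj (p $ 2) ^ l)} \<or>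
      biholomorphically_equivalent_at_0 (model_hypersurface P)
        {p. Im (p $ 3) = (cmod (p $ 1))\<^sup>2 + cmod (p $ 2) ^ (2 * l)} \<or>
      biholomorphically_equivalent_at_0 (model_hypersurface P)
        {p. Im (p $ 3) = (cmod (p $ 1))\<^sup>2 - cmod (p $ 2) ^ (2 * l)})"
proof -
  have mu: "\<mu>1 \<le> 1/2" "\<mu>2 \<le> \<mu>1" "\<mu>2 > 0"
    using assms(4,6) unfolding multitype_weight_def is_weight_def by auto
  then have mu': "\<mu>1 > 0" "\<mu>2 \<le> 1/2" by auto
  have real: "zpoly_eval P z t \<in> \<real>" for z t using assms(1) unfolding real_valued_def by blast
  obtain Pz Pt where wP: "wpoly False (real_of_rat \<mu>1) (real_of_rat \<mu>2) 1 (zpoly_eval P) Pz Pt"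
    using wpoly_zpoly_eval[OF assms(2)] by blast
  have half: "real_of_rat \<mu>1 \<le> 1/2" using of_rat_less_eq[of \<mu>1 "1/2", where ?'a = real] mu(1) by (simp add: of_rat_divide)
  have ab: "0 < real_of_rat \<mu>2" "real_of_rat \<mu>2 \<le> real_of_rat \<mu>1" using mu by (simp_all add: of_rat_less_eq)
  have nd: "nondegenerate_model (real_of_rat \<mu>1) (real_of_rat \<mu>2) Pz Pt"
    by (rule nondegenerate_model_zpoly[OF wP real _ _ assms(7)]) (use mu mu' in simp_all)
  obtain \<kappa> f0 f1 h0 h1 g0 g1 where "0 < \<kappa>" "\<kappa> < 1"
    "symmetry (real_of_rat \<mu>1) (real_of_rat \<mu>2) \<kappa> (zpoly_eval P) Pz Pt f0 f1 h0 h1 g0 g1" "\<exists>z t. f1 z t \<noteq> 0 \<or> h1 z t \<noteq> 0"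
    using dim_gn_symmetry[OF wP real mu'(1) mu(3) mu(1) mu'(2) assms(8)] by blast
  from equivalent_to_model_of_symmetry[OF ab half this(1,2) wP real nd this(3,4)]
  have "equivalent_to_model (model_hypersurface P)" unfolding hypersurface_def model_hypersurface_def .
  then show ?thesis unfolding equivalent_to_model_def using globally_equivalent_at_0 by blast
qed

end
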